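(* Let $a\in S^m_{\rho,\delta}$ for some $m<0$ and $0<\delta\le\rho<1$. Then for any compactly supported bounded functions $f,g$ on $\mathbb{R}^n$, there exist sparse collections $\mathcal{S}$ and $\widetilde{\mathcal{S}}$ of dyadic cubes such that $$|\langle T_af,g\rangle|\le C(m,\rho,r,s)\,\Lambda_{\mathcal{S},r,s'}(f,g)$$ and $$|\langle T_af,g\rangle|\le C(m,\rho,r,s)\,\Lambda_{\widetilde{\mathcal{S}},s',r}(f,g)$$ for all pairs $(r,s')$ and $(s',r)$ such that $$m<-n(1-\rho)(1/r-1/2),\qquad 1\le r\le s\le 2$$ or $$m<-n(1-\rho)(1/r-1/s),\qquad 1\le r\le 2\le s\le r'.$$
   Context: For $m\in\mathbb{R}$ and $0\le\delta,\rho\le1$, the symbol class $S^m_{\rho,\delta}$ consists of all $a\in C^\infty(\mathbb{R}^n\times\mathbb{R}^n)$ satisfying $|\partial_x^\nu\partial_\xi^\sigma a(x,\xi)|\lesssim(1+|\xi|)^{m-\rho|\sigma|+\delta|\nu|}$ for all multi-indices $\nu,\sigma\in\mathbb{N}^n$, where $A\lesssim B$ means $A\le CB$ for some constant $C$. The pseudodifferential operator associated to $a$ is $T_af(x)=\int_{\mathbb{R}^n}e^{ix\cdot\xi}a(x,\xi)\widehat f(\xi)\,d\xi$ for Schwartz functions $f$, where $\widehat f$ is the Fourier transform of $f$ (constant factors of $\pi$ from the normalisation of the Fourier transform are omitted). The pairing $\langle\cdot,\cdot\rangle$ is the $L^2(\mathbb{R}^n)$ pairing; $T_af$ for bounded compactly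 supported $f$ is understood through the bounded extension of $T_a$ to $L^2(\mathbb{R}^n)$. For $1\le p\le\infty$, $p'$ denotes the conjugate exponent, $1/p+1/p'=1$. A collection $\mathcal{S}$ of dyadic cubes in $\mathbb{R}^n$ is $\eta$-sparse, for $0<\eta<1$, if there exist pairwise disjoint sets $\{E_Q:Q\in\mathcal{S}\}$ with $E_Q\subset Q$ and $|E_Q|>\eta|Q|$ for all $Q\in\mathcal{S}$; it is sparse if it is $\eta$-sparse for some $0<\eta<1$. For a dyadic cube $Q$ and $1\le p<\infty$, $\langle f\rangle_{p,Q}$ is defined by $\langle f\rangle_{p,Q}^p=|Q|^{-1}\int_Q|f|^p\,dx$, and $\langle f\rangle_{\infty,Q}$ is the essential supremum of $|f|$ over $Q$. The $(p,q)$ sparse form is $\Lambda_{\mathcal{S},p,q}(f,g)=\sum_{Q\in\mathcal{S}}|Q|\,\langle f\rangle_{p,Q}\,\langle g\rangle_{q,Q}$.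
   Formalization: The constant C may depend on the symbol a (as scaling a forces), not only on m, ρ, r, s; and the dyadic cubes of each collection come from one dyadic grid that may be chosen depending on f, g, since with the standard grid the claim fails for f, g in different orthants. *)

theory Defs
  imports "HOL-Analysis.Analysis" "HOL-Probability.Essential_Supremum"
begin

section \<open>Partial derivatives and smooth functions\<close>

text \<open>
  Iterated partial derivatives are indexed by words of basis vectors. For smooth functions the
  order of differentiation is irrelevant, so a multi-index \<open>\<nu>\<close> corresponds to the words in which
  the \<open>i\<close>-th direction occurs \<open>\<nu> i\<close> times, and \<open>|\<nu>|\<close> is the length of such a word.
\<close>

primrec iter_partial ::
    "'a::euclidean_space list \<Rightarrow> ('a \<Rightarrow> 'b::real_normed_vector) \<Rightarrow> 'a \<Rightarrow> 'b" where
  "iter_partial [] F = F"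
| "iter_partial (b # bs) F = (\<lambda>z. frechet_derivative (iter_partial bs F) (at z) b)"

definition smooth :: "('a::euclidean_space \<Rightarrow> 'b::real_normed_vector) \<Rightarrow> bool" where
  "smooth F \<longleftrightarrow> (\<forall>bs z. set bs \<subseteq> Basis \<longrightarrow> iter_partial bs F differentiable (at z))"

section \<open>Symbols and pseudodifferential operators\<close>

definition dir_x :: "'n::finite \<Rightarrow> (real^'n) \<times> (real^'n)" where
  "dir_x i = (axis i 1, 0)"

definition dir_xi :: "'n::finite \<Rightarrow> (real^'n) \<times> (real^'n)" where
  "dir_xi i = (0, axis i 1)"

definition symbol_class ::
    "real \<Rightarrow> real \<Rightarrow> real \<Rightarrow> ((real^'n) \<times> (real^'n) \<Rightarrow> complex) set" where
  "symbol_class m \<rho> \<delta> = {a. smooth a \<and>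
     (\<forall>\<nu> \<sigma> :: 'n::finite list. \<exists>C. \<forall>x \<xi>.
        norm (iter_partial (map dir_x \<nu> @ map dir_xi \<sigma>) a (x, \<xi>))
          \<le> C * (1 + norm \<xi>) powr (m - \<rho> * real (length \<sigma>) + \<delta> * real (length \<nu>)))}"

definition schwartz :: "(real^'n::finite \<Rightarrow> complex) \<Rightarrow> bool" where
  "schwartz f \<longleftrightarrow> smooth f \<and>
     (\<forall>k :: nat. \<forall>bs. set bs \<subseteq> Basis \<longrightarrow>
        (\<exists>C. \<forall>x. (1 + norm x) ^ k * norm (iter_partial bs f x) \<le> C))"

definition fourier :: "(real^'n::finite \<Rightarrow> complex) \<Rightarrow> real^'n \<Rightarrow> complex" where
  "fourier f \<xi> = (LINT x|lebesgue. cis (- (x \<bullet> \<xi>)) * f x)"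

definition pdo ::
    "((real^'n::finite) \<times> (real^'n) \<Rightarrow> complex) \<Rightarrow> (real^'n \<Rightarrow> complex) \<Rightarrow> real^'n \<Rightarrow> complex" where
  "pdo a f x = (LINT \<xi>|lebesgue. cis (x \<bullet> \<xi>) * a (x, \<xi>) * fourier f \<xi>)"

definition L2 :: "(real^'n::finite \<Rightarrow> complex) set" where
  "L2 = {f \<in> borel_measurable lebesgue. integrable lebesgue (\<lambda>x. (norm (f x))\<^sup>2)}"

definition L2_norm :: "(real^'n::finite \<Rightarrow> complex) \<Rightarrow> real" where
  "L2_norm f = sqrt (LINT x|lebesgue. (norm (f x))\<^sup>2)"

definition L2_pairing :: "(real^'n::finite \<Rightarrow> complex) \<Rightarrow> (real^'n \<Rightarrow> complex) \<Rightarrow> complex" where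
  "L2_pairing u v = (LINT x|lebesgue. u x * cnj (v x))"

text \<open>
  Operators on \<open>L\<^sup>2\<close> act on representatives, so all identities hold almost everywhere. By density
  of the Schwartz functions, two bounded extensions agree up to null sets, so the choice made by
  \<open>pdo_L2\<close> affects no pairing.
\<close>

definition bounded_L2_extension ::
    "((real^'n::finite) \<times> (real^'n) \<Rightarrow> complex) \<Rightarrow>
     ((real^'n \<Rightarrow> complex) \<Rightarrow> (real^'n \<Rightarrow> complex)) \<Rightarrow> bool" where
  "bounded_L2_extension a T \<longleftrightarrow>
     (\<forall>f\<in>L2. T f \<in> L2) \<and>
     (\<forall>f\<in>L2. \<forall>g\<in>L2. \<forall>c. AE x in lebesgue. T (\<lambda>y. c * f y + g y) x = c * T f x + T g x) \<and>
     (\<exists>B. \<forall>f\<in>L2. L2_norm (T f) \<le> B * L2_norm f) \<and>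
     (\<forall>f. schwartz f \<longrightarrow> (AE x in lebesgue. T f x = pdo a f x))"

definition pdo_L2 ::
    "((real^'n::finite) \<times> (real^'n) \<Rightarrow> complex) \<Rightarrow> (real^'n \<Rightarrow> complex) \<Rightarrow> real^'n \<Rightarrow> complex" where
  "pdo_L2 a = (SOME T. bounded_L2_extension a T)"

definition bounded_compactly_supported :: "(real^'n::finite \<Rightarrow> complex) \<Rightarrow> bool" where
  "bounded_compactly_supported f \<longleftrightarrow>
     f \<in> borel_measurable lebesgue \<and> bounded (range f) \<and> (\<exists>K. compact K \<and> (\<forall>x. x \<notin> K \<longrightarrow> f x = 0))"

section \<open>Dyadic cubes and sparse forms\<close>

definition half_open_cube :: "real^'n::finite \<Rightarrow> real \<Rightarrow> (real^'n) set" where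
  "half_open_cube c l = {x. \<forall>i. c $ i \<le> x $ i \<and> x $ i < c $ i + l}"

text \<open>
  A dyadic lattice may be any (for instance translated) system of nested dyadic partitions. The
  standard lattice alone would not do: its cubes never meet two different orthants, so its
  sparse forms vanish when \<open>f\<close> and \<open>g\<close> live in different orthants.
\<close>

definition dyadic_lattice :: "(real^'n::finite) set set \<Rightarrow> bool" where
  "dyadic_lattice D \<longleftrightarrow>
     (\<forall>Q\<in>D. \<exists>c. \<exists>k::int. Q = half_open_cube c (2 powi k)) \<and>
     (\<forall>k::int. \<forall>x. \<exists>c. half_open_cube c (2 powi k) \<in> D \<and> x \<in> half_open_cube c (2 powi k)) \<and>
     (\<forall>Q\<in>D. \<forall>R\<in>D. Q \<inter> R = {} \<or> Q \<subseteq> R \<or> R \<subseteq> Q)"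

definition dyadic_collection :: "(real^'n::finite) set set \<Rightarrow> bool" where
  "dyadic_collection S \<longleftrightarrow> (\<exists>D. dyadic_lattice D \<and> S \<subseteq> D)"

definition eta_sparse :: "real \<Rightarrow> (real^'n::finite) set set \<Rightarrow> bool" where
  "eta_sparse \<eta> S \<longleftrightarrow>
     (\<exists>E. disjoint_family_on E S \<and>
          (\<forall>Q\<in>S. E Q \<in> sets lebesgue \<and> E Q \<subseteq> Q \<and> measure lebesgue (E Q) > \<eta> * measure lebesgue Q))"

text \<open>
  The Bochner integral below is \<open>0\<close> when \<open>|f|\<^sup>p\<close> is not integrable on \<open>Q\<close>; the average is meant for
  locally bounded measurable \<open>f\<close>.
\<close>

definition average :: "ennreal \<Rightarrow> (real^'n::finite \<Rightarrow> complex) \<Rightarrow> (real^'n) set \<Rightarrow> ennreal" where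
  "average p f Q =
     (if p = \<infinity> then esssup (restrict_space lebesgue Q) (\<lambda>x. ennreal (norm (f x)))
      else ennreal (((LINT x:Q|lebesgue. norm (f x) powr enn2real p) / measure lebesgue Q)
                      powr (1 / enn2real p)))"

text \<open>An unconditional sum in \<^typ>\<open>ennreal\<close>, so it is meaningful for infinite collections.\<close>

definition sparse_form ::
    "(real^'n::finite) set set \<Rightarrow> ennreal \<Rightarrow> ennreal \<Rightarrow>
     (real^'n \<Rightarrow> complex) \<Rightarrow> (real^'n \<Rightarrow> complex) \<Rightarrow> ennreal" where
  "sparse_form S p q f g = (\<Sum>\<^sub>\<infinity>Q\<in>S. emeasure lebesgue Q * average p f Q * average q g Q)"

text \<open>The arithmetic of \<^typ>\<open>ennreal\<close> covers the endpoints: \<open>1' = \<infinity>\<close> and \<open>\<infinity>' = 1\<close>.\<close>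

definition conj_exponent :: "ennreal \<Rightarrow> ennreal" where
  "conj_exponent p = 1 / (1 - 1 / p)"

lemma conj_exponent_eq:
  assumes "1 \<le> p"
  shows "1 / p + 1 / conj_exponent p = 1"
proof -
  have le: "1 / p \<le> 1"
    by (rule divide_le_posI_ennreal) (use assms in \<open>auto intro: less_le_trans[of 0 1]\<close>)
  have inv: "1 / (1 / x) = x" for x :: ennreal
  proof (cases x)
    case (real r)
    then show ?thesis
      by (cases "r = 0") (simp_all add: divide_ennreal_def inverse_ennreal)
  qed (simp add: divide_ennreal_def)
  show ?thesis
    unfolding conj_exponent_def inv using le by (rule add_diff_inverse_ennreal)
qed

end

theory Submission
  imports Defs "HOL-Probability.Probability"
begin

text \<open>
  The symbol is cut into pieces supported on the annuli \<open>|\<xi>| \<approx> 2\<^sup>j\<close>. The kernel of the \<open>j\<close>-th piece decays rapidly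
  beyond the scale \<open>2 powr (- j \<rho>)\<close>, so the piece is tested on a grid of cubes \<open>Q\<close> of side about \<open>2 powr (- j r)\<close> with
  \<open>r\<close> slightly below \<open>\<rho>\<close>, and the part of \<open>f\<close> outside \<open>3Q\<close> only produces rapidly decreasing multiples of
  averages over larger cubes. On \<open>Q\<close> itself the dependence of the symbol on \<open>x\<close> can be decoupled, since \<open>\<delta> \<le> \<rho>\<close> makes
  every \<open>x\<close>-derivative cost at most one over the side of \<open>Q\<close>. Plancherel and the trivial \<open>L\<^sup>1\<close> bound then apply, and
  splitting \<open>f\<close> and \<open>g\<close> at a suitable height yields the product of the averages with exponents \<open>p, q \<in> [1, 2]\<close>, with a
  constant decaying geometrically in \<open>j\<close> as soon as \<open>m + n (1 - \<rho>) (1/p + 1/q - 1) < 0\<close>.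

  It remains to dominate such grid forms, at every scale \<open>2\<^sup>v\<close>, by one sparse form. A measure estimate provides a
  translation of the dyadic lattice for which every grid cube that matters sits inside a lattice cube larger by a factor of
  only \<open>2 powr (\<theta> |v|)\<close>; this loss is absorbed by the geometric decay. A stopping time that treats countably many exponents
  simultaneously then gives a single sparse family for all rational \<open>p, q\<close>, and the general exponents follow from
  the strict inequality by lowering them to rational ones. The condition is symmetric in \<open>p, q\<close>, so the same
  family serves both bounds.

  For \<open>p = q = 2\<close> the estimate also shows that the sum of the pieces is bounded on \<open>L\<^sup>2\<close>. It agrees with the
  pseudodifferential operator on Schwartz functions, hence by density with every bounded extension.
\<close>

text \<open>The family must be fixed before the exponents, so one lattice has to serve every
  exponent pair and every scale. With finitely many adjacent dyadic systems the best system could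
  change with the exponents. The shift is therefore found by a Chebyshev argument: for each scale
  and each exponent choice, only those shifts are discarded that put more than half of the grid form
  on badly placed cubes. Their measures are made summable over all scales by letting the ratio
  between lattice cube and grid cube grow with \<open>|v|\<close>; this is the origin of the loss
  \<open>2 powr (\<theta> * |v|)\<close>. The affordable \<open>\<theta>\<close> depends on the gap
  in the strict inequality, so triples \<open>(p, q, \<theta>)\<close> are enumerated and not only
  pairs. The gap pays a second time. On cubes of side exactly \<open>2 powr (- j * \<rho>)\<close>,
  integrating by parts N times gains nothing in j. A side with exponent \<open>r < \<rho>\<close>
  gains \<open>(\<rho> - r) * N\<close> for the far part, with N arbitrary, and costs only a fixed
  multiple of \<open>n * (\<rho> - r)\<close> in the near part.\<close>

hide_fact (open)
  Henstock_Kurzweil_Integration.integrable_add Henstock_Kurzweil_Integration.integrable_bound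
  Henstock_Kurzweil_Integration.integrable_sum Henstock_Kurzweil_Integration.integral_add
  Henstock_Kurzweil_Integration.integral_cnj Henstock_Kurzweil_Integration.integral_cong
  Henstock_Kurzweil_Integration.integral_diff Henstock_Kurzweil_Integration.integral_sum

section \<open>Gaussians and a Plancherel inequality\<close>

lemma cis_borel[measurable (raw)]: "f \<in> borel_measurable M \<Longrightarrow> (\<lambda>x. cis (f x)) \<in> borel_measurable M"
  by (rule measurable_compose[of f M borel cis borel])
     (auto intro!: borel_measurable_continuous_onI continuous_intros)

lemma cnj_borel[measurable (raw)]: "f \<in> borel_measurable M \<Longrightarrow> (\<lambda>x. cnj (f x)) \<in> borel_measurable M"
  by (rule measurable_compose[of f M borel cnj borel])
     (auto intro!: borel_measurable_continuous_onI continuous_intros)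

text \<open>Through \<open>lborel_eq\<close>, Lebesgue measure is the image of a product of
  one-dimensional copies. The Gaussian integrals and the integrability of the inverse of
  \<open>japanese\<close> both reduce to one variable in this way.\<close>

lemma lborel_product_integral:
  fixes h :: "'a::euclidean_space \<Rightarrow> real \<Rightarrow> complex"
  assumes "\<And>b. b \<in> Basis \<Longrightarrow> integrable lborel (h b)"
  shows "integrable lborel (\<lambda>x. \<Prod>b\<in>Basis. h b (x \<bullet> b))"
    and "(LBINT x. (\<Prod>b\<in>Basis. h b (x \<bullet> b))) = (\<Prod>b\<in>Basis. LBINT t. h b t)"
proof -
  interpret product_sigma_finite "\<lambda>b::'a. lborel :: real measure"
    by (simp add: product_sigma_finite_def sigma_finite_lborel)
  have [measurable]: "\<And>b. b \<in> Basis \<Longrightarrow> h b \<in> borel_measurable borel"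
    using assms borel_measurable_integrable by fastforce
  have meas: "(\<lambda>x. \<Prod>b\<in>Basis. h b (x \<bullet> b)) \<in> borel_measurable borel"
    by (intro borel_measurable_prod) measurable
  have T: "(\<lambda>f. \<Sum>b\<in>Basis. f b *\<^sub>R b) \<in> (\<Pi>\<^sub>M b\<in>Basis. lborel) \<rightarrow>\<^sub>M (borel :: 'a measure)"
    by measurable
  have eq: "(\<Prod>b\<in>Basis. h b ((\<Sum>c\<in>Basis. f c *\<^sub>R c) \<bullet> b)) = (\<Prod>b\<in>Basis. h b (f b))" for f
    by (intro prod.cong refl) (simp add: inner_sum_left_Basis)
  have "integrable (\<Pi>\<^sub>M b\<in>Basis. lborel) (\<lambda>f. \<Prod>b\<in>Basis. h b (f b))"
    by (rule product_integrable_prod) (use assms in auto)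
  then show "integrable lborel (\<lambda>x. \<Prod>b\<in>Basis. h b (x \<bullet> b))"
    by (subst lborel_eq, subst integrable_distr_eq[OF T meas]) (simp only: eq)
  show "(LBINT x. (\<Prod>b\<in>Basis. h b (x \<bullet> b))) = (\<Prod>b\<in>Basis. LBINT t. h b t)"
    by (subst lborel_eq[where 'a='a], subst integral_distr[OF T meas]) (simp only: eq product_integral_prod[OF _ assms] finite_Basis)
qed

lemma integrable_gauss: "integrable lborel (\<lambda>t::real. exp (- t\<^sup>2 / 2))"
proof -
  have "integrable lborel (\<lambda>t. sqrt (2 * pi) * std_normal_density t)"
    by (intro integrable_mult_right) (simp add: integrable_normal_density)
  then show ?thesis by (simp add: std_normal_density_def)
qed

text \<open>The characteristic function of the standard normal distribution is this integral up to
  the factor \<open>sqrt (2 * pi)\<close> in the density.\<close>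

lemma gauss_fourier_unit:
  "(LBINT t. cis (t * z) * complex_of_real (exp (- t\<^sup>2 / 2))) = sqrt (2 * pi) * exp (- z\<^sup>2 / 2)"
proof -
  have "char std_normal_distribution z = (LBINT t. std_normal_density t *\<^sub>R cis (z * t))"
    unfolding char_def cis_conv_exp[symmetric]
    by (rule integral_density) auto
  also have "(\<lambda>t. std_normal_density t *\<^sub>R cis (z * t)) = (\<lambda>t. complex_of_real (1 / sqrt (2*pi)) * (cis (t * z) * complex_of_real (exp (- t\<^sup>2 / 2))))"
    by (simp only: std_normal_density_def scaleR_conv_of_real of_real_mult mult_ac)
  also have "integral\<^sup>L lborel \<dots> = complex_of_real (1 / sqrt (2*pi)) * (LBINT t. cis (t * z) * complex_of_real (exp (- t\<^sup>2 / 2)))"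
    by (rule integral_mult_right_zero)
  finally have e: "complex_of_real (exp (- (z^2) / 2)) = complex_of_real (1 / sqrt (2*pi)) * (LBINT t. cis (t * z) * complex_of_real (exp (- t\<^sup>2 / 2)))"
    by (simp only: char_std_normal_distribution)
  have "complex_of_real (sqrt (2*pi)) * complex_of_real (exp (- (z^2) / 2)) 
     = complex_of_real (sqrt (2*pi) * (1 / sqrt (2*pi))) * (LBINT t. cis (t * z) * complex_of_real (exp (- t\<^sup>2 / 2)))"
    unfolding e by (simp only: of_real_mult mult.assoc)
  also have "sqrt (2*pi) * (1 / sqrt (2*pi)) = 1" by simp
  finally show ?thesis by (simp only: of_real_mult of_real_1 mult_1_left)
qed

lemma gauss_fourier_1d:
  assumes "s > 0"
  shows "integrable lborel (\<lambda>t. cis (t * z) * exp (- (s * t)\<^sup>2 / 2))"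
    and "(LBINT t. cis (t * z) * exp (- (s * t)\<^sup>2 / 2)) = sqrt (2 * pi) / s * exp (- (z / s)\<^sup>2 / 2)"
proof -
  have I: "integrable lborel (\<lambda>t::real. exp (- (s * t)\<^sup>2 / 2))"
    using lborel_integrable_real_affine[OF integrable_gauss, of s 0] assms by simp
  show "integrable lborel (\<lambda>t. cis (t * z) * exp (- (s * t)\<^sup>2 / 2))"
    by (rule integrable_bound[OF I]) (measurable, auto simp: norm_mult)
  have "(LBINT t. cis (t * (z/s)) * complex_of_real (exp (- t\<^sup>2 / 2)))
      = s *\<^sub>R (LBINT t. cis ((0 + s * t) * (z/s)) * complex_of_real (exp (- (0 + s * t)\<^sup>2 / 2)))"
    using lborel_integral_real_affine[of s "\<lambda>t. cis (t * (z/s)) * complex_of_real (exp (- t\<^sup>2 / 2))" 0] assms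
    by simp
  also have "(\<lambda>t. cis ((0 + s * t) * (z/s)) * complex_of_real (exp (- (0 + s * t)\<^sup>2 / 2)))
     = (\<lambda>t. cis (t * z) * complex_of_real (exp (- (s * t)\<^sup>2 / 2)))"
    using assms by (intro ext) simp
  finally have "complex_of_real (sqrt (2 * pi) * exp (- (z / s)\<^sup>2 / 2))
     = s *\<^sub>R (LBINT t. cis (t * z) * complex_of_real (exp (- (s * t)\<^sup>2 / 2)))"
    by (simp only: gauss_fourier_unit)
  then have "(1 / s) *\<^sub>R complex_of_real (sqrt (2 * pi) * exp (- (z / s)\<^sup>2 / 2))
     = (LBINT t. cis (t * z) * complex_of_real (exp (- (s * t)\<^sup>2 / 2)))"
    using assms by (simp only: scaleR_scaleR) simp
  then show "(LBINT t. cis (t * z) * exp (- (s * t)\<^sup>2 / 2)) = sqrt (2 * pi) / s * exp (- (z / s)\<^sup>2 / 2)"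
    by (simp add: scaleR_conv_of_real)
qed

lemma cis_sum: "finite A \<Longrightarrow> cis (\<Sum>i\<in>A. f i) = (\<Prod>i\<in>A. cis (f i))"
  by (induction rule: finite_induct) (simp, metis cis_mult prod.insert sum.insert)

lemma gauss_fourier:
  fixes z :: "'a::euclidean_space"
  assumes "s > 0"
  shows "integrable lborel (\<lambda>x::'a. cis (x \<bullet> z) * exp (- (s * norm x)\<^sup>2 / 2))"
    and "(LBINT x. cis (x \<bullet> z) * exp (- (s * norm x)\<^sup>2 / 2))
           = (sqrt (2 * pi) / s) ^ DIM('a) * exp (- (norm z / s)\<^sup>2 / 2)"
proof -
  have n2: "(norm y)\<^sup>2 = (\<Sum>b\<in>Basis. (y \<bullet> b)\<^sup>2)" for y :: 'a
    unfolding power2_norm_eq_inner by (simp add: euclidean_inner[of y y] power2_eq_square)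
  have eq: "cis (x \<bullet> z) * exp (- (s * norm x)\<^sup>2 / 2)
      = (\<Prod>b\<in>Basis. cis ((x \<bullet> b) * (z \<bullet> b)) * exp (- (s * (x \<bullet> b))\<^sup>2 / 2))" for x :: 'a
    by (simp add: prod.distrib euclidean_inner[of x z] cis_sum power_mult_distrib n2 sum_distrib_left
        sum_divide_distrib exp_sum[symmetric] sum_negf[symmetric] flip: of_real_prod)
  have eq2: "(\<Prod>b\<in>Basis. complex_of_real (sqrt (2 * pi) / s * exp (- (z \<bullet> b / s)\<^sup>2 / 2)))
     = (sqrt (2 * pi) / s) ^ DIM('a) * exp (- (norm z / s)\<^sup>2 / 2)"
    by (simp add: prod.distrib power_divide n2 sum_divide_distrib exp_sum[symmetric] sum_negf[symmetric] prod_dividef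
         flip: of_real_prod)
  show "integrable lborel (\<lambda>x::'a. cis (x \<bullet> z) * exp (- (s * norm x)\<^sup>2 / 2))"
    unfolding eq by (rule lborel_product_integral) (use gauss_fourier_1d assms in auto)
  show "(LBINT x. cis (x \<bullet> z) * exp (- (s * norm x)\<^sup>2 / 2))
           = (sqrt (2 * pi) / s) ^ DIM('a) * exp (- (norm z / s)\<^sup>2 / 2)"
    unfolding eq
    apply (subst lborel_product_integral(2))
    using gauss_fourier_1d assms apply auto[1]
    unfolding eq2[symmetric] gauss_fourier_1d(2)[OF assms] ..
qed

text \<open>The working class of test functions. It asks for Borel measurability, where the theorem
  has Lebesgue measurability, so that Fubini on products and compositions with continuous maps apply
  directly; \<open>bcs_copy\<close> passes from one to the other.\<close>

definition bcs :: "(real^'n::finite \<Rightarrow> complex) \<Rightarrow> bool" where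
  "bcs f \<longleftrightarrow> f \<in> borel_measurable borel \<and> bounded (range f) \<and> bounded {x. f x \<noteq> 0}"

lemma bcs_measurable[measurable_dest]: "bcs f \<Longrightarrow> f \<in> borel_measurable borel"
  by (simp add: bcs_def)

lemma bcs_bound: assumes "bcs f" obtains B where "B \<ge> 0" "\<And>x. norm (f x) \<le> B"
proof -
  from assms obtain B where "\<And>x. norm (f x) \<le> B" by (auto simp: bcs_def bounded_iff)
  then have "norm (f x) \<le> max B 0" for x by (meson le_max_iff_disj)
  then show ?thesis using that[of "max B 0"] by simp
qed

lemma bcs_support: assumes "bcs f" obtains R where "R > 0" "\<And>x. f x \<noteq> 0 \<Longrightarrow> norm x \<le> R"
proof -
  from assms obtain B where "\<And>x. f x \<noteq> 0 \<Longrightarrow> norm x \<le> B" by (auto simp: bcs_def bounded_iff)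
  then show ?thesis using that[of "max B 1"] by (meson le_max_iff_disj less_max_iff_disj zero_less_one)
qed

lemma bcsI:
  assumes "f \<in> borel_measurable borel" "\<And>x. norm (f x) \<le> B" "\<And>x. f x \<noteq> 0 \<Longrightarrow> norm x \<le> R"
  shows "bcs f"
  using assms by (auto simp: bcs_def bounded_iff)

lemma integrable_bounded_support:
  fixes f :: "'a::euclidean_space \<Rightarrow> 'b::{banach, second_countable_topology}"
  assumes [measurable]: "f \<in> borel_measurable borel" and "\<And>x. norm (f x) \<le> B"
    "\<And>x. f x \<noteq> 0 \<Longrightarrow> norm x \<le> R"
  shows "integrable lborel f"
proof -
  have "integrable lborel (\<lambda>x. indicator (cball (0::'a) R) x * B)"
    by (intro integrable_mult_left integrable_real_indicator) (auto simp: emeasure_lborel_cball_finite[unfolded infinity_ennreal_def])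
  then show ?thesis
    by (rule integrable_bound)
       (use assms in \<open>auto simp: indicator_def intro!: AE_I2\<close>, (metis abs_ge_self order_trans)+)
qed

lemma bcs_integrable: assumes "bcs f" shows "integrable lborel f"
proof -
  obtain B where "\<And>x. norm (f x) \<le> B" using bcs_bound[OF assms] by metis
  moreover obtain R where "\<And>x. f x \<noteq> 0 \<Longrightarrow> norm x \<le> R" using bcs_support[OF assms] by metis
  ultimately show ?thesis using integrable_bounded_support bcs_measurable[OF assms] by blast
qed

lemma bcs_mult:
  assumes "bcs f" "g \<in> borel_measurable borel" "\<And>x. f x \<noteq> 0 \<Longrightarrow> norm (g x) \<le> M"
  shows "bcs (\<lambda>x. g x * f x)"
proof -
  obtain B where B: "B \<ge> 0" "\<And>x. norm (f x) \<le> B" using bcs_bound[OF assms(1)] by metis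
  obtain R where R: "\<And>x. f x \<noteq> 0 \<Longrightarrow> norm x \<le> R" using bcs_support[OF assms(1)] by metis
  have [measurable]: "f \<in> borel_measurable borel" "g \<in> borel_measurable borel"
    using assms bcs_measurable by auto
  have "norm (g x * f x) \<le> \<bar>M\<bar> * B" for x
  proof (cases "f x = 0")
    case False
    then have "norm (g x) \<le> \<bar>M\<bar>" using assms(3)[of x] by linarith
    then show ?thesis using B by (simp add: norm_mult mult_mono)
  qed (use B in auto)
  then show ?thesis using R by (intro bcsI[of _ "\<bar>M\<bar> * B" R]) auto
qed

lemma bcs_indicator: "bcs f \<Longrightarrow> E \<in> sets borel \<Longrightarrow> bcs (\<lambda>x. indicator E x * f x)"
  by (rule bcs_mult[where M=1]) (auto simp: indicator_def)

lemma bcs_cnj: "bcs f \<Longrightarrow> bcs (\<lambda>x. cnj (f x))"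
  by (auto simp: bcs_def bounded_iff intro!: cnj_borel)

lemma bcs_norm_sq: "bcs f \<Longrightarrow> integrable lborel (\<lambda>x. (norm (f x))\<^sup>2)"
proof -
  assume f: "bcs f"
  obtain B where B: "B \<ge> 0" "\<And>x. norm (f x) \<le> B" using bcs_bound[OF f] by metis
  have "bcs (\<lambda>x. cnj (f x) * f x)" by (rule bcs_mult[OF f, of _ B]) (use f B in \<open>auto dest: bcs_measurable intro!: cnj_borel\<close>)
  then have "integrable lborel (\<lambda>x. norm (cnj (f x) * f x))" by (intro integrable_norm bcs_integrable)
  then show ?thesis by (simp add: norm_mult power2_eq_square)
qed


section \<open>Fubini under a product majorant, translation invariance and the Plancherel
  inequality\<close>

lemma fubini_dominated:
  fixes F :: "'a::euclidean_space \<Rightarrow> 'b::euclidean_space \<Rightarrow> complex"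
  assumes F[measurable]: "(\<lambda>(x, y). F x y) \<in> borel_measurable borel"
    and G: "integrable lborel G" and H: "integrable lborel (H :: 'b \<Rightarrow> real)"
    and le: "\<And>x y. norm (F x y) \<le> G x * H y"
  shows "integrable lborel (\<lambda>(x, y). F x y)"
    and "integral\<^sup>L lborel (\<lambda>(x, y). F x y) = (LBINT x. LBINT y. F x y)"
    and "(LBINT x. LBINT y. F x y) = (LBINT y. LBINT x. F x y)"
proof -
  have [measurable]: "G \<in> borel_measurable borel" "H \<in> borel_measurable borel"
    using G H by (auto dest: borel_measurable_integrable)
  have F'[measurable]: "(\<lambda>(x, y). F x y) \<in> borel_measurable (lborel \<Otimes>\<^sub>M lborel)"
    unfolding lborel_prod using F by simp
  have "integrable (lborel \<Otimes>\<^sub>M lborel) (\<lambda>(x, y). G x * H y)"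
  proof (rule lborel_pair.Fubini_integrable)
    show "(\<lambda>(x, y). G x * H y) \<in> borel_measurable (lborel \<Otimes>\<^sub>M lborel)" by measurable
    show "integrable lborel (\<lambda>x. LBINT y. norm (case (x, y) of (x, y) \<Rightarrow> G x * H y))"
      using G by (simp add: abs_mult)
    show "AE x in lborel. integrable lborel (\<lambda>y. case (x, y) of (x, y) \<Rightarrow> G x * H y)"
      using H by simp
  qed
  then have I: "integrable (lborel \<Otimes>\<^sub>M lborel) (\<lambda>(x, y). F x y)"
    by (rule integrable_bound)
       (use le in \<open>auto intro!: AE_I2 intro: order_trans[OF _ abs_ge_self]\<close>)
  then show "integrable lborel (\<lambda>(x, y). F x y)" by (simp add: lborel_prod)
  show "integral\<^sup>L lborel (\<lambda>(x, y). F x y) = (LBINT x. LBINT y. F x y)"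
    using lborel_pair.integral_fst[OF I] by (simp add: lborel_prod)
  show "(LBINT x. LBINT y. F x y) = (LBINT y. LBINT x. F x y)"
    using lborel_pair.Fubini_integral[OF I] by simp
qed

lemma integral_translate:
  fixes f :: "'a::euclidean_space \<Rightarrow> 'b::{banach, second_countable_topology}"
  assumes "f \<in> borel_measurable borel"
  shows "(LBINT x. f (x + c)) = (LBINT x. f x)"
proof -
  have "(LBINT x. f x) = integral\<^sup>L (distr lborel borel ((+) c)) f"
    by (simp add: lborel_distr_plus)
  also have "\<dots> = (LBINT x. f (c + x))"
    by (rule integral_distr) (use assms in auto)
  finally show ?thesis by (simp add: add.commute)
qed

lemma nn_integral_translate:
  fixes f :: "'a::euclidean_space \<Rightarrow> ennreal"
  assumes "f \<in> borel_measurable borel"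
  shows "(\<integral>\<^sup>+x. f (x + c) \<partial>lborel) = (\<integral>\<^sup>+x. f x \<partial>lborel)"
proof -
  have "(\<integral>\<^sup>+x. f x \<partial>lborel) = integral\<^sup>N (distr lborel borel ((+) c)) f"
    by (simp add: lborel_distr_plus)
  also have "\<dots> = (\<integral>\<^sup>+x. f (c + x) \<partial>lborel)"
    by (rule nn_integral_distr) (use assms in auto)
  finally show ?thesis by (simp add: add.commute)
qed

lemma gauss_integral:
  assumes "s > 0"
  shows "integrable lborel (\<lambda>z::'a::euclidean_space. exp (- (s * norm z)\<^sup>2 / 2))"
    and "(\<integral>z. exp (- (s * norm z)\<^sup>2 / 2) \<partial>(lborel :: 'a measure)) = (sqrt (2 * pi) / s) ^ DIM('a)"
proof -
  have e: "Re (cis (z \<bullet> 0) * complex_of_real (exp (- (s * norm z)\<^sup>2 / 2))) = exp (- (s * norm z)\<^sup>2 / 2)" for z :: 'a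
    by (simp only: inner_zero_right cis_zero mult_1_left Re_complex_of_real)
  note I = gauss_fourier(1)[OF assms, of "0::'a"]
  from integrable_Re[OF I] show "integrable lborel (\<lambda>z::'a::euclidean_space. exp (- (s * norm z)\<^sup>2 / 2))"
    by (simp only: e)
  from integral_Re[OF I] show "(\<integral>z. exp (- (s * norm z)\<^sup>2 / 2) \<partial>(lborel :: 'a measure)) = (sqrt (2 * pi) / s) ^ DIM('a)"
    unfolding e gauss_fourier(2)[OF assms] Re_complex_of_real by simp
qed

lemma gauss_kernel_integral:
  assumes "s > 0"
  shows "(\<integral>\<^sup>+z. ennreal ((sqrt (2 * pi) / s) ^ DIM('a) * exp (- (norm z / s)\<^sup>2 / 2)) \<partial>(lborel :: 'a::euclidean_space measure))
     = ennreal ((2 * pi) ^ DIM('a))"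
proof -
  have s: "1 / s > 0" using assms by simp
  have e: "1 / s * norm z = norm z / s" for z :: 'a by simp
  have I: "integrable lborel (\<lambda>z::'a. (sqrt (2 * pi) / s) ^ DIM('a) * exp (- (norm z / s)\<^sup>2 / 2))"
    using gauss_integral(1)[OF s, where 'a='a] unfolding e by (rule integrable_mult_right)
  have "(\<integral>\<^sup>+z. ennreal ((sqrt (2 * pi) / s) ^ DIM('a) * exp (- (norm z / s)\<^sup>2 / 2)) \<partial>(lborel :: 'a measure))
     = ennreal (\<integral>z. (sqrt (2 * pi) / s) ^ DIM('a) * exp (- (norm z / s)\<^sup>2 / 2) \<partial>(lborel :: 'a measure))"
    by (rule nn_integral_eq_integral[OF I]) (use assms in auto)
  also have "\<dots> = ennreal ((sqrt (2 * pi) / s) ^ DIM('a) * (sqrt (2 * pi) / (1 / s)) ^ DIM('a))"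
    using gauss_integral(2)[OF s, where 'a='a] unfolding e by simp
  also have "(sqrt (2 * pi) / s) ^ DIM('a) * (sqrt (2 * pi) / (1 / s)) ^ DIM('a) = (2 * pi) ^ DIM('a)"
    unfolding power_mult_distrib[symmetric] using assms by simp
  finally show ?thesis .
qed

text \<open>A Gaussian weight \<open>E\<close> is inserted and the square of the transform is
  written as a double integral over \<open>x\<close> and \<open>y\<close>. Integrating in the
  frequency first turns \<open>E\<close> into a nonnegative kernel \<open>K (x - y)\<close> of total
  mass \<open>(2 * pi) ^ n\<close>. A Schur test then bounds the weighted integral uniformly in the
  width \<open>s\<close>, and Fatou removes the weight as \<open>s\<close> tends to 0.\<close>

lemma plancherel_bound:
  fixes w :: "real^'n::finite \<Rightarrow> complex"
  assumes w: "bcs w"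
  shows "(\<integral>\<^sup>+\<xi>. ennreal ((norm (LBINT x. cis (x \<bullet> \<xi>) * w x))\<^sup>2) \<partial>lborel)
           \<le> ennreal ((2 * pi) ^ CARD('n) * (LBINT x. (norm (w x))\<^sup>2))"
proof -
  define W where "W = (\<lambda>\<xi>. LBINT x. cis (x \<bullet> \<xi>) * w x)"
  have [measurable]: "w \<in> borel_measurable borel" using w by (rule bcs_measurable)
  have [measurable]: "W \<in> borel_measurable borel"
    unfolding W_def by (rule lborel.borel_measurable_lebesgue_integral) measurable
  have wi: "integrable lborel (\<lambda>x. norm (w x))" using bcs_integrable[OF w] by simp
  have bound: "(\<integral>\<^sup>+\<xi>. ennreal ((norm (W \<xi>))\<^sup>2 * exp (- (s * norm \<xi>)\<^sup>2 / 2)) \<partial>lborel)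
      \<le> ennreal ((2 * pi) ^ CARD('n) * (LBINT x. (norm (w x))\<^sup>2))" if s: "s > 0" for s
  proof -
    define K where "K = (\<lambda>z::real^'n. (sqrt (2 * pi) / s) ^ CARD('n) * exp (- (norm z / s)\<^sup>2 / 2))"
    have K0: "K z \<ge> 0" for z using s by (simp add: K_def)
    have [measurable]: "K \<in> borel_measurable borel" unfolding K_def by measurable
    define P where "P = (\<lambda>(x::real^'n, y). w x * cnj (w y))"
    define E where "E = (\<lambda>\<xi>::real^'n. exp (- (s * norm \<xi>)\<^sup>2 / 2))"
    have [measurable]: "E \<in> borel_measurable borel" unfolding E_def by measurable
    have Ei: "integrable lborel E" unfolding E_def by (rule gauss_integral(1)[OF s])
    have P[measurable]: "P \<in> borel_measurable borel" 
      unfolding P_def borel_prod[symmetric] by measurable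
    have [measurable]: "P \<in> borel_measurable (borel \<Otimes>\<^sub>M borel)" using P by (simp add: borel_prod)
    have Pn: "integrable lborel P"
      unfolding P_def
      by (rule fubini_dominated(1)[OF _ wi wi]) (use P P_def in \<open>auto simp: norm_mult\<close>)
    have W2: "W \<xi> * cnj (W \<xi>) = integral\<^sup>L lborel (\<lambda>p. cis ((fst p - snd p) \<bullet> \<xi>) * P p)" for \<xi>
    proof -
      have m: "(\<lambda>(x, y). (cis (x \<bullet> \<xi>) * w x) * cnj (cis (y \<bullet> \<xi>) * w y)) \<in> borel_measurable borel"
        unfolding borel_prod[symmetric] by measurable
      have "W \<xi> * cnj (W \<xi>) = (LBINT x. LBINT y. (cis (x \<bullet> \<xi>) * w x) * cnj (cis (y \<bullet> \<xi>) * w y))"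
        unfolding W_def by (simp flip: integral_cnj)
      also have "\<dots> = integral\<^sup>L lborel (\<lambda>(x, y). (cis (x \<bullet> \<xi>) * w x) * cnj (cis (y \<bullet> \<xi>) * w y))"
        by (rule fubini_dominated(2)[OF m wi wi, symmetric]) (simp add: norm_mult)
      also have "\<dots> = integral\<^sup>L lborel (\<lambda>p. cis ((fst p - snd p) \<bullet> \<xi>) * P p)"
      proof (intro integral_cong refl)
        fix p :: "(real^'n) \<times> (real^'n)"
        obtain x y where p: "p = (x, y)" by (cases p)
        have "cis ((x - y) \<bullet> \<xi>) = cis (x \<bullet> \<xi>) * cnj (cis (y \<bullet> \<xi>))"
          by (simp add: inner_diff_left cis_cnj cis_mult)
        then show "(case p of (x, y) \<Rightarrow> (cis (x \<bullet> \<xi>) * w x) * cnj (cis (y \<bullet> \<xi>) * w y))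
            = cis ((fst p - snd p) \<bullet> \<xi>) * P p"
          by (simp add: p P_def)
      qed
      finally show ?thesis .
    qed
    have mm: "(\<lambda>(\<xi>, p). E \<xi> * (cis ((fst p - snd p) \<bullet> \<xi>) * P p)) \<in> borel_measurable borel"
      unfolding borel_prod[symmetric] by measurable
    have Pni: "integrable lborel (\<lambda>p. norm (P p))" using Pn by simp
    have "(LBINT \<xi>. complex_of_real (E \<xi>) * (W \<xi> * cnj (W \<xi>)))
       = (LBINT \<xi>. LBINT p. E \<xi> * (cis ((fst p - snd p) \<bullet> \<xi>) * P p))"
      unfolding W2 by simp
    also have "\<dots> = (LBINT p. LBINT \<xi>. E \<xi> * (cis ((fst p - snd p) \<bullet> \<xi>) * P p))"
      by (rule fubini_dominated(3)[OF mm Ei Pni]) (auto simp: norm_mult E_def)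
    also have "\<dots> = (LBINT p. K (fst p - snd p) * P p)"
    proof (intro integral_cong refl)
      fix p :: "(real^'n) \<times> (real^'n)"
      have "(LBINT \<xi>. E \<xi> * (cis ((fst p - snd p) \<bullet> \<xi>) * P p))
         = (LBINT \<xi>. (cis (\<xi> \<bullet> (fst p - snd p)) * E \<xi>) * P p)"
        by (intro integral_cong refl) (simp add: inner_commute)
      also have "\<dots> = (LBINT \<xi>. cis (\<xi> \<bullet> (fst p - snd p)) * E \<xi>) * P p"
        by simp
      also have "(LBINT \<xi>. cis (\<xi> \<bullet> (fst p - snd p)) * E \<xi>) = K (fst p - snd p)"
        unfolding E_def K_def using gauss_fourier(2)[OF s, of "fst p - snd p"] by simp
      finally show "(LBINT \<xi>. E \<xi> * (cis ((fst p - snd p) \<bullet> \<xi>) * P p)) = K (fst p - snd p) * P p" .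
    qed
    finally have eq: "(LBINT \<xi>. complex_of_real (E \<xi>) * (W \<xi> * cnj (W \<xi>))) = (LBINT p. K (fst p - snd p) * P p)" .
    have Wb: "norm (W \<xi>) \<le> (LBINT x. norm (w x))" for \<xi>
      unfolding W_def by (rule order_trans[OF integral_norm_bound]) (simp add: norm_mult)
    have EWi: "integrable lborel (\<lambda>\<xi>. (norm (W \<xi>))\<^sup>2 * E \<xi>)"
    proof (rule integrable_bound)
      show "integrable lborel (\<lambda>\<xi>. (LBINT x. norm (w x))\<^sup>2 * E \<xi>)" using Ei by (rule integrable_mult_right)
      show "AE \<xi> in lborel. norm ((norm (W \<xi>))\<^sup>2 * E \<xi>) \<le> norm ((LBINT x. norm (w x))\<^sup>2 * E \<xi>)"
        using Wb by (intro AE_I2) (auto simp: abs_mult intro!: mult_right_mono power_mono)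
    qed measurable
    have K1: "(\<integral>\<^sup>+y. ennreal (K (y + c)) \<partial>lborel) = ennreal ((2 * pi) ^ CARD('n))" for c
      using nn_integral_translate[of "\<lambda>y. ennreal (K y)" c] gauss_kernel_integral[OF s, where 'a="real^'n"] by (simp add: K_def)
    have KI: "(\<integral>\<^sup>+y. ennreal (K (x - y)) * c \<partial>lborel) = ennreal ((2 * pi) ^ CARD('n)) * c"
      "(\<integral>\<^sup>+y. ennreal (K (y - x)) * c \<partial>lborel) = ennreal ((2 * pi) ^ CARD('n)) * c" for x c
      unfolding K1[of "- x", symmetric] by (subst nn_integral_multc[symmetric], auto simp: K_def norm_minus_commute)+
    have m1: "(\<lambda>p. ennreal (K (fst p - snd p)) * ennreal ((norm (w (fst p)))\<^sup>2 / 2)) \<in> borel_measurable (lborel \<Otimes>\<^sub>M lborel)"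
      by measurable
    have m2: "(\<lambda>(x, y). ennreal (K (x - y)) * ennreal ((norm (w y))\<^sup>2 / 2)) \<in> borel_measurable (lborel \<Otimes>\<^sub>M lborel)"
      by measurable
    have "(\<integral>\<^sup>+\<xi>. ennreal ((norm (W \<xi>))\<^sup>2 * E \<xi>) \<partial>lborel) = ennreal (LBINT \<xi>. (norm (W \<xi>))\<^sup>2 * E \<xi>)"
      by (rule nn_integral_eq_integral[OF EWi]) (simp add: E_def)
    also have "(LBINT \<xi>. (norm (W \<xi>))\<^sup>2 * E \<xi>) = Re (LBINT \<xi>. complex_of_real ((norm (W \<xi>))\<^sup>2 * E \<xi>))"
      by (subst integral_complex_of_real) (simp only: Re_complex_of_real)
    also have "(LBINT \<xi>. complex_of_real ((norm (W \<xi>))\<^sup>2 * E \<xi>)) = (LBINT \<xi>. complex_of_real (E \<xi>) * (W \<xi> * cnj (W \<xi>)))"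
      by (intro integral_cong refl) (simp add: complex_norm_square[symmetric] del: of_real_power)
    also have "\<dots> = (LBINT p. K (fst p - snd p) * P p)" by (rule eq)
    also have "ennreal (Re \<dots>) \<le> (\<integral>\<^sup>+p. ennreal (norm (K (fst p - snd p) * P p)) \<partial>lborel)"
    proof -
      have "ennreal (Re (LBINT p. K (fst p - snd p) * P p)) \<le> ennreal (norm (LBINT p. K (fst p - snd p) * P p))"
        by (intro ennreal_leI complex_Re_le_cmod)
      also have "\<dots> \<le> (\<integral>\<^sup>+p. ennreal (norm (K (fst p - snd p) * P p)) \<partial>lborel)"
      \<comment> \<open>A Bochner integral without integrability is 0, so the bound by the
        nonnegative integral holds in either case.\<close>
      proof (cases "integrable lborel (\<lambda>p. K (fst p - snd p) * P p)")
        case True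
        then show ?thesis by (rule integral_norm_bound_ennreal)
      qed (simp add: not_integrable_integral_eq)
      finally show ?thesis .
    qed
    \<comment> \<open>The arithmetic-geometric mean inequality separates \<open>w (fst p)\<close>
      from \<open>w (snd p)\<close>; each half then sees only the mass of \<open>K\<close> in the
      other variable.\<close>
    also have "\<dots> \<le> (\<integral>\<^sup>+p. ennreal (K (fst p - snd p)) * ennreal ((norm (w (fst p)))\<^sup>2 / 2)
                       + ennreal (K (fst p - snd p)) * ennreal ((norm (w (snd p)))\<^sup>2 / 2) \<partial>lborel)"
    proof (intro nn_integral_mono)
      fix p :: "(real^'n) \<times> (real^'n)"
      have "norm (w (fst p)) * norm (w (snd p)) \<le> (norm (w (fst p)))\<^sup>2 / 2 + (norm (w (snd p)))\<^sup>2 / 2"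
        using sum_squares_bound[of "norm (w (fst p))" "norm (w (snd p))"] by simp
      then have "norm (K (fst p - snd p) * P p) \<le> K (fst p - snd p) * ((norm (w (fst p)))\<^sup>2 / 2 + (norm (w (snd p)))\<^sup>2 / 2)"
        using K0[of "fst p - snd p"] by (auto simp: norm_mult P_def case_prod_beta intro!: mult_left_mono)
      then show "ennreal (norm (K (fst p - snd p) * P p)) \<le> ennreal (K (fst p - snd p)) * ennreal ((norm (w (fst p)))\<^sup>2 / 2)
                       + ennreal (K (fst p - snd p)) * ennreal ((norm (w (snd p)))\<^sup>2 / 2)"
        using K0[of "fst p - snd p"]
        by (simp add: ennreal_mult[symmetric] ennreal_plus[symmetric] distrib_left ennreal_leI del: ennreal_plus)
    qed
    also have "\<dots> = (\<integral>\<^sup>+p. ennreal (K (fst p - snd p)) * ennreal ((norm (w (fst p)))\<^sup>2 / 2) \<partial>(lborel \<Otimes>\<^sub>M lborel))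
                + (\<integral>\<^sup>+p. ennreal (K (fst p - snd p)) * ennreal ((norm (w (snd p)))\<^sup>2 / 2) \<partial>(lborel \<Otimes>\<^sub>M lborel))"
      unfolding lborel_prod[symmetric] by (rule nn_integral_add) measurable
    also have "(\<integral>\<^sup>+p. ennreal (K (fst p - snd p)) * ennreal ((norm (w (fst p)))\<^sup>2 / 2) \<partial>(lborel \<Otimes>\<^sub>M lborel))
       = (\<integral>\<^sup>+x. \<integral>\<^sup>+y. ennreal (K (x - y)) * ennreal ((norm (w x))\<^sup>2 / 2) \<partial>lborel \<partial>lborel)"
      using lborel.nn_integral_fst[OF m1] by simp
    also have "\<dots> = (\<integral>\<^sup>+x. ennreal ((2 * pi) ^ CARD('n)) * ennreal ((norm (w x))\<^sup>2 / 2) \<partial>lborel)"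
      by (intro nn_integral_cong) (simp only: KI(1))
    also have "(\<integral>\<^sup>+p. ennreal (K (fst p - snd p)) * ennreal ((norm (w (snd p)))\<^sup>2 / 2) \<partial>(lborel \<Otimes>\<^sub>M lborel))
       = (\<integral>\<^sup>+y. \<integral>\<^sup>+x. ennreal (K (x - y)) * ennreal ((norm (w y))\<^sup>2 / 2) \<partial>lborel \<partial>lborel)"
      using lborel_pair.nn_integral_snd[OF m2] by (simp add: split_beta')
    also have "\<dots> = (\<integral>\<^sup>+y. ennreal ((2 * pi) ^ CARD('n)) * ennreal ((norm (w y))\<^sup>2 / 2) \<partial>lborel)"
      by (intro nn_integral_cong) (simp only: KI(2))
    also have "(\<integral>\<^sup>+y. ennreal ((2 * pi) ^ CARD('n)) * ennreal ((norm (w y))\<^sup>2 / 2) \<partial>lborel)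
        = ennreal ((2 * pi) ^ CARD('n) * (LBINT x. (norm (w x))\<^sup>2) / 2)"
    proof -
      have "(\<integral>\<^sup>+y. ennreal ((2 * pi) ^ CARD('n)) * ennreal ((norm (w y))\<^sup>2 / 2) \<partial>lborel)
         = ennreal ((2 * pi) ^ CARD('n)) * (\<integral>\<^sup>+y. ennreal ((norm (w y))\<^sup>2 / 2) \<partial>lborel)"
        by (rule nn_integral_cmult) measurable
      also have "(\<integral>\<^sup>+y. ennreal ((norm (w y))\<^sup>2 / 2) \<partial>lborel) = ennreal (LBINT y. (norm (w y))\<^sup>2 / 2)"
        by (rule nn_integral_eq_integral) (use bcs_norm_sq[OF w] in auto)
      finally show ?thesis by (simp add: ennreal_mult[symmetric])
    qed
    also have "ennreal ((2 * pi) ^ CARD('n) * (LBINT x. (norm (w x))\<^sup>2) / 2)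
         + ennreal ((2 * pi) ^ CARD('n) * (LBINT x. (norm (w x))\<^sup>2) / 2)
        = ennreal ((2 * pi) ^ CARD('n) * (LBINT x. (norm (w x))\<^sup>2))"
      by (subst ennreal_plus[symmetric]) auto
    finally show ?thesis by (simp add: E_def)
  qed
  have lim: "(\<lambda>k. ennreal ((norm (W \<xi>))\<^sup>2 * exp (- (1 / Suc k * norm \<xi>)\<^sup>2 / 2))) \<longlonglongrightarrow> ennreal ((norm (W \<xi>))\<^sup>2)" for \<xi>
  proof -
    have "(\<lambda>k. (norm (W \<xi>))\<^sup>2 * exp (- (1 / Suc k * norm \<xi>)\<^sup>2 / 2)) \<longlonglongrightarrow> (norm (W \<xi>))\<^sup>2 * exp (- (0 * norm \<xi>)\<^sup>2 / 2)"
      by (intro tendsto_intros LIMSEQ_Suc[OF lim_1_over_n]) simp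
    then show ?thesis by (intro tendsto_ennrealI) simp
  qed
  have "(\<integral>\<^sup>+\<xi>. ennreal ((norm (W \<xi>))\<^sup>2) \<partial>lborel)
      = (\<integral>\<^sup>+\<xi>. liminf (\<lambda>k. ennreal ((norm (W \<xi>))\<^sup>2 * exp (- (1 / Suc k * norm \<xi>)\<^sup>2 / 2))) \<partial>lborel)"
    by (intro nn_integral_cong lim_imp_Liminf[symmetric] lim) simp
  also have "\<dots> \<le> liminf (\<lambda>k. \<integral>\<^sup>+\<xi>. ennreal ((norm (W \<xi>))\<^sup>2 * exp (- (1 / Suc k * norm \<xi>)\<^sup>2 / 2)) \<partial>lborel)"
    by (rule nn_integral_liminf) measurable
  also have "\<dots> \<le> liminf (\<lambda>k::nat. ennreal ((2 * pi) ^ CARD('n) * (LBINT x. (norm (w x))\<^sup>2)))"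
    by (intro Liminf_mono always_eventually allI bound) simp
  also have "\<dots> = ennreal ((2 * pi) ^ CARD('n) * (LBINT x. (norm (w x))\<^sup>2))"
    by (simp add: Liminf_const)
  finally show ?thesis unfolding W_def .
qed

section \<open>Translated dyadic lattices\<close>

abbreviation vol :: "'a::euclidean_space set \<Rightarrow> real" where
  "vol \<equiv> measure lborel"

lemma half_open_cube_borel[measurable]: "half_open_cube c l \<in> sets borel"
proof -
  have "half_open_cube c l = (\<Inter>i. {x. c $ i \<le> x $ i} \<inter> {x. x $ i < c $ i + l})"
    by (auto simp: half_open_cube_def)
  also have "\<dots> \<in> sets borel"
    by (intro sets.countable_INT' sets.Int borel_closed borel_open)
       (auto intro!: closed_Collect_le open_Collect_less continuous_intros)
  finally show ?thesis .
qed

lemma measure_half_open_cube: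
  fixes c :: "real^'n::finite"
  assumes "l \<ge> 0"
  shows "emeasure lborel (half_open_cube c l) = ennreal (l ^ CARD('n))"
    and "vol (half_open_cube c l) = l ^ CARD('n)"
proof -
  have box: "box c (c + (\<chi> i. l)) \<subseteq> half_open_cube c l"
    by (auto simp: half_open_cube_def mem_box_cart less_imp_le)
  have cbox: "half_open_cube c l \<subseteq> cbox c (c + (\<chi> i. l))"
    by (auto simp: half_open_cube_def mem_box_cart less_imp_le)
  have le: "c \<bullet> b \<le> (c + (\<chi> i. l)) \<bullet> b" if "b \<in> Basis" for b
    using that assms by (auto simp: Basis_vec_def inner_axis)
  have pr: "(\<Prod>b\<in>Basis. (c + (\<chi> i. l) - c) \<bullet> b) = l ^ CARD('n)"
  proof -
    have "(\<Prod>b\<in>Basis. (c + (\<chi> i. l) - c) \<bullet> b) = (\<Prod>b\<in>(Basis :: (real^'n) set). l)"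
      by (rule prod.cong) (auto simp: Basis_vec_def inner_axis)
    then show ?thesis by simp
  qed
  have "emeasure lborel (box c (c + (\<chi> i. l))) = ennreal (l ^ CARD('n))"
    using le pr by (subst emeasure_lborel_box) auto
  moreover have "emeasure lborel (cbox c (c + (\<chi> i. l))) = ennreal (l ^ CARD('n))"
    using le pr by (subst emeasure_lborel_cbox) auto
  ultimately show e: "emeasure lborel (half_open_cube c l) = ennreal (l ^ CARD('n))"
    using emeasure_mono[OF box, of lborel] emeasure_mono[OF cbox, of lborel] by auto
  show "vol (half_open_cube c l) = l ^ CARD('n)"
    using assms by (simp add: measure_def e)
qed

lemma fmeasurable_half_open_cube: "half_open_cube c l \<in> fmeasurable lborel"
proof (cases "l \<ge> 0")
  case True
  then show ?thesis by (simp add: fmeasurable_def measure_half_open_cube)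
next
  case False
  then have "half_open_cube c l = {}" by (force simp: half_open_cube_def)
  then show ?thesis by simp
qed

lemma half_open_cube_subset_imp_le:
  fixes c d :: "real^'n::finite"
  assumes "half_open_cube c l \<subseteq> half_open_cube d k" "l > 0"
  shows "l \<le> k"
proof -
  have c: "c \<in> half_open_cube c l" using assms by (auto simp: half_open_cube_def)
  then have "c \<in> half_open_cube d k" using assms(1) by blast
  then have "d $ undefined \<le> c $ undefined \<and> c $ undefined < d $ undefined + k"
    by (simp add: half_open_cube_def)
  then have k: "k > 0" by linarith
  have "l ^ CARD('n) \<le> k ^ CARD('n)"
    using measure_mono_fmeasurable[OF assms(1), of lborel] fmeasurable_half_open_cube[of d k] assms k
    by (simp add: measure_half_open_cube)
  then show ?thesis using k assms by (simp add: power_mono_iff)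
qed

text \<open>One real number \<open>t\<close> shifts all coordinates and all scales alike, so that a
  good lattice can be sought by measuring subsets of an interval.\<close>

definition tcube :: "real \<Rightarrow> int \<Rightarrow> int^'n::finite \<Rightarrow> (real^'n) set" where
  "tcube t v z = half_open_cube (\<chi> i. t + 2 powi v * real_of_int (z $ i)) (2 powi v)"

text \<open>The concentric threefold dilate of the untranslated cube \<open>tcube 0 v z\<close>.
  Grid cubes always belong to the untranslated grid; only the lattice that must capture them is
  moved.\<close>

definition tcube3 :: "int \<Rightarrow> int^'n::finite \<Rightarrow> (real^'n) set" where
  "tcube3 v z = half_open_cube (\<chi> i. 2 powi v * (real_of_int (z $ i) - 1)) (3 * 2 powi v)"

text \<open>Membership becomes a condition on integer parts, so that nesting of the cubes is integer
  division, as in \<open>floor_powi_coarsen\<close>.\<close>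

lemma mem_tcube: "x \<in> tcube t v z \<longleftrightarrow> (\<forall>i. \<lfloor>(x $ i - t) / 2 powi v\<rfloor> = z $ i)"
proof -
  have p: "(2::real) powi v > 0" by simp
  have "\<lfloor>(x $ i - t) / 2 powi v\<rfloor> = z $ i \<longleftrightarrow> t + 2 powi v * real_of_int (z $ i) \<le> x $ i \<and> x $ i < t + 2 powi v * real_of_int (z $ i) + 2 powi v" for i
    unfolding floor_eq_iff using p by (auto simp: field_simps)
  then show ?thesis by (simp add: tcube_def half_open_cube_def)
qed

lemma mem_tcube3: "x \<in> tcube3 v z \<longleftrightarrow> (\<forall>i. \<bar>\<lfloor>x $ i / 2 powi v\<rfloor> - z $ i\<bar> \<le> 1)"
proof -
  have p: "(2::real) powi v > 0" by simp
  have "\<bar>\<lfloor>y / 2 powi v\<rfloor> - k\<bar> \<le> 1 \<longleftrightarrow> 2 powi v * (real_of_int k - 1) \<le> y \<and> y < 2 powi v * (real_of_int k - 1) + 3 * 2 powi v" for y and k :: int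
  proof -
    have "\<bar>\<lfloor>y / 2 powi v\<rfloor> - k\<bar> \<le> 1 \<longleftrightarrow> k - 1 \<le> \<lfloor>y / 2 powi v\<rfloor> \<and> \<lfloor>y / 2 powi v\<rfloor> < k + 2" by linarith
    also have "\<dots> \<longleftrightarrow> real_of_int k - 1 \<le> y / 2 powi v \<and> y / 2 powi v < real_of_int k + 2"
      by (simp add: le_floor_iff floor_less_iff)
    also have "\<dots> \<longleftrightarrow> 2 powi v * (real_of_int k - 1) \<le> y \<and> y < 2 powi v * (real_of_int k - 1) + 3 * 2 powi v"
      using p by (auto simp: field_simps)
    finally show ?thesis .
  qed
  then show ?thesis by (simp add: tcube3_def half_open_cube_def)
qed

lemma tcube_nonempty: "tcube t v z \<noteq> {}"
proof -
  have "(\<chi> i. t + 2 powi v * real_of_int (z $ i)) \<in> tcube t v z"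
    by (simp add: tcube_def half_open_cube_def)
  then show ?thesis by blast
qed

lemma tcube_eqI: "x \<in> tcube t v z \<Longrightarrow> x \<in> tcube t v w \<Longrightarrow> z = w"
  unfolding mem_tcube vec_eq_iff by metis

lemma floor_powi_coarsen:
  fixes y :: real
  assumes "v \<le> u"
  shows "\<lfloor>y / 2 powi u\<rfloor> = \<lfloor>y / 2 powi v\<rfloor> div 2 ^ nat (u - v)"
proof -
  have "(2::real) powi u = 2 powi v * 2 powi (u - v)" by (subst power_int_add[symmetric]) auto
  also have "(2::real) powi (u - v) = real (2 ^ nat (u - v))" using assms by (simp add: power_int_def)
  finally have "(2::real) powi u = 2 powi v * real (2 ^ nat (u - v))" .
  then have "y / 2 powi u = (y / 2 powi v) / real (2 ^ nat (u - v))" by (simp only: divide_divide_eq_left)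
  then show ?thesis
    using floor_divide_real_eq_div[of "2 ^ nat (u - v)" "y / 2 powi v"] by (simp only:) simp
qed

lemma tcube_nested:
  assumes "v \<le> u" "x \<in> tcube t v z" "x \<in> tcube t u w"
  shows "tcube t v z \<subseteq> tcube t u w"
proof
  fix y assume "y \<in> tcube t v z"
  with assms show "y \<in> tcube t u w"
    unfolding mem_tcube by (simp add: floor_powi_coarsen[OF assms(1)])
qed

definition dyad :: "real \<Rightarrow> (real^'n::finite) set set" where
  "dyad t = {tcube t v z | v z. True}"

lemma dyad_cover: "\<exists>z. x \<in> tcube t v z"
  by (rule exI[of _ "\<chi> i. \<lfloor>(x $ i - t) / 2 powi v\<rfloor>"]) (simp add: mem_tcube)

lemma dyadic_lattice_dyad: "dyadic_lattice (dyad t)"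
  unfolding dyadic_lattice_def
proof (intro conjI ballI allI)
  fix Q :: "(real^'n) set" assume "Q \<in> dyad t"
  then show "\<exists>c k. Q = half_open_cube c (2 powi k)" by (auto simp: dyad_def tcube_def)
next
  fix k x
  from dyad_cover[of x t k] obtain z where "x \<in> tcube t k z" by blast
  then show "\<exists>c. half_open_cube c (2 powi k) \<in> dyad t \<and> x \<in> half_open_cube c (2 powi k)"
    unfolding dyad_def tcube_def by blast
next
  fix Q R :: "(real^'n) set" assume "Q \<in> dyad t" "R \<in> dyad t"
  then obtain v z u w where "Q = tcube t v z" "R = tcube t u w" by (auto simp: dyad_def)
  then show "Q \<inter> R = {} \<or> Q \<subseteq> R \<or> R \<subseteq> Q"
    using tcube_nested[of v u _ t z w] tcube_nested[of u v _ t w z] by (meson disjoint_iff nle_le)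
qed

lemma powi_two_le_iff: "(2::real) powi a \<le> 2 powi b \<longleftrightarrow> a \<le> b"
  by (metis power_int_increasing power_int_strict_increasing linorder_not_le one_le_numeral one_less_numeral_iff semiring_norm(76))

text \<open>Fix a point of \<open>Q\<close>. A lattice cube containing it is determined by its
  scale, and the scale lies between those of \<open>Q\<close> and \<open>R\<close>.\<close>

lemma dyad_finite_chain:
  assumes "Q \<in> dyad t" "R \<in> dyad t"
  shows "finite {P \<in> dyad t. Q \<subseteq> P \<and> P \<subseteq> R}"
proof -
  obtain v z u w where Q: "Q = tcube t v z" and R: "R = tcube t u w" using assms by (auto simp: dyad_def)
  obtain x where x: "x \<in> Q" using tcube_nonempty Q by blast
  define idx where "idx = (\<lambda>k::int. \<chi> i. \<lfloor>(x $ i - t) / 2 powi k\<rfloor>)"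
  have "{P \<in> dyad t. Q \<subseteq> P \<and> P \<subseteq> R} \<subseteq> (\<lambda>k. tcube t k (idx k)) ` {v..u}"
  proof
    fix P assume P: "P \<in> {P \<in> dyad t. Q \<subseteq> P \<and> P \<subseteq> R}"
    then obtain k y where k: "P = tcube t k y" by (auto simp: dyad_def)
    have "y = idx k" using P x k by (auto simp: idx_def mem_tcube vec_eq_iff)
    moreover have "(2::real) powi v \<le> 2 powi k"
      using P Q k half_open_cube_subset_imp_le unfolding tcube_def by (metis (no_types, lifting) mem_Collect_eq zero_less_numeral zero_less_power_int)
    moreover have "(2::real) powi k \<le> 2 powi u"
      using P R k half_open_cube_subset_imp_le unfolding tcube_def by (metis (no_types, lifting) mem_Collect_eq zero_less_numeral zero_less_power_int)
    ultimately show "P \<in> (\<lambda>k. tcube t k (idx k)) ` {v..u}"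
      using k by (auto simp: powi_two_le_iff)
  qed
  then show ?thesis by (rule finite_subset) simp
qed

lemma countable_dyad: "countable (dyad t :: (real^'n::finite) set set)"
proof -
  have "(dyad t :: (real^'n) set set) = (\<lambda>(v, z). tcube t v z) ` UNIV" by (auto simp: dyad_def)
  moreover have "countable ((\<lambda>(v, z). tcube t v z :: (real^'n) set) ` UNIV)"
    by (rule countable_image[OF countableI_type])
  ultimately show ?thesis by (rule ssubst)
qed

section \<open>Stopping times in nested families of sets\<close>

definition stop_children :: "'a set set \<Rightarrow> ('a set \<Rightarrow> 'a set \<Rightarrow> bool) \<Rightarrow> 'a set \<Rightarrow> 'a set set" where
  "stop_children D stop P =
     {Q \<in> D. Q \<subset> P \<and> stop P Q \<and> (\<forall>Q'\<in>D. Q \<subset> Q' \<and> Q' \<subset> P \<longrightarrow> \<not> stop P Q')}"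

lemma stop_children_disjoint:
  assumes "\<And>Q R. Q \<in> D \<Longrightarrow> R \<in> D \<Longrightarrow> Q \<inter> R = {} \<or> Q \<subseteq> R \<or> R \<subseteq> Q"
    and "Q \<in> stop_children D stop P" "Q' \<in> stop_children D stop P" "Q \<noteq> Q'"
  shows "Q \<inter> Q' = {}"
proof (rule ccontr)
  assume "Q \<inter> Q' \<noteq> {}"
  then have "Q \<subset> Q' \<or> Q' \<subset> Q" using assms(1)[of Q Q'] assms(2-4) by (auto simp: stop_children_def)
  then show False using assms(2,3) unfolding stop_children_def by blast
qed

text \<open>The family consists of \<open>R0\<close> and all its iterated stopping children. A
  member of a later generation that meets \<open>P\<close> lies inside a child of \<open>P\<close>,
  so the sets \<open>P\<close> minus children are disjoint. For the last claim take the smallest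
  member \<open>P\<close> above \<open>R\<close>: if \<open>R\<close> stopped at \<open>P\<close>, a
  maximal stopping set between \<open>R\<close> and \<open>P\<close> would be a smaller member above
  \<open>R\<close>. Finite chains provide both extremal sets.\<close>

lemma stopping_family:
  fixes D :: "'a set set" and stop :: "'a set \<Rightarrow> 'a set \<Rightarrow> bool"
  assumes nested: "\<And>Q R. Q \<in> D \<Longrightarrow> R \<in> D \<Longrightarrow> Q \<inter> R = {} \<or> Q \<subseteq> R \<or> R \<subseteq> Q"
    and nonempty: "\<And>Q. Q \<in> D \<Longrightarrow> Q \<noteq> {}"
    and chain: "\<And>Q R. Q \<in> D \<Longrightarrow> R \<in> D \<Longrightarrow> finite {P \<in> D. Q \<subseteq> P \<and> P \<subseteq> R}"
    and R0: "R0 \<in> D"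
  obtains S where "R0 \<in> S" "S \<subseteq> D" "\<And>P. P \<in> S \<Longrightarrow> P \<subseteq> R0"
    "disjoint_family_on (\<lambda>P. P - \<Union>(stop_children D stop P)) S"
    "\<And>R. R \<in> D \<Longrightarrow> R \<subseteq> R0 \<Longrightarrow> \<exists>P\<in>S. R \<subseteq> P \<and> (R = P \<or> \<not> stop P R)"
proof -
  define children where "children = stop_children D stop"
  define G where "G = rec_nat {R0} (\<lambda>_ A. \<Union>(children ` A))"
  have G0: "G 0 = {R0}" and GS: "G (Suc m) = \<Union>(children ` G m)" for m by (auto simp: G_def)
  define S where "S = (\<Union>m. G m)"
  have chD: "Q \<in> children P \<Longrightarrow> Q \<in> D \<and> Q \<subset> P" for P Q by (auto simp: children_def stop_children_def)
  have chdisj: "Q \<inter> Q' = {}" if "Q \<in> children P" "Q' \<in> children P" "Q \<noteq> Q'" for P Q Q'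
    using stop_children_disjoint[of D Q stop P Q'] nested that unfolding children_def by blast
  have GD: "G m \<subseteq> D \<and> (\<forall>P\<in>G m. P \<subseteq> R0)" for m
    by (induction m) (use R0 chD in \<open>auto simp: G0 GS, blast+\<close>)
  have Gdisj: "P \<in> G m \<Longrightarrow> P' \<in> G m \<Longrightarrow> P \<noteq> P' \<Longrightarrow> P \<inter> P' = {}" for m P P'
  proof (induction m arbitrary: P P')
    case (Suc m)
    then obtain X Y where X: "X \<in> G m" "P \<in> children X" and Y: "Y \<in> G m" "P' \<in> children Y" by (auto simp: GS)
    show ?case
    proof (cases "X = Y")
      case True
      then show ?thesis using chdisj X Y Suc.prems(3) by blast
    next
      case False
      then show ?thesis using Suc.IH[OF X(1) Y(1) False] chD[OF X(2)] chD[OF Y(2)] by blast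
    qed
  qed (auto simp: G0)
  \<comment> \<open>A member of generation \<open>m + d + 1\<close> remembers which child of which
    member of generation \<open>m\<close> it descends from.\<close>
  have anc: "\<exists>P\<in>G m. \<exists>X\<in>children P. P' \<subseteq> X" if "P' \<in> G (Suc (m + d))" for m d P'
    using that
  proof (induction d arbitrary: P')
    case 0 then show ?case by (auto simp: GS)
  next
    case (Suc d)
    then obtain Y where "Y \<in> G (Suc (m + d))" "P' \<in> children Y" by (auto simp: GS[of "Suc (m + d)"])
    then show ?case using Suc.IH[of Y] chD[of P' Y] by blast
  qed
  have key: "\<exists>X\<in>children P. P' \<subseteq> X" if P: "P \<in> G m" and P': "P' \<in> G m'" and int: "P \<inter> P' \<noteq> {}" and "m < m'" for P P' m m'
  proof -
    obtain d where "m' = Suc (m + d)" using \<open>m < m'\<close> less_iff_Suc_add by auto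
    then obtain P2 X where P2: "P2 \<in> G m" "X \<in> children P2" "P' \<subseteq> X" using anc P' by blast
    have "P2 = P"
    proof (rule ccontr)
      assume "P2 \<noteq> P"
      then have "P2 \<inter> P = {}" using Gdisj P P2 by blast
      then show False using P2 chD[OF P2(2)] int by blast
    qed
    then show ?thesis using P2 by blast
  qed
  have disj: "disjoint_family_on (\<lambda>P. P - \<Union>(children P)) S"
    unfolding disjoint_family_on_def
  proof (intro ballI impI)
    fix P P' assume "P \<in> S" "P' \<in> S" and ne: "P \<noteq> P'"
    then obtain m m' where m: "P \<in> G m" "P' \<in> G m'" by (auto simp: S_def)
    show "(P - \<Union>(children P)) \<inter> (P' - \<Union>(children P')) = {}"
    proof (cases "P \<inter> P' = {}")
      case False
      consider "m = m'" | "m < m'" | "m' < m" by linarith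
      then show ?thesis
      proof cases
        case 1 then show ?thesis using Gdisj m ne False by blast
      next
        case 2 then show ?thesis using key[OF m False] by blast
      next
        case 3 then show ?thesis using key[OF m(2) m(1) _ 3] False by blast
      qed
    qed auto
  qed
  have chS: "X \<in> S" if "P \<in> S" "X \<in> children P" for P X
  proof -
    obtain m where "P \<in> G m" using \<open>P \<in> S\<close> by (auto simp: S_def)
    then have "X \<in> G (Suc m)" using that by (auto simp: GS)
    then show ?thesis by (auto simp: S_def)
  qed
  have SD: "S \<subseteq> D" using GD by (auto simp: S_def)
  have SR: "\<And>P. P \<in> S \<Longrightarrow> P \<subseteq> R0" using GD by (auto simp: S_def)
  have R0S: "R0 \<in> S" using G0 by (auto simp: S_def)
  have cover: "\<exists>P\<in>S. R \<subseteq> P \<and> (R = P \<or> \<not> stop P R)" if R: "R \<in> D" "R \<subseteq> R0" for R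
  proof -
    define A where "A = {P \<in> S. R \<subseteq> P}"
    have "A \<subseteq> {P \<in> D. R \<subseteq> P \<and> P \<subseteq> R0}" using SD SR by (auto simp: A_def)
    then have "finite A" by (rule finite_subset[OF _ chain[OF R(1) R0]])
    moreover have "R0 \<in> A" using R R0S by (auto simp: A_def)
    ultimately obtain P where P: "P \<in> A" "\<And>B. B \<in> A \<Longrightarrow> \<not> B \<subset> P"
      using finite_has_minimal[of A] by (metis empty_iff psubset_eq)
    have PS: "P \<in> S" "R \<subseteq> P" using P by (auto simp: A_def)
    have "R = P \<or> \<not> stop P R"
    proof (rule ccontr)
      assume "\<not> ?thesis"
      then have st: "R \<subset> P" "stop P R" using PS by auto
      \<comment> \<open>The stopping sets between \<open>R\<close> and \<open>P\<close>; a largest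
        one is a stopping child of \<open>P\<close>, hence a member above \<open>R\<close> that is
        smaller than \<open>P\<close>.\<close>
      define B where "B = {Q \<in> D. R \<subseteq> Q \<and> Q \<subset> P \<and> stop P Q}"
      have "B \<subseteq> {Q \<in> D. R \<subseteq> Q \<and> Q \<subseteq> P}" by (auto simp: B_def)
      moreover have "P \<in> D" using PS SD by blast
      ultimately have "finite B" using finite_subset[OF _ chain[OF R(1)]] by blast
      moreover have "R \<in> B" using R st by (auto simp: B_def)
      ultimately obtain X where X: "X \<in> B" "\<And>Y. Y \<in> B \<Longrightarrow> \<not> X \<subset> Y"
        using finite_has_maximal[of B] by (metis empty_iff psubset_eq)
      have "X \<in> children P"
        unfolding children_def stop_children_def using X unfolding B_def by blast
      then have "X \<in> A" using chS[OF PS(1)] X by (auto simp: A_def B_def)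
      then show False using P(2)[of X] X by (auto simp: B_def)
    qed
    then show ?thesis using PS by blast
  qed
  show ?thesis by (rule that[OF R0S SD SR disj[unfolded children_def] cover])
qed

section \<open>Averages and sparse families\<close>

definition Ip :: "real \<Rightarrow> (real^'n::finite \<Rightarrow> complex) \<Rightarrow> (real^'n) set \<Rightarrow> real" where
  "Ip p f E = (LBINT x. indicator E x * (norm (f x)) powr p)"

definition av :: "real \<Rightarrow> (real^'n::finite \<Rightarrow> complex) \<Rightarrow> (real^'n) set \<Rightarrow> real" where
  "av p f E = (Ip p f E / vol E) powr (1 / p)"

lemma Ip_integrable:
  assumes "bcs f" "p > 0" "E \<in> sets borel"
  shows "integrable lborel (\<lambda>x. indicator E x * (norm (f x)) powr p)"
proof -
  obtain B where B: "B \<ge> 0" "\<And>x. norm (f x) \<le> B" using bcs_bound[OF assms(1)] by metis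
  obtain R where R: "\<And>x. f x \<noteq> 0 \<Longrightarrow> norm x \<le> R" using bcs_support[OF assms(1)] by metis
  have [measurable]: "f \<in> borel_measurable borel" "E \<in> sets borel" using assms by (auto dest: bcs_measurable)
  show ?thesis
  proof (rule integrable_bounded_support[of _ "B powr p" R])
    show "norm (indicator E x * (norm (f x)) powr p) \<le> B powr p" for x
      using B(2)[of x] assms(2) by (auto simp: indicator_def intro!: powr_mono2)
    show "norm x \<le> R" if "indicator E x * (norm (f x)) powr p \<noteq> (0::real)" for x
      using that R by auto
  qed measurable
qed

lemma Ip_nonneg: "Ip p f E \<ge> 0"
  unfolding Ip_def by (rule integral_nonneg_AE) auto

lemma av_nonneg: "av p f E \<ge> 0"
  unfolding av_def by simp

lemma Ip_mono:
  assumes "bcs f" "p > 0" "E \<in> sets borel" "E' \<in> sets borel" "\<And>x. x \<in> E \<Longrightarrow> f x \<noteq> 0 \<Longrightarrow> x \<in> E'"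
  shows "Ip p f E \<le> Ip p f E'"
  unfolding Ip_def
  by (rule integral_mono[OF Ip_integrable Ip_integrable]) (use assms in \<open>auto simp: indicator_def\<close>)

lemma Ip_disjoint_sum:
  assumes "bcs f" "p > 0" "finite G" "\<And>Q. Q \<in> G \<Longrightarrow> Q \<in> sets borel" "\<And>Q. Q \<in> G \<Longrightarrow> Q \<subseteq> P" "P \<in> sets borel"
    "\<And>Q Q'. Q \<in> G \<Longrightarrow> Q' \<in> G \<Longrightarrow> Q \<noteq> Q' \<Longrightarrow> Q \<inter> Q' = {}"
  shows "(\<Sum>Q\<in>G. Ip p f Q) \<le> Ip p f P"
proof -
  have "(\<Sum>Q\<in>G. Ip p f Q) = (LBINT x. (\<Sum>Q\<in>G. indicator Q x * (norm (f x)) powr p))"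
    unfolding Ip_def by (rule integral_sum[symmetric]) (use assms in \<open>auto intro!: Ip_integrable\<close>)
  also have "\<dots> \<le> Ip p f P"
    unfolding Ip_def
  proof (rule integral_mono)
    show "integrable lborel (\<lambda>x. \<Sum>Q\<in>G. indicator Q x * (norm (f x)) powr p)"
      by (intro integrable_sum Ip_integrable) (use assms in auto)
    show "integrable lborel (\<lambda>x. indicator P x * (norm (f x)) powr p)"
      by (rule Ip_integrable) (use assms in auto)
    fix x
    have "(\<Sum>Q\<in>G. indicator Q x :: real) = indicator (\<Union>G) x"
      by (subst indicator_UN_disjoint[of G "\<lambda>Q. Q" x, simplified])
         (use assms(3,7) in \<open>auto simp: disjoint_family_on_def\<close>)
    also have "\<dots> \<le> indicator P x" using assms(5) by (auto simp: indicator_def)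
    finally have "(\<Sum>Q\<in>G. indicator Q x :: real) \<le> indicator P x" .
    then show "(\<Sum>Q\<in>G. indicator Q x * (norm (f x)) powr p) \<le> indicator P x * (norm (f x)) powr p"
      unfolding sum_distrib_right[symmetric] by (rule mult_right_mono) simp
  qed
  finally show ?thesis .
qed

text \<open>Passing to a larger set costs \<open>\<beta> powr (1 / p)\<close>; rounding this up to
  \<open>\<beta>\<close> makes the factor the same for all exponents.\<close>

lemma av_compare:
  assumes "p \<ge> 1" "Ip p f E \<le> Ip p f R" "vol E > 0" "vol R \<le> \<beta> * vol E" "\<beta> \<ge> 1" "vol R > 0"
  shows "av p f E \<le> \<beta> * av p f R"
proof -
  have "Ip p f E / vol E \<le> Ip p f R / vol E"
    using assms by (simp add: divide_right_mono)
  also have "\<dots> \<le> \<beta> * (Ip p f R / vol R)"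
    using mult_right_mono[OF assms(4) Ip_nonneg[of p f R]] assms(3,6) by (simp add: field_simps)
  finally have "av p f E \<le> (\<beta> * (Ip p f R / vol R)) powr (1 / p)"
    unfolding av_def using assms Ip_nonneg[of p f E] by (intro powr_mono2) auto
  also have "\<dots> = \<beta> powr (1 / p) * av p f R"
    unfolding av_def by (rule powr_mult)
  also have "\<dots> \<le> \<beta> powr 1 * av p f R"
    using assms by (intro mult_right_mono powr_mono av_nonneg) auto
  finally show ?thesis using assms by simp
qed

text \<open>The weak-type bound behind the stopping time. The p-th power of the hypothesis compares
  integrals, disjointness bounds their sum by the integral over \<open>P\<close>, and
  \<open>b powr p \<ge> b\<close> makes the conclusion independent of the exponent.\<close>

lemma av_stop_measure:
  assumes f: "bcs f" and p: "p \<ge> 1" and P: "P \<in> sets borel" "vol P > 0" and b: "b \<ge> 1"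
    and G: "finite G" "\<And>Q. Q \<in> G \<Longrightarrow> Q \<in> sets borel" "\<And>Q. Q \<in> G \<Longrightarrow> Q \<subseteq> P"
      "\<And>Q Q'. Q \<in> G \<Longrightarrow> Q' \<in> G \<Longrightarrow> Q \<noteq> Q' \<Longrightarrow> Q \<inter> Q' = {}"
      "\<And>Q. Q \<in> G \<Longrightarrow> vol Q > 0"
    and big: "\<And>Q. Q \<in> G \<Longrightarrow> av p f Q > b * av p f P"
  shows "(\<Sum>Q\<in>G. vol Q) \<le> vol P / b"
proof (cases "Ip p f P = 0")
  case True
  have False if "Q \<in> G" for Q
  proof -
    have "Ip p f Q \<le> 0" using Ip_mono[of f p Q P] f p P G that True by force
    then have "Ip p f Q = 0" using Ip_nonneg[of p f Q] by simp
    then show False using big[OF that] True by (simp add: av_def)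
  qed
  then have "G = {}" by blast
  then show ?thesis using b by simp
next
  case False
  then have IP: "Ip p f P > 0" using Ip_nonneg[of p f P] by simp
  have "b * Ip p f P * vol Q \<le> Ip p f Q * vol P" if "Q \<in> G" for Q
  proof -
    have "(b * av p f P) powr p \<le> (av p f Q) powr p"
      using big[OF that] b p by (intro powr_mono2) (auto simp: av_nonneg)
    then have "b powr p * (Ip p f P / vol P) \<le> Ip p f Q / vol Q"
      using b p Ip_nonneg[of p f P] Ip_nonneg[of p f Q] by (simp add: av_def powr_mult powr_powr)
    moreover have "b * (Ip p f P / vol P) \<le> b powr p * (Ip p f P / vol P)"
      using b p Ip_nonneg[of p f P] powr_mono[of 1 p b] by (intro mult_right_mono) auto
    ultimately have "b * (Ip p f P / vol P) \<le> Ip p f Q / vol Q" by linarith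
    then show ?thesis using P(2) G(5)[OF that] by (simp add: field_simps)
  qed
  then have "(\<Sum>Q\<in>G. b * Ip p f P * vol Q) \<le> (\<Sum>Q\<in>G. Ip p f Q * vol P)"
    by (rule sum_mono)
  also have "\<dots> \<le> Ip p f P * vol P"
    unfolding sum_distrib_right[symmetric]
    by (intro mult_right_mono Ip_disjoint_sum) (use f p G P in auto)
  finally have "Ip p f P * (b * (\<Sum>Q\<in>G. vol Q)) \<le> Ip p f P * vol P"
    by (simp add: sum_distrib_left mult_ac)
  then have "b * (\<Sum>Q\<in>G. vol Q) \<le> vol P" using IP by simp
  then show ?thesis using b by (simp add: field_simps)
qed

lemma tcube_measure: "vol (tcube t v z :: (real^'n::finite) set) = (2 powi v) ^ CARD('n)"
  unfolding tcube_def by (rule measure_half_open_cube) simp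

lemma tcube3_measure: "vol (tcube3 v z :: (real^'n::finite) set) = (3 * 2 powi v) ^ CARD('n)"
  unfolding tcube3_def by (rule measure_half_open_cube) simp

lemma tcube_borel[measurable]: "tcube t v z \<in> sets borel" "tcube3 v z \<in> sets borel"
  by (simp_all add: tcube_def tcube3_def half_open_cube_borel)

lemma dyad_props:
  assumes "Q \<in> dyad t"
  shows "Q \<in> sets borel" "vol Q > 0" "Q \<in> fmeasurable lborel"
  using assms by (auto simp: dyad_def tcube_measure tcube_borel tcube_def fmeasurable_half_open_cube half_open_cube_borel measure_half_open_cube)

lemma sum_UN_le:
  fixes h :: "'a \<Rightarrow> real"
  assumes "finite I" "\<And>i. i \<in> I \<Longrightarrow> finite (A i)" "\<And>x. h x \<ge> 0"
  shows "sum h (\<Union>i\<in>I. A i) \<le> (\<Sum>i\<in>I. sum h (A i))"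
  using assms(1,2)
proof (induction I rule: finite_induct)
  case (insert i I)
  have "sum h (A i \<union> (\<Union>i\<in>I. A i)) \<le> sum h (A i) + sum h (\<Union>i\<in>I. A i)"
    using sum.union_inter[of "A i" "\<Union>i\<in>I. A i" h] sum_nonneg[of "A i \<inter> (\<Union>i\<in>I. A i)" h] insert assms(3) by simp
  then show ?case using insert by simp
qed simp

text \<open>One stopping rule serves countably many exponent pairs: the thresholds \<open>4 ^ (k + 3)\<close> grow fast enough for the
  stopped cubes of all pairs together to cover only a small part of their parent.\<close>

lemma universal_sparse:
  fixes f g :: "real^'n::finite \<Rightarrow> complex" and ps qs :: "nat \<Rightarrow> real"
  assumes f: "bcs f" and g: "bcs g" and ps: "\<And>k. ps k \<ge> 1" and qs: "\<And>k. qs k \<ge> 1" and R0: "R0 \<in> dyad t"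
  obtains S where "R0 \<in> S" "S \<subseteq> dyad t" "\<And>P. P \<in> S \<Longrightarrow> P \<subseteq> R0" "eta_sparse (1 / 4) S"
    "\<And>k R. R \<in> dyad t \<Longrightarrow> R \<subseteq> R0 \<Longrightarrow>
       \<exists>P\<in>S. R \<subseteq> P \<and> av (ps k) f R * av (qs k) g R \<le> 4 ^ (k + 3) * (av (ps k) f P * av (qs k) g P)"
proof -
  define F where "F = (\<lambda>k Q. av (ps k) f Q * av (qs k) g Q)"
  have F0: "F k Q \<ge> 0" for k Q by (simp add: F_def av_nonneg)
  define stop where "stop = (\<lambda>P Q. \<exists>k. F k Q > 4 ^ (k + 3) * F k P)"
  have nested: "Q \<inter> R = {} \<or> Q \<subseteq> R \<or> R \<subseteq> Q" if "Q \<in> dyad t" "R \<in> dyad t" for Q R :: "(real^'n) set"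
    using dyadic_lattice_dyad[of t] that unfolding dyadic_lattice_def by blast
  have ne: "Q \<noteq> {}" if "Q \<in> dyad t" for Q :: "(real^'n) set" using that tcube_nonempty by (auto simp: dyad_def)
  obtain S where S: "R0 \<in> S" "S \<subseteq> dyad t" "\<And>P. P \<in> S \<Longrightarrow> P \<subseteq> R0"
    "disjoint_family_on (\<lambda>P. P - \<Union>(stop_children (dyad t) stop P)) S"
    "\<And>R. R \<in> dyad t \<Longrightarrow> R \<subseteq> R0 \<Longrightarrow> \<exists>P\<in>S. R \<subseteq> P \<and> (R = P \<or> \<not> stop P R)"
    using stopping_family[OF nested ne dyad_finite_chain R0, of stop] by blast
  have cb: "vol (\<Union>G) \<le> vol P / 2"
    if P: "P \<in> dyad t" and G: "G \<subseteq> stop_children (dyad t) stop P" "finite G" for P G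
  proof -
    have GD: "Q \<in> dyad t" "Q \<subseteq> P" "stop P Q" if "Q \<in> G" for Q using that G by (auto simp: stop_children_def)
    have Gdisj: "Q \<inter> Q' = {}" if "Q \<in> G" "Q' \<in> G" "Q \<noteq> Q'" for Q Q'
      by (rule stop_children_disjoint[OF nested]) (use that G in auto)
    have Gp: "Q \<in> sets borel" "vol Q > 0" if "Q \<in> G" for Q
      using dyad_props[OF GD(1)[OF that]] by auto
    note Pp = dyad_props[OF P]
    \<comment> \<open>If the product of two averages grows by more than \<open>4 ^ (k + 3)\<close>,
      then one of the factors grows by more than \<open>2 ^ (k + 3)\<close>. Each of
      \<open>A k\<close> and \<open>B k\<close> fills at most \<open>vol P / 2 ^ (k + 3)\<close>,
      and twice the sum of these over \<open>k\<close> is \<open>vol P / 2\<close>.\<close>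
    define A where "A = (\<lambda>k. {Q \<in> G. av (ps k) f Q > 2 ^ (k + 3) * av (ps k) f P})"
    define B where "B = (\<lambda>k. {Q \<in> G. av (qs k) g Q > 2 ^ (k + 3) * av (qs k) g P})"
    have "\<exists>k. Q \<in> A k \<union> B k" if "Q \<in> G" for Q
    proof -
      obtain k where k: "F k Q > 4 ^ (k + 3) * F k P" using GD(3)[OF \<open>Q \<in> G\<close>] by (auto simp: stop_def)
      have "Q \<in> A k \<union> B k"
      proof (rule ccontr)
        assume "\<not> ?thesis"
        then have "av (ps k) f Q \<le> 2 ^ (k + 3) * av (ps k) f P" "av (qs k) g Q \<le> 2 ^ (k + 3) * av (qs k) g P"
          using that by (auto simp: A_def B_def)
        then have "F k Q \<le> (2 ^ (k + 3) * av (ps k) f P) * (2 ^ (k + 3) * av (qs k) g P)"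
          unfolding F_def by (intro mult_mono) (auto simp: av_nonneg)
        also have "\<dots> = (2 ^ (k + 3) * 2 ^ (k + 3)) * F k P" by (simp add: F_def)
        also have "(2::real) ^ (k + 3) * 2 ^ (k + 3) = 4 ^ (k + 3)" by (simp flip: power_mult_distrib)
        finally show False using k by simp
      qed
      then show ?thesis by blast
    qed
    then obtain kk where kk: "\<And>Q. Q \<in> G \<Longrightarrow> Q \<in> A (kk Q) \<union> B (kk Q)" by metis
    have sub: "A k \<subseteq> G" "B k \<subseteq> G" for k by (auto simp: A_def B_def)
    have fin: "finite (A k)" "finite (B k)" for k
      using finite_subset[OF sub(1) G(2)] finite_subset[OF sub(2) G(2)] by auto
    have Am: "(\<Sum>Q\<in>A k. vol Q) \<le> vol P / 2 ^ (k + 3)" for k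
      by (rule av_stop_measure[where f=f and p="ps k"])
         (use f ps Pp Gp GD(2) Gdisj fin sub in \<open>auto simp: A_def\<close>)
    have Bm: "(\<Sum>Q\<in>B k. vol Q) \<le> vol P / 2 ^ (k + 3)" for k
      by (rule av_stop_measure[where f=g and p="qs k"])
         (use g qs Pp Gp GD(2) Gdisj fin sub in \<open>auto simp: B_def\<close>)
    \<comment> \<open>The bound is first proved for finitely many children, which involve finitely
      many \<open>k\<close>; the countable union follows by continuity of measure.\<close>
    define N where "N = Suc (Max (insert 0 (kk ` G)))"
    have kN: "kk Q < N" if "Q \<in> G" for Q
      using that G(2) by (auto simp: N_def less_Suc_eq_le intro!: Max_ge)
    have "vol (\<Union>G) \<le> (\<Sum>Q\<in>G. vol Q)"
      using measure_Union_le[of G lborel] G(2) Gp by auto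
    also have "\<dots> \<le> (\<Sum>Q\<in>(\<Union>k<N. A k \<union> B k). vol Q)"
      using kk kN fin by (intro sum_mono2) auto
    also have "\<dots> \<le> (\<Sum>k<N. \<Sum>Q\<in>A k \<union> B k. vol Q)"
      by (rule sum_UN_le) (use fin in auto)
    also have "\<dots> \<le> (\<Sum>k<N. vol P / 2 ^ (k + 3) + vol P / 2 ^ (k + 3))"
    proof (rule sum_mono)
      fix k
      have "(\<Sum>Q\<in>A k \<union> B k. vol Q) \<le> (\<Sum>Q\<in>A k. vol Q) + (\<Sum>Q\<in>B k. vol Q)"
        using sum.union_inter[OF fin(1)[of k] fin(2)[of k], of "vol"]
          sum_nonneg[of "A k \<inter> B k" "vol"] by simp
      then show "(\<Sum>Q\<in>A k \<union> B k. vol Q) \<le> vol P / 2 ^ (k + 3) + vol P / 2 ^ (k + 3)"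
        using Am[of k] Bm[of k] by linarith
    qed
    also have "\<dots> = (\<Sum>k<N. (1/2) ^ k) * (vol P / 4)"
      unfolding sum_distrib_right by (intro sum.cong refl) (simp add: power_add power_one_over field_simps)
    also have "(\<Sum>k<N. (1/2::real) ^ k) \<le> 2"
      by (simp add: sum_gp_strict)
    finally show "vol (\<Union>G) \<le> vol P / 2" by (simp add: mult_right_mono)
  qed
  have chfm: "D \<in> fmeasurable lborel" if "D \<in> stop_children (dyad t) stop P" for D P
    by (rule dyad_props(3)[of D t]) (use that in \<open>simp add: stop_children_def\<close>)
  have chc: "countable (stop_children (dyad t) stop P)" for P
    by (rule countable_subset[OF _ countable_dyad[of t]]) (auto simp: stop_children_def)
  have ch: "\<Union>(stop_children (dyad t) stop P) \<in> fmeasurable lborel \<and>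
      vol (\<Union>(stop_children (dyad t) stop P)) \<le> vol P / 2" if P: "P \<in> dyad t" for P
  proof
    show "\<Union>(stop_children (dyad t) stop P) \<in> fmeasurable lborel"
      by (rule fmeasurable_Union_bound[OF chc chfm cb[OF P]])
    show "vol (\<Union>(stop_children (dyad t) stop P)) \<le> vol P / 2"
      by (rule measure_Union_bound[OF chc chfm cb[OF P]])
  qed
  have sp: "eta_sparse (1 / 4) S"
    unfolding eta_sparse_def
  proof (intro exI conjI ballI)
    show "disjoint_family_on (\<lambda>P. P - \<Union>(stop_children (dyad t) stop P)) S" by (rule S(4))
    fix Q assume "Q \<in> S"
    then have Q: "Q \<in> dyad t" using S(2) by blast
    let ?U = "\<Union>(stop_children (dyad t) stop Q)"
    have U: "?U \<in> fmeasurable lborel" "vol ?U \<le> vol Q / 2" using ch[OF Q] by auto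
    have sU: "?U \<in> sets borel" "Q \<in> sets borel" using U(1) dyad_props[OF Q] by (auto dest: fmeasurableD)
    have sub: "?U \<subseteq> Q" by (auto simp: stop_children_def)
    show "Q - ?U \<in> sets lebesgue" using sU by (auto intro!: sets_completionI_sets)
    show "Q - ?U \<subseteq> Q" by blast
    have "vol (Q - ?U) = vol Q - vol ?U"
      by (rule measure_Diff[OF _ _ _ sub]) (use dyad_props[OF Q] U sU in \<open>auto dest: fmeasurableD2\<close>)
    \<comment> \<open>At least half of \<open>Q\<close> survives. Since \<open>eta_sparse\<close>
      asks for a strict inequality, the parameter is taken below 1/2.\<close>
    then have "vol (Q - ?U) > vol Q / 4" using U dyad_props(2)[OF Q] by linarith
    then show "measure lebesgue (Q - ?U) > 1 / 4 * measure lebesgue Q"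
      using sU by (simp add: measure_completion)
  qed
  have dom: "\<exists>P\<in>S. R \<subseteq> P \<and> av (ps k) f R * av (qs k) g R \<le> 4 ^ (k + 3) * (av (ps k) f P * av (qs k) g P)"
    if "R \<in> dyad t" "R \<subseteq> R0" for R k
  proof -
    obtain P where P: "P \<in> S" "R \<subseteq> P" "R = P \<or> \<not> stop P R" using S(5) \<open>R \<in> dyad t\<close> \<open>R \<subseteq> R0\<close> by blast
    have "F k R \<le> 4 ^ (k + 3) * F k P"
    proof (cases "R = P")
      case True
      have "1 * F k P \<le> 4 ^ (k + 3) * F k P" by (intro mult_right_mono F0) simp
      then show ?thesis using True by simp
    next
      case False
      then show ?thesis using P(3) by (auto simp: stop_def not_less)
    qed
    then show ?thesis using P by (auto simp: F_def)
  qed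
  show ?thesis by (rule that[OF S(1,2,3) sp dom])
qed

section \<open>Domination of grid forms at all scales\<close>

text \<open>An interval of length \<open>h\<close> fails to fit into a cell of the shifted grid only
  if a grid point falls strictly inside it. In terms of the shift \<open>t\<close> this is an open
  interval of length \<open>h\<close> for each integer \<open>m\<close>.\<close>

lemma shift_avoid:
  fixes a h L T :: real
  assumes "h > 0" "L > 0" "h \<le> L" "L \<le> T"
  obtains B where "B \<in> sets borel" "emeasure lborel B \<le> ennreal (3 * (T / L) * h)"
    "\<And>t. t \<in> {0..T} \<Longrightarrow> t \<notin> B \<Longrightarrow> \<exists>m::int. t + L * m \<le> a \<and> a + h \<le> t + L * m + L"
proof -
  \<comment> \<open>Exactly the integers whose interval of bad shifts meets \<open>{0..T}\<close>.
    There are at most \<open>T / L + h / L + 1\<close> of them, and each summand is at most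
    \<open>T / L\<close>.\<close>
  define M where "M = {\<lfloor>(a - T) / L\<rfloor> + 1..\<lceil>(a + h) / L\<rceil> - 1}"
  define B where "B = (\<Union>m\<in>M. {a - L * m<..<a + h - L * m})"
  have "emeasure lborel B \<le> (\<Sum>m\<in>M. emeasure lborel {a - L * m<..<a + h - L * m})"
    unfolding B_def by (rule emeasure_subadditive_finite) (auto simp: M_def)
  also have "\<dots> = ennreal (real (card M) * h)"
    using assms by (simp add: ennreal_mult ennreal_of_nat_eq_real_of_nat)
  also have "\<dots> \<le> ennreal (3 * (T / L) * h)"
  proof (intro ennreal_leI mult_right_mono)
    have T1: "T / L \<ge> 1" "h / L \<le> 1" using assms by auto
    have "real_of_int (\<lceil>(a + h) / L\<rceil> - \<lfloor>(a - T) / L\<rfloor> - 1) \<le> (a + h) / L - (a - T) / L + 1"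
      by linarith
    also have "\<dots> = T / L + h / L + 1" using assms by (simp add: field_simps)
    finally have r: "real_of_int (\<lceil>(a + h) / L\<rceil> - \<lfloor>(a - T) / L\<rfloor> - 1) \<le> 3 * (T / L)" using T1 by linarith
    have "real (card M) = max 0 (real_of_int (\<lceil>(a + h) / L\<rceil> - \<lfloor>(a - T) / L\<rfloor> - 1))"
      unfolding M_def by (simp add: max_def of_nat_nat)
    then show "real (card M) \<le> 3 * (T / L)" using r T1 by linarith
  qed (use assms in auto)
  finally have mB: "emeasure lborel B \<le> ennreal (3 * (T / L) * h)" .
  have "\<exists>m::int. t + L * m \<le> a \<and> a + h \<le> t + L * m + L" if t: "t \<in> {0..T}" "t \<notin> B" for t
  proof -
    define m where "m = \<lfloor>(a - t) / L\<rfloor>"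
    have "real_of_int m \<le> (a - t) / L" "(a - t) / L < real_of_int m + 1" unfolding m_def by linarith+
    then have m: "t + L * m \<le> a" "a < t + L * m + L" using assms by (auto simp: field_simps)
    have "a + h \<le> t + L * m + L"
    proof (rule ccontr)
      assume "\<not> ?thesis"
      then have lt: "t + L * (m + 1) < a + h" "a < t + L * (m + 1)" using m by (auto simp: algebra_simps)
      have "(a - T) / L < real_of_int (m + 1)" "real_of_int (m + 1) < (a + h) / L"
        using lt t assms by (auto simp: field_simps)
      then have "m + 1 \<in> M" unfolding M_def by (simp add: floor_less_iff less_ceiling_iff) linarith
      then have "t \<in> B" unfolding B_def using lt by (auto intro!: bexI[of _ "m + 1"])
      then show False using t by simp
    qed
    then show ?thesis using m by blast
  qed
  moreover have "B \<in> sets borel" unfolding B_def by (intro sets.finite_UN) (auto simp: M_def)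
  ultimately show ?thesis using that mB by blast
qed

lemma powi_add_nat: "(2::real) powi (v + int N) = 2 powi v * 2 ^ N"
  by (simp add: power_int_add)

text \<open>The one-dimensional estimate in every coordinate. The constant 9 is the 3 from the count
  of grid points times the 3 in the side of \<open>tcube3\<close>; \<open>N \<ge> 2\<close> makes
  the lattice cube wide enough for the triple.\<close>

lemma tcube3_avoid:
  fixes z :: "int^'n::finite"
  assumes N: "N \<ge> 2" and K: "v + int N \<le> K"
  obtains B where "B \<in> sets borel" "emeasure lborel B \<le> ennreal (9 * real CARD('n) * 2 powi K / 2 ^ N)"
    "\<And>t. t \<in> {0..2 powi K} \<Longrightarrow> t \<notin> B \<Longrightarrow> \<exists>w. tcube3 v z \<subseteq> tcube t (v + int N) w"
proof -
  let ?L = "2 powi (v + int N) :: real" and ?h = "3 * 2 powi v :: real"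
  have L: "?L = 2 powi v * 2 ^ N" by (rule powi_add_nat)
  have "(2::real)^2 \<le> 2 ^ N" using N by (intro power_increasing) auto
  then have hL: "?h \<le> ?L" unfolding L by simp
  have LT: "?L \<le> 2 powi K" using K by (simp add: powi_two_le_iff)
  have e: "3 * (2 powi K / ?L) * ?h = 9 * 2 powi K / 2 ^ N"
    unfolding L by (simp add: field_simps)
  have "\<exists>B. B \<in> sets borel \<and> emeasure lborel B \<le> ennreal (9 * 2 powi K / 2 ^ N) \<and>
     (\<forall>t\<in>{0..2 powi K}. t \<notin> B \<longrightarrow> (\<exists>m::int. t + ?L * m \<le> 2 powi v * (real_of_int (z $ i) - 1) \<and> 2 powi v * (real_of_int (z $ i) - 1) + ?h \<le> t + ?L * m + ?L))" for i
    using shift_avoid[of ?h ?L "2 powi K" "2 powi v * (real_of_int (z $ i) - 1)"] hL LT unfolding e by (metis zero_less_mult_iff zero_less_numeral zero_less_power_int)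
  then obtain B where B: "\<And>i. B i \<in> sets borel" "\<And>i. emeasure lborel (B i) \<le> ennreal (9 * 2 powi K / 2 ^ N)"
     "\<And>i t. t\<in>{0..2 powi K} \<Longrightarrow> t \<notin> B i \<Longrightarrow> (\<exists>m::int. t + ?L * m \<le> 2 powi v * (real_of_int (z $ i) - 1) \<and> 2 powi v * (real_of_int (z $ i) - 1) + ?h \<le> t + ?L * m + ?L)"
    by metis
  show ?thesis
  proof
    show "(\<Union>i. B i) \<in> sets borel" using B(1) by (intro sets.finite_UN) auto
    have "emeasure lborel (\<Union>i. B i) \<le> (\<Sum>i\<in>UNIV. emeasure lborel (B i))"
      by (rule emeasure_subadditive_finite) (use B(1) in auto)
    also have "\<dots> \<le> (\<Sum>i\<in>(UNIV::'n set). ennreal (9 * 2 powi K / 2 ^ N))" by (rule sum_mono) (rule B(2))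
    also have "\<dots> = ennreal (9 * real CARD('n) * 2 powi K / 2 ^ N)"
      by (simp add: ennreal_mult[symmetric] ennreal_of_nat_eq_real_of_nat mult_ac)
    finally show "emeasure lborel (\<Union>i. B i) \<le> ennreal (9 * real CARD('n) * 2 powi K / 2 ^ N)" .
    fix t assume t: "t \<in> {0..2 powi K}" "t \<notin> (\<Union>i. B i)"
    then have "\<forall>i. \<exists>m::int. t + ?L * m \<le> 2 powi v * (real_of_int (z $ i) - 1) \<and> 2 powi v * (real_of_int (z $ i) - 1) + ?h \<le> t + ?L * m + ?L"
      using B(3) by blast
    then obtain m :: "'n \<Rightarrow> int" where m: "\<And>i. t + ?L * m i \<le> 2 powi v * (real_of_int (z $ i) - 1)"
       "\<And>i. 2 powi v * (real_of_int (z $ i) - 1) + ?h \<le> t + ?L * m i + ?L" by metis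
    have "tcube3 v z \<subseteq> tcube t (v + int N) (\<chi> i. m i)"
      unfolding tcube3_def tcube_def half_open_cube_def
      using m by (auto intro: order_trans less_le_trans)
    then show "\<exists>w. tcube3 v z \<subseteq> tcube t (v + int N) w" by blast
  qed
qed

text \<open>The averages live on the triples but the weight is the volume of the small cube:
  disjointness of the small cubes is what allows many of them to be charged to one sparse
  cube.\<close>

definition grid_form :: "real \<Rightarrow> real \<Rightarrow> (real^'n::finite \<Rightarrow> complex) \<Rightarrow> (real^'n \<Rightarrow> complex) \<Rightarrow> int \<Rightarrow> (int^'n) set \<Rightarrow> real" where
  "grid_form p q f g v Z = (\<Sum>z\<in>Z. vol (tcube 0 v z) * (av p f (tcube3 v z) * av q g (tcube3 v z)))"

text \<open>The counterpart of \<open>sparse_form\<close> for Borel functions and real exponents;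
  \<open>av_form_le_sparse_form\<close> returns to the form in the theorem.\<close>

definition av_form :: "real \<Rightarrow> real \<Rightarrow> (real^'n::finite \<Rightarrow> complex) \<Rightarrow> (real^'n \<Rightarrow> complex) \<Rightarrow> (real^'n) set set \<Rightarrow> ennreal" where
  "av_form p q f g S = (\<Sum>\<^sub>\<infinity>P\<in>S. ennreal (vol P * (av p f P * av q g P)))"

lemma av_form_ge_finite:
  assumes "finite G" "G \<subseteq> S"
  shows "ennreal (\<Sum>P\<in>G. vol P * (av p f P * av q g P)) \<le> av_form p q f g S"
proof -
  have "ennreal (\<Sum>P\<in>G. vol P * (av p f P * av q g P)) = (\<Sum>P\<in>G. ennreal (vol P * (av p f P * av q g P)))"
    by (rule sum_ennreal[symmetric]) (simp add: av_nonneg)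
  also have "\<dots> \<le> av_form p q f g S"
    unfolding av_form_def by (subst nonneg_infsum_complete) (use assms in \<open>auto intro: SUP_upper\<close>)
  finally show ?thesis .
qed

text \<open>All disjoint \<open>Q i\<close> assigned to the same \<open>P\<close> lie in
  \<open>P\<close>, so together they weigh at most \<open>vol P\<close>. Hence no multiplicity
  appears when grid cubes are charged to sparse cubes.\<close>

lemma sum_grouped_le:
  fixes h :: "'a::euclidean_space set \<Rightarrow> real" and Q :: "'i \<Rightarrow> 'a set" and R :: "'i \<Rightarrow> 'a set"
  assumes fin: "finite I" and Q: "\<And>i. i \<in> I \<Longrightarrow> Q i \<in> fmeasurable lborel" "\<And>i. i \<in> I \<Longrightarrow> Q i \<subseteq> R i" "\<And>i. i \<in> I \<Longrightarrow> R i \<in> fmeasurable lborel"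
    and disj: "disjoint_family_on Q I" and h: "\<And>P. h P \<ge> (0::real)"
  shows "(\<Sum>i\<in>I. vol (Q i) * h (R i)) \<le> (\<Sum>P\<in>R ` I. vol P * h P)"
proof -
  have "(\<Sum>i\<in>I. vol (Q i) * h (R i)) = (\<Sum>P\<in>R ` I. \<Sum>i\<in>{i\<in>I. R i = P}. vol (Q i) * h (R i))"
    by (rule sum.image_gen[OF fin])
  also have "\<dots> \<le> (\<Sum>P\<in>R ` I. vol P * h P)"
  proof (rule sum_mono)
    fix P assume P: "P \<in> R ` I"
    have "(\<Sum>i\<in>{i\<in>I. R i = P}. vol (Q i) * h (R i)) = (\<Sum>i\<in>{i\<in>I. R i = P}. vol (Q i)) * h P"
      by (simp add: sum_distrib_right)
    also have "(\<Sum>i\<in>{i\<in>I. R i = P}. vol (Q i)) = vol (\<Union>i\<in>{i\<in>I. R i = P}. Q i)"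
      by (rule measure_finite_Union[symmetric])
         (use fin Q disj in \<open>auto simp: disjoint_family_on_def fmeasurable_def less_top[symmetric]\<close>)
    also have "\<dots> \<le> vol P"
    proof (rule measure_mono_fmeasurable)
      show "(\<Union>i\<in>{i\<in>I. R i = P}. Q i) \<subseteq> P" using Q(2) by fastforce
      show "(\<Union>i\<in>{i\<in>I. R i = P}. Q i) \<in> sets lborel"
        using fin Q(1) by (intro sets.finite_UN) (auto simp: fmeasurable_def)
      show "P \<in> fmeasurable lborel" using P Q(3) by auto
    qed
    finally show "(\<Sum>i\<in>{i\<in>I. R i = P}. vol (Q i) * h (R i)) \<le> vol P * h P"
      by (simp add: mult_right_mono h)
  qed
  finally show ?thesis .
qed

section \<open>Grid cubes near the supports\<close>

lemma finite_vec_set: "finite A \<Longrightarrow> finite {z::'a^'n::finite. \<forall>i. z $ i \<in> A}"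
proof -
  assume A: "finite A"
  have "{z::'a^'n. \<forall>i. z $ i \<in> A} \<subseteq> vec_lambda ` (PiE UNIV (\<lambda>_. A))"
  proof
    fix z :: "'a^'n" assume "z \<in> {z. \<forall>i. z $ i \<in> A}"
    then have "(\<lambda>i. z $ i) \<in> PiE UNIV (\<lambda>_. A)" by auto
    then show "z \<in> vec_lambda ` (PiE UNIV (\<lambda>_. A))" by (metis imageI vec_lambda_eta)
  qed
  then show ?thesis using finite_PiE[of "UNIV::'n set" "\<lambda>_. A"] A finite_surj by auto
qed


text \<open>The scale \<open>K\<close> exceeds that of the supports by a factor of 4. This leaves an
  interval of shifts of length \<open>2 * 2 powi (K - 2)\<close> for which one lattice cube of side
  \<open>2 powi K\<close> contains both supports.\<close>

lemma bcs_cube_support: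
  assumes "bcs (f :: real^'n::finite \<Rightarrow> complex)" "bcs (g :: real^'n \<Rightarrow> complex)"
  obtains K :: int where "\<And>x i. f x \<noteq> 0 \<Longrightarrow> \<bar>x $ i\<bar> < 2 powi (K - 2)" "\<And>x i. g x \<noteq> 0 \<Longrightarrow> \<bar>x $ i\<bar> < 2 powi (K - 2)"
proof -
  obtain R where R: "\<And>x. f x \<noteq> 0 \<Longrightarrow> norm x \<le> R" using bcs_support[OF assms(1)] by metis
  obtain R' where R': "\<And>x. g x \<noteq> 0 \<Longrightarrow> norm x \<le> R'" using bcs_support[OF assms(2)] by metis
  obtain N where "max R R' < 2 ^ N" using real_arch_pow[of 2 "max R R'"] by auto
  then have N: "R < 2 powi (int N + 2 - 2)" "R' < 2 powi (int N + 2 - 2)" by auto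
  show ?thesis
  proof (rule that[of "int N + 2"])
    fix x and i :: 'n
    show "\<bar>x $ i\<bar> < 2 powi (int N + 2 - 2)" if "f x \<noteq> 0"
      using component_le_norm_cart[of x i] R[OF that] N by linarith
    show "\<bar>x $ i\<bar> < 2 powi (int N + 2 - 2)" if "g x \<noteq> 0"
      using component_le_norm_cart[of x i] R'[OF that] N by linarith
  qed
qed

lemma disjoint_tcubes: "disjoint_family_on (tcube t v) Z"
  by (auto simp: disjoint_family_on_def dest: tcube_eqI)

lemma tcube_sub_tcube3: "tcube 0 v z \<subseteq> tcube3 v z"
  by (auto simp: mem_tcube mem_tcube3)

lemma tcube_count:
  fixes Z :: "(int^'n::finite) set"
  assumes "finite Z" "L \<ge> 2 powi v" and meet: "\<And>z. z \<in> Z \<Longrightarrow> \<exists>x\<in>tcube3 v z. \<forall>i. \<bar>x $ i\<bar> < L"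
  shows "(\<Sum>z\<in>Z. vol (tcube 0 v z)) \<le> (8 * L) ^ CARD('n)"
proof -
  have L0: "L > 0" using assms(2) zero_less_power_int[of "2::real" v] by linarith
  let ?C = "half_open_cube (\<chi> i. - 4 * L) (8 * L) :: (real^'n) set"
  have "tcube 0 v z \<subseteq> ?C" if "z \<in> Z" for z
  proof
    fix y assume "y \<in> tcube 0 v z"
    then have y: "y \<in> tcube3 v z" using tcube_sub_tcube3 by blast
    obtain x where x: "x \<in> tcube3 v z" "\<And>i. \<bar>x $ i\<bar> < L" using meet[OF \<open>z \<in> Z\<close>] by blast
    have "- 4 * L \<le> y $ i \<and> y $ i < 4 * L" for i
    proof -
      have "\<bar>y $ i - x $ i\<bar> \<le> 3 * 2 powi v"
        using x(1) y by (auto simp: tcube3_def half_open_cube_def abs_le_iff) (smt (verit))+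
      then show ?thesis using x(2)[of i] assms(2) by linarith
    qed
    then show "y \<in> ?C" by (simp add: half_open_cube_def)
  qed
  then have sub: "(\<Union>z\<in>Z. tcube 0 v z) \<subseteq> ?C" by blast
  have "(\<Sum>z\<in>Z. vol (tcube 0 v z)) = vol (\<Union>z\<in>Z. tcube 0 v z)"
    by (rule measure_finite_Union[OF assms(1) _ disjoint_tcubes, symmetric])
       (auto simp: tcube_def measure_half_open_cube(1) half_open_cube_borel)
  also have "\<dots> \<le> vol ?C"
    by (rule measure_mono_fmeasurable[OF sub])
       (use assms(1) in \<open>auto intro!: sets.finite_UN simp: tcube_borel fmeasurable_half_open_cube\<close>)
  also have "\<dots> = (8 * L) ^ CARD('n)" using L0 by (simp add: measure_half_open_cube)
  finally show ?thesis .
qed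

text \<open>With \<open>L\<close> bounding the coordinates on the supports, every other index has a
  triple on which the functions vanish, so its term in \<open>grid_form\<close> is 0. This makes the
  sums finite.\<close>

definition Zset :: "int \<Rightarrow> real \<Rightarrow> (int^'n::finite) set" where
  "Zset v L = {z. \<exists>x\<in>tcube3 v z. \<forall>i. \<bar>x $ i\<bar> < L}"

lemma finite_Zset: "finite (Zset v L)"
proof -
  have "Zset v L \<subseteq> {z. \<forall>i. z $ i \<in> {- \<lceil>L / 2 powi v\<rceil> - 2..\<lceil>L / 2 powi v\<rceil> + 2}}"
  proof
    fix z :: "int^'n" assume "z \<in> Zset v L"
    then obtain x where x: "x \<in> tcube3 v z" "\<And>i. \<bar>x $ i\<bar> < L" by (auto simp: Zset_def)
    have "z $ i \<in> {- \<lceil>L / 2 powi v\<rceil> - 2..\<lceil>L / 2 powi v\<rceil> + 2}" for i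
    proof -
      have "\<bar>\<lfloor>x $ i / 2 powi v\<rfloor> - z $ i\<bar> \<le> 1" using x(1) by (simp add: mem_tcube3)
      moreover have "\<bar>x $ i / 2 powi v\<bar> < L / 2 powi v" using x(2)[of i] by (simp add: abs_divide divide_strict_right_mono)
      ultimately show ?thesis by (simp, linarith)
    qed
    then show "z \<in> {z. \<forall>i. z $ i \<in> {- \<lceil>L / 2 powi v\<rceil> - 2..\<lceil>L / 2 powi v\<rceil> + 2}}" by simp
  qed
  then show ?thesis by (rule finite_subset) (intro finite_vec_set finite_atLeastAtMost_int)
qed

text \<open>Not every cube can be well placed, since their number is not controlled. What survives
  averaging over the shift is that at least half of the total weight is. For fixed \<open>k\<close>
  and \<open>v\<close>, Markov's inequality bounds the shifts that violate this by twice the measure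
  in \<open>tcube3_avoid\<close>, whatever the weights are; the union over all \<open>k\<close> and
  \<open>v\<close> is smaller than the interval of shifts.\<close>

lemma shift_selection:
  fixes c :: "nat \<Rightarrow> int \<Rightarrow> int^'n::finite \<Rightarrow> real" and Z :: "int \<Rightarrow> (int^'n) set" and N :: "nat \<Rightarrow> nat \<Rightarrow> nat"
  assumes Z: "\<And>v. finite (Z v)" and c0: "\<And>k v z. c k v z \<ge> 0" and N2: "\<And>k w. N k w \<ge> 2"
    and N: "\<And>k. (\<Sum>w. ennreal (36 * real CARD('n) / 2 ^ N k w)) \<le> ennreal ((1 / 2) ^ (k + 3))"
  obtains t where "t \<in> {2 powi (K - 2)..3 * 2 powi (K - 2)}"
    "\<And>k v. v + int (N k (nat \<bar>v\<bar>)) \<le> K \<Longrightarrow>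
       (\<Sum>z\<in>Z v. c k v z) \<le> 2 * (\<Sum>z\<in>{z\<in>Z v. \<exists>w. tcube3 v z \<subseteq> tcube t (v + int (N k (nat \<bar>v\<bar>))) w}. c k v z)"
proof -
  define J where "J = {2 powi (K - 2)..3 * 2 powi (K - 2) :: real}"
  define n where "n = real CARD('n)"
  have K4: "(2::real) powi K = 4 * 2 powi (K - 2)" using power_int_add[of "2::real" "K - 2" 2] by simp
  have pK: "(2::real) powi K > 0" by simp
  define Nv where "Nv = (\<lambda>k v. N k (nat \<bar>v\<bar>))"
  define PB where "PB = (\<lambda>k v (z :: int^'n) B. B \<in> sets borel \<and> emeasure lborel B \<le> ennreal (9 * n * 2 powi K / 2 ^ Nv k v) \<and>
     (v + int (Nv k v) \<le> K \<longrightarrow> (\<forall>t\<in>{0..2 powi K}. t \<notin> B \<longrightarrow> (\<exists>w. tcube3 v z \<subseteq> tcube t (v + int (Nv k v)) w))))"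
  have "\<exists>B. B \<in> sets borel \<and> emeasure lborel B \<le> ennreal (9 * n * 2 powi K / 2 ^ Nv k v) \<and>
     (v + int (Nv k v) \<le> K \<longrightarrow> (\<forall>t\<in>{0..2 powi K}. t \<notin> B \<longrightarrow> (\<exists>w. tcube3 v z \<subseteq> tcube t (v + int (Nv k v)) w)))" for k v and z :: "int^'n"
  proof (cases "v + int (Nv k v) \<le> K")
    case True
    have "2 \<le> Nv k v" using N2 by (simp add: Nv_def)
    from tcube3_avoid[OF this True, of z] obtain B where
      "B \<in> sets borel" "emeasure lborel B \<le> ennreal (9 * real CARD('n) * 2 powi K / 2 ^ Nv k v)"
      "\<And>t. t \<in> {0..2 powi K} \<Longrightarrow> t \<notin> B \<Longrightarrow> \<exists>w. tcube3 v z \<subseteq> tcube t (v + int (Nv k v)) w" by metis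
    then show ?thesis unfolding n_def by blast
  next
    case False
    then show ?thesis by (intro exI[of _ "{}"]) (auto simp: n_def)
  qed
  then have ex: "\<exists>B. PB k v z B" for k v z unfolding PB_def by blast
  define B where "B = (\<lambda>k v z. SOME B. PB k v z B)"
  have BB: "PB k v z (B k v z)" for k v z unfolding B_def by (rule someI_ex[OF ex])
  have B: "\<And>k v z. B k v z \<in> sets borel" "\<And>k v z. emeasure lborel (B k v z) \<le> ennreal (9 * n * 2 powi K / 2 ^ Nv k v)"
    "\<And>k v z t. v + int (Nv k v) \<le> K \<Longrightarrow> t\<in>{0..2 powi K} \<Longrightarrow> t \<notin> B k v z \<Longrightarrow> (\<exists>w. tcube3 v z \<subseteq> tcube t (v + int (Nv k v)) w)"
    using BB unfolding PB_def by blast+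
  have [measurable]: "B k v z \<in> sets borel" for k v z by (rule B(1))
  define X where "X = (\<lambda>k v. \<Sum>z\<in>Z v. c k v z)"
  have X0: "X k v \<ge> 0" for k v unfolding X_def by (intro sum_nonneg c0)
  \<comment> \<open>The shifts for which the bad cubes carry more than half of the weight. The
    inequality is strict, so this set is empty when the total weight is 0.\<close>
  define U where "U = (\<lambda>k v. {t \<in> J. X k v < 2 * (\<Sum>z\<in>Z v. c k v z * indicator (B k v z) t)})"
  have Um[measurable]: "U k v \<in> sets borel" for k v
  proof -
    have "{t \<in> space borel. X k v < 2 * (\<Sum>z\<in>Z v. c k v z * indicator (B k v z) t)} \<in> sets borel" by measurable
    moreover have "U k v = J \<inter> {t \<in> space borel. X k v < 2 * (\<Sum>z\<in>Z v. c k v z * indicator (B k v z) t)}" by (auto simp: U_def)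
    ultimately show ?thesis by (simp add: J_def)
  qed
  have Ub: "emeasure lborel (U k v) \<le> ennreal (18 * n * 2 powi K / 2 ^ Nv k v)" for k v
  proof (cases "X k v = 0")
    case True
    then have "\<And>z. z \<in> Z v \<Longrightarrow> c k v z = 0" unfolding X_def using Z c0 by (simp add: sum_nonneg_eq_0_iff)
    then have "U k v = {}" using True by (auto simp: U_def)
    then show ?thesis by simp
  next
    case False
    then have Xp: "X k v > 0" using X0[of k v] by simp
    have "emeasure lborel (U k v) \<le> emeasure lborel J" by (rule emeasure_mono) (auto simp: U_def J_def)
    also have "\<dots> < \<infinity>" by (simp add: J_def)
    finally obtain \<mu> where \<mu>: "\<mu> \<ge> 0" "emeasure lborel (U k v) = ennreal \<mu>"
      by (metis ennreal_cases infinity_ennreal_def less_irrefl)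
    have "ennreal (X k v * \<mu>) = (\<integral>\<^sup>+t. ennreal (X k v) * indicator (U k v) t \<partial>lborel)"
      using \<mu> X0[of k v] by (simp add: nn_integral_cmult ennreal_mult)
    also have "\<dots> \<le> (\<integral>\<^sup>+t. (\<Sum>z\<in>Z v. ennreal (2 * c k v z) * indicator (B k v z) t) \<partial>lborel)"
    proof (rule nn_integral_mono)
      fix t
      have "(\<Sum>z\<in>Z v. ennreal (2 * c k v z) * indicator (B k v z) t) = ennreal (\<Sum>z\<in>Z v. 2 * (c k v z * indicator (B k v z) t))"
      proof -
        have "ennreal (\<Sum>z\<in>Z v. 2 * (c k v z * indicator (B k v z) t)) = (\<Sum>z\<in>Z v. ennreal (2 * (c k v z * indicator (B k v z) t)))"
          by (rule sum_ennreal[symmetric]) (use c0 in simp)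
        also have "\<dots> = (\<Sum>z\<in>Z v. ennreal (2 * c k v z) * indicator (B k v z) t)"
          by (rule sum.cong) (auto simp: indicator_def)
        finally show ?thesis by simp
      qed
      moreover have "ennreal (X k v) * indicator (U k v) t \<le> ennreal (\<Sum>z\<in>Z v. 2 * (c k v z * indicator (B k v z) t))"
      proof (cases "t \<in> U k v")
        case True
        then have "X k v \<le> (\<Sum>z\<in>Z v. 2 * (c k v z * indicator (B k v z) t))"
          unfolding U_def by (simp add: sum_distrib_left)
        then show ?thesis using True by (simp add: ennreal_leI)
      qed simp
      ultimately show "ennreal (X k v) * indicator (U k v) t \<le> (\<Sum>z\<in>Z v. ennreal (2 * c k v z) * indicator (B k v z) t)"
        by (simp only:)
    qed
    also have "\<dots> = (\<Sum>z\<in>Z v. ennreal (2 * c k v z) * emeasure lborel (B k v z))"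
      by (subst nn_integral_sum) (auto simp: nn_integral_cmult)
    also have "\<dots> \<le> (\<Sum>z\<in>Z v. ennreal (2 * c k v z) * ennreal (9 * n * 2 powi K / 2 ^ Nv k v))"
      by (intro sum_mono mult_left_mono B(2)) simp
    also have "\<dots> = ennreal (\<Sum>z\<in>Z v. 2 * c k v z * (9 * n * 2 powi K / 2 ^ Nv k v))"
    proof -
      have "ennreal (\<Sum>z\<in>Z v. 2 * c k v z * (9 * n * 2 powi K / 2 ^ Nv k v)) = (\<Sum>z\<in>Z v. ennreal (2 * c k v z * (9 * n * 2 powi K / 2 ^ Nv k v)))"
        by (rule sum_ennreal[symmetric]) (use c0 in \<open>simp add: n_def\<close>)
      also have "\<dots> = (\<Sum>z\<in>Z v. ennreal (2 * c k v z) * ennreal (9 * n * 2 powi K / 2 ^ Nv k v))"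
        by (intro sum.cong refl ennreal_mult) (use c0 in \<open>auto simp: n_def\<close>)
      finally show ?thesis by simp
    qed
    also have "(\<Sum>z\<in>Z v. 2 * c k v z * (9 * n * 2 powi K / 2 ^ Nv k v)) = X k v * (18 * n * 2 powi K / 2 ^ Nv k v)"
      unfolding X_def sum_distrib_right by (intro sum.cong refl) simp
    finally have "X k v * \<mu> \<le> X k v * (18 * n * 2 powi K / 2 ^ Nv k v)"
      using X0[of k v] by (subst (asm) ennreal_le_iff) (auto simp: n_def)
    then have "\<mu> \<le> 18 * n * 2 powi K / 2 ^ Nv k v" by (rule mult_left_le_imp_le[OF _ Xp])
    then show ?thesis using \<mu> by (simp add: ennreal_leI)
  qed
  \<comment> \<open>Scales are grouped by \<open>|v|\<close>, two signs at a time; the constant 36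
    is 9 from the avoidance estimate, 2 from Markov and 2 for the signs.\<close>
  define W where "W = (\<Union>k. \<Union>w. U k (int w) \<union> U k (- int w))"
  have "emeasure lborel W \<le> (\<Sum>k. emeasure lborel (\<Union>w. U k (int w) \<union> U k (- int w)))"
    unfolding W_def by (rule emeasure_subadditive_countably) auto
  also have "\<dots> \<le> (\<Sum>k. \<Sum>w. emeasure lborel (U k (int w) \<union> U k (- int w)))"
    by (intro suminf_le emeasure_subadditive_countably) auto
  also have "\<dots> \<le> (\<Sum>k. \<Sum>w. ennreal (2 powi K) * ennreal (36 * real CARD('n) / 2 ^ N k w))"
  proof (intro suminf_le)
    fix k w
    have "emeasure lborel (U k (int w) \<union> U k (- int w)) \<le> emeasure lborel (U k (int w)) + emeasure lborel (U k (- int w))"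
      by (rule emeasure_subadditive) auto
    also have "\<dots> \<le> ennreal (18 * n * 2 powi K / 2 ^ N k w) + ennreal (18 * n * 2 powi K / 2 ^ N k w)"
      using Ub[of k "int w"] Ub[of k "- int w"] by (intro add_mono) (simp_all add: Nv_def)
    also have "\<dots> = ennreal (2 powi K) * ennreal (36 * real CARD('n) / 2 ^ N k w)"
      by (simp add: ennreal_plus[symmetric] ennreal_mult[symmetric] n_def del: ennreal_plus)
    finally show "emeasure lborel (U k (int w) \<union> U k (- int w)) \<le> ennreal (2 powi K) * ennreal (36 * real CARD('n) / 2 ^ N k w)" .
  qed auto
  also have "\<dots> = (\<Sum>k. ennreal (2 powi K) * (\<Sum>w. ennreal (36 * real CARD('n) / 2 ^ N k w)))"
    by simp
  also have "\<dots> \<le> (\<Sum>k. ennreal (2 powi K) * ennreal ((1 / 2) ^ (k + 3)))"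
    by (intro suminf_le mult_left_mono N) auto
  also have "\<dots> = ennreal (2 powi K) * (\<Sum>k. ennreal ((1 / 2) ^ (k + 3)))" by simp
  also have "(\<Sum>k. ennreal ((1 / 2) ^ (k + 3))) = ennreal (1 / 4)"
  proof -
    have "(\<lambda>k. (1/2::real) ^ k * (1/8)) sums (2 * (1/8))"
      using geometric_sums[of "1/2::real"] by (intro sums_mult2) simp
    then have "(\<lambda>k. (1/2::real) ^ (k + 3)) sums (1/4)" by (simp add: power_add power3_eq_cube)
    then show ?thesis by (intro suminf_ennreal_eq) auto
  qed
  also have "ennreal (2 powi K) * ennreal (1 / 4) = ennreal (2 powi (K - 2))"
    by (subst ennreal_mult[symmetric]) (auto simp: K4)
  finally have W: "emeasure lborel W \<le> ennreal (2 powi (K - 2))" .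
  \<comment> \<open>The discarded shifts have measure at most \<open>2 powi (K - 2)\<close>, half
    the length of \<open>J\<close>.\<close>
  have "\<not> J \<subseteq> W"
  proof
    assume "J \<subseteq> W"
    then have "emeasure lborel J \<le> emeasure lborel W" by (rule emeasure_mono) (auto simp: W_def)
    moreover have "emeasure lborel J = ennreal (2 * 2 powi (K - 2))" unfolding J_def by (subst emeasure_lborel_Icc) auto
    ultimately have "ennreal (2 * 2 powi (K - 2)) \<le> ennreal (2 powi (K - 2))" using W by (metis order_trans)
    then show False by (simp add: ennreal_le_iff)
  qed
  then obtain t where t: "t \<in> J" "t \<notin> W" by blast
  have tK: "t \<in> {0..2 powi K}" using t(1) unfolding J_def K4 by (auto intro: order_trans[OF zero_le_power_int])
  show ?thesis
  proof (rule that[of t])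
    show "t \<in> {2 powi (K - 2)..3 * 2 powi (K - 2)}" using t by (simp add: J_def)
    fix k v assume "v + int (N k (nat \<bar>v\<bar>)) \<le> K"
    then have vK: "v + int (Nv k v) \<le> K" by (simp add: Nv_def)
    have "t \<notin> U k v"
    proof -
      have "v = int (nat \<bar>v\<bar>) \<or> v = - int (nat \<bar>v\<bar>)" by linarith
      moreover have "t \<notin> U k (int w)" "t \<notin> U k (- int w)" for w
        using t(2) unfolding W_def by blast+
      ultimately show ?thesis by metis
    qed
    then have "2 * (\<Sum>z\<in>Z v. c k v z * indicator (B k v z) t) \<le> X k v" using t by (auto simp: U_def)
    moreover have "X k v \<le> (\<Sum>z\<in>{z\<in>Z v. \<exists>w. tcube3 v z \<subseteq> tcube t (v + int (Nv k v)) w}. c k v z) + (\<Sum>z\<in>Z v. c k v z * indicator (B k v z) t)"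
    proof -
      have "X k v = (\<Sum>z\<in>{z\<in>Z v. t \<notin> B k v z}. c k v z) + (\<Sum>z\<in>Z v. c k v z * indicator (B k v z) t)"
      proof -
        have "(\<Sum>z\<in>{z\<in>Z v. t \<notin> B k v z}. c k v z) = (\<Sum>z\<in>Z v. if t \<notin> B k v z then c k v z else 0)"
          using Z by (simp add: sum.inter_filter)
        then show ?thesis unfolding X_def by (simp add: sum.distrib[symmetric]) (auto intro!: sum.cong simp: indicator_def)
      qed
      moreover have "(\<Sum>z\<in>{z\<in>Z v. t \<notin> B k v z}. c k v z) \<le> (\<Sum>z\<in>{z\<in>Z v. \<exists>w. tcube3 v z \<subseteq> tcube t (v + int (Nv k v)) w}. c k v z)"
        using Z B(3)[OF vK tK] c0 by (intro sum_mono2) auto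
      ultimately show ?thesis by linarith
    qed
    ultimately show "(\<Sum>z\<in>Z v. c k v z) \<le> 2 * (\<Sum>z\<in>{z\<in>Z v. \<exists>w. tcube3 v z \<subseteq> tcube t (v + int (N k (nat \<bar>v\<bar>))) w}. c k v z)"
      by (simp add: X_def Nv_def)
  qed
qed

lemma power_double: "(x::real) ^ (2 * m) = x ^ m * x ^ m"
  by (simp add: mult_2 power_add)

lemma av_shrink:
  assumes "s \<ge> 1" "Ip s h E \<le> Ip s h R" "vol R > 0" "vol R \<le> vol E"
  shows "av s h E \<le> (vol R / vol E) powr (1 / s) * av s h R"
proof -
  have "av s h E \<le> (Ip s h R / vol E) powr (1 / s)"
    unfolding av_def using assms Ip_nonneg[of s h E] by (intro powr_mono2 divide_right_mono) auto
  also have "Ip s h R / vol E = (vol R / vol E) * (Ip s h R / vol R)"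
    using assms by simp
  also have "\<dots> powr (1 / s) = (vol R / vol E) powr (1 / s) * av s h R"
    unfolding av_def by (rule powr_mult)
  finally show ?thesis .
qed

text \<open>This is where both exponents must be at most 2: then
  \<open>1 / p + 1 / q \<ge> 1\<close>, so over a huge set \<open>E\<close> the product of averages
  decays at least like the inverse volume and compensates the volume of the grid cube.\<close>

lemma av_small_compare:
  assumes "p \<ge> 1" "q \<ge> 1" "p \<le> 2" "q \<le> 2" "Ip p f E \<le> Ip p f R" "Ip q g E \<le> Ip q g R"
    "vol R > 0" "vol R \<le> vol E"
  shows "av p f E * av q g E \<le> vol R / vol E * (av p f R * av q g R)"
proof -
  let ?r = "vol R / vol E"
  have r: "?r > 0" "?r \<le> 1" using assms by auto
  have "av p f E * av q g E \<le> (?r powr (1 / p) * av p f R) * (?r powr (1 / q) * av q g R)"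
    by (intro mult_mono av_shrink) (use assms in \<open>auto simp: av_nonneg\<close>)
  also have "\<dots> = ?r powr (1 / p + 1 / q) * (av p f R * av q g R)"
    by (simp add: powr_add)
  also have "\<dots> \<le> ?r powr 1 * (av p f R * av q g R)"
  proof (intro mult_right_mono powr_mono')
    have "1 / p \<ge> 1 / 2" "1 / q \<ge> 1 / 2" using assms by (auto simp: field_simps)
    then show "1 \<le> 1 / p + 1 / q" by linarith
  qed (use r in \<open>auto simp: av_nonneg\<close>)
  finally show ?thesis using r by simp
qed

text \<open>At these scales the enlarged cube need not fit into \<open>R0\<close>, so the whole form
  is charged to the single cube \<open>R0\<close>, which contains the supports. Up to side
  \<open>2 powi K\<close> the averages are comparable with those on \<open>R0\<close>; beyond it at
  most \<open>8 ^ n\<close> cubes matter.\<close>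

lemma large_scale_bound:
  fixes f g :: "real^'n::finite \<Rightarrow> complex"
  assumes pq: "p \<ge> 1" "q \<ge> 1" "p \<le> 2" "q \<le> 2"
    and R0: "vol R0 = (2 powi K) ^ CARD('n)"
    and le: "\<And>E. E \<in> sets borel \<Longrightarrow> Ip p f E \<le> Ip p f R0" "\<And>E. E \<in> sets borel \<Longrightarrow> Ip q g E \<le> Ip q g R0"
    and vK: "v + int N > K"
  shows "grid_form p q f g v (Zset v (2 powi (K - 2))) \<le> 8 ^ CARD('n) * (2 ^ N) ^ (2 * CARD('n)) * (vol R0 * (av p f R0 * av q g R0))"
proof -
  let ?Z = "Zset v (2 powi (K - 2)) :: (int^'n) set"
  define Fz where "Fz = vol R0 * (av p f R0 * av q g R0)"
  have F0: "Fz \<ge> 0" by (simp add: Fz_def av_nonneg)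
  have K2: "(2::real) powi (K - 2) \<le> 2 powi K" by (simp add: powi_two_le_iff)
  have v0: "(2::real) powi v > 0" "(2::real) powi K > 0" by simp_all
  have N1: "(1::real) \<le> (2 ^ N) ^ (2 * CARD('n))" by (intro one_le_power) auto
  show ?thesis
  proof (cases "v \<le> K")
    case True
    have "2 powi K \<le> (2::real) powi (v + int N)" using vK by (simp add: powi_two_le_iff)
    then have le2: "(2::real) powi K \<le> 2 ^ N * 2 powi v" by (simp add: powi_add_nat mult.commute)
    have b: "vol R0 \<le> (2 ^ N) ^ CARD('n) * vol (tcube3 v z)" for z :: "int^'n"
    proof -
      have "(2 powi K :: real) ^ CARD('n) \<le> (2 ^ N * (3 * 2 powi v)) ^ CARD('n)"
        using le2 v0 by (intro power_mono) (auto intro: order_trans)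
      then show ?thesis by (simp add: R0 tcube3_measure power_mult_distrib)
    qed
    have t: "av p f (tcube3 v z) * av q g (tcube3 v z) \<le> (2 ^ N) ^ (2 * CARD('n)) * (av p f R0 * av q g R0)" for z :: "int^'n"
    proof -
      have "av p f (tcube3 v z) * av q g (tcube3 v z) \<le> ((2 ^ N) ^ CARD('n) * av p f R0) * ((2 ^ N) ^ CARD('n) * av q g R0)"
        by (intro mult_mono av_compare) (use pq le b in \<open>auto simp: av_nonneg tcube_borel R0 tcube3_measure\<close>)
      also have "\<dots> = (2 ^ N) ^ (2 * CARD('n)) * (av p f R0 * av q g R0)"
        unfolding power_double by (simp only: mult_ac)
      finally show ?thesis .
    qed
    have "grid_form p q f g v ?Z \<le> (\<Sum>z\<in>?Z. vol (tcube 0 v z) * ((2 ^ N) ^ (2 * CARD('n)) * (av p f R0 * av q g R0)))"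
      unfolding grid_form_def by (intro sum_mono mult_left_mono t) simp
    also have "\<dots> = (\<Sum>z\<in>?Z. vol (tcube 0 v z)) * ((2 ^ N) ^ (2 * CARD('n)) * (av p f R0 * av q g R0))"
      by (simp add: sum_distrib_right)
    also have "\<dots> \<le> (8 * 2 powi K) ^ CARD('n) * ((2 ^ N) ^ (2 * CARD('n)) * (av p f R0 * av q g R0))"
    proof (intro mult_right_mono tcube_count finite_Zset)
      show "2 powi v \<le> (2 powi K :: real)" using True by (simp add: powi_two_le_iff)
      show "\<exists>x\<in>tcube3 v z. \<forall>i. \<bar>x $ i\<bar> < 2 powi K" if "z \<in> ?Z" for z
        using that K2 unfolding Zset_def by (auto intro: less_le_trans)
    qed (simp add: av_nonneg)
    finally show ?thesis by (simp add: R0 power_mult_distrib mult_ac)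
  next
    case False
    \<comment> \<open>Now the triple is larger than \<open>R0\<close>, and
      \<open>av_small_compare\<close> makes each single term at most \<open>Fz\<close>.\<close>
    have le2: "(2::real) powi K \<le> 2 powi v" using False by (simp add: powi_two_le_iff)
    have b: "vol R0 \<le> vol (tcube3 v z)" for z :: "int^'n"
      unfolding R0 tcube3_measure using le2 v0 by (intro power_mono) linarith+
    have t: "vol (tcube 0 v z) * (av p f (tcube3 v z) * av q g (tcube3 v z)) \<le> Fz" for z :: "int^'n"
    proof -
      have "av p f (tcube3 v z) * av q g (tcube3 v z) \<le> vol R0 / vol (tcube3 v z) * (av p f R0 * av q g R0)"
        by (rule av_small_compare) (use pq le b in \<open>auto simp: R0 tcube_borel\<close>)
      also have "\<dots> = Fz / vol (tcube3 v z)" by (simp add: Fz_def)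
      also have "\<dots> \<le> Fz / vol (tcube 0 v z)"
        unfolding tcube3_measure tcube_measure using v0 F0 by (intro divide_left_mono power_mono mult_pos_pos zero_less_power) auto
      finally show ?thesis by (simp add: tcube_measure field_simps)
    qed
    have "grid_form p q f g v ?Z \<le> (\<Sum>z\<in>?Z. Fz)" unfolding grid_form_def by (intro sum_mono t)
    also have "\<dots> = real (card ?Z) * Fz" by simp
    also have "\<dots> \<le> 8 ^ CARD('n) * Fz"
    proof (intro mult_right_mono F0)
      have "(\<Sum>z\<in>?Z. vol (tcube 0 v z)) \<le> (8 * 2 powi v) ^ CARD('n)"
      proof (intro tcube_count finite_Zset)
        show "\<exists>x\<in>tcube3 v z. \<forall>i. \<bar>x $ i\<bar> < 2 powi v" if "z \<in> ?Z" for z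
          using that less_le_trans[OF _ order_trans[OF K2 le2]] unfolding Zset_def by blast
      qed simp
      then have "real (card ?Z) * (2 powi v) ^ CARD('n) \<le> 8 ^ CARD('n) * (2 powi v) ^ CARD('n)"
        by (simp add: tcube_measure power_mult_distrib)
      then show "real (card ?Z) \<le> 8 ^ CARD('n)" by simp
    qed
    also have "\<dots> \<le> 8 ^ CARD('n) * (2 ^ N) ^ (2 * CARD('n)) * Fz"
      using N1 F0 by (intro mult_right_mono) auto
    finally show ?thesis by (simp add: Fz_def)
  qed
qed

text \<open>Each triple sits in a lattice cube with side larger by \<open>2 ^ N\<close>. Moving both
  averages there costs \<open>(2 ^ N) ^ n\<close> twice, \<open>dom\<close> moves on to a member of
  \<open>S\<close>, and \<open>sum_grouped_le\<close> adds up the small cubes.\<close>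

lemma good_scale_bound:
  fixes f g :: "real^'n::finite \<Rightarrow> complex"
  assumes f: "bcs f" and g: "bcs g" and pq: "p \<ge> 1" "q \<ge> 1" 
    and R0: "R0 = tcube t K w0" and vK: "v + int N \<le> K"
    and supp: "\<And>x. f x \<noteq> 0 \<Longrightarrow> x \<in> R0"
    and S: "S \<subseteq> dyad t" and dom: "\<And>R. R \<in> dyad t \<Longrightarrow> R \<subseteq> R0 \<Longrightarrow>
       \<exists>P\<in>S. R \<subseteq> P \<and> av p f R * av q g R \<le> A * (av p f P * av q g P)" and A: "A \<ge> 0"
    and Z: "finite Z" "\<And>z. z \<in> Z \<Longrightarrow> \<exists>w. tcube3 v z \<subseteq> tcube t (v + int N) w"
  shows "ennreal (grid_form p q f g v Z) \<le> ennreal ((2 ^ N) ^ (2 * CARD('n)) * A) * av_form p q f g S"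
proof -
  define F where "F = (\<lambda>P. av p f P * av q g P)"
  have F0: "F P \<ge> 0" for P by (simp add: F_def av_nonneg)
  define Z' where "Z' = {z\<in>Z. F (tcube3 v z) \<noteq> 0}"
  have Z': "finite Z'" using Z by (simp add: Z'_def)
  have "grid_form p q f g v Z = grid_form p q f g v Z'"
    unfolding grid_form_def by (rule sum.mono_neutral_right) (use Z in \<open>auto simp: Z'_def F_def\<close>)
  have ex: "\<exists>P\<in>S. tcube3 v z \<subseteq> P \<and> F (tcube3 v z) \<le> (2 ^ N) ^ (2 * CARD('n)) * A * F P" if z: "z \<in> Z'" for z
  proof -
    obtain w where w: "tcube3 v z \<subseteq> tcube t (v + int N) w" using Z(2) \<open>z \<in> Z'\<close> by (auto simp: Z'_def)
    let ?R = "tcube t (v + int N) w"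
    \<comment> \<open>Since the scale of \<open>?R\<close> is at most \<open>K\<close>, it is either
      inside \<open>R0\<close> or disjoint from it. In the second case \<open>f\<close> vanishes on
      the triple, and such indices were removed from \<open>Z'\<close>.\<close>
    have "?R \<subseteq> R0"
    proof (cases "?R \<inter> R0 = {}")
      case True
      have "Ip p f (tcube3 v z) \<le> Ip p f {}"
        using f pq w True supp by (intro Ip_mono) (auto simp: tcube_borel)
      moreover have "Ip p f {} = 0" by (simp add: Ip_def)
      ultimately have "Ip p f (tcube3 v z) = 0" using Ip_nonneg[of p f "tcube3 v z"] by linarith
      then have "F (tcube3 v z) = 0" by (simp add: F_def av_def)
      then show ?thesis using z by (simp add: Z'_def)
    next
      case False
      then show ?thesis using tcube_nested[OF vK] R0 by blast
    qed
    then obtain P where P: "P \<in> S" "?R \<subseteq> P" "F ?R \<le> A * F P"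
      using dom[of ?R] by (auto simp: dyad_def F_def)
    have b: "vol ?R \<le> (2 ^ N) ^ CARD('n) * vol (tcube3 v z)"
    proof -
      have "(2 powi v * 2 ^ N :: real) ^ CARD('n) \<le> (2 ^ N * (3 * 2 powi v)) ^ CARD('n)"
        by (intro power_mono) auto
      then show ?thesis by (simp add: tcube_measure tcube3_measure powi_add_nat power_mult_distrib)
    qed
    have "F (tcube3 v z) \<le> ((2 ^ N) ^ CARD('n) * av p f ?R) * ((2 ^ N) ^ CARD('n) * av q g ?R)"
      unfolding F_def
    proof (intro mult_mono av_compare Ip_mono f g b)
      show "1 \<le> ((2::real) ^ N) ^ CARD('n)" by (intro one_le_power) auto
    qed (use pq w in \<open>auto simp: tcube_measure tcube3_measure tcube_borel av_nonneg\<close>)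
    also have "\<dots> = (2 ^ N) ^ (2 * CARD('n)) * F ?R"
      unfolding power_double by (simp only: F_def mult_ac)
    also have "\<dots> \<le> (2 ^ N) ^ (2 * CARD('n)) * (A * F P)"
      by (intro mult_left_mono P) simp
    finally show ?thesis using P w by (auto simp: mult_ac)
  qed
  then obtain P where P: "\<And>z. z \<in> Z' \<Longrightarrow> P z \<in> S" "\<And>z. z \<in> Z' \<Longrightarrow> tcube3 v z \<subseteq> P z"
     "\<And>z. z \<in> Z' \<Longrightarrow> F (tcube3 v z) \<le> (2 ^ N) ^ (2 * CARD('n)) * A * F (P z)" by metis
  have "grid_form p q f g v Z' \<le> (\<Sum>z\<in>Z'. vol (tcube 0 v z) * ((2 ^ N) ^ (2 * CARD('n)) * A * F (P z)))"
    unfolding grid_form_def using P(3) by (intro sum_mono mult_left_mono) (auto simp: F_def)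
  also have "\<dots> = (2 ^ N) ^ (2 * CARD('n)) * A * (\<Sum>z\<in>Z'. vol (tcube 0 v z) * F (P z))"
    by (simp add: sum_distrib_left mult_ac)
  also have "\<dots> \<le> (2 ^ N) ^ (2 * CARD('n)) * A * (\<Sum>Q\<in>P ` Z'. vol Q * F Q)"
  proof (intro mult_left_mono sum_grouped_le Z' disjoint_tcubes F0)
    show "tcube 0 v i \<in> fmeasurable lborel" for i :: "int^'n" by (simp add: tcube_def fmeasurable_half_open_cube)
    show "tcube 0 v i \<subseteq> P i" if "i \<in> Z'" for i using P(2)[OF that] tcube_sub_tcube3 by blast
    show "P i \<in> fmeasurable lborel" if "i \<in> Z'" for i using P(1)[OF that] S dyad_props(3) by blast
  qed (use A in auto)
  finally have "ennreal (grid_form p q f g v Z) \<le> ennreal ((2 ^ N) ^ (2 * CARD('n)) * A * (\<Sum>Q\<in>P ` Z'. vol Q * F Q))"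
    using \<open>grid_form p q f g v Z = grid_form p q f g v Z'\<close> by (simp add: ennreal_leI)
  also have "\<dots> = ennreal ((2 ^ N) ^ (2 * CARD('n)) * A) * ennreal (\<Sum>Q\<in>P ` Z'. vol Q * F Q)"
    by (rule ennreal_mult) (use A F0 in \<open>auto intro!: sum_nonneg\<close>)
  also have "\<dots> \<le> ennreal ((2 ^ N) ^ (2 * CARD('n)) * A) * av_form p q f g S"
    unfolding F_def by (intro mult_left_mono av_form_ge_finite) (use P Z' in auto)
  finally show ?thesis .
qed

text \<open>Enlargement exponents that grow linearly in \<open>|v|\<close> give a geometric series
  of bad measures, with ratio \<open>2 powr (- \<theta>)\<close>; the offset \<open>M\<close> then
  makes the sum small. Any faster decay of the measures would need a larger loss.\<close>

lemma shift_exponents: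
  assumes "\<theta> > 0" "c > 0" "\<epsilon> > 0"
  obtains M :: nat where "M \<ge> 2" "(\<Sum>w. ennreal (c / 2 ^ (M + nat \<lceil>\<theta> * real w\<rceil>))) \<le> ennreal \<epsilon>"
proof -
  define r where "r = (2::real) powr (- \<theta>)"
  have r: "0 < r" "r < 1" using assms powr_less_mono[of "- \<theta>" 0 "2::real"] by (auto simp: r_def)
  obtain M0 where M0: "(1 / 2) ^ M0 < \<epsilon> * (1 - r) / c"
    using real_arch_pow_inv[of "\<epsilon> * (1 - r) / c" "1/2"] assms r by auto
  define M where "M = M0 + 2"
  have M: "c * (1 / 2) ^ M / (1 - r) \<le> \<epsilon>"
  proof -
    have "(1 / 2 :: real) ^ M \<le> (1 / 2) ^ M0" unfolding M_def by (rule power_decreasing) auto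
    then have "c * (1 / 2) ^ M \<le> c * (1 / 2) ^ M0" using assms by (intro mult_left_mono) auto
    also have "\<dots> \<le> \<epsilon> * (1 - r)" using M0 assms by (simp add: pos_less_divide_eq mult.commute less_imp_le)
    finally show ?thesis using r by (simp only: pos_divide_le_eq diff_gt_0_iff_gt)
  qed
  have "(\<Sum>w. ennreal (c / 2 ^ (M + nat \<lceil>\<theta> * real w\<rceil>))) \<le> (\<Sum>w. ennreal (c * (1/2) ^ M * r ^ w))"
  proof (intro suminf_le ennreal_leI)
    fix w
    have "r ^ w = 2 powr (- (\<theta> * w))" using r by (simp add: r_def powr_powr powr_realpow[symmetric] powr_power)
    moreover have "2 powr (- real (nat \<lceil>\<theta> * real w\<rceil>)) \<le> 2 powr (- (\<theta> * w))"
      by (intro powr_mono) (auto simp: of_nat_nat real_nat_ceiling_ge)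
    moreover have "2 powr (- real (nat \<lceil>\<theta> * real w\<rceil>)) = 1 / 2 ^ nat \<lceil>\<theta> * real w\<rceil>"
      by (simp add: powr_minus powr_realpow field_simps)
    ultimately have "1 / 2 ^ nat \<lceil>\<theta> * real w\<rceil> \<le> r ^ w" by simp
    then have "c * (1/2) ^ M * (1 / 2 ^ nat \<lceil>\<theta> * real w\<rceil>) \<le> c * (1/2) ^ M * r ^ w"
      using assms by (intro mult_left_mono) auto
    then show "c / 2 ^ (M + nat \<lceil>\<theta> * real w\<rceil>) \<le> c * (1/2) ^ M * r ^ w"
      by (simp add: power_add power_one_over)
  qed auto
  also have "\<dots> = ennreal (c * (1/2) ^ M * (1 / (1 - r)))"
    using geometric_sums[of r] r assms by (intro suminf_ennreal_eq sums_mult) auto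
  also have "\<dots> \<le> ennreal \<epsilon>" using M by (intro ennreal_leI) simp
  finally show ?thesis by (intro that[of M]) (auto simp: M_def)
qed

theorem grid_sum_domination:
  fixes ps qs \<theta> :: "nat \<Rightarrow> real"
  assumes p: "\<And>k. ps k \<in> {1..2}" and q: "\<And>k. qs k \<in> {1..2}" and \<theta>: "\<And>k. \<theta> k > 0"
  shows "\<exists>Cst :: nat \<Rightarrow> real. (\<forall>k. Cst k \<ge> 0) \<and> (\<forall>f g :: real^'n::finite \<Rightarrow> complex. bcs f \<longrightarrow> bcs g \<longrightarrow>
     (\<exists>S. dyadic_collection S \<and> eta_sparse (1 / 4) S \<and> (\<forall>k v Z. finite Z \<longrightarrow>
        ennreal (grid_form (ps k) (qs k) f g v Z) \<le> ennreal (Cst k * 2 powr (\<theta> k * \<bar>v\<bar>)) * av_form (ps k) (qs k) f g S)))"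
proof -
  define n where "n = real CARD('n)"
  have n: "n > 0" by (simp add: n_def)
  \<comment> \<open>Two averages are enlarged in n dimensions, so the loss is
    \<open>(2 ^ N) ^ (2 * n)\<close>; a slope of \<open>\<theta> / (2 * n)\<close> turns it into
    \<open>2 powr (\<theta> * |v|)\<close> up to a constant.\<close>
  define \<theta>' where "\<theta>' = (\<lambda>k. \<theta> k / (2 * n))"
  have \<theta>': "\<theta>' k > 0" for k using \<theta>[of k] n by (simp add: \<theta>'_def)
  have "\<exists>M :: nat. M \<ge> 2 \<and> (\<Sum>w. ennreal (36 * n / 2 ^ (M + nat \<lceil>\<theta>' k * real w\<rceil>))) \<le> ennreal ((1 / 2) ^ (k + 3))" for k
    using shift_exponents[of "\<theta>' k" "36 * n" "(1 / 2) ^ (k + 3)"] \<theta>' n by (metis mult_pos_pos zero_less_numeral zero_less_power half_gt_zero_iff zero_less_one)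
  then obtain M :: "nat \<Rightarrow> nat" where M: "\<And>k. M k \<ge> 2" "\<And>k. (\<Sum>w. ennreal (36 * n / 2 ^ (M k + nat \<lceil>\<theta>' k * real w\<rceil>))) \<le> ennreal ((1 / 2) ^ (k + 3))"
    by metis
  define N where "N = (\<lambda>k w. M k + nat \<lceil>\<theta>' k * real w\<rceil>)"
  have N2: "N k w \<ge> 2" for k w using M(1)[of k] by (simp add: N_def)
  have Nsum: "(\<Sum>w. ennreal (36 * real CARD('n) / 2 ^ N k w)) \<le> ennreal ((1 / 2) ^ (k + 3))" for k
    using M(2)[of k] by (simp add: N_def n_def)
  have Npow: "(2 ^ N k (nat \<bar>v\<bar>)) ^ (2 * CARD('n)) \<le> 2 powr (2 * n * (real (M k) + 1)) * 2 powr (\<theta> k * \<bar>v\<bar>)" for k and v :: int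
  proof -
    have "real (nat \<lceil>\<theta>' k * real (nat \<bar>v\<bar>)\<rceil>) \<le> \<theta>' k * \<bar>v\<bar> + 1"
      using \<theta>'[of k] by (simp add: of_nat_nat)
    then have "real (N k (nat \<bar>v\<bar>)) * (2 * n) \<le> (real (M k) + 1 + \<theta>' k * \<bar>v\<bar>) * (2 * n)"
      using n by (intro mult_right_mono) (auto simp: N_def)
    also have "\<dots> = 2 * n * (real (M k) + 1) + \<theta> k * \<bar>v\<bar>" using n by (simp add: \<theta>'_def field_simps)
    finally have h1: "2 powr (real (N k (nat \<bar>v\<bar>)) * (2 * n)) \<le> 2 powr (2 * n * (real (M k) + 1) + \<theta> k * \<bar>v\<bar>)"
      by (intro powr_mono) auto
    have h2: "2 powr (real (N k (nat \<bar>v\<bar>)) * (2 * n)) = (2 ^ N k (nat \<bar>v\<bar>)) ^ (2 * CARD('n))"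
    proof -
      have "real (N k (nat \<bar>v\<bar>)) * (2 * n) = real (N k (nat \<bar>v\<bar>) * (2 * CARD('n)))" by (simp add: n_def)
      then show ?thesis by (simp only: powr_realpow[of 2] zero_less_numeral power_mult)
    qed
    show ?thesis using h1 unfolding h2 powr_add .
  qed
  \<comment> \<open>The first summand pays for the good scales, with a 2 for keeping only half of
    the weight and the stopping threshold \<open>4 ^ (k + 3)\<close>; the second pays for the large
    scales.\<close>
  define Cst where "Cst = (\<lambda>k. (2 * 4 ^ (k + 3) + 8 ^ CARD('n)) * 2 powr (2 * n * (real (M k) + 1)))"
  have C0: "Cst k \<ge> 0" for k by (simp add: Cst_def)
  have Cb: "(2 * 4 ^ (k + 3) + 8 ^ CARD('n)) * (2 ^ N k (nat \<bar>v\<bar>)) ^ (2 * CARD('n)) \<le> Cst k * 2 powr (\<theta> k * \<bar>v\<bar>)" for k and v :: int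
    using mult_left_mono[OF Npow[of k v], of "2 * 4 ^ (k + 3) + 8 ^ CARD('n)"] by (simp add: Cst_def mult_ac)
  show ?thesis
  proof (intro exI[of _ Cst] conjI allI impI C0)
    fix f g :: "real^'n \<Rightarrow> complex" assume f: "bcs f" and g: "bcs g"
    obtain K where K: "\<And>x i. f x \<noteq> 0 \<Longrightarrow> \<bar>x $ i\<bar> < 2 powi (K - 2)" "\<And>x i. g x \<noteq> 0 \<Longrightarrow> \<bar>x $ i\<bar> < 2 powi (K - 2)"
      using bcs_cube_support[OF f g] by metis
    have K4: "(2::real) powi K = 4 * 2 powi (K - 2)" using power_int_add[of "2::real" "K - 2" 2] by simp
    define Zs where "Zs = (\<lambda>v. Zset v (2 powi (K - 2)) :: (int^'n) set)"
    have finZs: "finite (Zs v)" for v by (simp add: Zs_def finite_Zset)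
    define c where "c = (\<lambda>k v (z::int^'n). vol (tcube 0 v z) * (av (ps k) f (tcube3 v z) * av (qs k) g (tcube3 v z)))"
    have c0: "c k v z \<ge> 0" for k v z by (simp add: c_def av_nonneg)
    have Xc: "grid_form (ps k) (qs k) f g v Z = sum (c k v) Z" for k v Z by (simp add: grid_form_def c_def)
    obtain t where t: "t \<in> {2 powi (K - 2)..3 * 2 powi (K - 2)}"
      "\<And>k v. v + int (N k (nat \<bar>v\<bar>)) \<le> K \<Longrightarrow>
       (\<Sum>z\<in>Zs v. c k v z) \<le> 2 * (\<Sum>z\<in>{z\<in>Zs v. \<exists>w. tcube3 v z \<subseteq> tcube t (v + int (N k (nat \<bar>v\<bar>))) w}. c k v z)"
      by (rule shift_selection[of Zs c N K, OF finZs c0 N2 Nsum]) (rule that; assumption)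
    have t1: "2 powi (K - 2) \<le> t" "t \<le> 3 * 2 powi (K - 2)" using t(1) by simp_all
    \<comment> \<open>The index -1 selects the cube with every coordinate in
      \<open>t - 2 powi K \<le> x < t\<close>. For \<open>t\<close> between one and three quarters
      of \<open>2 powi K\<close> it contains both supports.\<close>
    define w0 :: "int^'n" where "w0 = (\<chi> i. - 1)"
    define R0 where "R0 = tcube t K w0"
    have inR0: "x \<in> R0" if "\<And>i. \<bar>x $ i\<bar> < 2 powi (K - 2)" for x
      unfolding R0_def tcube_def half_open_cube_def w0_def
    proof (simp, intro allI)
      fix i
      show "t - 2 powi K \<le> x $ i \<and> x $ i < t" using that[of i] t1 K4 by linarith
    qed
    have R0D: "R0 \<in> dyad t" by (auto simp: R0_def dyad_def)
    have R0m: "vol R0 = (2 powi K) ^ CARD('n)" by (simp add: R0_def tcube_measure)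
    have p1: "ps k \<ge> 1" "ps k \<le> 2" "qs k \<ge> 1" "qs k \<le> 2" for k using p[of k] q[of k] by auto
    obtain S where S: "R0 \<in> S" "S \<subseteq> dyad t" "\<And>P. P \<in> S \<Longrightarrow> P \<subseteq> R0" "eta_sparse (1 / 4) S"
      "\<And>k R. R \<in> dyad t \<Longrightarrow> R \<subseteq> R0 \<Longrightarrow>
       \<exists>P\<in>S. R \<subseteq> P \<and> av (ps k) f R * av (qs k) g R \<le> 4 ^ (k + 3) * (av (ps k) f P * av (qs k) g P)"
      by (rule universal_sparse[OF f g p1(1) p1(3) R0D]) (rule that; assumption)
    have leI: "Ip (ps k) f E \<le> Ip (ps k) f R0" "Ip (qs k) g E \<le> Ip (qs k) g R0" if "E \<in> sets borel" for k E
    proof -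
      have R0b: "R0 \<in> sets borel" using dyad_props(1)[OF R0D] .
      show "Ip (ps k) f E \<le> Ip (ps k) f R0"
        using p1(1)[of k] by (intro Ip_mono f that R0b inR0 K(1)) auto
      show "Ip (qs k) g E \<le> Ip (qs k) g R0"
        using p1(3)[of k] by (intro Ip_mono g that R0b inR0 K(2)) auto
    qed
    show "\<exists>S. dyadic_collection S \<and> eta_sparse (1 / 4) S \<and> (\<forall>k v Z. finite Z \<longrightarrow>
        ennreal (grid_form (ps k) (qs k) f g v Z) \<le> ennreal (Cst k * 2 powr (\<theta> k * \<bar>v\<bar>)) * av_form (ps k) (qs k) f g S)"
    proof (intro exI[of _ S] conjI allI impI S(4))
      show "dyadic_collection S" unfolding dyadic_collection_def using dyadic_lattice_dyad S(2) by blast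
      fix k v and Z :: "(int^'n) set" assume Z: "finite Z"
      let ?N = "N k (nat \<bar>v\<bar>)"
      let ?B = "(2 ^ ?N) ^ (2 * CARD('n)) :: real"
      have zero: "c k v z = 0" if "z \<notin> Zs v" for z
      proof -
        have "Ip (ps k) f (tcube3 v z) \<le> Ip (ps k) f {}"
          using p1(1)[of k] K(1) that unfolding Zs_def Zset_def by (intro Ip_mono f) (auto simp: tcube_borel)
        moreover have "Ip (ps k) f {} = 0" by (simp add: Ip_def)
        ultimately have "Ip (ps k) f (tcube3 v z) = 0" using Ip_nonneg[of "ps k" f "tcube3 v z"] by linarith
        then show ?thesis by (simp add: c_def av_def)
      qed
      have "sum (c k v) Z = sum (c k v) (Z \<inter> Zs v)"
        by (rule sum.mono_neutral_right) (use Z zero in auto)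
      also have "\<dots> \<le> sum (c k v) (Zs v)"
        by (rule sum_mono2) (auto simp: Zs_def finite_Zset c0)
      finally have XZ: "grid_form (ps k) (qs k) f g v Z \<le> sum (c k v) (Zs v)" by (simp add: Xc)
      have main: "ennreal (sum (c k v) (Zs v)) \<le> ennreal ((2 * 4 ^ (k + 3) + 8 ^ CARD('n)) * ?B) * av_form (ps k) (qs k) f g S"
      proof (cases "v + int ?N \<le> K")
        case True
        define Zg where "Zg = {z\<in>Zs v. \<exists>w. tcube3 v z \<subseteq> tcube t (v + int ?N) w}"
        have "ennreal (sum (c k v) (Zs v)) \<le> ennreal (2 * grid_form (ps k) (qs k) f g v Zg)"
          using t(2)[OF True] by (intro ennreal_leI) (simp add: Xc Zg_def)
        also have "\<dots> = ennreal 2 * ennreal (grid_form (ps k) (qs k) f g v Zg)"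
          by (rule ennreal_mult) (auto simp: Xc intro!: sum_nonneg c0)
        also have "\<dots> \<le> ennreal 2 * (ennreal (?B * 4 ^ (k + 3)) * av_form (ps k) (qs k) f g S)"
        proof (intro mult_left_mono good_scale_bound[OF f g p1(1) p1(3) R0_def True _ S(2)])
          show "x \<in> R0" if "f x \<noteq> 0" for x using inR0 K(1)[OF that] by blast
          show "\<exists>P\<in>S. R \<subseteq> P \<and> av (ps k) f R * av (qs k) g R \<le> 4 ^ (k + 3) * (av (ps k) f P * av (qs k) g P)"
            if "R \<in> dyad t" "R \<subseteq> R0" for R using S(5) that by blast
          show "finite Zg" unfolding Zg_def Zs_def by (simp add: finite_Zset)
          show "\<exists>w. tcube3 v z \<subseteq> tcube t (v + int ?N) w" if "z \<in> Zg" for z using that by (simp add: Zg_def)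
        qed auto
        also have "\<dots> = ennreal (2 * (?B * 4 ^ (k + 3))) * av_form (ps k) (qs k) f g S"
          by (subst ennreal_mult) (auto simp: mult.assoc)
        also have "\<dots> \<le> ennreal ((2 * 4 ^ (k + 3) + 8 ^ CARD('n)) * ?B) * av_form (ps k) (qs k) f g S"
          by (intro mult_right_mono ennreal_leI) (auto simp: algebra_simps)
        finally show ?thesis .
      next
        case False
        have "sum (c k v) (Zs v) \<le> 8 ^ CARD('n) * ?B * (vol R0 * (av (ps k) f R0 * av (qs k) g R0))"
          unfolding Xc[symmetric] Zs_def
          by (rule large_scale_bound[OF p1(1) p1(3) p1(2) p1(4) R0m leI]) (use False in auto)
        also have "\<dots> \<le> ((2 * 4 ^ (k + 3) + 8 ^ CARD('n)) * ?B) * (vol R0 * (av (ps k) f R0 * av (qs k) g R0))"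
          by (intro mult_right_mono) (auto simp: av_nonneg algebra_simps)
        finally have "ennreal (sum (c k v) (Zs v)) \<le> ennreal (((2 * 4 ^ (k + 3) + 8 ^ CARD('n)) * ?B) * (vol R0 * (av (ps k) f R0 * av (qs k) g R0)))"
          by (rule ennreal_leI)
        also have "\<dots> = ennreal ((2 * 4 ^ (k + 3) + 8 ^ CARD('n)) * ?B) * ennreal (vol R0 * (av (ps k) f R0 * av (qs k) g R0))"
          by (rule ennreal_mult) (auto simp: av_nonneg)
        also have "\<dots> \<le> ennreal ((2 * 4 ^ (k + 3) + 8 ^ CARD('n)) * ?B) * av_form (ps k) (qs k) f g S"
          using av_form_ge_finite[of "{R0}" S "ps k" f "qs k" g] S(1) by (intro mult_left_mono) auto
        finally show ?thesis .
      qed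
      have "ennreal (grid_form (ps k) (qs k) f g v Z) \<le> ennreal (sum (c k v) (Zs v))" using XZ by (rule ennreal_leI)
      also note main
      also have "ennreal ((2 * 4 ^ (k + 3) + 8 ^ CARD('n)) * ?B) * av_form (ps k) (qs k) f g S
          \<le> ennreal (Cst k * 2 powr (\<theta> k * \<bar>v\<bar>)) * av_form (ps k) (qs k) f g S"
        by (intro mult_right_mono ennreal_leI Cb) auto
      finally show "ennreal (grid_form (ps k) (qs k) f g v Z) \<le> ennreal (Cst k * 2 powr (\<theta> k * \<bar>v\<bar>)) * av_form (ps k) (qs k) f g S" .
    qed
  qed
qed

section \<open>Smooth cutoffs\<close>

text \<open>The factor \<open>(1 / x) ^ n\<close> makes the family closed under differentiation up to linear combinations.\<close>

definition flat_exp :: "nat \<Rightarrow> real \<Rightarrow> real" where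
  "flat_exp n x = (if x > 0 then (1 / x) ^ n * exp (- (1 / x)) else 0)"

text \<open>One term of the exponential series at \<open>1 / x\<close>. The factor
  \<open>x\<^sup>2\<close> makes the difference quotient at 0 tend to 0, which is the only delicate
  point in \<open>flat_exp_deriv\<close>.\<close>

lemma flat_exp_bound: "\<bar>flat_exp n x\<bar> \<le> fact (n + 2) * x\<^sup>2"
proof (cases "x > 0")
  case True
  define y where "y = 1 / x"
  have y: "y > 0" using True by (simp add: y_def)
  have "y ^ (n + 2) / fact (n + 2) \<le> exp y"
  proof -
    have e: "(\<lambda>k. y ^ k /\<^sub>R fact k) sums exp y" by (rule exp_converges)
    have "sum (\<lambda>k. y ^ k /\<^sub>R fact k) {n + 2} \<le> exp y"
      using y sum_le_suminf[of "\<lambda>k. y ^ k /\<^sub>R fact k" "{n + 2}"] e by (auto simp: sums_iff)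
    then show ?thesis by (simp add: divide_inverse mult.commute)
  qed
  then have "y ^ (n + 2) \<le> exp y * fact (n + 2)"
    by (simp only: pos_divide_le_eq[OF fact_gt_zero])
  then have "y ^ (n + 2) * exp (- y) \<le> exp y * fact (n + 2) * exp (- y)"
    by (rule mult_right_mono) simp
  also have "\<dots> = fact (n + 2)" by (simp only: exp_minus mult.assoc) simp
  finally have "y ^ n * exp (- y) * y\<^sup>2 \<le> fact (n + 2)"
    by (simp only: power_add mult_ac)
  then have "y ^ n * exp (- y) \<le> fact (n + 2) * x\<^sup>2"
    using True by (simp add: y_def field_simps power2_eq_square)
  then show ?thesis using True by (simp add: flat_exp_def y_def)
qed (simp add: flat_exp_def)

lemma flat_exp_deriv:
  "(flat_exp n has_real_derivative (flat_exp (n + 2) x - real n * flat_exp (n + 1) x)) (at x)"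
proof -
  consider "x > 0" | "x < 0" | "x = 0" by linarith
  then show ?thesis
  proof cases
    case 1
    have d: "((\<lambda>x. (1 / x) ^ n * exp (- (1 / x))) has_real_derivative (flat_exp (n + 2) x - real n * flat_exp (n + 1) x)) (at x)"
      using 1 by (auto intro!: derivative_eq_intros simp: flat_exp_def field_simps power2_eq_square)
         (cases n; simp add: field_simps)
    show ?thesis
      by (rule has_field_derivative_transform_within_open[OF d, of "{0<..}"]) (use 1 in \<open>auto simp: flat_exp_def\<close>)
  next
    case 2
    have d: "((\<lambda>x. 0) has_real_derivative (flat_exp (n + 2) x - real n * flat_exp (n + 1) x)) (at x)"
      using 2 by (simp add: flat_exp_def)
    show ?thesis
      by (rule has_field_derivative_transform_within_open[OF d, of "{..<0}"]) (use 2 in \<open>auto simp: flat_exp_def\<close>)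
  next
    case 3
    have "((\<lambda>h. flat_exp n h / h) \<longlongrightarrow> 0) (at 0)"
    proof (rule Lim_null_comparison)
      show "\<forall>\<^sub>F h in at 0. norm (flat_exp n h / h) \<le> fact (n + 2) * \<bar>h\<bar>"
      proof (intro eventually_at_filter[THEN iffD2] always_eventually allI impI)
        fix h :: real assume h: "h \<noteq> 0"
        have "\<bar>flat_exp n h\<bar> / \<bar>h\<bar> \<le> fact (n + 2) * \<bar>h\<bar>\<^sup>2 / \<bar>h\<bar>"
          using flat_exp_bound[of n h] by (intro divide_right_mono) (simp_all only: power2_abs abs_ge_zero)
        show "norm (flat_exp n h / h) \<le> fact (n + 2) * \<bar>h\<bar>"
        proof -
          have "fact (n + 2) * \<bar>h\<bar>\<^sup>2 / \<bar>h\<bar> = fact (n + 2) * \<bar>h\<bar>" using h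
            by (simp only: power2_eq_square times_divide_eq_right[symmetric] mult.assoc) (simp del: fact_Suc abs_mult_self_eq)
          then show ?thesis using \<open>\<bar>flat_exp n h\<bar> / \<bar>h\<bar> \<le> fact (n + 2) * \<bar>h\<bar>\<^sup>2 / \<bar>h\<bar>\<close>
            by (simp only: real_norm_def abs_divide)
        qed
      qed
      show "((\<lambda>h. fact (n + 2) * \<bar>h\<bar>) \<longlongrightarrow> 0) (at (0::real))"
        by (auto intro!: tendsto_eq_intros)
    qed
    then show ?thesis using 3 by (simp add: DERIV_def flat_exp_def)
  qed
qed

text \<open>An algebra of functions that is closed under differentiation, by
  \<open>smooth1_deriv\<close>. Membership therefore yields derivatives of every order by mere
  iteration. The affine argument in \<open>flat\<close> allows both \<open>flat_exp 0 x\<close> and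
  \<open>flat_exp 0 (1 - x)\<close>.\<close>

inductive smooth1 :: "(real \<Rightarrow> real) \<Rightarrow> bool" where
  flat: "smooth1 (\<lambda>x. flat_exp n (\<alpha> * x + \<beta>))"
| const: "smooth1 (\<lambda>x. c)"
| ident: "smooth1 (\<lambda>x. x)"
| add: "smooth1 u \<Longrightarrow> smooth1 v \<Longrightarrow> smooth1 (\<lambda>x. u x + v x)"
| mult: "smooth1 u \<Longrightarrow> smooth1 v \<Longrightarrow> smooth1 (\<lambda>x. u x * v x)"
| inverse: "smooth1 u \<Longrightarrow> (\<And>x. u x > 0) \<Longrightarrow> smooth1 (\<lambda>x. inverse (u x))"

lemma smooth1_deriv: "smooth1 u \<Longrightarrow> \<exists>u'. smooth1 u' \<and> (\<forall>x. (u has_real_derivative u' x) (at x))"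
proof (induction rule: smooth1.induct)
  case (flat n \<alpha> \<beta>)
  let ?u = "\<lambda>x. \<alpha> * (flat_exp (n + 2) (\<alpha> * x + \<beta>) + (- real n) * flat_exp (n + 1) (\<alpha> * x + \<beta>))"
  have "smooth1 ?u" by (intro smooth1.intros)
  moreover have "((\<lambda>x. flat_exp n (\<alpha> * x + \<beta>)) has_real_derivative ?u x) (at x)" for x
    by (rule DERIV_cong[OF DERIV_chain2[OF flat_exp_deriv, of "\<lambda>x. \<alpha> * x + \<beta>" \<alpha>]])
       (auto intro!: derivative_eq_intros)
  ultimately show ?case by blast
next
  case (const c)
  then show ?case by (intro exI[of _ "\<lambda>_. 0"]) (auto intro: smooth1.const)
next
  case ident
  then show ?case by (intro exI[of _ "\<lambda>_. 1"]) (auto intro: smooth1.const)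
next
  case (add u v)
  then obtain u' v' where "smooth1 u'" "\<forall>x. (u has_real_derivative u' x) (at x)"
    "smooth1 v'" "\<forall>x. (v has_real_derivative v' x) (at x)" by blast
  then show ?case by (intro exI[of _ "\<lambda>x. u' x + v' x"]) (auto intro: smooth1.intros DERIV_add)
next
  case (mult u v)
  then obtain u' v' where d: "smooth1 u'" "\<forall>x. (u has_real_derivative u' x) (at x)"
    "smooth1 v'" "\<forall>x. (v has_real_derivative v' x) (at x)" by blast
  show ?case
  proof (intro exI[of _ "\<lambda>x. u' x * v x + v' x * u x"] conjI allI)
    show "smooth1 (\<lambda>x. u' x * v x + v' x * u x)" using d mult by (intro smooth1.intros)
  qed (use d in \<open>auto intro: DERIV_mult\<close>)
next
  case (inverse u)
  then obtain u' where d: "smooth1 u'" "\<forall>x. (u has_real_derivative u' x) (at x)" by blast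
  have ne: "u x \<noteq> 0" for x using inverse(2)[of x] by simp
  show ?case
  proof (intro exI[of _ "\<lambda>x. (- 1) * (inverse (u x) * (u' x * inverse (u x)))"] conjI allI)
    show "smooth1 (\<lambda>x. (- 1) * (inverse (u x) * (u' x * inverse (u x))))"
      using d inverse by (intro smooth1.intros)
    show "((\<lambda>x. inverse (u x)) has_real_derivative (- 1) * (inverse (u x) * (u' x * inverse (u x)))) (at x)" for x
      using DERIV_inverse'[OF d(2)[rule_format, of x] ne] by (simp add: mult.assoc)
  qed
qed

lemma smooth1_derivs:
  assumes "smooth1 u"
  obtains us where "us 0 = u" "\<And>k. smooth1 (us k)" "\<And>k x. (us k has_real_derivative us (Suc k) x) (at x)"
proof -
  define us where "us = (\<lambda>k. (deriv ^^ k) u)"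
  have s: "smooth1 v \<Longrightarrow> smooth1 (deriv v) \<and> (\<forall>x. (v has_real_derivative deriv v x) (at x))" for v
  proof -
    assume "smooth1 v"
    then obtain v' where v': "smooth1 v'" "\<forall>x. (v has_real_derivative v' x) (at x)" using smooth1_deriv by blast
    then have "deriv v = v'" by (auto intro: DERIV_imp_deriv)
    then show ?thesis using v' by simp
  qed
  have sm: "smooth1 (us k)" for k unfolding us_def by (induction k) (use assms s in auto)
  show ?thesis
    by (rule that[of us]) (use sm s in \<open>auto simp: us_def\<close>)
qed

section \<open>A smooth step and a smooth bump\<close>

definition step_fun :: "real \<Rightarrow> real" where
  "step_fun x = flat_exp 0 x * inverse (flat_exp 0 x + flat_exp 0 (1 - x))"

definition bump :: "real \<Rightarrow> real" where
  "bump x = step_fun (2 - x) * step_fun (2 + x)"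

lemma flat_exp_nonneg: "flat_exp n x \<ge> 0" by (simp add: flat_exp_def)

lemma flat_exp_pos: "x > 0 \<Longrightarrow> flat_exp n x > 0" by (simp add: flat_exp_def)

lemma step_denominator_pos: "flat_exp 0 x + flat_exp 0 (1 - x) > 0"
  using flat_exp_pos[of x 0] flat_exp_pos[of "1 - x" 0] flat_exp_nonneg[of 0 x] flat_exp_nonneg[of 0 "1 - x"]
  by (cases "x > 0") (auto intro: add_pos_nonneg add_nonneg_pos)

lemma step_fun_bounds: "0 \<le> step_fun x" "step_fun x \<le> 1" "x \<le> 0 \<Longrightarrow> step_fun x = 0" "x \<ge> 1 \<Longrightarrow> step_fun x = 1"
  using step_denominator_pos[of x] flat_exp_nonneg[of 0 x] flat_exp_nonneg[of 0 "1 - x"]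
  by (auto simp: step_fun_def divide_inverse[symmetric] flat_exp_def)

lemma smooth1_bump: "smooth1 bump"
proof -
  have st: "smooth1 (\<lambda>x. step_fun (\<alpha> * x + \<beta>))" for \<alpha> \<beta>
  proof -
    have "smooth1 (\<lambda>x. flat_exp 0 (\<alpha> * x + \<beta>) * inverse (flat_exp 0 (\<alpha> * x + \<beta>) + flat_exp 0 ((- \<alpha>) * x + (1 - \<beta>))))"
    proof (intro smooth1.intros)
      show "flat_exp 0 (\<alpha> * x + \<beta>) + flat_exp 0 ((- \<alpha>) * x + (1 - \<beta>)) > 0" for x
        using step_denominator_pos[of "\<alpha> * x + \<beta>"] by (simp add: algebra_simps)
    qed
    then show ?thesis unfolding step_fun_def by (simp add: algebra_simps)
  qed
  have "smooth1 (\<lambda>x. step_fun ((-1) * x + 2) * step_fun (1 * x + 2))" by (intro smooth1.mult st)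
  then show ?thesis unfolding bump_def[abs_def] by (simp add: algebra_simps)
qed

lemma bump_props: "0 \<le> bump x" "bump x \<le> 1" "\<bar>x\<bar> \<le> 1 \<Longrightarrow> bump x = 1" "\<bar>x\<bar> \<ge> 2 \<Longrightarrow> bump x = 0"
  using step_fun_bounds[of "2 - x"] step_fun_bounds[of "2 + x"]
  by (auto simp: bump_def abs_le_iff abs_if mult_le_one split: if_splits)

text \<open>The analogue in several variables, generated by functions of one coordinate. Closure
  under the partial derivatives of the algebra gives \<open>smooth\<close> without any chain rule
  for higher derivatives.\<close>

inductive smooth_alg :: "('a::euclidean_space \<Rightarrow> complex) \<Rightarrow> bool" where
  gen: "smooth1 u \<Longrightarrow> b \<in> Basis \<Longrightarrow> smooth_alg (\<lambda>x. complex_of_real (u (x \<bullet> b)))"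
| const: "smooth_alg (\<lambda>x. c)"
| add: "smooth_alg F \<Longrightarrow> smooth_alg G \<Longrightarrow> smooth_alg (\<lambda>x. F x + G x)"
| mult: "smooth_alg F \<Longrightarrow> smooth_alg G \<Longrightarrow> smooth_alg (\<lambda>x. F x * G x)"

lemma smooth_alg_deriv:
  "smooth_alg F \<Longrightarrow> \<exists>F'. (\<forall>x. (F has_derivative F' x) (at x)) \<and> (\<forall>c\<in>Basis. smooth_alg (\<lambda>x. F' x c))"
proof (induction rule: smooth_alg.induct)
  case (gen u b)
  obtain u' where u': "smooth1 u'" "\<And>x. (u has_real_derivative u' x) (at x)" using smooth1_deriv[OF gen(1)] by blast
  show ?case
  proof (intro exI[of _ "\<lambda>x h. complex_of_real (u' (x \<bullet> b)) * complex_of_real (h \<bullet> b)"] conjI allI ballI)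
    fix x :: 'a
    have "((\<lambda>x. u (x \<bullet> b)) has_derivative (\<lambda>h. u' (x \<bullet> b) * (h \<bullet> b))) (at x)"
    proof -
      have 1: "((\<lambda>x. x \<bullet> b) has_derivative (\<lambda>h. h \<bullet> b)) (at x)"
        by (auto intro!: derivative_eq_intros)
      have 2: "(u has_derivative (*) (u' (x \<bullet> b))) (at (x \<bullet> b))"
        using u'(2)[of "x \<bullet> b"] by (simp add: has_field_derivative_def)
      from has_derivative_compose[OF 1 2] show ?thesis .
    qed
    from has_derivative_of_real[OF this] 
    show "((\<lambda>x. complex_of_real (u (x \<bullet> b))) has_derivative (\<lambda>h. complex_of_real (u' (x \<bullet> b)) * complex_of_real (h \<bullet> b))) (at x)"
      by simp
  next
    fix c :: 'a
    show "smooth_alg (\<lambda>x. complex_of_real (u' (x \<bullet> b)) * complex_of_real (c \<bullet> b))"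
      by (intro smooth_alg.mult smooth_alg.gen u' gen smooth_alg.const)
  qed
next
  case (const c)
  then show ?case by (intro exI[of _ "\<lambda>_ _. 0"]) (auto intro: smooth_alg.const)
next
  case (add F G)
  then obtain F' G' where d: "\<And>x. (F has_derivative F' x) (at x)" "\<And>c. c \<in> Basis \<Longrightarrow> smooth_alg (\<lambda>x. F' x c)"
    "\<And>x. (G has_derivative G' x) (at x)" "\<And>c. c \<in> Basis \<Longrightarrow> smooth_alg (\<lambda>x. G' x c)" by metis
  show ?case
    by (intro exI[of _ "\<lambda>x h. F' x h + G' x h"] conjI allI ballI has_derivative_add d smooth_alg.add)
next
  case (mult F G)
  then obtain F' G' where d: "\<And>x. (F has_derivative F' x) (at x)" "\<And>c. c \<in> Basis \<Longrightarrow> smooth_alg (\<lambda>x. F' x c)"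
    "\<And>x. (G has_derivative G' x) (at x)" "\<And>c. c \<in> Basis \<Longrightarrow> smooth_alg (\<lambda>x. G' x c)" by metis
  show ?case
    by (intro exI[of _ "\<lambda>x h. F x * G' x h + F' x h * G x"] conjI allI ballI has_derivative_mult d smooth_alg.add smooth_alg.mult mult.hyps)
qed

lemma smooth_alg_frechet:
  assumes "smooth_alg F"
  shows "F differentiable (at x)" "b \<in> Basis \<Longrightarrow> smooth_alg (\<lambda>z. frechet_derivative F (at z) b)"
proof -
  obtain F' where F': "\<And>x. (F has_derivative F' x) (at x)" "\<And>c. c \<in> Basis \<Longrightarrow> smooth_alg (\<lambda>x. F' x c)"
    using smooth_alg_deriv[OF assms] by blast
  show "F differentiable (at x)" using F'(1) differentiable_def by blast
  have "frechet_derivative F (at z) = F' z" for z using F'(1) frechet_derivative_at by metis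
  then show "b \<in> Basis \<Longrightarrow> smooth_alg (\<lambda>z. frechet_derivative F (at z) b)" using F'(2) by simp
qed

lemma smooth_alg_iter_partial:
  assumes "smooth_alg F" "set bs \<subseteq> Basis"
  shows "smooth_alg (iter_partial bs F)"
  using assms(2) by (induction bs) (auto simp: assms(1) smooth_alg_frechet(2))

lemma smooth_alg_smooth: "smooth_alg F \<Longrightarrow> smooth F"
  unfolding smooth_def using smooth_alg_iter_partial smooth_alg_frechet(1) by blast

lemma smooth_alg_prod:
  "finite A \<Longrightarrow> (\<And>i. i \<in> A \<Longrightarrow> smooth_alg (F i)) \<Longrightarrow> smooth_alg (\<lambda>x. \<Prod>i\<in>A. F i x)"
  by (induction A rule: finite_induct) (auto intro: smooth_alg.intros)

lemma smooth_alg_sum: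
  "finite A \<Longrightarrow> (\<And>i. i \<in> A \<Longrightarrow> smooth_alg (F i)) \<Longrightarrow> smooth_alg (\<lambda>x. \<Sum>i\<in>A. F i x)"
  by (induction A rule: finite_induct) (auto intro: smooth_alg.intros)

lemma integrable_translate:
  fixes f :: "'a::euclidean_space \<Rightarrow> 'b::{banach, second_countable_topology}"
  assumes "integrable lborel f"
  shows "integrable lborel (\<lambda>x. f (x + c))"
proof -
  have "integrable (distr lborel borel ((+) c)) f" using assms by (simp add: lborel_distr_plus)
  then have "integrable lborel (\<lambda>x. f (c + x))" by (rule integrable_distr[rotated]) simp
  then show ?thesis by (simp add: add.commute)
qed

text \<open>By translation invariance \<open>F (\<xi> + e) - F \<xi>\<close> integrates to 0, and by
  the fundamental theorem it is the integral of \<open>F'\<close> along a unit segment. Fubini and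
  translation invariance again leave the integral of \<open>F'\<close>. Integrability replaces any
  decay at infinity.\<close>

lemma integral_partial_zero:
  fixes F F' :: "'a::euclidean_space \<Rightarrow> complex" and e :: 'a
  assumes Fi: "integrable lborel F" and F'i: "integrable lborel F'" and c: "continuous_on UNIV F'"
    and d: "\<And>\<xi>. ((\<lambda>t. F (\<xi> + t *\<^sub>R e)) has_vector_derivative F' \<xi>) (at 0)"
  shows "(LBINT \<xi>. F' \<xi>) = 0"
proof -
  have [measurable]: "F \<in> borel_measurable borel" "F' \<in> borel_measurable borel"
    using Fi F'i by (auto dest: borel_measurable_integrable)
  have d': "((\<lambda>t. F (\<xi> + t *\<^sub>R e)) has_vector_derivative F' (\<xi> + s *\<^sub>R e)) (at s)" for \<xi> s
  proof -
    have "((\<lambda>t. F ((\<xi> + s *\<^sub>R e) + (t - s) *\<^sub>R e)) has_vector_derivative F' (\<xi> + s *\<^sub>R e)) (at s)"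
    proof -
      have 1: "((\<lambda>t. t - s) has_vector_derivative 1) (at s)" by (auto intro!: derivative_eq_intros)
      have 2: "((\<lambda>t. F ((\<xi> + s *\<^sub>R e) + t *\<^sub>R e)) has_vector_derivative F' (\<xi> + s *\<^sub>R e)) (at (s - s))"
        using d[of "\<xi> + s *\<^sub>R e"] by simp
      show ?thesis using vector_diff_chain_at[OF 1 2] by (simp add: o_def)
    qed
    then show ?thesis by (simp add: algebra_simps)
  qed
  have ftc: "(LBINT t. indicator {0..1} t *\<^sub>R F' (\<xi> + t *\<^sub>R e)) = F (\<xi> + e) - F \<xi>" for \<xi>
  proof -
    have "(LBINT t. indicator {0..1} t *\<^sub>R F' (\<xi> + t *\<^sub>R e)) = F (\<xi> + 1 *\<^sub>R e) - F (\<xi> + 0 *\<^sub>R e)"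
      by (rule integral_FTC_atLeastAtMost)
         (auto intro!: has_vector_derivative_at_within[OF d'] continuous_on_compose2[OF c] continuous_intros)
    then show ?thesis by simp
  qed
  have mt: "(\<lambda>(t, \<xi>). indicator {0..1} t *\<^sub>R F' (\<xi> + t *\<^sub>R e)) \<in> borel_measurable (lborel \<Otimes>\<^sub>M lborel)"
    by measurable
  have tr: "integrable lborel (\<lambda>\<xi>. F' (\<xi> + t *\<^sub>R e))" for t by (rule integrable_translate[OF F'i])
  have trF: "integrable lborel (\<lambda>\<xi>. F (\<xi> + e))" by (rule integrable_translate[OF Fi])
  have I: "integrable (lborel \<Otimes>\<^sub>M lborel) (\<lambda>(t, \<xi>). indicator {0..1::real} t *\<^sub>R F' (\<xi> + t *\<^sub>R e))"
  proof (rule lborel_pair.Fubini_integrable[OF mt])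
    have "(\<lambda>t. LBINT \<xi>. norm (case (t, \<xi>) of (t, \<xi>) \<Rightarrow> indicator {0..1::real} t *\<^sub>R F' (\<xi> + t *\<^sub>R e)))
       = (\<lambda>t. indicator {0..1} t * (LBINT \<xi>. norm (F' \<xi>)))"
    proof
      fix t
      have "(LBINT \<xi>. norm (F' (\<xi> + t *\<^sub>R e))) = (LBINT \<xi>. norm (F' \<xi>))"
        by (rule integral_translate) measurable
      then show "(LBINT \<xi>. norm (case (t, \<xi>) of (t, \<xi>) \<Rightarrow> indicator {0..1::real} t *\<^sub>R F' (\<xi> + t *\<^sub>R e)))
       = indicator {0..1} t * (LBINT \<xi>. norm (F' \<xi>))" by simp
    qed
    then show "integrable lborel (\<lambda>t. LBINT \<xi>. norm (case (t, \<xi>) of (t, \<xi>) \<Rightarrow> indicator {0..1::real} t *\<^sub>R F' (\<xi> + t *\<^sub>R e)))"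
      by simp
    show "AE t in lborel. integrable lborel (\<lambda>\<xi>. case (t, \<xi>) of (t, \<xi>) \<Rightarrow> indicator {0..1::real} t *\<^sub>R F' (\<xi> + t *\<^sub>R e))"
      using tr by simp
  qed
  have "0 = (LBINT \<xi>. F (\<xi> + e)) - (LBINT \<xi>. F \<xi>)"
    by (simp add: integral_translate)
  also have "\<dots> = (LBINT \<xi>. F (\<xi> + e) - F \<xi>)"
    by (rule integral_diff[symmetric]) (use Fi trF in auto)
  also have "\<dots> = (LBINT \<xi>. LBINT t. indicator {0..1} t *\<^sub>R F' (\<xi> + t *\<^sub>R e))"
    by (simp only: ftc)
  also have "\<dots> = (LBINT t. LBINT \<xi>. indicator {0..1} t *\<^sub>R F' (\<xi> + t *\<^sub>R e))"
    using lborel_pair.Fubini_integral[OF I] by simp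
  also have "\<dots> = (LBINT t. indicator {0..1::real} t *\<^sub>R (LBINT \<xi>. F' \<xi>))"
    by (simp add: integral_translate)
  also have "\<dots> = (LBINT \<xi>. F' \<xi>)" by simp
  finally show ?thesis by simp
qed

section \<open>Derivatives of the bump and the Littlewood-Paley partition\<close>

definition bump_derivs :: "nat \<Rightarrow> real \<Rightarrow> real" where
  "bump_derivs = (SOME us. us 0 = bump \<and> (\<forall>k. smooth1 (us k)) \<and> (\<forall>k x. (us k has_real_derivative us (Suc k) x) (at x)))"

lemma bump_derivs: "bump_derivs 0 = bump" "(bump_derivs k has_real_derivative bump_derivs (Suc k) x) (at x)"
proof -
  have "\<exists>us. us 0 = bump \<and> (\<forall>k. smooth1 (us k)) \<and> (\<forall>k x. (us k has_real_derivative us (Suc k) x) (at x))"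
    using smooth1_derivs[OF smooth1_bump] by metis
  from someI_ex[OF this] show "bump_derivs 0 = bump" "(bump_derivs k has_real_derivative bump_derivs (Suc k) x) (at x)"
    unfolding bump_derivs_def by blast+
qed

lemma bump_derivs_cont: "continuous_on UNIV (bump_derivs k)"
  using bump_derivs(2) by (meson DERIV_isCont continuous_at_imp_continuous_on)

lemma bump_derivs_const:
  "\<bar>x\<bar> < 1 \<Longrightarrow> bump_derivs (Suc k) x = 0" "\<bar>x\<bar> > 2 \<Longrightarrow> bump_derivs k x = 0"
proof -
  have loc: "v x = 0" if "\<And>y. (u has_real_derivative v y) (at y)" "open S" "x \<in> S" "\<And>y. y \<in> S \<Longrightarrow> u y = c" for u v :: "real \<Rightarrow> real" and S c x
  proof -
    have "(u has_real_derivative 0) (at x)"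
      by (rule has_field_derivative_transform_within_open[of "\<lambda>_. c" 0 x S]) (use that in auto)
    then show ?thesis using that(1) DERIV_unique by blast
  qed
  have op: "open {y::real. \<bar>y\<bar> < 1}" "open {y::real. \<bar>y\<bar> > 2}"
    by (auto intro!: open_Collect_less continuous_intros)
  show "\<bar>x\<bar> < 1 \<Longrightarrow> bump_derivs (Suc k) x = 0"
  proof (induction k arbitrary: x)
    case 0
    show ?case by (rule loc[OF bump_derivs(2) op(1)]) (use 0 bump_props(3) in \<open>auto simp: bump_derivs(1)\<close>)
  next
    case (Suc k)
    show ?case by (rule loc[OF bump_derivs(2) op(1)]) (use Suc in auto)
  qed
  show "\<bar>x\<bar> > 2 \<Longrightarrow> bump_derivs k x = 0"
  proof (induction k arbitrary: x)
    case 0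
    then show ?case using bump_props(4)[of x] by (simp add: bump_derivs(1))
  next
    case (Suc k)
    show ?case by (rule loc[OF bump_derivs(2) op(2)]) (use Suc in auto)
  qed
qed

lemma bump_derivs_bounded: "\<exists>M\<ge>0. \<forall>x. \<bar>bump_derivs k x\<bar> \<le> M"
proof -
  have "bounded (bump_derivs k ` {-2..2})"
    by (intro compact_imp_bounded compact_continuous_image continuous_on_subset[OF bump_derivs_cont]) auto
  then obtain M where "\<forall>y\<in>bump_derivs k ` {-2..2}. norm y \<le> M" unfolding bounded_iff by blast
  then have M: "\<And>x. x \<in> {-2..2} \<Longrightarrow> \<bar>bump_derivs k x\<bar> \<le> M" by simp
  have "\<bar>bump_derivs k x\<bar> \<le> max M 0" for x
  proof (cases "\<bar>x\<bar> > 2")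
    case False
    then have "x \<in> {-2..2}" by auto
    then show ?thesis using M by fastforce
  qed (simp add: bump_derivs_const(2))
  then show ?thesis by (intro exI[of _ "max M 0"]) auto
qed

text \<open>\<open>dcut i k s\<close> is the \<open>k\<close>-th derivative in direction \<open>i\<close> of the cutoff at frequency \<open>2\<^sup>s\<close>.\<close>

definition dcut :: "'n::finite \<Rightarrow> nat \<Rightarrow> int \<Rightarrow> real^'n \<Rightarrow> real" where
  "dcut i k s \<xi> = bump_derivs k (\<xi> $ i / 2 powi s) / (2 powi s) ^ k * (\<Prod>l\<in>UNIV - {i}. bump (\<xi> $ l / 2 powi s))"

definition cut :: "int \<Rightarrow> real^'n::finite \<Rightarrow> real" where
  "cut s \<xi> = (\<Prod>l\<in>UNIV. bump (\<xi> $ l / 2 powi s))"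

definition dpsi :: "'n::finite \<Rightarrow> nat \<Rightarrow> nat \<Rightarrow> real^'n \<Rightarrow> real" where
  "dpsi i k j \<xi> = dcut i k (int j) \<xi> - (if j = 0 then 0 else dcut i k (int j - 1) \<xi>)"

text \<open>A Littlewood-Paley partition of unity: successive cutoffs telescope, as
  \<open>sum_psi\<close> records, and the term with \<open>j = 0\<close> keeps all low
  frequencies.\<close>

definition psi :: "nat \<Rightarrow> real^'n::finite \<Rightarrow> real" where
  "psi j \<xi> = cut (int j) \<xi> - (if j = 0 then 0 else cut (int j - 1) \<xi>)"

lemma dcut_0: "dcut i 0 s \<xi> = cut s \<xi>"
  unfolding dcut_def cut_def by (subst prod.remove[of UNIV i]) (auto simp: bump_derivs(1))

lemma dpsi_0: "dpsi i 0 j \<xi> = psi j \<xi>"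
  by (simp add: dpsi_def psi_def dcut_0)

lemma sum_psi: "(\<Sum>j<Suc J. psi j \<xi>) = cut (int J) \<xi>"
  by (induction J) (auto simp: psi_def)

lemma dcut_deriv: "((\<lambda>t. dcut i k s (\<xi> + t *\<^sub>R axis i 1)) has_real_derivative dcut i (Suc k) s \<xi>) (at 0)"
proof -
  have e: "dcut i k s (\<xi> + t *\<^sub>R axis i 1) = bump_derivs k ((1 / 2 powi s) * t + \<xi> $ i / 2 powi s) *
     ((\<Prod>l\<in>UNIV - {i}. bump (\<xi> $ l / 2 powi s)) / (2 powi s) ^ k)" for t
  proof -
    have "(\<Prod>l\<in>UNIV - {i}. bump ((\<xi> + t *\<^sub>R axis i 1) $ l / 2 powi s)) = (\<Prod>l\<in>UNIV - {i}. bump (\<xi> $ l / 2 powi s))"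
      by (rule prod.cong) (auto simp: axis_def)
    then show ?thesis unfolding dcut_def by (simp add: axis_def add_divide_distrib add.commute)
  qed
  have "((\<lambda>t. bump_derivs k ((1 / 2 powi s) * t + \<xi> $ i / 2 powi s)) has_real_derivative bump_derivs (Suc k) ((1 / 2 powi s) * 0 + \<xi> $ i / 2 powi s) * (1 / 2 powi s)) (at 0)"
    by (rule DERIV_chain2[OF bump_derivs(2)]) (auto intro!: derivative_eq_intros)
  from DERIV_cmult_right[OF this, of "(\<Prod>l\<in>UNIV - {i}. bump (\<xi> $ l / 2 powi s)) / (2 powi s) ^ k"]
  have 2: "((\<lambda>t. dcut i k s (\<xi> + t *\<^sub>R axis i 1)) has_real_derivative bump_derivs (Suc k) ((1 / 2 powi s) * 0 + \<xi> $ i / 2 powi s) * (1 / 2 powi s)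
     * ((\<Prod>l\<in>UNIV - {i}. bump (\<xi> $ l / 2 powi s)) / (2 powi s) ^ k)) (at 0)"
    by (simp only: e)
  show ?thesis by (rule DERIV_cong[OF 2]) (simp add: dcut_def field_simps)
qed

lemma dpsi_deriv: "((\<lambda>t. dpsi i k j (\<xi> + t *\<^sub>R axis i 1)) has_real_derivative dpsi i (Suc k) j \<xi>) (at 0)"
  unfolding dpsi_def by (cases "j = 0") (auto intro!: DERIV_diff dcut_deriv)

lemma bump_cont: "continuous_on UNIV bump"
  using bump_derivs_cont[of 0] by (simp add: bump_derivs(1))

lemma dcut_cont: "continuous_on UNIV (dcut i k s)"
  unfolding dcut_def
  by (intro continuous_intros continuous_on_compose2[OF bump_cont] continuous_on_compose2[OF bump_derivs_cont]) auto

lemma dpsi_cont: "continuous_on UNIV (dpsi i k j)"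
  unfolding dpsi_def by (cases "j = 0") (auto intro!: continuous_intros dcut_cont)

lemma psi_cont: "continuous_on UNIV (psi j)"
  using dpsi_cont[of undefined 0 j] by (simp add: dpsi_0)

text \<open>Measured in the maximum norm to match the product cutoffs. For \<open>j = 0\<close> it
  is a full box, hence the guard on the lower bound.\<close>

definition annulus :: "nat \<Rightarrow> (real^'n::finite) set" where
  "annulus j = {\<xi>. (\<forall>i. \<bar>\<xi> $ i\<bar> \<le> 2 ^ (j + 1)) \<and> (j \<ge> 1 \<longrightarrow> (\<exists>i. \<bar>\<xi> $ i\<bar> \<ge> 2 ^ (j - 1)))}"

lemma dcut_outside: "dcut i k s \<xi> = 0" if "\<bar>\<xi> $ l\<bar> > 2 * 2 powi s"
proof -
  have p: "(2::real) powi s > 0" by simp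
  have "\<bar>\<xi> $ l / 2 powi s\<bar> > 2" using that p by (simp add: abs_divide pos_less_divide_eq)
  then show ?thesis
    using bump_derivs_const(2)[of "\<xi> $ i / 2 powi s" k] bump_props(4)[of "\<xi> $ l / 2 powi s"]
    by (cases "l = i") (auto simp: dcut_def)
qed

lemma dcut_inside:
  assumes "\<And>l. \<bar>\<xi> $ l\<bar> < 2 powi s"
  shows "dcut i k s \<xi> = (if k = 0 then 1 else 0)"
proof -
  have p: "(2::real) powi s > 0" by simp
  have b: "\<bar>\<xi> $ l / 2 powi s\<bar> < 1" for l using assms[of l] p by (simp add: abs_divide)
  have "bump (\<xi> $ l / 2 powi s) = 1" for l using bump_props(3) b[of l] by (simp add: less_imp_le)
  then show ?thesis
    using bump_derivs_const(1)[OF b[of i]] by (cases k) (auto simp: dcut_def bump_derivs(1))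
qed

lemma dpsi_support: assumes "dpsi i k j \<xi> \<noteq> 0" shows "\<xi> \<in> annulus j"
proof -
  have "\<bar>\<xi> $ l\<bar> \<le> 2 ^ (j + 1)" for l
  proof (rule ccontr)
    assume "\<not> ?thesis"
    then have l: "\<bar>\<xi> $ l\<bar> > 2 * 2 powi (int j)" by simp
    moreover have "(2::real) powi (int j - 1) \<le> 2 powi (int j)" by (rule power_int_increasing) auto
    ultimately have l': "\<bar>\<xi> $ l\<bar> > 2 * 2 powi (int j - 1)" by linarith
    show False using assms dcut_outside[OF l] dcut_outside[OF l'] by (auto simp: dpsi_def split: if_splits)
  qed
  moreover have "\<exists>l. \<bar>\<xi> $ l\<bar> \<ge> 2 ^ (j - 1)" if "j \<ge> 1"
  proof (rule ccontr)
    assume "\<not> ?thesis"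
    then have l: "\<bar>\<xi> $ l\<bar> < 2 ^ (j - 1)" for l by (auto simp: not_le)
    have l1: "\<bar>\<xi> $ l\<bar> < 2 powi (int j - 1)" for l
      using l[of l] that by (simp add: power_int_def of_nat_diff nat_diff_distrib)
    have "(2::real) powi (int j - 1) \<le> 2 powi (int j)" by (rule power_int_increasing) auto
    then have l2: "\<bar>\<xi> $ l\<bar> < 2 powi (int j)" for l using l1[of l] by linarith
    show False using assms that by (simp add: dpsi_def dcut_inside[OF l1] dcut_inside[OF l2])
  qed
  ultimately show ?thesis by (auto simp: annulus_def)
qed

lemma psi_support: "psi j \<xi> \<noteq> 0 \<Longrightarrow> \<xi> \<in> annulus j"
  using dpsi_support[of undefined 0 j \<xi>] by (simp add: dpsi_0)

lemma dcut_bound: "\<exists>M\<ge>0. \<forall>i s. \<forall>\<xi>::real^'n::finite. \<bar>dcut i k s \<xi>\<bar> \<le> M / (2 powi s) ^ k"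
proof -
  obtain M where M: "M \<ge> 0" "\<And>x. \<bar>bump_derivs k x\<bar> \<le> M" using bump_derivs_bounded by metis
  have "\<bar>dcut i k s \<xi>\<bar> \<le> M / (2 powi s) ^ k" for i s and \<xi> :: "real^'n"
  proof -
    have "\<bar>\<Prod>l\<in>UNIV - {i}. bump (\<xi> $ l / 2 powi s)\<bar> \<le> 1"
      using bump_props(1,2) by (simp add: abs_prod prod_le_1)
    then have "\<bar>bump_derivs k (\<xi> $ i / 2 powi s)\<bar> / (2 powi s) ^ k * \<bar>\<Prod>l\<in>UNIV - {i}. bump (\<xi> $ l / 2 powi s)\<bar> \<le> M / (2 powi s) ^ k * 1"
      using M by (intro mult_mono divide_right_mono) auto
    then show ?thesis by (simp add: dcut_def abs_mult abs_divide)
  qed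
  then show ?thesis using M by blast
qed

lemma dpsi_bound: "\<exists>M\<ge>0. \<forall>i j. \<forall>\<xi>::real^'n::finite. \<bar>dpsi i k j \<xi>\<bar> \<le> M / 2 ^ (j * k)"
proof -
  obtain M where M: "M \<ge> 0" "\<And>i s (\<xi> :: real^'n). \<bar>dcut i k s \<xi>\<bar> \<le> M / (2 powi s) ^ k" using dcut_bound by metis
  have "\<bar>dpsi i k j \<xi>\<bar> \<le> (M * (1 + 2 ^ k)) / 2 ^ (j * k)" for i j and \<xi> :: "real^'n"
  proof (cases "j = 0")
    case True
    have "\<bar>dpsi i k j \<xi>\<bar> \<le> M" using M(2)[of i "int j" \<xi>] True by (simp add: dpsi_def)
    also have "\<dots> \<le> M * (1 + 2 ^ k)" using M(1) by (simp add: algebra_simps)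
    finally show ?thesis using True by simp
  next
    case False
    have e: "(2 powi (int j - 1) :: real) = 2 ^ j / 2" by (simp add: power_int_diff)
    have "\<bar>dpsi i k j \<xi>\<bar> \<le> M / (2 powi int j) ^ k + M / (2 powi (int j - 1)) ^ k"
      using M(2)[of i "int j" \<xi>] M(2)[of i "int j - 1" \<xi>] False unfolding dpsi_def by simp
    also have "\<dots> = (M * (1 + 2 ^ k)) / 2 ^ (j * k)"
      unfolding e by (simp add: power_mult power_divide algebra_simps add_divide_distrib)
    finally show ?thesis .
  qed
  then show ?thesis using M(1) by (intro exI[of _ "M * (1 + 2 ^ k)"]) auto
qed

text \<open>On the annulus \<open>1 + norm \<xi>\<close> lies between fixed multiples of
  \<open>2 ^ j\<close>. Adding the constants for the two ends covers both signs of
  \<open>e\<close>.\<close>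

lemma annulus_weight:
  "\<exists>C\<ge>0. \<forall>j. \<forall>\<xi>\<in>(annulus j :: (real^'n::finite) set). (1 + norm \<xi>) powr e \<le> C * 2 powr (j * e)"
proof -
  define n where "n = real CARD('n)"
  have n: "n \<ge> 1" unfolding n_def using finite_UNIV_card_ge_0[where 'a='n] by simp
  have "(1 + norm \<xi>) powr e \<le> ((1/2) powr e + (3 * n) powr e) * 2 powr (j * e)" if \<xi>: "\<xi> \<in> annulus j" for j and \<xi> :: "real^'n"
  proof -
    define t where "t = (1 + norm \<xi>) / 2 ^ j"
    have "norm \<xi> \<le> (\<Sum>i\<in>UNIV. \<bar>\<xi> $ i\<bar>)" by (rule norm_le_l1_cart)
    also have "\<dots> \<le> (\<Sum>i\<in>(UNIV::'n set). 2 ^ (j + 1))" using \<xi> by (intro sum_mono) (auto simp: annulus_def)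
    finally have "norm \<xi> \<le> n * 2 ^ (j + 1)" by (simp add: n_def)
    moreover have "1 \<le> n * 2 ^ j" using mult_mono[of 1 n 1 "2 ^ j :: real"] n by simp
    ultimately have "1 + norm \<xi> \<le> 3 * n * 2 ^ j" by simp
    then have t1: "t \<le> 3 * n" by (simp add: t_def pos_divide_le_eq)
    have t2: "t \<ge> 1 / 2"
    proof (cases "j = 0")
      case False
      then obtain i where "\<bar>\<xi> $ i\<bar> \<ge> 2 ^ (j - 1)" using \<xi> by (auto simp: annulus_def)
      then have "norm \<xi> \<ge> 2 ^ (j - 1)" using component_le_norm_cart[of \<xi> i] by linarith
      moreover have "(2::real) ^ j = 2 * 2 ^ (j - 1)" using False by (simp add: power_eq_if)
      ultimately show ?thesis by (simp add: t_def pos_le_divide_eq)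
    qed (simp add: t_def)
    have "t powr e \<le> (1/2) powr e + (3 * n) powr e"
    proof (cases "e \<ge> 0")
      case True
      then have "t powr e \<le> (3 * n) powr e" using t1 t2 by (intro powr_mono2) auto
      then show ?thesis by (simp add: add_increasing)
    next
      case False
      then have "t powr e \<le> (1/2) powr e" using t2 by (intro powr_mono2') auto
      then show ?thesis by (simp add: add_increasing2)
    qed
    moreover have "(1 + norm \<xi>) powr e = t powr e * 2 powr (j * e)"
    proof -
      have "1 + norm \<xi> = t * 2 powr j" by (simp add: t_def powr_realpow)
      then show ?thesis using t2 by (simp add: powr_mult powr_powr)
    qed
    ultimately show ?thesis by (simp add: mult_right_mono)
  qed
  then show ?thesis by (intro exI[of _ "(1/2) powr e + (3 * n) powr e"]) auto
qed

section \<open>Decay of the kernels\<close>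

lemma dir_basis: "dir_x i \<in> Basis" "dir_xi i \<in> Basis"
  by (simp_all add: dir_x_def dir_xi_def Basis_prod_def axis_in_Basis_iff)

lemma iter_partial_line_derivative:
  fixes F :: "'a::euclidean_space \<Rightarrow> 'b::real_normed_vector"
  assumes "iter_partial bs F differentiable (at z)"
  shows "((\<lambda>t. iter_partial bs F (z + t *\<^sub>R b)) has_vector_derivative iter_partial (b # bs) F z) (at 0)"
proof -
  let ?G = "iter_partial bs F" and ?D = "frechet_derivative (iter_partial bs F) (at z)"
  have D: "(?G has_derivative ?D) (at z)" using assms frechet_derivative_works by blast
  have 1: "((\<lambda>t::real. z + t *\<^sub>R b) has_derivative (\<lambda>t. t *\<^sub>R b)) (at 0)"
    by (auto intro!: derivative_eq_intros)
  have "((\<lambda>t. ?G (z + t *\<^sub>R b)) has_derivative (\<lambda>t. ?D (t *\<^sub>R b))) (at 0)"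
    using has_derivative_compose[OF 1, of ?G ?D] D by simp
  moreover have "?D (t *\<^sub>R b) = t *\<^sub>R ?D b" for t
    using has_derivative_bounded_linear[OF D] by (simp add: linear_simps)
  ultimately show ?thesis by (simp add: has_vector_derivative_def)
qed

lemma annulus_norm_le: "\<xi> \<in> annulus j \<Longrightarrow> norm (\<xi>::real^'n::finite) \<le> real CARD('n) * 2 ^ (j + 1)"
proof -
  assume \<xi>: "\<xi> \<in> annulus j"
  have "norm \<xi> \<le> (\<Sum>i\<in>UNIV. \<bar>\<xi> $ i\<bar>)" by (rule norm_le_l1_cart)
  also have "\<dots> \<le> (\<Sum>i\<in>(UNIV::'n set). 2 ^ (j + 1))" using \<xi> by (intro sum_mono) (auto simp: annulus_def)
  finally show ?thesis by simp
qed

lemma annulus_sub_cube: "annulus j \<subseteq> half_open_cube (\<chi> i. - (2 ^ (j + 2))) (2 ^ (j + 3))"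
proof
  fix \<xi> :: "real^'n" assume \<xi>: "\<xi> \<in> annulus j"
  have "- (2 ^ (j + 2)) \<le> \<xi> $ i \<and> \<xi> $ i < - (2 ^ (j + 2)) + 2 ^ (j + 3)" for i
  proof -
    have "\<bar>\<xi> $ i\<bar> \<le> 2 ^ (j + 1)" using \<xi> by (simp add: annulus_def)
    moreover have "(2::real) ^ (j + 2) = 2 * 2 ^ (j + 1)" "(2::real) ^ (j + 3) = 4 * 2 ^ (j + 1)" "(2::real) ^ (j + 1) > 0"
      by (simp_all add: power_add)
    ultimately show ?thesis by (simp only: abs_le_iff) linarith
  qed
  then show "\<xi> \<in> half_open_cube (\<chi> i. - (2 ^ (j + 2))) (2 ^ (j + 3))" by (simp add: half_open_cube_def)
qed

lemma cis_line_derivative: "((\<lambda>t. cis (z \<bullet> (\<xi> + t *\<^sub>R axis i 1))) has_vector_derivative \<i> * complex_of_real (z $ i) * cis (z \<bullet> \<xi>)) (at 0)"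
proof -
  have e: "z \<bullet> (\<xi> + t *\<^sub>R axis i 1) = z \<bullet> \<xi> + t * z $ i" for t
    by (simp add: inner_add_right inner_axis)
  have "((\<lambda>w. exp (\<i> * (complex_of_real (z \<bullet> \<xi>) + w * complex_of_real (z $ i)))) has_field_derivative
     \<i> * complex_of_real (z $ i) * exp (\<i> * complex_of_real (z \<bullet> \<xi>))) (at (complex_of_real 0))"
    by (auto intro!: derivative_eq_intros)
  from has_vector_derivative_real_field[OF this] show ?thesis unfolding e by (simp add: cis_conv_exp)
qed

locale pdo_symbol =
  fixes a :: "(real^'n::finite) \<times> (real^'n) \<Rightarrow> complex" and m \<rho> \<delta> :: real
  assumes symbol: "a \<in> symbol_class m \<rho> \<delta>"
    and m_neg: "m < 0" and \<delta>_pos: "0 < \<delta>" and \<delta>_le: "\<delta> \<le> \<rho>" and \<rho>_lt: "\<rho> < 1"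
begin

lemma a_diff: "set bs \<subseteq> Basis \<Longrightarrow> iter_partial bs a differentiable (at z)"
  using symbol unfolding symbol_class_def smooth_def by blast

lemma a_cont: "set bs \<subseteq> Basis \<Longrightarrow> continuous_on UNIV (iter_partial bs a)"
  using a_diff differentiable_imp_continuous_within by (blast intro: continuous_at_imp_continuous_on)

lemma a_bound: "\<exists>C\<ge>0. \<forall>x \<xi>. norm (iter_partial (map dir_x \<nu> @ map dir_xi \<sigma>) a (x, \<xi>))
          \<le> C * (1 + norm \<xi>) powr (m - \<rho> * real (length \<sigma>) + \<delta> * real (length \<nu>))"
proof -
  obtain C where C: "\<forall>x \<xi>. norm (iter_partial (map dir_x \<nu> @ map dir_xi \<sigma>) a (x, \<xi>))
          \<le> C * (1 + norm \<xi>) powr (m - \<rho> * real (length \<sigma>) + \<delta> * real (length \<nu>))"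
    using symbol unfolding symbol_class_def by blast
  have "norm (iter_partial (map dir_x \<nu> @ map dir_xi \<sigma>) a (0, 0)) \<le> C"
    using C[rule_format, of 0 0] by simp
  then have "C \<ge> 0" using norm_ge_zero order_trans by blast
  then show ?thesis using C by blast
qed

definition dA :: "'n \<Rightarrow> nat \<Rightarrow> real^'n \<Rightarrow> real^'n \<Rightarrow> complex" where
  "dA i l x \<xi> = iter_partial (replicate l (dir_xi i)) a (x, \<xi>)"

lemma dir_xi_sub: "set (replicate l (dir_xi i)) \<subseteq> Basis"
  using dir_basis by (auto simp: set_replicate_conv_if)

lemma dA_cont2: "continuous_on UNIV (dA i l x)"
  unfolding dA_def
  by (rule continuous_on_compose2[OF a_cont[OF dir_xi_sub] continuous_on_Pair[OF continuous_on_const continuous_on_id]]) auto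

lemma dA_deriv: "((\<lambda>t. dA i l x (\<xi> + t *\<^sub>R axis i 1)) has_vector_derivative dA i (Suc l) x \<xi>) (at 0)"
proof -
  from iter_partial_line_derivative[OF a_diff[OF dir_xi_sub, of l i "(x, \<xi>)"], of "dir_xi i"]
  show ?thesis unfolding dA_def by (simp add: dir_xi_def)
qed

lemma dA_bound: "\<exists>C\<ge>0. \<forall>i j x. \<forall>\<xi>\<in>annulus j. norm (dA i l x \<xi>) \<le> C * 2 powr (j * (m - \<rho> * l))"
proof -
  have "\<exists>C\<ge>0. \<forall>x \<xi>. norm (dA i l x \<xi>) \<le> C * (1 + norm \<xi>) powr (m - \<rho> * l)" for i
    using a_bound[of "[]" "replicate l i"] by (simp add: dA_def map_replicate_const)
  then obtain C where C: "\<And>i. C i \<ge> 0" "\<And>i x \<xi>. norm (dA i l x \<xi>) \<le> C i * (1 + norm \<xi>) powr (m - \<rho> * l)" by metis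
  obtain D where D: "D \<ge> 0" "\<And>j (\<xi>::real^'n). \<xi> \<in> annulus j \<Longrightarrow> (1 + norm \<xi>) powr (m - \<rho> * l) \<le> D * 2 powr (j * (m - \<rho> * l))"
    using annulus_weight[of "m - \<rho> * l"] by metis
  have "norm (dA i l x \<xi>) \<le> ((\<Sum>i\<in>UNIV. C i) * D) * 2 powr (j * (m - \<rho> * l))" if "\<xi> \<in> annulus j" for i j x \<xi>
  proof -
    have "norm (dA i l x \<xi>) \<le> C i * (1 + norm \<xi>) powr (m - \<rho> * l)" by (rule C(2))
    also have "\<dots> \<le> (\<Sum>i\<in>UNIV. C i) * (D * 2 powr (j * (m - \<rho> * l)))"
      using C(1) D that by (intro mult_mono member_le_sum sum_nonneg) auto
    finally show ?thesis by simp
  qed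
  moreover have "(\<Sum>i\<in>UNIV. C i) * D \<ge> 0" using C(1) D(1) by (intro mult_nonneg_nonneg sum_nonneg) auto
  ultimately show ?thesis by blast
qed

text \<open>\<open>leibniz N k l i j x\<close> is the \<open>N\<close>-th derivative of \<open>dpsi i k j \<cdot> dA i l x\<close> in direction \<open>i\<close>, expanded by the product rule.\<close>

primrec leibniz :: "nat \<Rightarrow> nat \<Rightarrow> nat \<Rightarrow> 'n \<Rightarrow> nat \<Rightarrow> real^'n \<Rightarrow> real^'n \<Rightarrow> complex" where
  "leibniz 0 k l i j x \<xi> = complex_of_real (dpsi i k j \<xi>) * dA i l x \<xi>"
| "leibniz (Suc N) k l i j x \<xi> = leibniz N (Suc k) l i j x \<xi> + leibniz N k (Suc l) i j x \<xi>"

lemma leibniz_cont: "continuous_on UNIV (leibniz N k l i j x)"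
proof (induction N arbitrary: k l)
  case 0
  show ?case by (auto intro!: continuous_intros dpsi_cont dA_cont2 simp: leibniz.simps(1)[abs_def])
next
  case (Suc N)
  show ?case unfolding leibniz.simps(2)[abs_def] by (intro continuous_intros Suc)
qed

lemma leibniz_deriv: "((\<lambda>t. leibniz N k l i j x (\<xi> + t *\<^sub>R axis i 1)) has_vector_derivative leibniz (Suc N) k l i j x \<xi>) (at 0)"
proof (induction N arbitrary: k l)
  case 0
  have "((\<lambda>t. complex_of_real (dpsi i k j (\<xi> + t *\<^sub>R axis i 1))) has_vector_derivative complex_of_real (dpsi i (Suc k) j \<xi>)) (at 0)"
    by (intro has_vector_derivative_of_real) (use dpsi_deriv in \<open>simp add: has_real_derivative_iff_has_vector_derivative\<close>)
  from has_vector_derivative_mult[OF this dA_deriv[of i l x \<xi>]]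
  show ?case by (simp add: add.commute)
next
  case (Suc N)
  show ?case using has_vector_derivative_add[OF Suc[of "Suc k" l] Suc[of k "Suc l"]] by simp
qed

lemma leibniz_support: "leibniz N k l i j x \<xi> \<noteq> 0 \<Longrightarrow> \<xi> \<in> annulus j"
  by (induction N arbitrary: k l) (auto intro: dpsi_support, metis add_0)

text \<open>A derivative falling on the cutoff gains \<open>2 powr (- j)\<close>, one falling on the
  symbol gains only \<open>2 powr (- j * \<rho>)\<close>. As \<open>\<rho> < 1\<close>, the weaker
  gain bounds both, and every term of the product rule has the same size.\<close>

lemma leibniz_bound: "\<exists>C\<ge>0. \<forall>i j x \<xi>. norm (leibniz N k l i j x \<xi>) \<le> C * 2 powr (j * (m - \<rho> * real (N + k + l)))"
proof (induction N arbitrary: k l)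
  case 0
  obtain M where M: "M \<ge> 0" "\<And>i j (\<xi>::real^'n). \<bar>dpsi i k j \<xi>\<bar> \<le> M / 2 ^ (j * k)" using dpsi_bound by metis
  obtain C where C: "C \<ge> 0" "\<And>i j x \<xi>. \<xi> \<in> annulus j \<Longrightarrow> norm (dA i l x \<xi>) \<le> C * 2 powr (j * (m - \<rho> * l))" using dA_bound by metis
  have "norm (leibniz 0 k l i j x \<xi>) \<le> (M * C) * 2 powr (j * (m - \<rho> * real (0 + k + l)))" for i j x \<xi>
  proof (cases "dpsi i k j \<xi> = 0")
    case True
    then show ?thesis using M C by simp
  next
    case False
    then have \<xi>: "\<xi> \<in> annulus j" by (rule dpsi_support)
    have "1 / 2 ^ (j * k) = 2 powr (- (real j * k))"
      by (simp add: powr_minus powr_realpow[symmetric] field_simps)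
    also have "\<dots> \<le> 2 powr (j * (- \<rho> * k))"
    proof (rule powr_mono)
      have "\<rho> * (real j * k) \<le> 1 * (real j * k)" using \<rho>_lt by (intro mult_right_mono) auto
      then show "- (real j * k) \<le> j * (- \<rho> * k)" by (simp add: mult_ac)
    qed simp
    finally have e: "1 / 2 ^ (j * k) \<le> 2 powr (j * (- \<rho> * k))" .
    have "norm (leibniz 0 k l i j x \<xi>) \<le> (M / 2 ^ (j * k)) * (C * 2 powr (j * (m - \<rho> * l)))"
      unfolding leibniz.simps norm_mult norm_of_real by (intro mult_mono M C \<xi>) (use M in auto)
    also have "\<dots> = (M * C) * ((1 / 2 ^ (j * k)) * 2 powr (j * (m - \<rho> * l)))" by simp
    also have "\<dots> \<le> (M * C) * (2 powr (j * (- \<rho> * k)) * 2 powr (j * (m - \<rho> * l)))"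
      using M C e by (intro mult_left_mono mult_right_mono) auto
    also have "2 powr (j * (- \<rho> * k)) * 2 powr (j * (m - \<rho> * l)) = 2 powr (j * (m - \<rho> * real (0 + k + l)))"
      by (simp add: powr_add[symmetric] algebra_simps)
    finally show ?thesis .
  qed
  then show ?case using M C by (intro exI[of _ "M * C"]) auto
next
  case (Suc N)
  obtain C where C: "C \<ge> 0" "\<And>i j x \<xi>. norm (leibniz N (Suc k) l i j x \<xi>) \<le> C * 2 powr (j * (m - \<rho> * real (N + Suc k + l)))"
    using Suc[of "Suc k" l] by metis
  obtain D where D: "D \<ge> 0" "\<And>i j x \<xi>. norm (leibniz N k (Suc l) i j x \<xi>) \<le> D * 2 powr (j * (m - \<rho> * real (N + k + Suc l)))"
    using Suc[of k "Suc l"] by metis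
  have "norm (leibniz (Suc N) k l i j x \<xi>) \<le> (C + D) * 2 powr (j * (m - \<rho> * real (Suc N + k + l)))" for i j x \<xi>
    using norm_triangle_mono[OF C(2)[of i j x \<xi>] D(2)[of i j x \<xi>]] by (simp add: algebra_simps)
  then show ?case using C D by (intro exI[of _ "C + D"]) auto
qed

lemma leibniz_integrable:
  "integrable lborel (\<lambda>\<xi>. cis (z \<bullet> \<xi>) * leibniz N k l i j x \<xi>)"
proof -
  obtain C where C: "\<And>\<xi>. norm (leibniz N k l i j x \<xi>) \<le> C * 2 powr (j * (m - \<rho> * real (N + k + l)))" using leibniz_bound by metis
  have [measurable]: "leibniz N k l i j x \<in> borel_measurable borel"
    by (intro borel_measurable_continuous_onI leibniz_cont)
  show ?thesis
  proof (rule integrable_bounded_support[of _ "C * 2 powr (j * (m - \<rho> * real (N + k + l)))" "real CARD('n) * 2 ^ (j + 1)"])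
    show "norm \<xi> \<le> real CARD('n) * 2 ^ (j + 1)" if "cis (z \<bullet> \<xi>) * leibniz N k l i j x \<xi> \<noteq> 0" for \<xi>
      by (rule annulus_norm_le[OF leibniz_support]) (use that in auto)
  qed (use C in \<open>auto simp: norm_mult\<close>)
qed

definition kern :: "nat \<Rightarrow> real^'n \<Rightarrow> real^'n \<Rightarrow> complex" where
  "kern j x y = (LBINT \<xi>. cis ((x - y) \<bullet> \<xi>) * (complex_of_real (psi j \<xi>) * a (x, \<xi>)))"

lemma leibniz_000: "leibniz 0 0 0 i j x \<xi> = complex_of_real (psi j \<xi>) * a (x, \<xi>)"
  by (simp add: dpsi_0 dA_def)

lemma kern_by_parts:
  "(LBINT \<xi>. cis (z \<bullet> \<xi>) * leibniz (Suc N) k l i j x \<xi>)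
     = - \<i> * complex_of_real (z $ i) * (LBINT \<xi>. cis (z \<bullet> \<xi>) * leibniz N k l i j x \<xi>)"
proof -
  let ?F = "\<lambda>\<xi>. cis (z \<bullet> \<xi>) * leibniz N k l i j x \<xi>"
  let ?F' = "\<lambda>\<xi>. cis (z \<bullet> \<xi>) * leibniz (Suc N) k l i j x \<xi> + \<i> * complex_of_real (z $ i) * (cis (z \<bullet> \<xi>) * leibniz N k l i j x \<xi>)"
  have I2: "integrable lborel (\<lambda>\<xi>. \<i> * complex_of_real (z $ i) * (cis (z \<bullet> \<xi>) * leibniz N k l i j x \<xi>))"
    by (intro integrable_mult_right leibniz_integrable)
  have "(LBINT \<xi>. ?F' \<xi>) = 0"
  proof (rule integral_partial_zero)
    show "integrable lborel ?F" by (rule leibniz_integrable)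
    show "integrable lborel ?F'" by (intro integrable_add leibniz_integrable I2)
    show "continuous_on UNIV ?F'" by (intro continuous_intros leibniz_cont)
    fix \<xi>
    show "((\<lambda>t. cis (z \<bullet> (\<xi> + t *\<^sub>R axis i 1)) * leibniz N k l i j x (\<xi> + t *\<^sub>R axis i 1)) has_vector_derivative ?F' \<xi>) (at 0)"
      using has_vector_derivative_mult[OF cis_line_derivative[of z \<xi> i] leibniz_deriv[of N k l i j x \<xi>]] by (simp add: mult_ac)
  qed
  then show ?thesis
    by (simp only: integral_add[OF leibniz_integrable I2] integral_mult_right_zero) (simp add: eq_neg_iff_add_eq_0)
qed

text \<open>N integrations by parts in direction \<open>i\<close> produce the N-th power of
  \<open>x $ i - y $ i\<close>. The integrand is bounded by \<open>leibniz_bound\<close> and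
  supported in a box of volume \<open>8 ^ n * 2 powr (j * n)\<close>.\<close>

lemma kern_decay: "\<exists>C\<ge>0. \<forall>i j x y. \<bar>x $ i - y $ i\<bar> ^ N * norm (kern j x y) \<le> C * 2 powr (j * (m + CARD('n) - \<rho> * N))"
proof -
  obtain C where C: "C \<ge> 0" "\<And>i j x \<xi>. norm (leibniz N 0 0 i j x \<xi>) \<le> C * 2 powr (j * (m - \<rho> * N))"
    using leibniz_bound[of N 0 0] by auto
  have "\<bar>x $ i - y $ i\<bar> ^ N * norm (kern j x y) \<le> (C * 8 ^ CARD('n)) * 2 powr (j * (m + CARD('n) - \<rho> * N))" for i j x y
  proof -
    let ?z = "x - y"
    have "(- \<i> * complex_of_real (?z $ i)) ^ N * kern j x y = (LBINT \<xi>. cis (?z \<bullet> \<xi>) * leibniz N 0 0 i j x \<xi>)"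
      unfolding kern_def leibniz_000[symmetric, of _ _ _ i]
      by (induction N) (simp_all add: kern_by_parts[of ?z] mult.assoc del: leibniz.simps)
    then have "\<bar>?z $ i\<bar> ^ N * norm (kern j x y) = norm (LBINT \<xi>. cis (?z \<bullet> \<xi>) * leibniz N 0 0 i j x \<xi>)"
      by (metis norm_mult norm_power norm_minus_cancel norm_ii mult_1_left mult_minus_left norm_of_real)
    also have "\<dots> \<le> (LBINT \<xi>. norm (cis (?z \<bullet> \<xi>) * leibniz N 0 0 i j x \<xi>))" by (rule integral_norm_bound)
    also have "\<dots> \<le> (LBINT \<xi>. indicator (half_open_cube (\<chi> i. - (2 ^ (j + 2))) (2 ^ (j + 3)) :: (real^'n) set) \<xi> * (C * 2 powr (j * (m - \<rho> * N))))"
    proof (rule integral_mono)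
      show "integrable lborel (\<lambda>\<xi>. norm (cis (?z \<bullet> \<xi>) * leibniz N 0 0 i j x \<xi>))"
        by (intro integrable_norm leibniz_integrable)
      show "integrable lborel (\<lambda>\<xi>::real^'n. indicator (half_open_cube (\<chi> i. - (2 ^ (j + 2))) (2 ^ (j + 3))) \<xi> * (C * 2 powr (j * (m - \<rho> * N))))"
        by (intro integrable_mult_left integrable_real_indicator) (auto simp: half_open_cube_borel measure_half_open_cube)
      show "norm (cis (?z \<bullet> \<xi>) * leibniz N 0 0 i j x \<xi>) \<le> indicator (half_open_cube (\<chi> i. - (2 ^ (j + 2))) (2 ^ (j + 3))) \<xi> * (C * 2 powr (j * (m - \<rho> * N)))" for \<xi>
      proof (cases "leibniz N 0 0 i j x \<xi> = 0")
        case False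
        then have "\<xi> \<in> half_open_cube (\<chi> i. - (2 ^ (j + 2))) (2 ^ (j + 3))"
          using leibniz_support annulus_sub_cube by blast
        then show ?thesis using C by (simp add: norm_mult)
      qed (use C in simp)
    qed
    also have "\<dots> = (2 ^ (j + 3)) ^ CARD('n) * (C * 2 powr (j * (m - \<rho> * N)))"
      by (simp add: measure_half_open_cube)
    also have "(2 ^ (j + 3) :: real) ^ CARD('n) = 8 ^ CARD('n) * 2 powr (j * CARD('n))"
      by (simp add: power_add power_mult_distrib powr_realpow[symmetric] powr_powr flip: power_mult)
    also have "8 ^ CARD('n) * 2 powr (j * CARD('n)) * (C * 2 powr (j * (m - \<rho> * N))) = (C * 8 ^ CARD('n)) * (2 powr (j * CARD('n)) * 2 powr (j * (m - \<rho> * N)))" by simp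
    also have "2 powr (j * CARD('n)) * 2 powr (j * (m - \<rho> * N)) = 2 powr (j * (m + CARD('n) - \<rho> * N))"
      by (simp add: powr_add[symmetric] algebra_simps)
    finally show ?thesis by simp
  qed
  then show ?thesis using C by (intro exI[of _ "C * 8 ^ CARD('n)"]) auto
qed

end

section \<open>Estimates on a cube\<close>

definition l2 :: "('a::euclidean_space \<Rightarrow> complex) \<Rightarrow> real" where
  "l2 f = sqrt (LBINT x. (norm (f x))\<^sup>2)"

definition l1 :: "('a::euclidean_space \<Rightarrow> complex) \<Rightarrow> real" where
  "l1 f = (LBINT x. norm (f x))"

lemma l2_nonneg: "l2 f \<ge> 0" by (simp add: l2_def)
lemma l1_nonneg: "l1 f \<ge> 0" by (simp add: l1_def)
lemma l2_sq: "(l2 f)\<^sup>2 = (LBINT x. (norm (f x))\<^sup>2)" by (simp add: l2_def)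

lemma cauchy_schwarz_integral:
  assumes "integrable lborel (\<lambda>x. (norm (f x))\<^sup>2)" "integrable lborel (\<lambda>x. (norm (g x))\<^sup>2)"
    "f \<in> borel_measurable borel" "g \<in> borel_measurable borel"
  shows "integrable lborel (\<lambda>x. norm (f x) * norm (g x))" "(LBINT x. norm (f x) * norm (g x)) \<le> l2 f * l2 g"
proof -
  note [measurable] = assms(3,4)
  have le: "(\<integral>\<^sup>+x. ennreal (norm (f x)) * ennreal (norm (g x)) \<partial>lborel)\<^sup>2 \<le> ennreal ((l2 f * l2 g)\<^sup>2)"
  proof -
    have "(\<integral>\<^sup>+x. ennreal (norm (f x)) * ennreal (norm (g x)) \<partial>lborel)\<^sup>2
      \<le> (\<integral>\<^sup>+x. (ennreal (norm (f x)))\<^sup>2 \<partial>lborel) * (\<integral>\<^sup>+x. (ennreal (norm (g x)))\<^sup>2 \<partial>lborel)"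
      by (rule Cauchy_Schwarz_nn_integral) measurable
    also have "(\<integral>\<^sup>+x. (ennreal (norm (f x)))\<^sup>2 \<partial>lborel) = ennreal ((l2 f)\<^sup>2)"
      unfolding l2_sq using assms(1) by (simp add: ennreal_power nn_integral_eq_integral)
    also have "(\<integral>\<^sup>+x. (ennreal (norm (g x)))\<^sup>2 \<partial>lborel) = ennreal ((l2 g)\<^sup>2)"
      unfolding l2_sq using assms(2) by (simp add: ennreal_power nn_integral_eq_integral)
    finally show ?thesis by (simp add: ennreal_mult[symmetric] power_mult_distrib)
  qed
  have le2: "(\<integral>\<^sup>+x. ennreal (norm (f x) * norm (g x)) \<partial>lborel) \<le> ennreal (l2 f * l2 g)"
  proof -
    let ?I = "\<integral>\<^sup>+x. ennreal (norm (f x)) * ennreal (norm (g x)) \<partial>lborel"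
    have "?I \<noteq> \<infinity>" using le by (auto simp: power2_eq_square ennreal_top_mult top_unique)
    then obtain r where r: "r \<ge> 0" "?I = ennreal r" by (metis ennreal_cases infinity_ennreal_def)
    have "r\<^sup>2 \<le> (l2 f * l2 g)\<^sup>2" using le r by (simp add: ennreal_power)
    then have "r \<le> l2 f * l2 g" by (rule power2_le_imp_le) (simp add: l2_nonneg)
    then show ?thesis using r by (simp add: ennreal_mult)
  qed
  show I: "integrable lborel (\<lambda>x. norm (f x) * norm (g x))"
    by (rule integrableI_bounded) (use le2 in \<open>auto simp: order_le_less_trans\<close>)
  have "ennreal (LBINT x. norm (f x) * norm (g x)) = (\<integral>\<^sup>+x. ennreal (norm (f x) * norm (g x)) \<partial>lborel)"
    by (rule nn_integral_eq_integral[symmetric, OF I]) simp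
  then have "ennreal (LBINT x. norm (f x) * norm (g x)) \<le> ennreal (l2 f * l2 g)" using le2 by simp
  then show "(LBINT x. norm (f x) * norm (g x)) \<le> l2 f * l2 g"
    by (subst (asm) ennreal_le_iff) (simp_all add: l2_nonneg)
qed

lemma fourier_integral_l2:
  fixes w :: "real^'n::finite \<Rightarrow> complex"
  assumes w: "bcs w" and W_def: "W = (\<lambda>\<xi>. LBINT x. cis (x \<bullet> \<xi>) * w x)"
  shows "W \<in> borel_measurable borel" "integrable lborel (\<lambda>\<xi>. (norm (W \<xi>))\<^sup>2)" "l2 W \<le> sqrt ((2 * pi) ^ CARD('n)) * l2 w"
proof -
  have [measurable]: "w \<in> borel_measurable borel" using w by (rule bcs_measurable)
  show W[measurable]: "W \<in> borel_measurable borel"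
    unfolding W_def by (rule lborel.borel_measurable_lebesgue_integral) measurable
  have P: "(\<integral>\<^sup>+\<xi>. ennreal ((norm (W \<xi>))\<^sup>2) \<partial>lborel) \<le> ennreal ((2 * pi) ^ CARD('n) * (LBINT x. (norm (w x))\<^sup>2))"
    unfolding W_def by (rule plancherel_bound[OF w])
  show I: "integrable lborel (\<lambda>\<xi>. (norm (W \<xi>))\<^sup>2)"
    by (rule integrableI_bounded) (use P in \<open>auto simp: order_le_less_trans\<close>)
  have "ennreal (LBINT \<xi>. (norm (W \<xi>))\<^sup>2) \<le> ennreal ((2 * pi) ^ CARD('n) * (LBINT x. (norm (w x))\<^sup>2))"
    using P nn_integral_eq_integral[OF I] by simp
  then have "(LBINT \<xi>. (norm (W \<xi>))\<^sup>2) \<le> (2 * pi) ^ CARD('n) * (LBINT x. (norm (w x))\<^sup>2)"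
    by (subst (asm) ennreal_le_iff) simp_all
  then show "l2 W \<le> sqrt ((2 * pi) ^ CARD('n)) * l2 w"
    unfolding l2_def real_sqrt_mult[symmetric] by simp
qed

text \<open>For distinct \<open>is\<close>: every mixed derivative of \<open>b\<close> in the first variable, of order at most one in each
  direction from \<open>is\<close> and of total order \<open>k\<close>, is bounded by \<open>B / l ^ k\<close> on \<open>Q \<times> E\<close>.\<close>

primrec regular :: "(real^'n::finite) set \<Rightarrow> (real^'n) set \<Rightarrow> real \<Rightarrow> 'n list \<Rightarrow> (real^'n \<Rightarrow> real^'n \<Rightarrow> complex) \<Rightarrow> real \<Rightarrow> bool" where
  "regular Q E l [] b B \<longleftrightarrow> continuous_on UNIV (\<lambda>p. b (fst p) (snd p)) \<and> (\<forall>x\<in>Q. \<forall>\<xi>\<in>E. norm (b x \<xi>) \<le> B)"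
| "regular Q E l (i # is) b B \<longleftrightarrow> regular Q E l is b B \<and>
     (\<exists>b'. (\<forall>x \<xi>. ((\<lambda>t. b (x + t *\<^sub>R axis i 1) \<xi>) has_vector_derivative b' x \<xi>) (at 0)) \<and> regular Q E l is b' (B / l))"

lemma regular_base: "regular Q E l is b B \<Longrightarrow> regular Q E l [] b B"
  by (induction "is" arbitrary: b B) auto

definition freeze :: "'n::finite \<Rightarrow> real \<Rightarrow> real^'n \<Rightarrow> real^'n" where
  "freeze i s x = (\<chi> k. if k = i then s else x $ k)"

lemma freeze_add_axis: "k \<noteq> i \<Longrightarrow> freeze i s (x + t *\<^sub>R axis k 1) = freeze i s x + t *\<^sub>R axis k 1"
  by (auto simp: freeze_def vec_eq_iff axis_def)

lemma freeze_self_add: "freeze i (s + t) x = freeze i s x + t *\<^sub>R axis i 1"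
  by (auto simp: freeze_def vec_eq_iff axis_def)

lemma freeze_id: "freeze i (x $ i) x = x"
  by (auto simp: freeze_def vec_eq_iff)

lemma freeze_alt: "freeze i s x = x + (s - x $ i) *\<^sub>R axis i 1"
  by (auto simp: freeze_def vec_eq_iff axis_def)

abbreviation ccube :: "real^'n::finite \<Rightarrow> real \<Rightarrow> (real^'n) set" where
  "ccube c l \<equiv> {x. \<forall>i. c $ i \<le> x $ i \<and> x $ i \<le> c $ i + l}"

lemma freeze_cube: "x \<in> ccube c l \<Longrightarrow> c $ i \<le> s \<Longrightarrow> s \<le> c $ i + l \<Longrightarrow> freeze i s x \<in> ccube c l"
  by (auto simp: freeze_def)

lemma regular_freeze:
  assumes "regular (ccube c l) E l is b B" "i \<notin> set is" "c $ i \<le> s" "s \<le> c $ i + l"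
  shows "regular (ccube c l) E l is (\<lambda>x. b (freeze i s x)) B"
  using assms(1,2)
proof (induction "is" arbitrary: b B)
  case Nil
  have fc: "continuous_on UNIV (freeze i s)" unfolding freeze_alt[abs_def] by (intro continuous_intros)
  have "continuous_on UNIV (\<lambda>p. b (fst (freeze i s (fst p), snd p)) (snd (freeze i s (fst p), snd p)))"
    using Nil(1) by (intro continuous_on_compose2[of UNIV "\<lambda>p. b (fst p) (snd p)" UNIV "\<lambda>p. (freeze i s (fst p), snd p)"])
      (auto intro!: continuous_intros continuous_on_compose2[OF fc])
  then show ?case using Nil freeze_cube[OF _ assms(3,4)] by simp
next
  case (Cons k "is")
  then obtain b' where b': "\<And>x \<xi>. ((\<lambda>t. b (x + t *\<^sub>R axis k 1) \<xi>) has_vector_derivative b' x \<xi>) (at 0)"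
    "regular (ccube c l) E l is b' (B / l)" by auto
  have ki: "k \<noteq> i" using Cons.prems(2) by auto
  have "((\<lambda>t. b (freeze i s (x + t *\<^sub>R axis k 1)) \<xi>) has_vector_derivative b' (freeze i s x) \<xi>) (at 0)" for x \<xi>
    using b'(1)[of "freeze i s x" \<xi>] by (simp add: freeze_add_axis[OF ki])
  then show ?case using Cons b'(2) by (auto intro!: exI[of _ "\<lambda>x. b' (freeze i s x)"])
qed

definition depends_only_on :: "'n::finite list \<Rightarrow> (real^'n \<Rightarrow> real^'n \<Rightarrow> complex) \<Rightarrow> bool" where
  "depends_only_on is b \<longleftrightarrow> (\<forall>x x' \<xi>. (\<forall>i\<in>set is. x $ i = x' $ i) \<longrightarrow> b x \<xi> = b x' \<xi>)"

lemma depends_only_on_freeze: "depends_only_on (i # is) b \<Longrightarrow> depends_only_on is (\<lambda>x. b (freeze i s x))"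
  unfolding depends_only_on_def freeze_def by simp

lemma depends_only_on_deriv:
  assumes "depends_only_on is b" "\<And>x \<xi>. ((\<lambda>t. b (x + t *\<^sub>R axis k 1) \<xi>) has_vector_derivative b' x \<xi>) (at 0)"
  shows "depends_only_on is b'"
  unfolding depends_only_on_def
proof (intro allI impI)
  fix x x' :: "real^'a" and \<xi> assume e: "\<forall>i\<in>set is. x $ i = x' $ i"
  have "(\<lambda>t. b (x + t *\<^sub>R axis k 1) \<xi>) = (\<lambda>t. b (x' + t *\<^sub>R axis k 1) \<xi>)"
    using assms(1) e unfolding depends_only_on_def by (intro ext) simp
  then show "b' x \<xi> = b' x' \<xi>"
    using assms(2)[of x \<xi>] assms(2)[of x' \<xi>] by (metis vector_derivative_unique_at)
qed

lemma l2_mono: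
  fixes f g :: "real^'n::finite \<Rightarrow> complex"
  assumes "bcs f" "g \<in> borel_measurable borel" "\<And>x. norm (g x) \<le> norm (f x)"
  shows "l2 g \<le> l2 f"
  unfolding l2_def
proof (rule real_sqrt_le_mono, rule integral_mono)
  show "integrable lborel (\<lambda>x. (norm (f x))\<^sup>2)" by (rule bcs_norm_sq[OF assms(1)])
  show "(norm (g x))\<^sup>2 \<le> (norm (f x))\<^sup>2" for x using assms(3) by (intro power_mono) auto
  have [measurable]: "g \<in> borel_measurable borel" by (rule assms(2))
  show "integrable lborel (\<lambda>x. (norm (g x))\<^sup>2)"
    by (rule integrable_bound[OF bcs_norm_sq[OF assms(1)]])
       (use assms(3) in \<open>auto intro!: power_mono\<close>)
qed

text \<open>The fundamental theorem of calculus is applied in one coordinate of \<open>x\<close> at a time. Each step either freezes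
  the coordinate at the corner \<open>c\<close> or trades a derivative, costing \<open>1 / l\<close>, for an integral over an interval of
  length \<open>l\<close>; the symbol left at the end does not depend on \<open>x\<close>, and Plancherel applies.\<close>

lemma decouple:
  fixes h w :: "real^'n::finite \<Rightarrow> complex"
  assumes h: "bcs h" "\<And>\<xi>. h \<xi> \<noteq> 0 \<Longrightarrow> \<xi> \<in> E" and l: "l > 0" 
  shows "distinct is \<Longrightarrow> regular (ccube c l) E l is b B \<Longrightarrow> depends_only_on is b \<Longrightarrow> bcs w \<Longrightarrow> (\<And>x. w x \<noteq> 0 \<Longrightarrow> x \<in> ccube c l) \<Longrightarrow> B \<ge> 0
   \<Longrightarrow> norm (LBINT p. h (snd p) * (cis (fst p \<bullet> snd p) * b (fst p) (snd p) * w (fst p)))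
    \<le> 2 ^ length is * B * sqrt ((2 * pi) ^ CARD('n)) * l2 h * l2 w"
proof (induction "is" arbitrary: b B w)
  case Nil
  define \<beta> where "\<beta> = b c"
  have hm[measurable]: "h \<in> borel_measurable borel" and wm[measurable]: "w \<in> borel_measurable borel"
    using h(1) Nil(4) by (auto dest: bcs_measurable)
  have hi: "integrable lborel (\<lambda>x. norm (h x))" and wi: "integrable lborel (\<lambda>x. norm (w x))"
    using bcs_integrable h(1) Nil(4) by auto
  have \<beta>: "b x \<xi> = \<beta> \<xi>" for x \<xi> using Nil(3) by (simp add: depends_only_on_def \<beta>_def)
  have cQ: "c \<in> ccube c l" using l by simp
  have \<beta>b: "norm (\<beta> \<xi>) \<le> B" if "\<xi> \<in> E" for \<xi> using Nil(2) cQ that by (auto simp: \<beta>_def)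
  have \<beta>c: "continuous_on UNIV \<beta>"
  proof -
    have "continuous_on UNIV (\<lambda>\<xi>. b (fst (c, \<xi>)) (snd (c, \<xi>)))"
      using Nil(2) by (intro continuous_on_compose2[of UNIV "\<lambda>p. b (fst p) (snd p)" UNIV "\<lambda>\<xi>. (c, \<xi>)"])
       (auto intro!: continuous_intros)
    then show ?thesis by (simp add: \<beta>_def)
  qed
  have [measurable]: "\<beta> \<in> borel_measurable borel" by (rule borel_measurable_continuous_onI[OF \<beta>c])
  define W where "W = (\<lambda>\<xi>. LBINT x. cis (x \<bullet> \<xi>) * w x)"
  note Wp = fourier_integral_l2[OF Nil(4) W_def]
  have [measurable]: "W \<in> borel_measurable borel" by (rule Wp(1))
  have H: "integrable lborel (\<lambda>x. B * norm (h x))" using hi by (rule integrable_mult_right)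
  have dom: "norm (h \<xi> * (cis (x \<bullet> \<xi>) * \<beta> \<xi> * w x)) \<le> norm (w x) * (B * norm (h \<xi>))" for x \<xi>
  proof (cases "h \<xi> = 0")
    case False
    then have "norm (\<beta> \<xi>) \<le> B" using h(2) \<beta>b by blast
    then have "norm (h \<xi>) * (norm (\<beta> \<xi>) * norm (w x)) \<le> norm (h \<xi>) * (B * norm (w x))"
      by (intro mult_left_mono mult_right_mono) auto
    then show ?thesis by (simp add: norm_mult mult_ac)
  qed simp
  have mm: "(\<lambda>(x, \<xi>). h \<xi> * (cis (x \<bullet> \<xi>) * \<beta> \<xi> * w x)) \<in> borel_measurable borel"
    unfolding borel_prod[symmetric] by measurable
  have "(LBINT p. h (snd p) * (cis (fst p \<bullet> snd p) * b (fst p) (snd p) * w (fst p)))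
     = integral\<^sup>L lborel (\<lambda>(x, \<xi>). h \<xi> * (cis (x \<bullet> \<xi>) * \<beta> \<xi> * w x))"
    by (simp add: \<beta> split_beta')
  also have "\<dots> = (LBINT x. LBINT \<xi>. h \<xi> * (cis (x \<bullet> \<xi>) * \<beta> \<xi> * w x))"
    by (rule fubini_dominated(2)[OF mm wi H dom])
  also have "\<dots> = (LBINT \<xi>. LBINT x. h \<xi> * (cis (x \<bullet> \<xi>) * \<beta> \<xi> * w x))"
    by (rule fubini_dominated(3)[OF mm wi H dom])
  also have "\<dots> = (LBINT \<xi>. h \<xi> * \<beta> \<xi> * W \<xi>)"
  proof (intro integral_cong refl)
    fix \<xi>
    have "(LBINT x. h \<xi> * (cis (x \<bullet> \<xi>) * \<beta> \<xi> * w x)) = (LBINT x. (h \<xi> * \<beta> \<xi>) * (cis (x \<bullet> \<xi>) * w x))"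
      by (intro integral_cong refl) simp
    then show "(LBINT x. h \<xi> * (cis (x \<bullet> \<xi>) * \<beta> \<xi> * w x)) = h \<xi> * \<beta> \<xi> * W \<xi>" by (simp add: W_def)
  qed
  finally have eq: "(LBINT p. h (snd p) * (cis (fst p \<bullet> snd p) * b (fst p) (snd p) * w (fst p))) = (LBINT \<xi>. h \<xi> * \<beta> \<xi> * W \<xi>)" .
  note CS = cauchy_schwarz_integral[OF bcs_norm_sq[OF h(1)] Wp(2) hm Wp(1)]
  have "norm (LBINT \<xi>. h \<xi> * \<beta> \<xi> * W \<xi>) \<le> (LBINT \<xi>. norm (h \<xi> * \<beta> \<xi> * W \<xi>))" by (rule integral_norm_bound)
  also have "\<dots> \<le> (LBINT \<xi>. B * (norm (h \<xi>) * norm (W \<xi>)))"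
  proof (rule integral_mono')
    show "integrable lborel (\<lambda>\<xi>. B * (norm (h \<xi>) * norm (W \<xi>)))" by (intro integrable_mult_right CS(1))
    show "norm (h \<xi> * \<beta> \<xi> * W \<xi>) \<le> B * (norm (h \<xi>) * norm (W \<xi>))" for \<xi>
    proof (cases "h \<xi> = 0")
      case False
      then have "norm (\<beta> \<xi>) \<le> B" using h(2) \<beta>b by blast
      then have "norm (\<beta> \<xi>) * (norm (h \<xi>) * norm (W \<xi>)) \<le> B * (norm (h \<xi>) * norm (W \<xi>))" by (intro mult_right_mono) auto
      then show ?thesis by (simp add: norm_mult mult_ac)
    qed simp
    show "0 \<le> B * (norm (h x) * norm (W x))" for x using Nil by simp
  qed
  also have "\<dots> = B * (LBINT \<xi>. norm (h \<xi>) * norm (W \<xi>))" by simp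
  also have "\<dots> \<le> B * (l2 h * (sqrt ((2 * pi) ^ CARD('n)) * l2 w))"
    using order_trans[OF CS(2) mult_left_mono[OF Wp(3) l2_nonneg]] Nil(6) by (rule mult_left_mono)
  finally show ?case unfolding eq by (simp add: mult_ac)
next
  case (Cons i "is")
  let ?\<kappa> = "sqrt ((2 * pi) ^ CARD('n))"
  have hm[measurable]: "h \<in> borel_measurable borel" and wm[measurable]: "w \<in> borel_measurable borel"
    using h(1) Cons(5) by (auto dest: bcs_measurable)
  have hi: "integrable lborel (\<lambda>x. norm (h x))" and wi: "integrable lborel (\<lambda>x. norm (w x))"
    using bcs_integrable h(1) Cons(5) by auto
  have di: "distinct is" "i \<notin> set is" using Cons(2) by auto
  obtain b' where b': "\<And>x \<xi>. ((\<lambda>t. b (x + t *\<^sub>R axis i 1) \<xi>) has_vector_derivative b' x \<xi>) (at 0)"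
    "regular (ccube c l) E l is b' (B / l)" and breg: "regular (ccube c l) E l is b B" using Cons(3) by auto
  have dep': "depends_only_on (i # is) b'" using depends_only_on_deriv[OF Cons(4) b'(1)] .
  have b'c: "continuous_on UNIV (\<lambda>p. b' (fst p) (snd p))" and b'b: "\<And>x \<xi>. x \<in> ccube c l \<Longrightarrow> \<xi> \<in> E \<Longrightarrow> norm (b' x \<xi>) \<le> B / l"
    using regular_base[OF b'(2)] by auto
  have Bl: "B / l \<ge> 0" using Cons(7) l by simp
  \<comment> \<open>The fundamental theorem integrates from \<open>c $ i\<close> up to
    \<open>x $ i\<close>, a limit depending on \<open>x\<close>. Writing it over the fixed interval
    \<open>{0..l}\<close> moves this dependence into a cutoff of \<open>w\<close>, which only
    decreases its norm.\<close>
  define wt where "wt = (\<lambda>t x. indicator {x. c $ i + t < x $ i} x * w x)"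
  define T where "T = (\<lambda>v b. LBINT p. h (snd p) * (cis (fst p \<bullet> snd p) * b (fst p) (snd p) * v (fst p)))"
  have b0: "norm (T w (\<lambda>x. b (freeze i (c $ i) x))) \<le> 2 ^ length is * B * ?\<kappa> * l2 h * l2 w"
    unfolding T_def
    by (rule Cons.IH[OF di(1) regular_freeze[OF breg di(2)] depends_only_on_freeze[OF Cons(4)] Cons(5,6,7)]) (use l in auto)
  have wtb: "bcs (wt t)" for t
    unfolding wt_def by (rule bcs_indicator[OF Cons(5)]) (auto intro!: borel_open open_Collect_less continuous_intros)
  have wtn: "norm (wt t x) \<le> norm (w x)" for t x by (simp add: wt_def indicator_def)
  have bt: "norm (T (wt t) (\<lambda>x. b' (freeze i (c $ i + t) x))) \<le> 2 ^ length is * (B / l) * ?\<kappa> * l2 h * l2 w" if t: "t \<in> {0..l}" for t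
  proof -
    have "norm (T (wt t) (\<lambda>x. b' (freeze i (c $ i + t) x))) \<le> 2 ^ length is * (B / l) * ?\<kappa> * l2 h * l2 (wt t)"
      unfolding T_def
      by (rule Cons.IH[OF di(1) regular_freeze[OF b'(2) di(2)] depends_only_on_freeze[OF dep'] wtb _ Bl])
         (use t Cons(6) in \<open>auto simp: wt_def indicator_def split: if_splits\<close>)
    also have "\<dots> \<le> 2 ^ length is * (B / l) * ?\<kappa> * l2 h * l2 w"
    proof (rule mult_left_mono)
      show "l2 (wt t) \<le> l2 w" by (rule l2_mono[OF Cons(5) bcs_measurable[OF wtb] wtn])
      show "0 \<le> 2 ^ length is * (B / l) * ?\<kappa> * l2 h" by (intro mult_nonneg_nonneg Bl l2_nonneg) auto
    qed
    finally show ?thesis .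
  qed
  define F where "F = (\<lambda>p t. h (snd p) * (cis (fst p \<bullet> snd p) * (indicator {0..l} t * b' (freeze i (c $ i + t) (fst p)) (snd p)) * wt t (fst p)))"
  have ftc: "b x \<xi> = b (freeze i (c $ i) x) \<xi> + (LBINT t. indicator {0..l} t * b' (freeze i (c $ i + t) x) \<xi> * indicator {x. c $ i + t < x $ i} x)"
    if x: "x \<in> ccube c l" for x \<xi>
  proof -
    let ?u = "x $ i - c $ i"
    have u: "0 \<le> ?u" "?u \<le> l" using x by (auto simp: algebra_simps)
    have d: "((\<lambda>t. b (freeze i (c $ i + t) x) \<xi>) has_vector_derivative b' (freeze i (c $ i + s) x) \<xi>) (at s)" for s
    proof -
      have 1: "((\<lambda>t. t - s) has_vector_derivative 1) (at s)" by (auto intro!: derivative_eq_intros)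
      have 2: "((\<lambda>t. b (freeze i (c $ i + s) x + t *\<^sub>R axis i 1) \<xi>) has_vector_derivative b' (freeze i (c $ i + s) x) \<xi>) (at (s - s))"
        using b'(1)[of "freeze i (c $ i + s) x" \<xi>] by simp
      show ?thesis using vector_diff_chain_at[OF 1 2] by (simp add: o_def freeze_self_add[symmetric])
    qed
    have bc: "continuous_on UNIV (\<lambda>t. b' (freeze i (c $ i + t) x) \<xi>)"
    proof -
      have "continuous_on UNIV (\<lambda>t. b' (fst (freeze i (c $ i + t) x, \<xi>)) (snd (freeze i (c $ i + t) x, \<xi>)))"
        by (rule continuous_on_compose2[OF b'c]) (auto intro!: continuous_intros simp: freeze_alt)
      then show ?thesis by simp
    qed
    have "(LBINT t. indicator {0..l} t * b' (freeze i (c $ i + t) x) \<xi> * indicator {x. c $ i + t < x $ i} x)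
       = (LBINT t. indicator {0..?u} t *\<^sub>R b' (freeze i (c $ i + t) x) \<xi>)"
    proof (rule integral_cong_AE)
      \<comment> \<open>The cutoff is strict while the interval is closed, so the integrands differ
        at the endpoint only.\<close>
      have "AE t in lborel. t \<noteq> ?u" by (rule AE_lborel_singleton)
      then show "AE t in lborel. indicator {0..l} t * b' (freeze i (c $ i + t) x) \<xi> * indicator {x. c $ i + t < x $ i} x
        = indicator {0..?u} t *\<^sub>R b' (freeze i (c $ i + t) x) \<xi>"
        by eventually_elim (use u in \<open>auto simp: indicator_def\<close>)
      have [measurable]: "(\<lambda>t. b' (freeze i (c $ i + t) x) \<xi>) \<in> borel_measurable borel" by (rule borel_measurable_continuous_onI[OF bc])
      have e: "indicator {x. c $ i + t < x $ i} x = (indicator {..<?u} t :: complex)" for t by (auto simp: indicator_def)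
      show "(\<lambda>t. indicator {0..l} t * b' (freeze i (c $ i + t) x) \<xi> * indicator {x. c $ i + t < x $ i} x) \<in> borel_measurable lborel"
        unfolding e by measurable
      show "(\<lambda>t. indicator {0..?u} t *\<^sub>R b' (freeze i (c $ i + t) x) \<xi>) \<in> borel_measurable lborel"
        by measurable
    qed
    also have "\<dots> = b (freeze i (c $ i + ?u) x) \<xi> - b (freeze i (c $ i + 0) x) \<xi>"
      by (rule integral_FTC_atLeastAtMost[OF u(1) has_vector_derivative_at_within[OF d]]) (auto intro: continuous_on_subset[OF bc])
    finally show ?thesis by (simp add: freeze_id)
  qed
  have Fm: "(\<lambda>(p, t). F p t) \<in> borel_measurable borel"
  proof -
    have cc: "continuous_on UNIV (\<lambda>q::((real^'n) \<times> (real^'n)) \<times> real. b' (fst (freeze i (c $ i + snd q) (fst (fst q)), snd (fst q))) (snd (freeze i (c $ i + snd q) (fst (fst q)), snd (fst q))))"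
      by (rule continuous_on_compose2[OF b'c]) (auto intro!: continuous_intros simp: freeze_alt)
    then have [measurable]: "(\<lambda>q::((real^'n) \<times> (real^'n)) \<times> real. b' (freeze i (c $ i + snd q) (fst (fst q))) (snd (fst q))) \<in> borel_measurable ((borel \<Otimes>\<^sub>M borel) \<Otimes>\<^sub>M borel)"
      unfolding borel_prod by (intro borel_measurable_continuous_onI) simp
    have [measurable]: "Measurable.pred ((borel \<Otimes>\<^sub>M borel) \<Otimes>\<^sub>M borel) (\<lambda>q::((real^'n) \<times> (real^'n)) \<times> real. c $ i + snd q < fst (fst q) $ i)"
    proof -
      have "{q::((real^'n) \<times> (real^'n)) \<times> real. c $ i + snd q < fst (fst q) $ i} \<in> sets borel"
        by (intro borel_open open_Collect_less continuous_intros)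
      then show ?thesis unfolding pred_def borel_prod by simp
    qed
    have "(\<lambda>q::((real^'n) \<times> (real^'n)) \<times> real. F (fst q) (snd q)) \<in> borel_measurable ((borel \<Otimes>\<^sub>M borel) \<Otimes>\<^sub>M borel)"
      unfolding F_def wt_def indicator_def by measurable
    then show ?thesis by (simp add: borel_prod split_beta')
  qed
  have Gm: "integrable lborel (\<lambda>p. norm (w (fst p) * h (snd p)))"
  proof -
    have "integrable lborel (\<lambda>(x, \<xi>). w x * h \<xi>)"
      by (rule fubini_dominated(1)[OF _ wi hi]) (unfold borel_prod[symmetric], measurable, simp add: norm_mult)
    then show ?thesis by (simp add: split_beta')
  qed
  have Hm: "integrable lborel (\<lambda>t. indicator {0..l} t * (B / l))" using l by simp
  have dom: "norm (F p t) \<le> norm (w (fst p) * h (snd p)) * (indicator {0..l} t * (B / l))" for p t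
  proof (cases "h (snd p) = 0 \<or> w (fst p) = 0 \<or> t \<notin> {0..l}")
    case False
    then have "fst p \<in> ccube c l" "snd p \<in> E" "t \<in> {0..l}" using h(2) Cons(6) by auto
    then have "norm (b' (freeze i (c $ i + t) (fst p)) (snd p)) \<le> B / l" by (intro b'b freeze_cube) auto
    then have "norm (h (snd p)) * (norm (b' (freeze i (c $ i + t) (fst p)) (snd p)) * norm (wt t (fst p))) \<le> norm (h (snd p)) * (B / l * norm (w (fst p)))"
      using wtn Bl by (intro mult_left_mono mult_mono) auto
    then show ?thesis using False by (simp add: F_def norm_mult mult_ac)
  qed (use wtn[of t "fst p"] in \<open>auto simp: F_def\<close>)
  have split: "h (snd p) * (cis (fst p \<bullet> snd p) * b (fst p) (snd p) * w (fst p))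
      = h (snd p) * (cis (fst p \<bullet> snd p) * b (freeze i (c $ i) (fst p)) (snd p) * w (fst p)) + (LBINT t. F p t)" for p
  proof (cases "w (fst p) = 0")
    case True
    then show ?thesis by (simp add: F_def wt_def)
  next
    case False
    then have x: "fst p \<in> ccube c l" using Cons(6) by auto
    have "(LBINT t. F p t) = (LBINT t. (h (snd p) * cis (fst p \<bullet> snd p) * w (fst p)) * (indicator {0..l} t * b' (freeze i (c $ i + t) (fst p)) (snd p) * indicator {x. c $ i + t < x $ i} (fst p)))"
      by (intro integral_cong refl) (simp add: F_def wt_def)
    also have "\<dots> = (h (snd p) * cis (fst p \<bullet> snd p) * w (fst p)) * (b (fst p) (snd p) - b (freeze i (c $ i) (fst p)) (snd p))"
      using ftc[OF x, of "snd p"] by simp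
    finally show ?thesis by (simp add: algebra_simps)
  qed
  have I0: "integrable lborel (\<lambda>p. h (snd p) * (cis (fst p \<bullet> snd p) * b (freeze i (c $ i) (fst p)) (snd p) * w (fst p)))"
  proof -
    have r0: "regular (ccube c l) E l [] (\<lambda>x. b (freeze i (c $ i) x)) B"
      by (rule regular_base[OF regular_freeze[OF breg di(2)]]) (use l in auto)
    then have "continuous_on UNIV (\<lambda>p::(real^'n)\<times>(real^'n). b (freeze i (c $ i) (fst p)) (snd p))" by simp
    then have [measurable]: "(\<lambda>p::(real^'n)\<times>(real^'n). b (freeze i (c $ i) (fst p)) (snd p)) \<in> borel_measurable (borel \<Otimes>\<^sub>M borel)"
      unfolding borel_prod by (rule borel_measurable_continuous_onI)
    have BG: "integrable lborel (\<lambda>p. norm (w (fst p) * h (snd p)) * B)" using Gm by (rule integrable_mult_left)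
    show ?thesis
    proof (rule integrable_bound[OF BG])
      have "(\<lambda>p. h (snd p) * (cis (fst p \<bullet> snd p) * b (freeze i (c $ i) (fst p)) (snd p) * w (fst p))) \<in> borel_measurable (borel \<Otimes>\<^sub>M borel)"
        by measurable
      then show "(\<lambda>p. h (snd p) * (cis (fst p \<bullet> snd p) * b (freeze i (c $ i) (fst p)) (snd p) * w (fst p))) \<in> borel_measurable lborel"
        by (simp add: borel_prod)
      show "AE p in lborel. norm (h (snd p) * (cis (fst p \<bullet> snd p) * b (freeze i (c $ i) (fst p)) (snd p) * w (fst p))) \<le> norm (norm (w (fst p) * h (snd p)) * B)"
      proof (rule AE_I2)
        fix p :: "(real^'n)\<times>(real^'n)"
        show "norm (h (snd p) * (cis (fst p \<bullet> snd p) * b (freeze i (c $ i) (fst p)) (snd p) * w (fst p))) \<le> norm (norm (w (fst p) * h (snd p)) * B)"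
        proof (cases "h (snd p) = 0 \<or> w (fst p) = 0")
          case False
          then have "norm (b (freeze i (c $ i) (fst p)) (snd p)) \<le> B" using r0 h(2) Cons(6) by auto
          then have "norm (h (snd p)) * (norm (b (freeze i (c $ i) (fst p)) (snd p)) * norm (w (fst p))) \<le> norm (h (snd p)) * (B * norm (w (fst p)))"
            by (intro mult_left_mono mult_right_mono) auto
          then show ?thesis using Cons(7) by (simp add: norm_mult abs_mult mult_ac)
        qed auto
      qed
    qed
  qed
  have "integrable (lborel \<Otimes>\<^sub>M lborel) (\<lambda>(p, t). F p t)"
    using fubini_dominated(1)[OF Fm Gm Hm dom] by (simp add: lborel_prod)
  then have IF: "integrable lborel (\<lambda>p. LBINT t. F p t)"
    using lborel_pair.integrable_fst[of F] by simp
  have "T w b = T w (\<lambda>x. b (freeze i (c $ i) x)) + (LBINT p. LBINT t. F p t)"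
    unfolding T_def by (subst split) (rule integral_add[OF I0 IF])
  also have "(LBINT p. LBINT t. F p t) = (LBINT t. LBINT p. F p t)"
    by (rule fubini_dominated(3)[OF Fm Gm Hm dom])
  also have "\<dots> = (LBINT t. indicator {0..l} t *\<^sub>R T (wt t) (\<lambda>x. b' (freeze i (c $ i + t) x)))"
    by (intro integral_cong refl) (auto simp: F_def T_def indicator_def)
  finally have Teq: "T w b = T w (\<lambda>x. b (freeze i (c $ i) x)) + (LBINT t. indicator {0..l} t *\<^sub>R T (wt t) (\<lambda>x. b' (freeze i (c $ i + t) x)))" .
  let ?D = "2 ^ length is * (B / l) * ?\<kappa> * l2 h * l2 w"
  have "norm (LBINT t. indicator {0..l} t *\<^sub>R T (wt t) (\<lambda>x. b' (freeze i (c $ i + t) x)))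
      \<le> (LBINT t. norm (indicator {0..l} t *\<^sub>R T (wt t) (\<lambda>x. b' (freeze i (c $ i + t) x))))" by (rule integral_norm_bound)
  also have "\<dots> \<le> (LBINT t. indicator {0..l} t * ?D)"
  proof (rule integral_mono')
    have D0: "0 \<le> ?D" by (intro mult_nonneg_nonneg Bl l2_nonneg) auto
    show "integrable lborel (\<lambda>t. indicator {0..l} t * ?D)"
      by (intro integrable_mult_left integrable_real_indicator) (use l in auto)
    show "0 \<le> indicator {0..l} t * ?D" for t :: real using D0 by (rule mult_nonneg_nonneg[OF indicator_pos_le])
    show "norm (indicator {0..l} t *\<^sub>R T (wt t) (\<lambda>x. b' (freeze i (c $ i + t) x))) \<le> indicator {0..l} t * ?D" for t
      using bt[of t] by (cases "t \<in> {0..l}") auto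
  qed
  also have "\<dots> = l * ?D" using l by simp
  finally have "norm (LBINT t. indicator {0..l} t *\<^sub>R T (wt t) (\<lambda>x. b' (freeze i (c $ i + t) x))) \<le> l * ?D" .
  then have "norm (T w b) \<le> 2 ^ length is * B * ?\<kappa> * l2 h * l2 w + l * ?D"
    unfolding Teq using b0 norm_triangle_mono by blast
  \<comment> \<open>The length of the interval cancels the cost \<open>1 / l\<close> of the
    derivative. The two terms are then equal, which is the factor 2 per coordinate.\<close>
  also have "l * ?D = 2 ^ length is * B * ?\<kappa> * l2 h * l2 w" using l by simp
  finally show ?case by (simp add: T_def mult_ac)
qed

section \<open>The pieces of the operator on the frequency side\<close>

lemma cut_bounds: "0 \<le> cut s \<xi>" "cut s \<xi> \<le> 1"
  unfolding cut_def using bump_props(1,2) by (auto intro!: prod_nonneg prod_le_1)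

lemma psi_abs_le: "\<bar>psi j \<xi>\<bar> \<le> 1"
  using cut_bounds[of "int j" \<xi>] cut_bounds[of "int j - 1" \<xi>] by (auto simp: psi_def abs_le_iff)

lemma psi_borel[measurable]: "psi j \<in> borel_measurable borel"
  by (rule borel_measurable_continuous_onI[OF psi_cont])

definition ft :: "(real^'n::finite \<Rightarrow> complex) \<Rightarrow> real^'n \<Rightarrow> complex" where
  "ft u \<xi> = (LBINT y. cis (- (y \<bullet> \<xi>)) * u y)"

text \<open>Conjugation changes the sign in the exponential, so the Plancherel inequality proved for
  one sign serves for the other.\<close>

lemma ft_cnj: "ft u = (\<lambda>\<xi>. cnj (LBINT y. cis (y \<bullet> \<xi>) * cnj (u y)))"
  unfolding ft_def by (intro ext) (simp add: integral_cnj[symmetric] cis_cnj)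

lemma ft_props:
  assumes "bcs u"
  shows "ft u \<in> borel_measurable borel" "integrable lborel (\<lambda>\<xi>. (norm (ft u \<xi>))\<^sup>2)" "l2 (ft u) \<le> sqrt ((2 * pi) ^ CARD('n)) * l2 (u :: real^'n::finite \<Rightarrow> complex)"
    "norm (ft u \<xi>) \<le> l1 u"
proof -
  let ?W = "\<lambda>\<xi>. LBINT y. cis (y \<bullet> \<xi>) * cnj (u y)"
  note W = fourier_integral_l2[OF bcs_cnj[OF assms] refl]
  show "ft u \<in> borel_measurable borel" unfolding ft_cnj using W(1) by (rule cnj_borel)
  show "integrable lborel (\<lambda>\<xi>. (norm (ft u \<xi>))\<^sup>2)" unfolding ft_cnj using W(2) by simp
  show "l2 (ft u) \<le> sqrt ((2 * pi) ^ CARD('n)) * l2 u" unfolding ft_cnj using W(3) by (simp add: l2_def)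
  show "norm (ft u \<xi>) \<le> l1 u"
    unfolding ft_def l1_def by (rule order_trans[OF integral_norm_bound]) (simp add: norm_mult)
qed

lemma l2_indicator_cube: "l2 (\<lambda>\<xi>::real^'n::finite. indicator (half_open_cube c l) \<xi>) = sqrt (l ^ CARD('n))" if "l \<ge> 0"
proof -
  have "(LBINT \<xi>. (norm (indicator (half_open_cube c l) \<xi> :: complex))\<^sup>2) = (\<integral>\<xi>. indicator (half_open_cube c l) \<xi> \<partial>(lborel :: (real^'n) measure))"
    by (intro integral_cong refl) (auto simp: indicator_def)
  then show ?thesis using that by (simp add: l2_def measure_half_open_cube)
qed

lemma cube_indicator_sq: "integrable lborel (\<lambda>\<xi>::real^'n::finite. (norm (indicator (half_open_cube c l) \<xi> :: complex))\<^sup>2)"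
proof -
  have "integrable lborel (\<lambda>\<xi>::real^'n. indicator (half_open_cube c l) \<xi> :: real)"
    using fmeasurable_half_open_cube[of c l] by (intro integrable_real_indicator) (auto simp: fmeasurable_def)
  moreover have "(\<lambda>\<xi>::real^'n. (norm (indicator (half_open_cube c l) \<xi> :: complex))\<^sup>2) = (\<lambda>\<xi>. indicator (half_open_cube c l) \<xi>)"
    by (auto simp: indicator_def)
  ultimately show ?thesis by simp
qed

abbreviation acube :: "nat \<Rightarrow> (real^'n::finite) set" where
  "acube j \<equiv> half_open_cube (\<chi> i. - (2 ^ (j + 2))) (2 ^ (j + 3))"

lemma sqrt_acube: "sqrt ((2 ^ (j + 3)) ^ n) = sqrt (8 ^ n) * 2 powr (real j * real n / 2)"
proof -
  have "(2 ^ (j + 3) :: real) ^ n = 8 ^ n * 2 powr (real j * n)"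
    by (simp add: power_add power_mult_distrib powr_realpow[symmetric] powr_powr flip: power_mult)
  moreover have "sqrt (2 powr (real j * n)) = 2 powr (real j * real n / 2)"
    by (simp add: powr_half_sqrt[symmetric] powr_powr)
  ultimately show ?thesis by (simp add: real_sqrt_mult)
qed

context pdo_symbol begin


lemma x_derivs_bound: "\<exists>C\<ge>0. \<forall>\<nu> j x. length \<nu> \<le> CARD('n) \<longrightarrow>
   (\<forall>\<xi>\<in>annulus j. norm (iter_partial (map dir_x \<nu>) a (x, \<xi>)) \<le> C * 2 powr (real j * (m + \<delta> * real (length \<nu>))))"
proof -
  have "\<exists>C\<ge>0. \<forall>j x. \<forall>\<xi>\<in>annulus j. norm (iter_partial (map dir_x \<nu>) a (x, \<xi>)) \<le> C * 2 powr (real j * (m + \<delta> * real (length \<nu>)))" for \<nu>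
  proof -
    obtain C where C: "C \<ge> 0" "\<And>x \<xi>. norm (iter_partial (map dir_x \<nu>) a (x, \<xi>)) \<le> C * (1 + norm \<xi>) powr (m + \<delta> * real (length \<nu>))"
      using a_bound[of \<nu> "[]"] by auto
    obtain D where D: "D \<ge> 0" "\<And>j (\<xi>::real^'n). \<xi> \<in> annulus j \<Longrightarrow> (1 + norm \<xi>) powr (m + \<delta> * real (length \<nu>)) \<le> D * 2 powr (real j * (m + \<delta> * real (length \<nu>)))"
      using annulus_weight[of "m + \<delta> * real (length \<nu>)"] by metis
    have "norm (iter_partial (map dir_x \<nu>) a (x, \<xi>)) \<le> (C * D) * 2 powr (real j * (m + \<delta> * real (length \<nu>)))" if "\<xi> \<in> annulus j" for j x \<xi>
      using order_trans[OF C(2) mult_left_mono[OF D(2)[OF that] C(1)]] by (simp add: mult.assoc)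
    then show ?thesis using C D by (intro exI[of _ "C * D"]) auto
  qed
  then obtain C where C: "\<And>\<nu>. C \<nu> \<ge> 0" "\<And>\<nu> j x \<xi>. \<xi> \<in> annulus j \<Longrightarrow> norm (iter_partial (map dir_x \<nu>) a (x, \<xi>)) \<le> C \<nu> * 2 powr (real j * (m + \<delta> * real (length \<nu>)))"
    by metis
  \<comment> \<open>Only finitely many words of length at most n occur, so one constant serves them
    all.\<close>
  define L where "L = {\<nu>::'n list. set \<nu> \<subseteq> UNIV \<and> length \<nu> \<le> CARD('n)}"
  have fin: "finite L" unfolding L_def by (rule finite_lists_length_le) simp
  have "norm (iter_partial (map dir_x \<nu>) a (x, \<xi>)) \<le> sum C L * 2 powr (real j * (m + \<delta> * real (length \<nu>)))" if "\<xi> \<in> annulus j" "length \<nu> \<le> CARD('n)" for \<nu> j x \<xi>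
  proof -
    have "C \<nu> \<le> sum C L" using that C fin by (intro member_le_sum) (auto simp: L_def)
    then show ?thesis using order_trans[OF C(2)[OF that(1)] mult_right_mono] by simp
  qed
  moreover have "sum C L \<ge> 0" using C by (intro sum_nonneg) auto
  ultimately show ?thesis by blast
qed

lemma dir_x_sub: "set (map dir_x \<nu>) \<subseteq> (Basis :: ((real^'n) \<times> (real^'n)) set)"
  using dir_basis by auto

text \<open>An \<open>x\<close>-derivative costs \<open>2 powr (j * \<delta>)\<close>. On a cube of
  side at most \<open>2 * 2 powr (- j * r)\<close> this is at most \<open>1 / l\<close> times
  \<open>2 * 2 powr (j * (\<rho> - r))\<close>, by \<open>\<delta> \<le> \<rho>\<close>. At most n
  derivatives are taken, whence the powers of these two factors in the constant.\<close>

lemma regular_symbol: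
  assumes C: "C \<ge> 0" "\<And>\<nu> j x \<xi>. length \<nu> \<le> CARD('n) \<Longrightarrow> \<xi> \<in> annulus j \<Longrightarrow> norm (iter_partial (map dir_x \<nu>) a (x, \<xi>)) \<le> C * 2 powr (real j * (m + \<delta> * real (length \<nu>)))"
    and r: "r \<le> \<rho>" and l: "l > 0" "l \<le> 2 * 2 powr (- (real j * r))"
  shows "length \<nu> + length is \<le> CARD('n) \<Longrightarrow>
    regular Q (annulus j) l is (\<lambda>x \<xi>. iter_partial (map dir_x \<nu>) a (x, \<xi>)) (C * 2 ^ CARD('n) * 2 powr (real j * (m + real CARD('n) * (\<rho> - r))) / l ^ length \<nu>)"
proof (induction "is" arbitrary: \<nu>)
  case Nil
  have "norm (iter_partial (map dir_x \<nu>) a (x, \<xi>)) \<le> C * 2 ^ CARD('n) * 2 powr (real j * (m + real CARD('n) * (\<rho> - r))) / l ^ length \<nu>" if "\<xi> \<in> annulus j" for x \<xi>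
  proof -
    let ?k = "length \<nu>"
    have "l ^ ?k \<le> (2 * 2 powr (- (real j * r))) ^ ?k" using l by (intro power_mono) auto
    also have "\<dots> = 2 ^ ?k * 2 powr (- (real j * r) * ?k)" by (simp add: power_mult_distrib powr_power mult_ac)
    finally have "2 powr (real j * (m + \<delta> * ?k)) * l ^ ?k \<le> 2 powr (real j * (m + \<delta> * ?k)) * (2 ^ ?k * 2 powr (- (real j * r) * ?k))"
      by (intro mult_left_mono) auto
    also have "\<dots> = 2 ^ ?k * 2 powr (real j * (m + (\<delta> - r) * ?k))"
      by (simp add: powr_add[symmetric] algebra_simps)
    also have "\<dots> \<le> 2 ^ CARD('n) * 2 powr (real j * (m + real CARD('n) * (\<rho> - r)))"
    proof (rule mult_mono)
      show "(2::real) ^ ?k \<le> 2 ^ CARD('n)" using Nil by (intro power_increasing) auto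
      have "(\<delta> - r) * ?k \<le> (\<rho> - r) * ?k" using \<delta>_le by (intro mult_right_mono) auto
      also have "\<dots> \<le> (\<rho> - r) * real CARD('n)" using r Nil by (intro mult_left_mono) auto
      finally have "m + (\<delta> - r) * ?k \<le> m + real CARD('n) * (\<rho> - r)" by (simp add: mult.commute)
      then have "real j * (m + (\<delta> - r) * ?k) \<le> real j * (m + real CARD('n) * (\<rho> - r))" by (rule mult_left_mono) simp
      then show "2 powr (real j * (m + (\<delta> - r) * ?k)) \<le> 2 powr (real j * (m + real CARD('n) * (\<rho> - r)))" by (rule powr_mono) simp
    qed auto
    finally have "2 powr (real j * (m + \<delta> * ?k)) \<le> 2 ^ CARD('n) * 2 powr (real j * (m + real CARD('n) * (\<rho> - r))) / l ^ ?k"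
      using l by (simp add: pos_le_divide_eq)
    then have "C * 2 powr (real j * (m + \<delta> * ?k)) \<le> C * (2 ^ CARD('n) * 2 powr (real j * (m + real CARD('n) * (\<rho> - r))) / l ^ ?k)"
      using C(1) by (rule mult_left_mono)
    then show ?thesis using C(2)[of \<nu> \<xi> j x] that Nil by simp
  qed
  then show ?case using a_cont[OF dir_x_sub[of \<nu>]] by simp
next
  case (Cons i "is")
  have "((\<lambda>t. iter_partial (map dir_x \<nu>) a (x + t *\<^sub>R axis i 1, \<xi>)) has_vector_derivative iter_partial (map dir_x (i # \<nu>)) a (x, \<xi>)) (at 0)" for x \<xi>
    using iter_partial_line_derivative[OF a_diff[OF dir_x_sub[of \<nu>], of "(x, \<xi>)"], of "dir_x i"] by (simp add: dir_x_def)
  moreover have "regular Q (annulus j) l is (\<lambda>x \<xi>. iter_partial (map dir_x \<nu>) a (x, \<xi>)) (C * 2 ^ CARD('n) * 2 powr (real j * (m + real CARD('n) * (\<rho> - r))) / l ^ length \<nu>)"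
    by (rule Cons.IH) (use Cons(2) in simp)
  moreover have "regular Q (annulus j) l is (\<lambda>x \<xi>. iter_partial (map dir_x (i # \<nu>)) a (x, \<xi>)) (C * 2 ^ CARD('n) * 2 powr (real j * (m + real CARD('n) * (\<rho> - r))) / l ^ length (i # \<nu>))"
    by (rule Cons.IH) (use Cons(2) in simp)
  ultimately show ?case
    unfolding regular.simps(2) by (intro conjI exI[of _ "\<lambda>x \<xi>. iter_partial (map dir_x (i # \<nu>)) a (x, \<xi>)"]) (auto simp: mult.commute)
qed

definition piece :: "nat \<Rightarrow> (real^'n \<Rightarrow> complex) \<Rightarrow> real^'n \<Rightarrow> complex" where
  "piece j f x = (LBINT y. kern j x y * f y)"

lemma a_borel[measurable]: "a \<in> borel_measurable (borel \<Otimes>\<^sub>M borel)"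
  using a_cont[of "[]"] unfolding borel_prod by (intro borel_measurable_continuous_onI) simp

lemma a_global_bound: "\<exists>C\<ge>0. \<forall>z. norm (a z) \<le> C"
proof -
  obtain C where C: "C \<ge> 0" "\<And>x \<xi>. norm (a (x, \<xi>)) \<le> C * (1 + norm \<xi>) powr m"
    using a_bound[of "[]" "[]"] by auto
  have "norm (a (x, \<xi>)) \<le> C" for x \<xi>
  proof -
    have "(1 + norm \<xi>) powr m \<le> (1 + norm \<xi>) powr 0" using m_neg by (intro powr_mono) auto
    also have "\<dots> = 1" using norm_ge_zero[of \<xi>] by (simp add: powr_zero_eq_one) (metis add_nonneg_eq_0_iff norm_ge_zero zero_le_one zero_neq_one)
    finally show ?thesis using C(2)[of x \<xi>] mult_left_mono[of "(1 + norm \<xi>) powr m" 1 C] C(1) by simp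
  qed
  then show ?thesis using C(1) by auto
qed

lemma kern_sub_bound: "norm (complex_of_real (psi j \<xi>) * a (x, \<xi>)) \<le> C * indicator (acube j) \<xi>"
  if C: "C \<ge> 0" "\<And>z. norm (a z) \<le> C"
proof (cases "psi j \<xi> = 0")
  case False
  then have "\<xi> \<in> acube j" using psi_support annulus_sub_cube by blast
  moreover have "\<bar>psi j \<xi>\<bar> * norm (a (x, \<xi>)) \<le> 1 * C" using C psi_abs_le by (intro mult_mono) auto
  ultimately show ?thesis by (simp add: norm_mult)
qed (use C in simp)

lemma acube_integrable: "integrable lborel (\<lambda>\<xi>::real^'n. C * indicator (acube j) \<xi> :: real)"
  using fmeasurable_half_open_cube[of "\<chi> i. - (2 ^ (j + 2))" "2 ^ (j + 3)"]
  by (intro integrable_mult_right integrable_real_indicator) (auto simp: fmeasurable_def)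

lemma piece_freq:
  assumes ui: "integrable lborel u"
  shows "piece j u x = (LBINT \<xi>. (complex_of_real (psi j \<xi>) * ft u \<xi>) * (cis (x \<bullet> \<xi>) * a (x, \<xi>)))"
proof -
  obtain C where C: "C \<ge> 0" "\<And>z. norm (a z) \<le> C" using a_global_bound by metis
  have [measurable]: "u \<in> borel_measurable borel" using borel_measurable_integrable[OF ui] by simp
  have ax[measurable]: "(\<lambda>\<xi>. a (x, \<xi>)) \<in> borel_measurable borel" by measurable
  have mm: "(\<lambda>(y, \<xi>). cis ((x - y) \<bullet> \<xi>) * (complex_of_real (psi j \<xi>) * a (x, \<xi>)) * u y) \<in> borel_measurable borel"
    unfolding borel_prod[symmetric] by measurable
  have dom: "norm (cis ((x - y) \<bullet> \<xi>) * (complex_of_real (psi j \<xi>) * a (x, \<xi>)) * u y) \<le> norm (u y) * (C * indicator (acube j) \<xi>)" for y \<xi>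
    using mult_right_mono[OF kern_sub_bound[OF C, of j \<xi> x] norm_ge_zero[of "u y"]] by (simp add: norm_mult mult_ac)
  have "piece j u x = (LBINT y. LBINT \<xi>. cis ((x - y) \<bullet> \<xi>) * (complex_of_real (psi j \<xi>) * a (x, \<xi>)) * u y)"
    unfolding piece_def kern_def by simp
  also have "\<dots> = (LBINT \<xi>. LBINT y. cis ((x - y) \<bullet> \<xi>) * (complex_of_real (psi j \<xi>) * a (x, \<xi>)) * u y)"
    by (rule fubini_dominated(3)[OF mm integrable_norm[OF ui] acube_integrable dom])
  also have "\<dots> = (LBINT \<xi>. (complex_of_real (psi j \<xi>) * ft u \<xi>) * (cis (x \<bullet> \<xi>) * a (x, \<xi>)))"
  proof (intro integral_cong refl)
    fix \<xi>
    have "(LBINT y. cis ((x - y) \<bullet> \<xi>) * (complex_of_real (psi j \<xi>) * a (x, \<xi>)) * u y)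
        = (LBINT y. (cis (x \<bullet> \<xi>) * (complex_of_real (psi j \<xi>) * a (x, \<xi>))) * (cis (- (y \<bullet> \<xi>)) * u y))"
    proof (intro integral_cong refl)
      fix y
      have "cis ((x - y) \<bullet> \<xi>) = cis (x \<bullet> \<xi>) * cis (- (y \<bullet> \<xi>))" by (simp add: inner_diff_left cis_mult)
      then show "cis ((x - y) \<bullet> \<xi>) * (complex_of_real (psi j \<xi>) * a (x, \<xi>)) * u y
         = (cis (x \<bullet> \<xi>) * (complex_of_real (psi j \<xi>) * a (x, \<xi>))) * (cis (- (y \<bullet> \<xi>)) * u y)"
        by (simp only: mult_ac)
    qed
    then show "(LBINT y. cis ((x - y) \<bullet> \<xi>) * (complex_of_real (psi j \<xi>) * a (x, \<xi>)) * u y) = (complex_of_real (psi j \<xi>) * ft u \<xi>) * (cis (x \<bullet> \<xi>) * a (x, \<xi>))"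
      by (simp add: ft_def)
  qed
  finally show ?thesis .
qed

text \<open>Two ways to measure the localised transform: Plancherel, or the supremum bound of the
  transform times the root of the volume of the frequency box. Having both makes the interpolation
  in \<open>near_cube\<close> possible.\<close>

lemma freq_bcs:
  fixes u :: "real^'n \<Rightarrow> complex"
  assumes "bcs u" and h_def: "h = (\<lambda>\<xi>. complex_of_real (psi j \<xi>) * ft u \<xi>)"
  shows "bcs h" "h \<xi> \<noteq> 0 \<Longrightarrow> \<xi> \<in> annulus j" "l2 h \<le> sqrt ((2 * pi) ^ CARD('n)) * l2 u"
    "l2 h \<le> sqrt (8 ^ CARD('n)) * (2 powr (real j * real CARD('n) / 2) * l1 u)"
proof -
  note ft = ft_props[OF assms(1)]
  have [measurable]: "ft u \<in> borel_measurable borel" by (rule ft(1))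
  have hm[measurable]: "h \<in> borel_measurable borel" unfolding h_def by measurable
  show sup: "h \<xi> \<noteq> 0 \<Longrightarrow> \<xi> \<in> annulus j" for \<xi> unfolding h_def using psi_support[of j \<xi>] by auto
  have hle: "norm (h \<xi>) \<le> norm (ft u \<xi>)" for \<xi>
    unfolding h_def using mult_right_mono[OF psi_abs_le[of j \<xi>] norm_ge_zero[of "ft u \<xi>"]] by (simp add: norm_mult)
  show hb: "bcs h"
  proof (rule bcsI[OF hm, of "l1 u" "real CARD('n) * 2 ^ (j + 1)"])
    show "norm (h x) \<le> l1 u" for x using order_trans[OF hle ft(4)] .
    show "norm x \<le> real CARD('n) * 2 ^ (j + 1)" if "h x \<noteq> 0" for x using annulus_norm_le[OF sup[OF that]] by simp
  qed
  have "l2 h \<le> l2 (ft u)"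
    unfolding l2_def
    by (intro real_sqrt_le_mono integral_mono bcs_norm_sq[OF hb] ft(2) power_mono hle) auto
  then show "l2 h \<le> sqrt ((2 * pi) ^ CARD('n)) * l2 u" using ft(3) by linarith
  have "(LBINT \<xi>. (norm (h \<xi>))\<^sup>2) \<le> (LBINT \<xi>. (l1 u)\<^sup>2 * indicator (acube j :: (real^'n) set) \<xi>)"
  proof (rule integral_mono[OF bcs_norm_sq[OF hb] acube_integrable])
    fix \<xi> :: "real^'n"
    show "(norm (h \<xi>))\<^sup>2 \<le> (l1 u)\<^sup>2 * indicator (acube j) \<xi>"
    proof (cases "h \<xi> = 0")
      case False
      then have "\<xi> \<in> acube j" using sup annulus_sub_cube by blast
      moreover have "(norm (h \<xi>))\<^sup>2 \<le> (l1 u)\<^sup>2" using order_trans[OF hle ft(4)] by (intro power_mono) auto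
      ultimately show ?thesis by simp
    qed simp
  qed
  also have "\<dots> = (l1 u)\<^sup>2 * (2 ^ (j + 3)) ^ CARD('n)" by (simp add: measure_half_open_cube)
  finally have "l2 h \<le> sqrt ((l1 u)\<^sup>2 * (2 ^ (j + 3)) ^ CARD('n))" unfolding l2_def by (rule real_sqrt_le_mono)
  also have "\<dots> = l1 u * sqrt ((2 ^ (j + 3)) ^ CARD('n))" by (simp add: real_sqrt_mult l1_nonneg)
  also have "sqrt ((2 ^ (j + 3)) ^ CARD('n)) = sqrt (8 ^ CARD('n)) * 2 powr (real j * real CARD('n) / 2)" by (rule sqrt_acube)
  finally show "l2 h \<le> sqrt (8 ^ CARD('n)) * (2 powr (real j * real CARD('n) / 2) * l1 u)" by (simp add: mult_ac)
qed

lemma piece_pairing: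
  assumes u: "bcs u" and w: "bcs w" and h_def: "h = (\<lambda>\<xi>. complex_of_real (psi j \<xi>) * ft u \<xi>)"
  shows "(LBINT x. piece j u x * w x) = (LBINT p. h (snd p) * (cis (fst p \<bullet> snd p) * a p * w (fst p)))"
    "(LBINT x. piece j u x * w x) = (LBINT \<xi>. LBINT x. h \<xi> * (cis (x \<bullet> \<xi>) * a (x, \<xi>) * w x))"
proof -
  obtain C where C: "C \<ge> 0" "\<And>z. norm (a z) \<le> C" using a_global_bound by metis
  note hb = freq_bcs[OF u h_def]
  have [measurable]: "h \<in> borel_measurable borel" "w \<in> borel_measurable borel"
    using bcs_measurable hb(1) w by auto
  have wi: "integrable lborel (\<lambda>y. norm (w y))" and hi: "integrable lborel (\<lambda>y. C * norm (h y))" using bcs_integrable w hb(1) by auto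
  have mm: "(\<lambda>(x, \<xi>). h \<xi> * (cis (x \<bullet> \<xi>) * a (x, \<xi>) * w x)) \<in> borel_measurable borel"
    unfolding borel_prod[symmetric] by measurable
  have dom: "norm (h \<xi> * (cis (x \<bullet> \<xi>) * a (x, \<xi>) * w x)) \<le> norm (w x) * (C * norm (h \<xi>))" for x \<xi>
    using mult_right_mono[OF C(2)[of "(x, \<xi>)"], of "norm (h \<xi>) * norm (w x)"] by (simp add: norm_mult mult_ac)
  have e: "(LBINT x. piece j u x * w x) = (LBINT x. LBINT \<xi>. h \<xi> * (cis (x \<bullet> \<xi>) * a (x, \<xi>) * w x))"
    unfolding piece_freq[OF bcs_integrable[OF u]] h_def by (intro integral_cong refl) (simp flip: integral_mult_left_zero add: mult_ac)
  show "(LBINT x. piece j u x * w x) = (LBINT p. h (snd p) * (cis (fst p \<bullet> snd p) * a p * w (fst p)))"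
    unfolding e fubini_dominated(2)[OF mm wi hi dom, symmetric] by (simp add: split_beta')
  show "(LBINT x. piece j u x * w x) = (LBINT \<xi>. LBINT x. h \<xi> * (cis (x \<bullet> \<xi>) * a (x, \<xi>) * w x))"
    unfolding e by (rule fubini_dominated(3)[OF mm wi hi dom])
qed

text \<open>For the \<open>l2\<close> bound in \<open>w\<close> the symbol is decoupled from
  \<open>x\<close> on the cube. For the \<open>l1\<close> bound absolute values suffice, with
  Cauchy-Schwarz over the frequency box. Together with the two bounds in \<open>freq_bcs\<close> all
  four combinations hold with one constant, so the minima may be taken separately in
  \<open>u\<close> and \<open>w\<close>.\<close>

lemma near_bilinear:
  assumes r: "r \<le> \<rho>"
  shows "\<exists>C\<ge>0. \<forall>j u w c l. bcs u \<longrightarrow> bcs w \<longrightarrow> l > 0 \<longrightarrow> l \<le> 2 * 2 powr (- (real j * r)) \<longrightarrow> (\<forall>x. w x \<noteq> 0 \<longrightarrow> x \<in> ccube c l) \<longrightarrow>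
    norm (LBINT x. piece j u x * w x) \<le> C * 2 powr (real j * (m + real CARD('n) * (\<rho> - r)))
      * min (l2 u) (2 powr (real j * real CARD('n) / 2) * l1 u) * min (l2 w) (2 powr (real j * real CARD('n) / 2) * l1 w)"
proof -
  obtain C where C: "C \<ge> 0" "\<And>\<nu> j x \<xi>. length \<nu> \<le> CARD('n) \<Longrightarrow> \<xi> \<in> annulus j \<Longrightarrow> norm (iter_partial (map dir_x \<nu>) a (x, \<xi>)) \<le> C * 2 powr (real j * (m + \<delta> * real (length \<nu>)))"
    using x_derivs_bound by metis
  obtain "is" :: "'n list" where isl: "set is = UNIV" "distinct is" using finite_distinct_list[of "UNIV::'n set"] by auto
  have len: "length is = CARD('n)" using isl by (metis distinct_card)
  define \<kappa> where "\<kappa> = sqrt ((2 * pi) ^ CARD('n))"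
  define \<gamma> where "\<gamma> = sqrt (8 ^ CARD('n) :: real)"
  have k0: "\<kappa> \<ge> 0" "\<gamma> \<ge> 0" by (auto simp: \<kappa>_def \<gamma>_def)
  define D where "D = C * (4 ^ CARD('n) * \<kappa> + \<gamma>) * (\<kappa> + \<gamma>)"
  have D0: "D \<ge> 0" using C k0 by (auto simp: D_def)
  have main: "norm (LBINT x. piece j u x * w x) \<le> D * 2 powr (real j * (m + real CARD('n) * (\<rho> - r)))
      * min (l2 u) (2 powr (real j * real CARD('n) / 2) * l1 u) * min (l2 w) (2 powr (real j * real CARD('n) / 2) * l1 w)"
    if u: "bcs u" and w: "bcs w" and l: "l > 0" "l \<le> 2 * 2 powr (- (real j * r))" and ws: "\<And>x. w x \<noteq> 0 \<Longrightarrow> x \<in> ccube c l" for j u w c l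
  proof -
    define h where "h = (\<lambda>\<xi>. complex_of_real (psi j \<xi>) * ft u \<xi>)"
    note hb = freq_bcs[OF u h_def]
    let ?M = "2 powr (real j * (m + real CARD('n) * (\<rho> - r)))" and ?S = "2 powr (real j * real CARD('n) / 2)"
    define A where "A = min (l2 u) (?S * l1 u)"
    have A0: "A \<ge> 0" by (simp add: A_def l1_nonneg l2_nonneg)
    have hA: "l2 h \<le> (\<kappa> + \<gamma>) * A"
    proof (cases "l2 u \<le> ?S * l1 u")
      case True
      then have "A = l2 u" by (simp add: A_def)
      then have "l2 h \<le> \<kappa> * A" using hb(3) by (simp add: \<kappa>_def)
      also have "\<dots> \<le> (\<kappa> + \<gamma>) * A" using k0 A0 by (intro mult_right_mono) auto
      finally show ?thesis .
    next
      case False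
      then have "A = ?S * l1 u" by (simp add: A_def)
      then have "l2 h \<le> \<gamma> * A" using hb(4) by (simp add: \<gamma>_def)
      also have "\<dots> \<le> (\<kappa> + \<gamma>) * A" using k0 A0 by (intro mult_right_mono) auto
      finally show ?thesis .
    qed
    have reg: "regular (ccube c l) (annulus j) l is (\<lambda>x \<xi>. a (x, \<xi>)) (C * 2 ^ CARD('n) * ?M)"
      using regular_symbol[OF C r l, of "[]" "is" "ccube c l"] len by simp
    have dp: "depends_only_on is (\<lambda>x \<xi>. a (x, \<xi>))" using isl unfolding depends_only_on_def by (auto simp: vec_eq_iff[symmetric])
    have b1: "norm (LBINT x. piece j u x * w x) \<le> (C * 4 ^ CARD('n) * \<kappa>) * ?M * l2 h * l2 w"
    proof -
      have "norm (LBINT p. h (snd p) * (cis (fst p \<bullet> snd p) * a (fst p, snd p) * w (fst p)))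
         \<le> 2 ^ length is * (C * 2 ^ CARD('n) * ?M) * sqrt ((2 * pi) ^ CARD('n)) * l2 h * l2 w"
        by (rule decouple[OF hb(1) hb(2) l(1) isl(2) reg dp w ws]) (use C in auto)
      also have "\<dots> = (C * (2 ^ CARD('n) * 2 ^ CARD('n)) * \<kappa>) * ?M * l2 h * l2 w" by (simp add: \<kappa>_def len mult_ac)
      also have "(2::real) ^ CARD('n) * 2 ^ CARD('n) = 4 ^ CARD('n)" by (simp flip: power_mult_distrib)
      finally show ?thesis using piece_pairing(1)[OF u w h_def] by simp
    qed
    have b2: "norm (LBINT x. piece j u x * w x) \<le> (C * \<gamma>) * ?M * l2 h * (?S * l1 w)"
    proof -
      have wi: "integrable lborel (\<lambda>y. norm (w y))" using bcs_integrable[OF w] by simp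
      have [measurable]: "h \<in> borel_measurable borel" by (rule bcs_measurable[OF hb(1)])
      have in1: "norm (LBINT x. h \<xi> * (cis (x \<bullet> \<xi>) * a (x, \<xi>) * w x)) \<le> C * 2 powr (real j * m) * l1 w * norm (h \<xi>)" for \<xi>
      proof (cases "h \<xi> = 0")
        case False
        then have \<xi>: "\<xi> \<in> annulus j" by (rule hb(2))
        have "norm (LBINT x. h \<xi> * (cis (x \<bullet> \<xi>) * a (x, \<xi>) * w x)) \<le> (LBINT x. norm (h \<xi> * (cis (x \<bullet> \<xi>) * a (x, \<xi>) * w x)))"
          by (rule integral_norm_bound)
        also have "\<dots> \<le> (LBINT x. (norm (h \<xi>) * (C * 2 powr (real j * m))) * norm (w x))"
        proof (rule integral_mono')
          show "integrable lborel (\<lambda>x. (norm (h \<xi>) * (C * 2 powr (real j * m))) * norm (w x))" using wi by (rule integrable_mult_right)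
          fix x
          have "norm (a (x, \<xi>)) \<le> C * 2 powr (real j * m)" using C(2)[of "[]" \<xi> j x] \<xi> by simp
          then have "norm (h \<xi>) * (norm (a (x, \<xi>)) * norm (w x)) \<le> norm (h \<xi>) * (C * 2 powr (real j * m) * norm (w x))"
            by (intro mult_left_mono mult_right_mono) auto
          then show "norm (h \<xi> * (cis (x \<bullet> \<xi>) * a (x, \<xi>) * w x)) \<le> (norm (h \<xi>) * (C * 2 powr (real j * m))) * norm (w x)"
            by (simp add: norm_mult mult.assoc)
          show "0 \<le> (norm (h \<xi>) * (C * 2 powr (real j * m))) * norm (w x)" using C by simp
        qed
        also have "\<dots> = C * 2 powr (real j * m) * l1 w * norm (h \<xi>)" by (simp add: l1_def mult_ac)
        finally show ?thesis .
      qed simp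
      have "norm (LBINT x. piece j u x * w x) \<le> (LBINT \<xi>. norm (LBINT x. h \<xi> * (cis (x \<bullet> \<xi>) * a (x, \<xi>) * w x)))"
        unfolding piece_pairing(2)[OF u w h_def] by (rule integral_norm_bound)
      also have "\<dots> \<le> (LBINT \<xi>. C * 2 powr (real j * m) * l1 w * norm (h \<xi>))"
      proof (rule integral_mono')
        show "integrable lborel (\<lambda>\<xi>. C * 2 powr (real j * m) * l1 w * norm (h \<xi>))"
          using bcs_integrable[OF hb(1)] by (intro integrable_mult_right integrable_norm)
        show "0 \<le> C * 2 powr (real j * m) * l1 w * norm (h \<xi>)" for \<xi> using C by (simp add: l1_nonneg)
      qed (rule in1)
      also have "\<dots> = C * 2 powr (real j * m) * l1 w * (LBINT \<xi>. norm (h \<xi>))" by simp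
      also have "(LBINT \<xi>. norm (h \<xi>)) = (LBINT \<xi>. norm (h \<xi>) * norm (indicator (acube j) \<xi> :: complex))"
      proof (intro integral_cong refl)
        fix \<xi>
        show "norm (h \<xi>) = norm (h \<xi>) * norm (indicator (acube j) \<xi> :: complex)"
          using hb(2)[of \<xi>] annulus_sub_cube[of j] by (cases "h \<xi> = 0") auto
      qed
      also have "C * 2 powr (real j * m) * l1 w * \<dots> \<le> C * 2 powr (real j * m) * l1 w * (l2 h * l2 (\<lambda>\<xi>::real^'n. indicator (acube j) \<xi> :: complex))"
      proof (rule mult_left_mono)
        show "(LBINT \<xi>. norm (h \<xi>) * norm (indicator (acube j) \<xi> :: complex)) \<le> l2 h * l2 (\<lambda>\<xi>::real^'n. indicator (acube j) \<xi> :: complex)"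
          by (rule cauchy_schwarz_integral(2)[OF bcs_norm_sq[OF hb(1)] cube_indicator_sq bcs_measurable[OF hb(1)]])
             (intro borel_measurable_indicator half_open_cube_borel)
        show "0 \<le> C * 2 powr (real j * m) * l1 w" using C by (simp add: l1_nonneg)
      qed
      also have "l2 (\<lambda>\<xi>::real^'n. indicator (acube j) \<xi> :: complex) = \<gamma> * ?S"
        by (simp add: l2_indicator_cube \<gamma>_def) (simp only: sqrt_acube[symmetric])
      also have "C * 2 powr (real j * m) * l1 w * (l2 h * (\<gamma> * ?S)) = 2 powr (real j * m) * ((C * \<gamma>) * l2 h * (?S * l1 w))" by (simp add: mult_ac)
      also have "\<dots> \<le> ?M * ((C * \<gamma>) * l2 h * (?S * l1 w))"
      proof (intro mult_right_mono powr_mono mult_left_mono)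
        have "0 \<le> real CARD('n) * (\<rho> - r)" using r by simp
        then show "m \<le> m + real CARD('n) * (\<rho> - r)" by simp
      qed (use C k0 in \<open>auto simp: l1_nonneg l2_nonneg\<close>)
      finally show ?thesis by (simp add: mult_ac)
    qed
    define W where "W = min (l2 w) (?S * l1 w)"
    have W0: "W \<ge> 0" by (simp add: W_def l1_nonneg l2_nonneg)
    have "norm (LBINT x. piece j u x * w x) \<le> (C * (4 ^ CARD('n) * \<kappa> + \<gamma>)) * ?M * l2 h * W"
    proof (cases "l2 w \<le> ?S * l1 w")
      case True
      then have "W = l2 w" by (simp add: W_def)
      moreover have "(C * 4 ^ CARD('n) * \<kappa>) * (?M * l2 h * W) \<le> (C * (4 ^ CARD('n) * \<kappa> + \<gamma>)) * (?M * l2 h * W)"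
        using C k0 W0 by (intro mult_right_mono) (auto simp: algebra_simps l2_nonneg)
      ultimately show ?thesis using b1 by (simp add: mult.assoc)
    next
      case False
      then have "W = ?S * l1 w" by (simp add: W_def)
      moreover have "(C * \<gamma>) * (?M * l2 h * W) \<le> (C * (4 ^ CARD('n) * \<kappa> + \<gamma>)) * (?M * l2 h * W)"
        using C k0 W0 by (intro mult_right_mono) (auto simp: algebra_simps l2_nonneg)
      ultimately show ?thesis using b2 by (simp add: mult.assoc)
    qed
    also have "\<dots> \<le> (C * (4 ^ CARD('n) * \<kappa> + \<gamma>)) * ?M * ((\<kappa> + \<gamma>) * A) * W"
      using hA C k0 W0 by (intro mult_right_mono mult_left_mono) auto
    also have "\<dots> = D * ?M * A * W" by (simp add: D_def mult_ac)
    finally show ?thesis unfolding A_def W_def .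
  qed
  show ?thesis using D0 main by (intro exI[of _ D]) blast
qed

end

text \<open>Real interpolation done by hand. Values of \<open>f\<close> above a height are measured
  in \<open>l1\<close>, where the exponent \<open>1 - p\<close> is at most 0, and values below it in
  \<open>l2\<close>, where \<open>2 - p\<close> is at least 0. The factor \<open>S\<close> is the
  price that \<open>near_bilinear\<close> charges for an \<open>l1\<close> norm.\<close>

lemma level_split:
  fixes f :: "real^'n::finite \<Rightarrow> complex"
  assumes f: "bcs f" and p: "1 \<le> p" "p \<le> 2" and E: "E \<in> sets borel" "vol E > 0"
    and sup: "\<And>x. f x \<noteq> 0 \<Longrightarrow> x \<in> E" and S: "S > 0"
  obtains f1 f2 where "bcs f1" "bcs f2" "\<And>x. f x = f1 x + f2 x" "\<And>x. f x = 0 \<Longrightarrow> f1 x = 0" "\<And>x. f x = 0 \<Longrightarrow> f2 x = 0"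
    "S * l1 f1 \<le> sqrt (vol E) * (S\<^sup>2 * vol E) powr (1 / p - 1 / 2) * av p f E"
    "l2 f2 \<le> sqrt (vol E) * (S\<^sup>2 * vol E) powr (1 / p - 1 / 2) * av p f E"
proof -
  define \<mu> where "\<mu> = vol E"
  define H where "H = S\<^sup>2 * \<mu>"
  define A where "A = av p f E"
  have \<mu>: "\<mu> > 0" and H: "H > 0" using E S by (auto simp: \<mu>_def H_def)
  have A0: "A \<ge> 0" by (simp add: A_def av_nonneg)
  have fm[measurable]: "f \<in> borel_measurable borel" by (rule bcs_measurable[OF f])
  have I: "Ip p f E = \<mu> * A powr p"
    using p \<mu> Ip_nonneg[of p f E] by (simp add: A_def av_def powr_powr \<mu>_def)
  have Ii: "integrable lborel (\<lambda>x. indicator E x * norm (f x) powr p)" by (rule Ip_integrable) (use f p E in auto)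
  show ?thesis
  \<comment> \<open>With vanishing average \<open>f\<close> is 0 almost everywhere and the height
    below would be 0; here \<open>f\<close> itself is the square-integrable part.\<close>
  proof (cases "A = 0")
    case True
    have "(LBINT x. indicator E x * norm (f x) powr p) = 0" using I True p by (simp add: Ip_def)
    then have ae: "AE x in lborel. indicator E x * norm (f x) powr p = 0"
      using integral_nonneg_eq_0_iff_AE[OF Ii] by auto
    have "AE x in lborel. (norm (f x))\<^sup>2 = 0"
      using ae by eventually_elim (use sup in \<open>auto simp: indicator_def split: if_splits\<close>)
    then have "(LBINT x. (norm (f x))\<^sup>2) = 0" by (rule integral_eq_zero_AE)
    then have "l2 f = 0" by (simp add: l2_def)
    moreover have "bcs (\<lambda>x::real^'n. 0)" by (rule bcsI[of _ 0 0]) auto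
    ultimately show ?thesis
      by (intro that[of "\<lambda>_. 0" f]) (use f True in \<open>auto simp: l1_def A_def\<close>)
  next
    case False
    then have Ap: "A > 0" using A0 by simp
    \<comment> \<open>The height that makes the two resulting bounds equal: both require
      \<open>lam powr p = H * A powr p\<close>.\<close>
    define lam where "lam = H powr (1 / p) * A"
    have lam: "lam > 0" using H Ap by (simp add: lam_def)
    define f1 where "f1 = (\<lambda>x. indicator {x. norm (f x) > lam} x * f x)"
    define f2 where "f2 = (\<lambda>x. indicator {x. norm (f x) \<le> lam} x * f x)"
    have b: "bcs f1" "bcs f2" unfolding f1_def f2_def by (intro bcs_indicator f; measurable)+
    have e1: "norm (f1 x) \<le> lam powr (1 - p) * (indicator E x * norm (f x) powr p)" for x
    proof (cases "norm (f x) > lam")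
      case True
      then have "norm (f x) powr (1 - p) \<le> lam powr (1 - p)" using lam p by (intro powr_mono2') auto
      moreover have "norm (f x) = norm (f x) powr (1 - p) * norm (f x) powr p" using True lam by (simp add: powr_add[symmetric])
      ultimately have "norm (f x) \<le> lam powr (1 - p) * norm (f x) powr p" by (metis mult_right_mono powr_ge_zero)
      moreover have "f x \<noteq> 0" using True lam by (metis less_asym norm_zero)
      then have "x \<in> E" by (rule sup)
      ultimately show ?thesis using True by (simp add: f1_def)
    qed (simp add: f1_def)
    have e2: "(norm (f2 x))\<^sup>2 \<le> lam powr (2 - p) * (indicator E x * norm (f x) powr p)" for x
    proof (cases "norm (f x) \<le> lam \<and> f x \<noteq> 0")
      case True
      then have "norm (f x) powr (2 - p) \<le> lam powr (2 - p)" using p by (intro powr_mono2) auto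
      moreover have "(norm (f x))\<^sup>2 = norm (f x) powr (2 - p) * norm (f x) powr p" using True by (simp add: powr_add[symmetric])
      ultimately have "(norm (f x))\<^sup>2 \<le> lam powr (2 - p) * norm (f x) powr p" by (metis mult_right_mono powr_ge_zero)
      then show ?thesis using True sup[of x] by (simp add: f2_def)
    qed (auto simp: f2_def)
    have "l1 f1 \<le> (LBINT x. lam powr (1 - p) * (indicator E x * norm (f x) powr p))"
      unfolding l1_def by (rule integral_mono[OF integrable_norm[OF bcs_integrable[OF b(1)]] integrable_mult_right[OF Ii]]) (rule e1)
    also have "\<dots> = lam powr (1 - p) * (\<mu> * A powr p)" using I by (simp add: Ip_def)
    finally have l1: "l1 f1 \<le> lam powr (1 - p) * (\<mu> * A powr p)" .
    have "(l2 f2)\<^sup>2 \<le> (LBINT x. lam powr (2 - p) * (indicator E x * norm (f x) powr p))"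
      unfolding l2_sq by (rule integral_mono[OF bcs_norm_sq[OF b(2)] integrable_mult_right[OF Ii]]) (rule e2)
    also have "\<dots> = lam powr (2 - p) * (\<mu> * A powr p)" using I by (simp add: Ip_def)
    finally have l2: "(l2 f2)\<^sup>2 \<le> lam powr (2 - p) * (\<mu> * A powr p)" .
    have sH: "S * \<mu> = sqrt \<mu> * H powr (1 / 2)"
      using S \<mu> by (simp add: H_def powr_half_sqrt real_sqrt_mult)
    have "S * l1 f1 \<le> S * (lam powr (1 - p) * (\<mu> * A powr p))" using l1 S by (intro mult_left_mono) auto
    also have "\<dots> = (S * \<mu>) * (H powr ((1 - p) / p) * (A powr (1 - p) * A powr p))"
      using H A0 by (simp add: lam_def powr_mult powr_powr)
    also have "A powr (1 - p) * A powr p = A" using Ap by (simp add: powr_add[symmetric])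
    also have "(S * \<mu>) * (H powr ((1 - p) / p) * A) = sqrt \<mu> * (H powr (1 / 2) * H powr ((1 - p) / p)) * A"
      unfolding sH by simp
    also have "H powr (1 / 2) * H powr ((1 - p) / p) = H powr (1 / p - 1 / 2)"
      using p by (simp add: powr_add[symmetric] diff_divide_distrib)
    finally have r1: "S * l1 f1 \<le> sqrt \<mu> * H powr (1 / p - 1 / 2) * A" .
    have "lam powr (2 - p) * (\<mu> * A powr p) = \<mu> * (H powr ((2 - p) / p) * (A powr (2 - p) * A powr p))"
      using H A0 by (simp add: lam_def powr_mult powr_powr)
    also have "A powr (2 - p) * A powr p = A\<^sup>2" using Ap by (simp add: powr_add[symmetric])
    also have "H powr ((2 - p) / p) = (H powr (1 / p - 1 / 2))\<^sup>2"
      using H p by (simp add: powr_power diff_divide_distrib)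
    also have "\<mu> * ((H powr (1 / p - 1 / 2))\<^sup>2 * A\<^sup>2) = (sqrt \<mu> * H powr (1 / p - 1 / 2) * A)\<^sup>2"
      using \<mu> by (simp add: power_mult_distrib)
    finally have "(l2 f2)\<^sup>2 \<le> (sqrt \<mu> * H powr (1 / p - 1 / 2) * A)\<^sup>2" using l2 by simp
    then have r2: "l2 f2 \<le> sqrt \<mu> * H powr (1 / p - 1 / 2) * A"
      by (rule power2_le_imp_le) (use \<mu> A0 in auto)
    show ?thesis
      by (rule that[OF b]) (use r1 r2 in \<open>auto simp: f1_def f2_def indicator_def H_def \<mu>_def A_def\<close>)
  qed
qed

text \<open>The power mean inequality, obtained from Young's inequality applied pointwise to the
  values of \<open>f\<close> divided by their q-average.\<close>

lemma av_mono_exponent: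
  fixes f :: "real^'n::finite \<Rightarrow> complex"
  assumes f: "bcs f" and p: "0 < p" "p \<le> q" and E: "E \<in> fmeasurable lborel" "vol E > 0"
  shows "av p f E \<le> av q f E"
proof -
  have Eb: "E \<in> sets borel" using E(1) by (auto dest: fmeasurableD)
  have q: "q > 0" using p by simp
  let ?\<mu> = "vol E"
  define A where "A = av q f E"
  have A0: "A \<ge> 0" by (simp add: A_def av_nonneg)
  have Iq: "Ip q f E = ?\<mu> * A powr q"
    using q E Ip_nonneg[of q f E] by (simp add: A_def av_def powr_powr)
  note ip = Ip_integrable[OF f p(1) Eb] and iq = Ip_integrable[OF f q Eb]
  have Ip: "Ip p f E \<le> ?\<mu> * A powr p"
  proof (cases "A = 0")
    case True
    then have "(LBINT x. indicator E x * norm (f x) powr q) = 0" using Iq by (simp add: Ip_def)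
    then have ae: "AE x in lborel. indicator E x * norm (f x) powr q = 0"
      using integral_nonneg_eq_0_iff_AE[OF iq] by auto
    have "AE x in lborel. indicator E x * norm (f x) powr p = 0"
      using ae by eventually_elim auto
    then have "Ip p f E = 0" unfolding Ip_def by (rule integral_eq_zero_AE)
    then show ?thesis by simp
  next
    case False
    then have Ap: "A > 0" using A0 by simp
    let ?\<alpha> = "p / q"
    have pw: "t powr p \<le> ?\<alpha> * A powr (p - q) * t powr q + (1 - ?\<alpha>) * A powr p" if "t \<ge> 0" for t
    proof (cases "t = 0")
      case True
      then show ?thesis using p Ap by simp
    next
      case False
      then have t: "t > 0" using that by simp
      have "((t / A) powr q) powr ?\<alpha> * 1 powr (1 - ?\<alpha>) \<le> ?\<alpha> * (t / A) powr q + (1 - ?\<alpha>) * 1"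
        by (rule Youngs_inequality_0) (use p q t Ap in auto)
      then have "(t / A) powr p \<le> ?\<alpha> * (t / A) powr q + (1 - ?\<alpha>)" using q by (simp add: powr_powr)
      then have "A powr p * (t / A) powr p \<le> A powr p * (?\<alpha> * (t / A) powr q + (1 - ?\<alpha>))" by (rule mult_left_mono) simp
      moreover have "A powr p * (t / A) powr p = t powr p" using t Ap by (simp add: powr_divide)
      moreover have "A powr p * (t / A) powr q = A powr (p - q) * t powr q" using t Ap by (simp add: powr_divide powr_diff)
      ultimately show ?thesis by (simp add: algebra_simps)
    qed
    have iE: "integrable lborel (indicator E :: real^'n \<Rightarrow> real)"
      using E(1) by (intro integrable_real_indicator) (auto simp: fmeasurable_def)
    have "Ip p f E \<le> (LBINT x. ?\<alpha> * A powr (p - q) * (indicator E x * norm (f x) powr q) + (1 - ?\<alpha>) * A powr p * indicator E x)"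
      unfolding Ip_def
    proof (rule integral_mono[OF ip])
      show "integrable lborel (\<lambda>x. ?\<alpha> * A powr (p - q) * (indicator E x * norm (f x) powr q) + (1 - ?\<alpha>) * A powr p * indicator E x)"
        by (intro integrable_add integrable_mult_right iq iE)
      show "indicator E x * norm (f x) powr p \<le> ?\<alpha> * A powr (p - q) * (indicator E x * norm (f x) powr q) + (1 - ?\<alpha>) * A powr p * indicator E x" for x
        using pw[of "norm (f x)"] by (simp add: indicator_def)
    qed
    also have "\<dots> = ?\<alpha> * A powr (p - q) * Ip q f E + (1 - ?\<alpha>) * A powr p * ?\<mu>"
      by (subst integral_add) (auto intro!: integrable_mult_right iq iE simp: Ip_def)
    also have "\<dots> = ?\<mu> * A powr p"
      using Ap by (simp add: Iq algebra_simps powr_diff)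
    finally show ?thesis .
  qed
  have "av p f E \<le> (A powr p) powr (1 / p)"
    unfolding av_def using Ip Ip_nonneg[of p f E] p E by (intro powr_mono2) (auto simp: pos_divide_le_eq mult.commute)
  also have "\<dots> = A" using p A0 by (simp add: powr_powr)
  finally show ?thesis by (simp add: A_def)
qed

text \<open>At a fixed scale each point lies in boundedly many triples, one for each offset in -1,
  0, 1 per coordinate. Cauchy-Schwarz over the cubes then gives a bound by global norms, uniform in
  the scale; this yields the square-integrable theory of the pieces.\<close>

lemma grid_form_l2:
  fixes f g :: "real^'n::finite \<Rightarrow> complex"
  shows "\<exists>C\<ge>0. \<forall>(f :: real^'n \<Rightarrow> complex) g v Z. bcs f \<longrightarrow> bcs g \<longrightarrow> finite Z \<longrightarrow> grid_form 2 2 f g v Z \<le> C * (l2 f * l2 g)"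
proof -
  define C where "C = real (card {d::int^'n. \<forall>i. d $ i \<in> {-1..1}})"
  have C0: "C \<ge> 0" by (simp add: C_def)
  have ov: "(\<Sum>z\<in>Z. indicator (tcube3 v z) x :: real) \<le> C" if "finite Z" for Z :: "(int^'n) set" and v x
  proof -
    define k where "k = (\<chi> i. \<lfloor>x $ i / 2 powi v\<rfloor>)"
    have "(\<Sum>z\<in>Z. indicator (tcube3 v z) x :: real) = real (card {z\<in>Z. x \<in> tcube3 v z})"
      using that by (simp add: indicator_def sum.If_cases Int_def)
    also have "\<dots> \<le> real (card ((\<lambda>d. k + d) ` {d::int^'n. \<forall>i. d $ i \<in> {-1..1}}))"
    proof (intro of_nat_mono card_mono finite_imageI finite_vec_set finite_atLeastAtMost_int subsetI)
      fix z assume "z \<in> {z\<in>Z. x \<in> tcube3 v z}"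
      then have "\<bar>k $ i - z $ i\<bar> \<le> 1" for i by (simp add: mem_tcube3 k_def)
      then have "z - k \<in> {d::int^'n. \<forall>i. d $ i \<in> {-1..1}}" by (auto simp: abs_le_iff) (smt (verit))+
      then show "z \<in> (\<lambda>d. k + d) ` {d::int^'n. \<forall>i. d $ i \<in> {-1..1}}" by (auto intro!: image_eqI[of _ _ "z - k"])
    qed
    also have "\<dots> \<le> C" unfolding C_def by (intro of_nat_mono card_image_le finite_vec_set finite_atLeastAtMost_int)
    finally show ?thesis .
  qed
  have Isum: "(\<Sum>z\<in>Z. Ip 2 f (tcube3 v z)) \<le> C * (l2 f)\<^sup>2" if f: "bcs f" and Z: "finite Z" for f :: "real^'n \<Rightarrow> complex" and v Z
  proof -
    have "(\<Sum>z\<in>Z. Ip 2 f (tcube3 v z)) = (LBINT x. (\<Sum>z\<in>Z. indicator (tcube3 v z) x * norm (f x) powr 2))"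
      unfolding Ip_def by (rule integral_sum[symmetric]) (rule Ip_integrable[OF f _ tcube_borel(2)], simp)
    also have "\<dots> \<le> (LBINT x. C * (norm (f x))\<^sup>2)"
    proof (rule integral_mono)
      show "integrable lborel (\<lambda>x. \<Sum>z\<in>Z. indicator (tcube3 v z) x * norm (f x) powr 2)"
        by (intro integrable_sum Ip_integrable f tcube_borel) auto
      show "integrable lborel (\<lambda>x. C * (norm (f x))\<^sup>2)" by (intro integrable_mult_right bcs_norm_sq f)
      show "(\<Sum>z\<in>Z. indicator (tcube3 v z) x * norm (f x) powr 2) \<le> C * (norm (f x))\<^sup>2" for x
        using ov[OF Z, of v x] unfolding sum_distrib_right[symmetric] by (simp add: mult_right_mono)
    qed
    also have "\<dots> = C * (l2 f)\<^sup>2" by (simp add: l2_sq)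
    finally show ?thesis .
  qed
  have "grid_form 2 2 f g v Z \<le> C * (l2 f * l2 g)" if f: "bcs f" and g: "bcs g" and Z: "finite Z" for f g :: "real^'n \<Rightarrow> complex" and v Z
  proof -
    let ?a = "\<lambda>z. sqrt (Ip 2 f (tcube3 v z))" and ?b = "\<lambda>z. sqrt (Ip 2 g (tcube3 v z))"
    have t: "vol (tcube 0 v z) * (av 2 f (tcube3 v z) * av 2 g (tcube3 v z)) \<le> ?a z * ?b z" for z :: "int^'n"
    proof -
      let ?m = "vol (tcube3 v z)"
      have m: "?m > 0" "vol (tcube 0 v z) \<le> ?m" by (auto simp: tcube_measure tcube3_measure intro!: power_mono)
      have "av 2 f (tcube3 v z) * av 2 g (tcube3 v z) = ?a z * ?b z / ?m"
        using m Ip_nonneg[of 2 f "tcube3 v z"] Ip_nonneg[of 2 g "tcube3 v z"]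
        by (simp add: av_def powr_half_sqrt real_sqrt_divide)
      then have "vol (tcube 0 v z) * (av 2 f (tcube3 v z) * av 2 g (tcube3 v z)) = (vol (tcube 0 v z) / ?m) * (?a z * ?b z)" by simp
      also have "\<dots> \<le> 1 * (?a z * ?b z)"
        using m Ip_nonneg by (intro mult_right_mono mult_nonneg_nonneg) auto
      finally show ?thesis by simp
    qed
    have "grid_form 2 2 f g v Z \<le> (\<Sum>z\<in>Z. ?a z * ?b z)" unfolding grid_form_def by (intro sum_mono t)
    moreover have "(\<Sum>z\<in>Z. ?a z * ?b z) \<le> C * (l2 f * l2 g)"
    proof (rule power2_le_imp_le)
      have "(\<Sum>z\<in>Z. ?a z * ?b z)\<^sup>2 \<le> (\<Sum>z\<in>Z. (?a z)\<^sup>2) * (\<Sum>z\<in>Z. (?b z)\<^sup>2)" by (rule Cauchy_Schwarz_ineq_sum)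
      also have "\<dots> \<le> (C * (l2 f)\<^sup>2) * (C * (l2 g)\<^sup>2)"
        using Isum[OF f Z, of v] Isum[OF g Z, of v] C0 by (intro mult_mono) (auto simp: Ip_nonneg sum_nonneg)
      also have "\<dots> = (C * (l2 f * l2 g))\<^sup>2" by (simp add: power_mult_distrib power2_eq_square mult_ac)
      finally show "(\<Sum>z\<in>Z. ?a z * ?b z)\<^sup>2 \<le> (C * (l2 f * l2 g))\<^sup>2" .
      show "0 \<le> C * (l2 f * l2 g)" using C0 by (simp add: l2_nonneg)
    qed
    ultimately show ?thesis by linarith
  qed
  then show ?thesis using C0 by blast
qed

section \<open>The pieces and grid forms\<close>

definition cube_index :: "int \<Rightarrow> real^'n::finite \<Rightarrow> int^'n" where
  "cube_index v x = (\<chi> i. \<lfloor>x $ i / 2 powi v\<rfloor>)"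

lemma cube_index_iff: "x \<in> tcube 0 v z \<longleftrightarrow> z = cube_index v x"
  by (auto simp: mem_tcube cube_index_def vec_eq_iff)

lemma cube_index_mem: "x \<in> tcube 0 v (cube_index v x)"
  by (simp add: cube_index_iff)

lemma tcube3_sup_dist:
  assumes "x \<in> tcube 0 v z" "y \<notin> tcube3 v z"
  shows "\<exists>i. \<bar>x $ i - y $ i\<bar> \<ge> 2 powi v"
proof -
  have p: "(2::real) powi v > 0" by simp
  obtain i where i: "\<not> \<bar>\<lfloor>y $ i / 2 powi v\<rfloor> - z $ i\<bar> \<le> 1" using assms(2) by (auto simp: mem_tcube3)
  have "z $ i = \<lfloor>x $ i / 2 powi v\<rfloor>" using assms(1) by (simp add: mem_tcube)
  then have "\<bar>x $ i / 2 powi v - y $ i / 2 powi v\<bar> \<ge> 1" using i by linarith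
  then have "\<bar>x $ i - y $ i\<bar> / 2 powi v \<ge> 1" using p by (simp add: diff_divide_distrib[symmetric])
  then show ?thesis using p by (auto simp: pos_le_divide_eq)
qed

lemma near_sub_tcube3:
  assumes "\<And>i. \<bar>x $ i - y $ i\<bar> < 2 powi u"
  shows "y \<in> tcube3 u (cube_index u x)"
proof -
  have p: "(2::real) powi u > 0" by simp
  have "\<bar>\<lfloor>y $ i / 2 powi u\<rfloor> - \<lfloor>x $ i / 2 powi u\<rfloor>\<bar> \<le> 1" for i
  proof -
    have "\<bar>x $ i / 2 powi u - y $ i / 2 powi u\<bar> < 1" using assms[of i] p by (simp add: diff_divide_distrib[symmetric])
    then show ?thesis by linarith
  qed
  then show ?thesis by (simp add: mem_tcube3 cube_index_def)
qed

context pdo_symbol begin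

lemma kern_borel[measurable]: "(\<lambda>p. kern j (fst p) (snd p)) \<in> borel_measurable (borel \<Otimes>\<^sub>M borel)"
proof -
  have "(\<lambda>(p, \<xi>). cis ((fst p - snd p) \<bullet> \<xi>) * (complex_of_real (psi j \<xi>) * a (fst p, \<xi>))) \<in> borel_measurable ((borel \<Otimes>\<^sub>M borel) \<Otimes>\<^sub>M lborel)"
    by measurable
  then show ?thesis unfolding kern_def by (rule lborel.borel_measurable_lebesgue_integral)
qed

lemma kern_borel2[measurable]: "kern j x \<in> borel_measurable borel"
  using measurable_compose[OF measurable_Pair1'[of x borel borel] kern_borel[of j]] by simp

lemma kern_bounded: "\<exists>C\<ge>0. \<forall>x y. norm (kern j x y) \<le> C"
proof -
  obtain C where C: "C \<ge> 0" "\<And>i j x y. \<bar>x $ i - y $ i\<bar> ^ 0 * norm (kern j x y) \<le> C * 2 powr (real j * (m + real CARD('n) - \<rho> * real 0))"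
    using kern_decay[of 0] by metis
  then show ?thesis by (intro exI[of _ "C * 2 powr (real j * (m + real CARD('n)))"]) auto
qed

lemma kern_bcs_integrable: "bcs f \<Longrightarrow> integrable lborel (\<lambda>y. kern j x y * f y)"
proof -
  assume f: "bcs f"
  obtain C where "\<And>x y. norm (kern j x y) \<le> C" using kern_bounded by metis
  then have "bcs (\<lambda>y. kern j x y * f y)" by (intro bcs_mult[OF f, of _ C]) auto
  then show ?thesis by (rule bcs_integrable)
qed

lemma piece_add: "bcs f \<Longrightarrow> bcs g \<Longrightarrow> (\<And>x. h x = f x + g x) \<Longrightarrow> piece j h x = piece j f x + piece j g x"
  unfolding piece_def by (simp add: distrib_left integral_add kern_bcs_integrable)

lemma piece_borel: "f \<in> borel_measurable borel \<Longrightarrow> piece j f \<in> borel_measurable borel"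
proof -
  assume [measurable]: "f \<in> borel_measurable borel"
  have "(\<lambda>(x, y). kern j x y * f y) \<in> borel_measurable (borel \<Otimes>\<^sub>M lborel)"
  proof -
    have "(\<lambda>p. kern j (fst p) (snd p) * f (snd p)) \<in> borel_measurable (borel \<Otimes>\<^sub>M borel)" by measurable
    then show ?thesis by (simp add: split_beta' cong: measurable_cong_sets)
  qed
  then show ?thesis unfolding piece_def[abs_def] by (rule lborel.borel_measurable_lebesgue_integral)
qed

lemma piece_bounded: "bcs f \<Longrightarrow> \<exists>C\<ge>0. \<forall>x. norm (piece j f x) \<le> C"
proof -
  assume f: "bcs f"
  obtain C where C: "C \<ge> 0" "\<And>x y. norm (kern j x y) \<le> C" using kern_bounded by metis
  have "norm (piece j f x) \<le> C * l1 f" for x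
  proof -
    have "norm (piece j f x) \<le> (LBINT y. norm (kern j x y * f y))" unfolding piece_def by (rule integral_norm_bound)
    also have "\<dots> \<le> (LBINT y. C * norm (f y))"
      by (rule integral_mono') (use C bcs_integrable[OF f] in \<open>auto simp: norm_mult intro!: mult_right_mono\<close>)
    finally show ?thesis by (simp add: l1_def)
  qed
  then show ?thesis using C by (intro exI[of _ "C * l1 f"]) (auto simp: l1_nonneg)
qed

lemma piece_pair_bcs: "bcs f \<Longrightarrow> bcs w \<Longrightarrow> bcs (\<lambda>x. piece j f x * w x)"
proof -
  assume f: "bcs f" and w: "bcs w"
  obtain C where "\<And>x. norm (piece j f x) \<le> C" using piece_bounded[OF f] by metis
  then show ?thesis by (intro bcs_mult[OF w, of _ C] piece_borel bcs_measurable[OF f]) auto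
qed

text \<open>Both functions are split by \<open>level_split\<close> with
  \<open>S = 2 powr (j * n / 2)\<close>, and each of the four products obeys the same bound. The
  number \<open>H = S\<^sup>2 * \<mu>\<close> compares the cube with the volume
  \<open>2 powr (- j * n)\<close> of a wave cell. The two splittings contribute
  \<open>1 / p - 1 / 2\<close> and \<open>1 / q - 1 / 2\<close> to its exponent, which is the origin
  of \<open>1 / p + 1 / q - 1\<close>.\<close>

lemma near_cube:
  assumes r: "0 < r" "r \<le> \<rho>" and p: "1 \<le> p" "p \<le> 2" and q: "1 \<le> q" "q \<le> 2"
  shows "\<exists>C\<ge>0. \<forall>j f g v z. bcs f \<longrightarrow> bcs g \<longrightarrow> 2 powi v \<le> 2 * 2 powr (- (real j * r)) \<longrightarrow>
    norm (LBINT x. piece j (\<lambda>y. indicator (tcube3 v z) y * f y) x * (indicator (tcube 0 v z) x * g x))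
     \<le> C * 2 powr (real j * (m + real CARD('n) * (\<rho> - r) + real CARD('n) * (1 - r) * (1 / p + 1 / q - 1)))
        * (vol (tcube 0 v z) * (av p f (tcube3 v z) * av q g (tcube3 v z)))"
proof -
  let ?n = "real CARD('n)"
  obtain C where C0: "C \<ge> 0" and Call: "\<forall>j u w c l. bcs u \<longrightarrow> bcs w \<longrightarrow> l > 0 \<longrightarrow> l \<le> 2 * 2 powr (- (real j * r)) \<longrightarrow> (\<forall>x. w x \<noteq> 0 \<longrightarrow> x \<in> ccube c l) \<longrightarrow>
    norm (LBINT x. piece j u x * w x) \<le> C * 2 powr (real j * (m + ?n * (\<rho> - r)))
      * min (l2 u) (2 powr (real j * ?n / 2) * l1 u) * min (l2 w) (2 powr (real j * ?n / 2) * l1 w)"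
    using near_bilinear[OF r(2)] by (elim exE conjE) (rule that)
  note C = C0 Call[rule_format]
  define e where "e = 1 / p + 1 / q - 1"
  have e: "0 \<le> e" "e \<le> 1"
  proof -
    have "1 / p \<ge> 1 / 2" "1 / q \<ge> 1 / 2" "1 / p \<le> 1" "1 / q \<le> 1" using p q by (auto simp: field_simps)
    then show "0 \<le> e" "e \<le> 1" by (auto simp: e_def)
  qed
  define D where "D = 4 * C * 6 ^ CARD('n) * 3 ^ CARD('n)"
  have main: "norm (LBINT x. piece j (\<lambda>y. indicator (tcube3 v z) y * f y) x * (indicator (tcube 0 v z) x * g x))
     \<le> D * 2 powr (real j * (m + ?n * (\<rho> - r) + ?n * (1 - r) * e))
        * (vol (tcube 0 v z) * (av p f (tcube3 v z) * av q g (tcube3 v z)))"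
    if f: "bcs f" and g: "bcs g" and v: "2 powi v \<le> 2 * 2 powr (- (real j * r))" for j f g v and z :: "int^'n"
  proof -
    define E where "E = tcube3 v z"
    define l where "l = (2 powi v :: real)"
    have l: "l > 0" by (simp add: l_def)
    have Eb: "E \<in> sets borel" by (simp add: E_def tcube_borel)
    define \<mu> where "\<mu> = vol E"
    have \<mu>: "\<mu> = (3 * l) ^ CARD('n)" by (simp add: \<mu>_def E_def tcube3_measure l_def)
    have \<mu>0: "\<mu> > 0" using l by (simp add: \<mu>)
    define S where "S = 2 powr (real j * ?n / 2)"
    have S0: "S > 0" by (simp add: S_def)
    define H where "H = S\<^sup>2 * \<mu>"
    have H0: "H > 0" using S0 \<mu>0 by (simp add: H_def)
    define F where "F = (\<lambda>y. indicator E y * f y)"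
    define G where "G = (\<lambda>x. indicator (tcube 0 v z) x * g x)"
    have Fb: "bcs F" unfolding F_def by (rule bcs_indicator[OF f Eb])
    have Gb: "bcs G" unfolding G_def by (rule bcs_indicator[OF g tcube_borel(1)])
    have GE: "x \<in> E" if "G x \<noteq> 0" for x using that tcube_sub_tcube3 by (auto simp: G_def E_def indicator_def split: if_splits)
    have FE: "x \<in> E" if "F x \<noteq> 0" for x using that by (auto simp: F_def indicator_def split: if_splits)
    obtain f1 f2 where f12: "bcs f1" "bcs f2" "\<And>x. F x = f1 x + f2 x" "\<And>x. F x = 0 \<Longrightarrow> f1 x = 0" "\<And>x. F x = 0 \<Longrightarrow> f2 x = 0"
      "S * l1 f1 \<le> sqrt \<mu> * H powr (1 / p - 1 / 2) * av p F E" "l2 f2 \<le> sqrt \<mu> * H powr (1 / p - 1 / 2) * av p F E"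
    proof (rule level_split[OF Fb p Eb \<mu>0[unfolded \<mu>_def] _ S0])
      show "x \<in> E" if "F x \<noteq> 0" for x by (rule FE[OF that])
    qed (rule that, assumption+, unfold H_def \<mu>_def, assumption+)
    obtain g1 g2 where g12: "bcs g1" "bcs g2" "\<And>x. G x = g1 x + g2 x" "\<And>x. G x = 0 \<Longrightarrow> g1 x = 0" "\<And>x. G x = 0 \<Longrightarrow> g2 x = 0"
      "S * l1 g1 \<le> sqrt \<mu> * H powr (1 / q - 1 / 2) * av q G E" "l2 g2 \<le> sqrt \<mu> * H powr (1 / q - 1 / 2) * av q G E"
    proof (rule level_split[OF Gb q Eb \<mu>0[unfolded \<mu>_def] _ S0])
      show "x \<in> E" if "G x \<noteq> 0" for x by (rule GE[OF that])
    qed (rule that, assumption+, unfold H_def \<mu>_def, assumption+)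
    define \<alpha> where "\<alpha> = sqrt \<mu> * H powr (1 / p - 1 / 2) * av p F E"
    define \<beta> where "\<beta> = sqrt \<mu> * H powr (1 / q - 1 / 2) * av q G E"
    have ab0: "\<alpha> \<ge> 0" "\<beta> \<ge> 0" using \<mu>0 by (auto simp: \<alpha>_def \<beta>_def av_nonneg)
    have mf: "min (l2 h) (S * l1 h) \<le> \<alpha>" if "h \<in> {f1, f2}" for h
      using that f12(6,7) by (auto simp: \<alpha>_def min_le_iff_disj)
    have mg: "min (l2 h) (S * l1 h) \<le> \<beta>" if "h \<in> {g1, g2}" for h
      using that g12(6,7) by (auto simp: \<beta>_def min_le_iff_disj)
    let ?M = "2 powr (real j * (m + ?n * (\<rho> - r)))"
    have Gc: "x \<in> ccube (\<chi> i. 0 + 2 powi v * real_of_int (z $ i)) l" if "G x \<noteq> 0" for x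
    proof -
      have "x \<in> tcube 0 v z" using that by (auto simp: G_def indicator_def split: if_splits)
      then show ?thesis by (auto simp: tcube_def half_open_cube_def l_def less_imp_le)
    qed
    have pr: "norm (LBINT x. piece j h x * k x) \<le> C * ?M * \<alpha> * \<beta>" if h: "h \<in> {f1, f2}" and k: "k \<in> {g1, g2}" for h k
    proof -
      have hk: "bcs h" "bcs k" using h k f12 g12 by auto
      have "norm (LBINT x. piece j h x * k x) \<le> C * ?M * min (l2 h) (S * l1 h) * min (l2 k) (S * l1 k)"
        unfolding S_def
      proof (rule C(2)[OF hk l])
        show "l \<le> 2 * 2 powr (- (real j * r))" using v by (simp add: l_def)
        show "x \<in> ccube (\<chi> i. 0 + 2 powi v * real_of_int (z $ i)) l" if "k x \<noteq> 0" for x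
          using Gc[of x] that k g12(4,5)[of x] by blast
      qed
      also have "\<dots> \<le> C * ?M * \<alpha> * \<beta>"
        using C(1) ab0 mf[OF h] mg[OF k] S0 by (intro mult_mono) (auto simp: l1_nonneg l2_nonneg)
      finally show ?thesis .
    qed
    have dec: "(LBINT x. piece j F x * G x) = ((LBINT x. piece j f1 x * g1 x) + (LBINT x. piece j f1 x * g2 x)) + ((LBINT x. piece j f2 x * g1 x) + (LBINT x. piece j f2 x * g2 x))"
    proof -
      have i: "integrable lborel (\<lambda>x. piece j h x * k x)" if "bcs h" "bcs k" for h k by (rule bcs_integrable[OF piece_pair_bcs[OF that]])
      have "(LBINT x. piece j F x * G x) = (LBINT x. (piece j f1 x * g1 x + piece j f1 x * g2 x) + (piece j f2 x * g1 x + piece j f2 x * g2 x))"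
        by (intro integral_cong refl) (simp add: piece_add[OF f12(1,2,3)] g12(3) algebra_simps)
      also have "\<dots> = ((LBINT x. piece j f1 x * g1 x) + (LBINT x. piece j f1 x * g2 x)) + ((LBINT x. piece j f2 x * g1 x) + (LBINT x. piece j f2 x * g2 x))"
        by (simp add: integral_add i f12(1,2) g12(1,2))
      finally show ?thesis .
    qed
    have "norm (LBINT x. piece j F x * G x) \<le> (C * ?M * \<alpha> * \<beta> + C * ?M * \<alpha> * \<beta>) + (C * ?M * \<alpha> * \<beta> + C * ?M * \<alpha> * \<beta>)"
      unfolding dec by (intro norm_triangle_mono pr) auto
    also have "\<dots> = 4 * C * ?M * (\<alpha> * \<beta>)" by simp
    also have "\<alpha> * \<beta> = (\<mu> * H powr e) * (av p F E * av q G E)"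
    proof -
      have "\<alpha> * \<beta> = (sqrt \<mu> * sqrt \<mu>) * (H powr (1 / p - 1 / 2) * H powr (1 / q - 1 / 2)) * (av p F E * av q G E)"
        by (simp add: \<alpha>_def \<beta>_def mult_ac)
      also have "H powr (1 / p - 1 / 2) * H powr (1 / q - 1 / 2) = H powr e"
        by (simp add: powr_add[symmetric] e_def)
      finally show ?thesis using \<mu>0 by simp
    qed
    finally have b1: "norm (LBINT x. piece j F x * G x) \<le> 4 * C * ?M * ((\<mu> * H powr e) * (av p F E * av q G E))" .
    have avF: "av p F E \<le> av p f E" "av q G E \<le> av q g E"
    proof -
      have "norm (F x) \<le> norm (f x)" "norm (G x) \<le> norm (g x)" for x by (auto simp: F_def G_def indicator_def)
      then have "Ip p F E \<le> Ip p f E" "Ip q G E \<le> Ip q g E"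
        unfolding Ip_def using p q Fb f Gb g Eb
        by (auto intro!: integral_mono Ip_integrable mult_left_mono powr_mono2)
      then show "av p F E \<le> av p f E" "av q G E \<le> av q g E"
        unfolding av_def using p q Ip_nonneg by (auto intro!: powr_mono2 divide_right_mono divide_nonneg_nonneg)
    qed
    \<comment> \<open>The side is at most \<open>2 * 2 powr (- j * r)\<close>, so its triple is at
      most \<open>6 * 2 powr (- j * r)\<close>; multiplied by \<open>S\<^sup>2\<close> this leaves
      \<open>2 powr (j * n * (1 - r))\<close>.\<close>
    have Hb: "H powr e \<le> 6 ^ CARD('n) * 2 powr (real j * (?n * (1 - r) * e))"
    proof -
      have "3 * l \<le> 6 * 2 powr (- (real j * r))" using v by (simp add: l_def)
      then have "\<mu> \<le> (6 * 2 powr (- (real j * r))) ^ CARD('n)" unfolding \<mu> using l by (intro power_mono) auto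
      also have "\<dots> = 6 ^ CARD('n) * 2 powr (- (real j * r * ?n))" by (simp add: power_mult_distrib powr_power mult_ac)
      finally have "H \<le> S\<^sup>2 * (6 ^ CARD('n) * 2 powr (- (real j * r * ?n)))" unfolding H_def by (intro mult_left_mono) auto
      also have "S\<^sup>2 = 2 powr (real j * ?n)" by (simp add: S_def powr_power)
      also have "2 powr (real j * ?n) * (6 ^ CARD('n) * 2 powr (- (real j * r * ?n))) = 6 ^ CARD('n) * 2 powr (real j * (?n * (1 - r)))"
        by (simp add: powr_add[symmetric] algebra_simps)
      finally have "H powr e \<le> (6 ^ CARD('n) * 2 powr (real j * (?n * (1 - r)))) powr e" using H0 e by (intro powr_mono2) auto
      also have "\<dots> = (6 ^ CARD('n)) powr e * 2 powr (real j * (?n * (1 - r) * e))"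
        by (simp add: powr_mult powr_powr mult.assoc)
      also have "(6 ^ CARD('n) :: real) powr e \<le> (6 ^ CARD('n)) powr 1" using e by (intro powr_mono) auto
      finally show ?thesis by (simp add: mult_right_mono)
    qed
    have "norm (LBINT x. piece j F x * G x) \<le> 4 * C * ?M * ((\<mu> * (6 ^ CARD('n) * 2 powr (real j * (?n * (1 - r) * e)))) * (av p f E * av q g E))"
    proof (rule order_trans[OF b1])
      have "\<mu> * H powr e \<le> \<mu> * (6 ^ CARD('n) * 2 powr (real j * (?n * (1 - r) * e)))" using Hb \<mu>0 by (intro mult_left_mono) auto
      moreover have "av p F E * av q G E \<le> av p f E * av q g E" by (intro mult_mono avF) (auto simp: av_nonneg)
      ultimately have "(\<mu> * H powr e) * (av p F E * av q G E) \<le> (\<mu> * (6 ^ CARD('n) * 2 powr (real j * (?n * (1 - r) * e)))) * (av p f E * av q g E)"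
        using \<mu>0 by (intro mult_mono[where c="av p F E * av q G E"]) (simp_all only: mult_nonneg_nonneg av_nonneg less_imp_le powr_ge_zero, auto)
      then show "4 * C * ?M * ((\<mu> * H powr e) * (av p F E * av q G E)) \<le> 4 * C * ?M * ((\<mu> * (6 ^ CARD('n) * 2 powr (real j * (?n * (1 - r) * e)))) * (av p f E * av q g E))"
        using C(1) by (intro mult_left_mono) auto
    qed
    also have "\<mu> = 3 ^ CARD('n) * vol (tcube 0 v z)" by (simp add: \<mu> tcube_measure l_def power_mult_distrib)
    also have "4 * C * ?M * ((3 ^ CARD('n) * vol (tcube 0 v z) * (6 ^ CARD('n) * 2 powr (real j * (?n * (1 - r) * e)))) * (av p f E * av q g E))
       = D * (?M * 2 powr (real j * (?n * (1 - r) * e))) * (vol (tcube 0 v z) * (av p f E * av q g E))"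
      by (simp add: D_def mult_ac)
    also have "?M * 2 powr (real j * (?n * (1 - r) * e)) = 2 powr (real j * (m + ?n * (\<rho> - r) + ?n * (1 - r) * e))"
      by (simp add: powr_add[symmetric] algebra_simps)
    finally show ?thesis by (simp add: F_def G_def E_def)
  qed
  have "D \<ge> 0" using C by (simp add: D_def)
  then show ?thesis using main unfolding e_def by (intro exI[of _ D]) blast
qed

end

section \<open>The part of a function far from the cube\<close>

lemma finite_cube_index: 
  assumes "bcs (w :: real^'n::finite \<Rightarrow> complex)"
  shows "finite (cube_index u ` {x. w x \<noteq> 0})"
proof -
  obtain R where R: "\<And>x. w x \<noteq> 0 \<Longrightarrow> norm x \<le> R" using bcs_support[OF assms] by metis
  have "cube_index u ` {x. w x \<noteq> 0} \<subseteq> {z. \<forall>i. z $ i \<in> {- \<lceil>R / 2 powi u\<rceil> - 1..\<lceil>R / 2 powi u\<rceil> + 1}}"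
  proof clarify
    fix x i assume "w x \<noteq> 0"
    then have "\<bar>x $ i\<bar> \<le> R" using R[of x] component_le_norm_cart[of x i] by linarith
    then have "- R / 2 powi u \<le> x $ i / 2 powi u" "x $ i / 2 powi u \<le> R / 2 powi u" by (intro divide_right_mono; simp)+
    then show "cube_index u x $ i \<in> {- \<lceil>R / 2 powi u\<rceil> - 1..\<lceil>R / 2 powi u\<rceil> + 1}" by (simp add: cube_index_def) linarith
  qed
  then show ?thesis by (rule finite_subset) (intro finite_vec_set finite_atLeastAtMost_int)
qed

context pdo_symbol begin

text \<open>Beyond distance \<open>2 powr (- j * r)\<close>, each order of decay gains
  \<open>2 powr (- j * (\<rho> - r))\<close>, so a large order beats any prescribed
  \<open>A\<close>. This is the place where \<open>r < \<rho>\<close> is indispensable for the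
  argument.\<close>

lemma far_kernel:
  assumes r: "0 < r" "r < \<rho>"
  shows "\<exists>C\<ge>0. \<forall>j v i x y. 2 powr (- (real j * r)) \<le> 2 powi v \<longrightarrow> (\<exists>k. 2 ^ i * 2 powi v \<le> \<bar>x $ k - y $ k\<bar>) \<longrightarrow>
    norm (kern j x y) \<le> C * 2 powr (- (real j * A)) * (1 / 2) ^ i / (2 ^ i * 2 powi v) ^ CARD('n)"
proof -
  let ?n = "real CARD('n)"
  obtain N0 :: nat where N0: "(m + ?n * (1 - r) + A) / (\<rho> - r) \<le> real N0" using real_arch_simple by blast
  \<comment> \<open>The n powers normalise by the volume of the ring, one more provides
    \<open>(1 / 2) ^ i\<close>, and \<open>N0\<close> provides the decay in
    \<open>j\<close>.\<close>
  define N where "N = N0 + CARD('n) + 1"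
  have NA: "m + ?n * (1 - r) - (\<rho> - r) * real N \<le> - A"
  proof -
    have "m + ?n * (1 - r) + A \<le> real N0 * (\<rho> - r)" using N0 r by (simp add: pos_divide_le_eq)
    also have "\<dots> \<le> real N * (\<rho> - r)" using r by (intro mult_right_mono) (auto simp: N_def)
    finally show ?thesis by (simp add: algebra_simps)
  qed
  obtain C where C0: "C \<ge> 0" and Call: "\<forall>i j x y. \<bar>x $ i - y $ i\<bar> ^ N * norm (kern j x y) \<le> C * 2 powr (real j * (m + ?n - \<rho> * real N))"
    using kern_decay[of N] by (elim exE conjE) (rule that)
  show ?thesis
  proof (intro exI[of _ C] conjI C0 allI impI)
    fix j i :: nat and v :: int and x y :: "real^'n"
    assume v: "2 powr (- (real j * r)) \<le> (2 powi v :: real)" and "\<exists>k. 2 ^ i * 2 powi v \<le> \<bar>x $ k - y $ k\<bar>"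
    then obtain k where k: "2 ^ i * 2 powi v \<le> \<bar>x $ k - y $ k\<bar>" by blast
    define l where "l = (2 powi v :: real)"
    define d where "d = 2 ^ i * l"
    have l: "l > 0" by (simp add: l_def)
    have d: "d > 0" using l by (simp add: d_def)
    have il: "inverse l \<le> 2 powr (real j * r)"
      using v l unfolding l_def[symmetric] by (simp add: powr_minus field_simps)
    define M where "M = N0 + 1"
    have NM: "N = CARD('n) + M" by (simp add: N_def M_def)
    have "inverse (d ^ M) \<le> (1 / 2) ^ i * 2 powr (real j * r * real M)"
    proof -
      have "inverse (d ^ M) = ((1 / 2) ^ i) ^ M * (inverse l) ^ M" by (simp add: d_def power_mult_distrib power_inverse power_one_over inverse_eq_divide)
      also have "\<dots> \<le> (1 / 2) ^ i * (2 powr (real j * r)) ^ M"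
      proof (intro mult_mono power_mono il)
        have "((1 / 2 :: real) ^ i) ^ M \<le> ((1 / 2) ^ i) ^ 1" by (rule power_decreasing) (auto simp: M_def power_le_one)
        then show "((1 / 2 :: real) ^ i) ^ M \<le> (1 / 2) ^ i" by simp
      qed (use l in auto)
      finally show ?thesis by (simp add: powr_power mult_ac)
    qed
    note dM = this
    have "d ^ N * norm (kern j x y) \<le> \<bar>x $ k - y $ k\<bar> ^ N * norm (kern j x y)"
      using k d by (intro mult_right_mono power_mono) (auto simp: d_def l_def)
    also have "\<dots> \<le> C * 2 powr (real j * (m + ?n - \<rho> * real N))" using Call by blast
    finally have "norm (kern j x y) \<le> C * 2 powr (real j * (m + ?n - \<rho> * real N)) * inverse (d ^ M) / d ^ CARD('n)"
      using d by (simp add: NM power_add field_simps)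
    also have "\<dots> \<le> C * 2 powr (real j * (m + ?n - \<rho> * real N)) * ((1 / 2) ^ i * 2 powr (real j * r * real M)) / d ^ CARD('n)"
      using dM C0 d by (intro divide_right_mono mult_left_mono) auto
    also have "\<dots> = C * 2 powr (real j * (m + ?n * (1 - r) - (\<rho> - r) * real N)) * (1 / 2) ^ i / d ^ CARD('n)"
    proof -
      have "2 powr (real j * (m + ?n - \<rho> * real N)) * 2 powr (real j * r * real M) = 2 powr (real j * (m + ?n * (1 - r) - (\<rho> - r) * real N))"
        by (simp add: powr_add[symmetric] NM algebra_simps)
      then show ?thesis by (simp add: mult_ac)
    qed
    also have "\<dots> \<le> C * 2 powr (real j * (- A)) * (1 / 2) ^ i / d ^ CARD('n)"
      using NA C0 d by (intro divide_right_mono mult_right_mono mult_left_mono powr_mono mult_left_mono) auto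
    finally show "norm (kern j x y) \<le> C * 2 powr (- (real j * A)) * (1 / 2) ^ i / (2 ^ i * 2 powi v) ^ CARD('n)"
      by (simp add: d_def l_def)
  qed
qed

text \<open>Points \<open>y\<close> outside the triple are sorted into dyadic rings around
  \<open>x\<close>. A ring of radius below \<open>2 ^ (i + 1) * 2 powi v\<close> lies in the triple
  of the grid cube around \<open>x\<close> at scale \<open>v + i + 1\<close>. The number
  \<open>I\<close> is any ring count that exhausts the support of \<open>f\<close>; the constant is
  independent of it.\<close>

lemma far_pointwise:
  assumes r: "0 < r" "r < \<rho>"
  shows "\<exists>C\<ge>0. \<forall>j v f x I. 2 powr (- (real j * r)) \<le> 2 powi v \<longrightarrow> bcs f \<longrightarrow>
    (\<forall>y k. f y \<noteq> 0 \<longrightarrow> \<bar>x $ k - y $ k\<bar> < 2 ^ I * 2 powi v) \<longrightarrow>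
    norm (piece j (\<lambda>y. indicator (- tcube3 v (cube_index v x)) y * f y) x)
     \<le> (\<Sum>i<I. C * 2 powr (- (real j * A)) * (1 / 2) ^ i / (2 ^ i * 2 powi v) ^ CARD('n) * Ip 1 f (tcube3 (v + int i + 1) (cube_index (v + int i + 1) x)))"
  using far_kernel[OF r, of A]
proof (elim exE conjE, goal_cases)
  case (1 C)
  note C0 = 1(1) and Call = 1(2)
  note C = Call[rule_format]
  show ?thesis
  proof (intro exI[of _ C] conjI C0 allI impI)
    fix j I :: nat and v :: int and f :: "real^'n \<Rightarrow> complex" and x :: "real^'n"
    assume v: "2 powr (- (real j * r)) \<le> (2 powi v :: real)" and f: "bcs f"
      and I: "\<forall>y k. f y \<noteq> 0 \<longrightarrow> \<bar>x $ k - y $ k\<bar> < 2 ^ I * 2 powi v"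
    define \<beta> where "\<beta> = (\<lambda>i. C * 2 powr (- (real j * A)) * (1 / 2) ^ i / (2 ^ i * 2 powi v) ^ CARD('n))"
    have \<beta>0: "\<beta> i \<ge> 0" for i using C0 by (simp add: \<beta>_def)
    define E where "E = (\<lambda>i. tcube3 (v + int i + 1) (cube_index (v + int i + 1) x))"
    have Eb[measurable]: "E i \<in> sets borel" for i by (simp add: E_def tcube_borel)
    define F where "F = (\<lambda>y. indicator (- tcube3 v (cube_index v x)) y * f y)"
    have F: "bcs F" unfolding F_def by (rule bcs_indicator[OF f]) (simp add: tcube_borel)
    have p2: "(2::real) powi (v + int i + 1) = 2 ^ (i + 1) * 2 powi v" for i
      by (simp add: power_int_add)
    have pw: "norm (kern j x y * F y) \<le> (\<Sum>i<I. \<beta> i * (indicator (E i) y * norm (f y) powr 1))" for y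
    proof (cases "F y = 0")
      case True
      then show ?thesis by (simp add: \<beta>0 sum_nonneg)
    next
      case False
      then have y: "f y \<noteq> 0" "y \<notin> tcube3 v (cube_index v x)" "F y = f y" by (auto simp: F_def indicator_def split: if_splits)
      obtain k0 where k0: "\<bar>x $ k0 - y $ k0\<bar> \<ge> 2 powi v" using tcube3_sup_dist[OF cube_index_mem y(2)] by blast
      define P where "P = (\<lambda>i. \<forall>k. \<bar>x $ k - y $ k\<bar> < 2 ^ i * 2 powi v)"
      have PI: "P I" using I y(1) by (simp add: P_def)
      have P0: "\<not> P 0" using k0 by (auto simp: P_def not_less)
      \<comment> \<open>The first radius that reaches \<open>y\<close>. It is not the 0th, because
        \<open>y\<close> lies outside the triple, so the previous radius still fails and gives the
        lower bound for the kernel estimate.\<close>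
      define L where "L = (LEAST i. P i)"
      have L: "P L" unfolding L_def by (rule LeastI[of P, OF PI])
      have L0: "L \<noteq> 0" using L P0 by metis
      have LI: "L \<le> I" unfolding L_def by (rule Least_le[of P, OF PI])
      define i where "i = L - 1"
      have i: "Suc i = L" "i < I" using L0 LI by (auto simp: i_def)
      have "\<not> P i" using not_less_Least[of i P] i by (simp add: L_def[symmetric])
      then have ex: "\<exists>k. 2 ^ i * 2 powi v \<le> \<bar>x $ k - y $ k\<bar>" by (auto simp: P_def not_less)
      have LS: "P (Suc i)" using L i(1) by simp
      have yE: "y \<in> E i" unfolding E_def by (rule near_sub_tcube3) (use LS in \<open>simp add: p2 P_def\<close>)
      have "norm (kern j x y) \<le> \<beta> i" using C[OF v ex] by (simp add: \<beta>_def)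
      then have "norm (kern j x y * F y) \<le> \<beta> i * (indicator (E i) y * norm (f y) powr 1)"
        using yE y by (simp add: norm_mult mult_right_mono)
      also have "\<dots> \<le> (\<Sum>i<I. \<beta> i * (indicator (E i) y * norm (f y) powr 1))"
        by (rule member_le_sum) (use i \<beta>0 in auto)
      finally show ?thesis .
    qed
    have "norm (piece j F x) \<le> (LBINT y. norm (kern j x y * F y))" unfolding piece_def by (rule integral_norm_bound)
    also have "\<dots> \<le> (LBINT y. (\<Sum>i<I. \<beta> i * (indicator (E i) y * norm (f y) powr 1)))"
    proof (rule integral_mono[OF integrable_norm[OF kern_bcs_integrable[OF F]] _ pw])
      show "integrable lborel (\<lambda>y. \<Sum>i<I. \<beta> i * (indicator (E i) y * norm (f y) powr 1))"
        by (intro integrable_sum integrable_mult_right Ip_integrable f Eb) auto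
    qed
    also have "\<dots> = (\<Sum>i<I. LBINT y. \<beta> i * (indicator (E i) y * norm (f y) powr 1))"
      by (intro integral_sum integrable_mult_right Ip_integrable f Eb) auto
    also have "\<dots> = (\<Sum>i<I. \<beta> i * Ip 1 f (E i))" unfolding Ip_def by simp
    finally show "norm (piece j (\<lambda>y. indicator (- tcube3 v (cube_index v x)) y * f y) x)
     \<le> (\<Sum>i<I. C * 2 powr (- (real j * A)) * (1 / 2) ^ i / (2 ^ i * 2 powi v) ^ CARD('n) * Ip 1 f (tcube3 (v + int i + 1) (cube_index (v + int i + 1) x)))"
      by (simp add: F_def \<beta>_def E_def)
  qed
qed

end

lemma Ip_grid_form_bound:
  fixes f w :: "real^'n::finite \<Rightarrow> complex"
  assumes f: "bcs f" and w: "bcs w" and p: "1 \<le> p" and q: "1 \<le> q"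
  shows "(\<Sum>z\<in>Z. Ip 1 f (tcube3 u z) * Ip 1 w (tcube 0 u z)) \<le> 9 ^ CARD('n) * (2 powi u) ^ CARD('n) * grid_form p q f w u Z"
proof -
  have "Ip 1 f (tcube3 u z) * Ip 1 w (tcube 0 u z) \<le> 9 ^ CARD('n) * (2 powi u) ^ CARD('n) * (vol (tcube 0 u z) * (av p f (tcube3 u z) * av q w (tcube3 u z)))" for z :: "int^'n"
  proof -
    let ?E = "tcube3 u z"
    have \<mu>: "vol ?E > 0" by (simp add: tcube3_measure)
    have fm: "?E \<in> fmeasurable lborel" unfolding tcube3_def by (rule fmeasurable_half_open_cube)
    have I: "Ip 1 h ?E = vol ?E * av 1 h ?E" for h :: "real^'n \<Rightarrow> complex"
      using \<mu> Ip_nonneg[of 1 h ?E] by (simp add: av_def)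
    have m: "Ip 1 w (tcube 0 u z) \<le> Ip 1 w ?E"
      by (rule Ip_mono[OF w]) (use tcube_sub_tcube3 in \<open>auto simp: tcube_borel\<close>)
    have "Ip 1 f ?E * Ip 1 w (tcube 0 u z) \<le> (vol ?E * av 1 f ?E) * (vol ?E * av 1 w ?E)"
      using m unfolding I[symmetric] by (intro mult_left_mono Ip_nonneg)
    also have "\<dots> \<le> (vol ?E * av p f ?E) * (vol ?E * av q w ?E)"
      using av_mono_exponent[OF f _ p fm \<mu>] av_mono_exponent[OF w _ q fm \<mu>] \<mu>
      by (intro mult_mono mult_left_mono) (auto simp: av_nonneg)
    also have "\<dots> = 9 ^ CARD('n) * (2 powi u) ^ CARD('n) * (vol (tcube 0 u z) * (av p f ?E * av q w ?E))"
    proof -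
      have "(9::real) ^ CARD('n) = 3 ^ CARD('n) * 3 ^ CARD('n)" by (simp flip: power_mult_distrib)
      then show ?thesis by (simp add: tcube3_measure tcube_measure power_mult_distrib)
    qed
    finally show ?thesis .
  qed
  then show ?thesis unfolding grid_form_def sum_distrib_left by (rule sum_mono)
qed


lemma sum_half_powr_le: "(\<Sum>i<I. 2 powr (- (real i / 2))) \<le> 4"
proof -
  define s where "s = (2::real) powr (- 1 / 2)"
  have s: "0 < s" "s \<le> 3 / 4"
  proof -
    show "0 < s" by (simp add: s_def)
    have "s\<^sup>2 = 2 powr (- 1)" unfolding s_def by (subst powr_power) auto
    then have "s\<^sup>2 \<le> (3 / 4)\<^sup>2" by (simp add: power2_eq_square powr_minus)
    then show "s \<le> 3 / 4" by (rule power2_le_imp_le) simp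
  qed
  have "(\<Sum>i<I. 2 powr (- (real i / 2))) = (\<Sum>i<I. s ^ i)"
    by (intro sum.cong refl) (simp add: s_def powr_power)
  also have "\<dots> = (1 - s ^ I) / (1 - s)" using s by (subst sum_gp_strict) auto
  also have "\<dots> \<le> 1 / (1 - s)" using s by (intro divide_right_mono) auto
  also have "\<dots> \<le> 4" using s by (simp add: field_simps)
  finally show ?thesis .
qed

context pdo_symbol begin

text \<open>After summing over the small cubes, the contribution of the i-th ring regroups into a
  grid form at the coarser scale \<open>v + i + 1\<close>. The hypothesis allows that form to grow
  by \<open>2 powr (\<theta> * (j + i + 1))\<close>; with \<open>\<theta> \<le> 1 / 2\<close> the
  factor \<open>(1 / 2) ^ i\<close> absorbs the part in \<open>i\<close>, and the part in
  \<open>j\<close> becomes \<open>A - \<theta>\<close>.\<close>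

lemma far_total:
  assumes r: "0 < r" "r < \<rho>" "r \<le> 1" and p: "1 \<le> p" and q: "1 \<le> q"
  shows "\<exists>C\<ge>0. \<forall>j v f w y \<theta> Z. 2 powr (- (real j * r)) \<le> 2 powi v \<longrightarrow> \<bar>v\<bar> \<le> int j \<longrightarrow> bcs f \<longrightarrow> bcs w \<longrightarrow>
    0 \<le> \<theta> \<longrightarrow> \<theta> \<le> 1 / 2 \<longrightarrow> 0 \<le> y \<longrightarrow> (\<forall>u Z. finite Z \<longrightarrow> grid_form p q f w u Z \<le> y * 2 powr (\<theta> * real_of_int \<bar>u\<bar>)) \<longrightarrow> finite Z \<longrightarrow>
    norm (\<Sum>z\<in>Z. LBINT x. piece j (\<lambda>y. indicator (- tcube3 v z) y * f y) x * (indicator (tcube 0 v z) x * w x))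
     \<le> C * 2 powr (- (real j * (A - \<theta>))) * y"
  using far_pointwise[OF r(1,2), of A]
proof (elim exE conjE, goal_cases)
  case (1 C)
  note C0 = 1(1) and Call = 1(2)
  note C = Call[rule_format]
  have main: "norm (\<Sum>z\<in>Z. LBINT x. piece j (\<lambda>y. indicator (- tcube3 v z) y * f y) x * (indicator (tcube 0 v z) x * w x))
     \<le> (8 * C * 18 ^ CARD('n)) * 2 powr (- (real j * (A - \<theta>))) * y"
    if v: "2 powr (- (real j * r)) \<le> 2 powi v" "\<bar>v\<bar> \<le> int j" and f: "bcs f" and w: "bcs w" and \<theta>: "0 \<le> \<theta>" "\<theta> \<le> 1 / 2" and y: "0 \<le> y"
      and X: "\<And>u Z. finite Z \<Longrightarrow> grid_form p q f w u Z \<le> y * 2 powr (\<theta> * real_of_int \<bar>u\<bar>)" and Z: "finite Z" for j v f w y \<theta> Z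
  proof -
    obtain R1 where R1: "\<And>x. f x \<noteq> 0 \<Longrightarrow> norm x \<le> R1" using bcs_support[OF f] by metis
    obtain R2 where R2: "\<And>x. w x \<noteq> 0 \<Longrightarrow> norm x \<le> R2" using bcs_support[OF w] by metis
    obtain I where I: "(R1 + R2) / 2 powi v < 2 ^ I" using real_arch_pow[of 2] by auto
    have dI: "\<bar>x $ k - y $ k\<bar> < 2 ^ I * 2 powi v" if "w x \<noteq> 0" "f y \<noteq> 0" for x y k
    proof -
      have "\<bar>x $ k - y $ k\<bar> \<le> norm x + norm y" using component_le_norm_cart[of x k] component_le_norm_cart[of y k] by linarith
      also have "\<dots> \<le> R1 + R2" using R1[OF that(2)] R2[OF that(1)] by simp
      also have "\<dots> < 2 ^ I * 2 powi v" using I by (simp add: pos_divide_less_eq)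
      finally show ?thesis .
    qed
    define \<beta> where "\<beta> = (\<lambda>i. C * 2 powr (- (real j * A)) * (1 / 2) ^ i / (2 ^ i * 2 powi v) ^ CARD('n))"
    have \<beta>0: "\<beta> i \<ge> 0" for i using C0 by (simp add: \<beta>_def)
    define u where "u = (\<lambda>i::nat. v + int i + 1)"
    define K where "K = (\<lambda>i. cube_index (u i) ` {x. w x \<noteq> 0})"
    have Kf: "finite (K i)" for i unfolding K_def by (rule finite_cube_index[OF w])
    define Fz where "Fz = (\<lambda>z x. piece j (\<lambda>y. indicator (- tcube3 v z) y * f y) x * (indicator (tcube 0 v z) x * w x))"
    have Fb: "bcs (Fz z)" for z
      unfolding Fz_def by (intro piece_pair_bcs bcs_indicator f w) (auto simp: tcube_borel)
    define G where "G = (\<lambda>x. \<Sum>i<I. \<beta> i * (\<Sum>k\<in>K i. Ip 1 f (tcube3 (u i) k) * (indicator (tcube 0 (u i) k) x * norm (w x) powr 1)))"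
    have Gi: "integrable lborel G"
      unfolding G_def by (intro integrable_sum integrable_mult_right Ip_integrable w tcube_borel) auto
    have pw: "norm (\<Sum>z\<in>Z. Fz z x) \<le> G x" for x
    proof (cases "w x = 0")
      case True
      then show ?thesis by (simp add: Fz_def G_def)
    next
      case False
      \<comment> \<open>Only the small cube containing \<open>x\<close> contributes at
        \<open>x\<close>, so summing over \<open>z\<close> costs nothing.\<close>
      have z0: "Fz z x = 0" if "z \<noteq> cube_index v x" for z using that by (simp add: Fz_def indicator_def cube_index_iff)
      have "(\<Sum>z\<in>Z. Fz z x) = (\<Sum>z\<in>Z. if z = cube_index v x then Fz (cube_index v x) x else 0)"
        by (intro sum.cong refl) (use z0 in auto)
      then have "norm (\<Sum>z\<in>Z. Fz z x) \<le> norm (Fz (cube_index v x) x)" using Z by (simp add: sum.delta)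
      also have "\<dots> = norm (piece j (\<lambda>y. indicator (- tcube3 v (cube_index v x)) y * f y) x) * norm (w x)"
        using cube_index_mem[of x v] by (simp add: Fz_def norm_mult)
      also have "\<dots> \<le> (\<Sum>i<I. \<beta> i * Ip 1 f (tcube3 (u i) (cube_index (u i) x))) * norm (w x)"
        unfolding \<beta>_def u_def by (intro mult_right_mono C v(1) f dI[OF False]) auto
      also have "\<dots> = G x"
      proof -
        have "(\<Sum>k\<in>K i. Ip 1 f (tcube3 (u i) k) * (indicator (tcube 0 (u i) k) x * norm (w x) powr 1)) = Ip 1 f (tcube3 (u i) (cube_index (u i) x)) * norm (w x)" for i
        proof -
          have "(\<Sum>k\<in>K i. Ip 1 f (tcube3 (u i) k) * (indicator (tcube 0 (u i) k) x * norm (w x) powr 1)) = (\<Sum>k\<in>K i. if k = cube_index (u i) x then Ip 1 f (tcube3 (u i) k) * norm (w x) else 0)"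
            by (intro sum.cong refl) (auto simp: indicator_def cube_index_iff)
          also have "\<dots> = Ip 1 f (tcube3 (u i) (cube_index (u i) x)) * norm (w x)"
            using Kf[of i] False by (auto simp: sum.delta K_def)
          finally show ?thesis .
        qed
        then show ?thesis unfolding G_def by (simp add: sum_distrib_right mult.assoc)
      qed
      finally show ?thesis .
    qed
    have "norm (\<Sum>z\<in>Z. LBINT x. Fz z x) = norm (LBINT x. (\<Sum>z\<in>Z. Fz z x))"
      by (subst integral_sum) (auto intro: bcs_integrable Fb)
    also have "\<dots> \<le> (LBINT x. norm (\<Sum>z\<in>Z. Fz z x))" by (rule integral_norm_bound)
    also have "\<dots> \<le> (LBINT x. G x)"
      by (intro integral_mono[OF _ Gi pw] integrable_norm integrable_sum bcs_integrable Fb)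
    also have "\<dots> = (\<Sum>i<I. \<beta> i * (\<Sum>k\<in>K i. Ip 1 f (tcube3 (u i) k) * Ip 1 w (tcube 0 (u i) k)))"
    proof -
      have a1: "integrable lborel (\<lambda>x. indicator (tcube 0 (u i) k) x * norm (w x) powr 1)" for i k
        by (rule Ip_integrable[OF w _ tcube_borel(1)]) simp
      have a2: "integrable lborel (\<lambda>x. Ip 1 f (tcube3 (u i) k) * (indicator (tcube 0 (u i) k) x * norm (w x) powr 1))" for i k
        by (rule integrable_mult_right[OF a1])
      have a3: "integrable lborel (\<lambda>x. \<Sum>k\<in>K i. Ip 1 f (tcube3 (u i) k) * (indicator (tcube 0 (u i) k) x * norm (w x) powr 1))" for i
        by (rule integrable_sum[OF a2])
      show ?thesis unfolding G_def
        by (simp only: integral_sum[OF integrable_mult_right[OF a3]] integral_mult_right_zero integral_sum[OF a2])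
          (simp add: Ip_def)
    qed
    also have "\<dots> \<le> (\<Sum>i<I. 2 * C * 18 ^ CARD('n) * 2 powr (- (real j * (A - \<theta>))) * y * 2 powr (- (real i / 2)))"
    proof (rule sum_mono)
      fix i assume "i \<in> {..<I}"
      have u2: "(2::real) powi u i = 2 * (2 ^ i * 2 powi v)" by (simp add: u_def power_int_add)
      define d where "d = (2 ^ i * 2 powi v :: real)"
      have d: "d > 0" by (simp add: d_def)
      have "(\<Sum>k\<in>K i. Ip 1 f (tcube3 (u i) k) * Ip 1 w (tcube 0 (u i) k)) \<le> 9 ^ CARD('n) * (2 powi u i) ^ CARD('n) * grid_form p q f w (u i) (K i)"
        by (rule Ip_grid_form_bound[OF f w p q])
      also have "\<dots> \<le> 9 ^ CARD('n) * (2 powi u i) ^ CARD('n) * (y * 2 powr (\<theta> * real_of_int \<bar>u i\<bar>))"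
        by (intro mult_left_mono X Kf) auto
      also have "\<dots> \<le> 9 ^ CARD('n) * (2 powi u i) ^ CARD('n) * (y * 2 powr (\<theta> * real j + real i / 2 + 1))"
      proof (intro mult_left_mono powr_mono y)
        have "\<theta> * real_of_int \<bar>u i\<bar> \<le> \<theta> * (real j + (real i + 1))"
          using v(2) \<theta> by (intro mult_left_mono) (auto simp: u_def)
        also have "\<dots> \<le> \<theta> * real j + 1 / 2 * (real i + 1)"
          using \<theta> by (simp only: distrib_left[of _ "real j"]) (intro add_left_mono mult_right_mono; simp)
        finally show "\<theta> * real_of_int \<bar>u i\<bar> \<le> \<theta> * real j + real i / 2 + 1" by (simp add: add_divide_distrib)
      qed auto
      also have "\<dots> = 18 ^ CARD('n) * d ^ CARD('n) * (y * 2 powr (\<theta> * real j + real i / 2 + 1))"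
      proof -
        have "(9::real) ^ CARD('n) * (2 powi u i) ^ CARD('n) = 18 ^ CARD('n) * d ^ CARD('n)"
          unfolding u2 d_def[symmetric] power_mult_distrib[symmetric] by simp
        then show ?thesis by simp
      qed
      finally have "\<beta> i * (\<Sum>k\<in>K i. Ip 1 f (tcube3 (u i) k) * Ip 1 w (tcube 0 (u i) k)) \<le> \<beta> i * (18 ^ CARD('n) * d ^ CARD('n) * (y * 2 powr (\<theta> * real j + real i / 2 + 1)))"
        by (rule mult_left_mono) (rule \<beta>0)
      also have "\<dots> = C * 18 ^ CARD('n) * y * (2 powr (- (real j * A)) * (1 / 2) ^ i * 2 powr (\<theta> * real j + real i / 2 + 1))"
        using d by (simp add: \<beta>_def d_def[symmetric])
      also have "2 powr (- (real j * A)) * (1 / 2) ^ i * 2 powr (\<theta> * real j + real i / 2 + 1) = 2 * (2 powr (- (real j * (A - \<theta>))) * 2 powr (- (real i / 2)))"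
      proof -
        have h: "(1 / 2 :: real) ^ i = 2 powr (- real i)" by (simp add: powr_minus powr_realpow power_one_over inverse_eq_divide)
        have "2 powr (- (real j * A)) * (1 / 2) ^ i * 2 powr (\<theta> * real j + real i / 2 + 1) = 2 powr (- (real j * A) + - real i + (\<theta> * real j + real i / 2 + 1))"
          unfolding h powr_add ..
        also have "- (real j * A) + - real i + (\<theta> * real j + real i / 2 + 1) = 1 + (- (real j * (A - \<theta>)) + - (real i / 2))"
          by (simp add: field_simps)
        also have "2 powr \<dots> = 2 * (2 powr (- (real j * (A - \<theta>))) * 2 powr (- (real i / 2)))"
          unfolding powr_add by simp
        finally show ?thesis .
      qed
      finally show "\<beta> i * (\<Sum>k\<in>K i. Ip 1 f (tcube3 (u i) k) * Ip 1 w (tcube 0 (u i) k)) \<le> 2 * C * 18 ^ CARD('n) * 2 powr (- (real j * (A - \<theta>))) * y * 2 powr (- (real i / 2))"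
        by (simp add: mult_ac)
    qed
    also have "\<dots> = 2 * C * 18 ^ CARD('n) * 2 powr (- (real j * (A - \<theta>))) * y * (\<Sum>i<I. 2 powr (- (real i / 2)))"
      by (simp add: sum_distrib_left)
    also have "\<dots> \<le> 2 * C * 18 ^ CARD('n) * 2 powr (- (real j * (A - \<theta>))) * y * 4"
      using C0 y by (intro mult_left_mono sum_half_powr_le) auto
    finally show ?thesis by (simp add: Fz_def mult_ac)
  qed
  have "8 * C * 18 ^ CARD('n) \<ge> 0" using C0 by simp
  then show ?thesis using main by (intro exI[of _ "8 * C * 18 ^ CARD('n)"]) (intro conjI allI impI; blast)
qed

text \<open>The number \<open>y\<close> stands for any bound on the grid forms at all scales, up to
  the loss. It is instantiated once by the sparse form and once by a product of global norms, the
  latter without loss.\<close>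

lemma piece_bound:
  assumes p: "1 \<le> p" "p \<le> 2" and q: "1 \<le> q" "q \<le> 2"
    and mneg: "m + real CARD('n) * (1 - \<rho>) * (1 / p + 1 / q - 1) < 0"
  shows "\<exists>\<epsilon>>0. \<exists>C\<ge>0. \<forall>j f w y \<theta>. bcs f \<longrightarrow> bcs w \<longrightarrow> 0 \<le> \<theta> \<longrightarrow> \<theta> \<le> 1 / 2 \<longrightarrow> 0 \<le> y \<longrightarrow>
    (\<forall>u Z. finite Z \<longrightarrow> grid_form p q f w u Z \<le> y * 2 powr (\<theta> * real_of_int \<bar>u\<bar>)) \<longrightarrow>
    norm (LBINT x. piece j f x * w x) \<le> C * 2 powr (- (real j * (\<epsilon> - \<theta>))) * y"
proof -
  let ?n = "real CARD('n)"
  define e where "e = 1 / p + 1 / q - 1"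
  have e: "0 \<le> e" "e \<le> 1"
  proof -
    have "1 / p \<ge> 1 / 2" "1 / q \<ge> 1 / 2" "1 / p \<le> 1" "1 / q \<le> 1" using p q by (auto simp: field_simps)
    then show "0 \<le> e" "e \<le> 1" by (auto simp: e_def)
  qed
  define \<kappa> where "\<kappa> = - (m + ?n * (1 - \<rho>) * e)"
  have \<kappa>: "\<kappa> > 0" using mneg by (simp add: \<kappa>_def e_def)
  \<comment> \<open>\<open>\<tau> = \<rho> - r\<close> spends part of the gap
    \<open>\<kappa>\<close>. It enters once through \<open>\<rho> - r\<close> and once through
    \<open>1 - r\<close>, at most \<open>n * \<tau> \<le> \<kappa> / 4\<close> each, and half of the
    gap remains as \<open>\<epsilon>\<close>; the bound by \<open>\<rho> / 2\<close> keeps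
    \<open>r\<close> positive.\<close>
  define \<tau> where "\<tau> = min (\<rho> / 2) (\<kappa> / (4 * ?n))"
  have n0: "?n > 0" by simp
  have \<rho>0: "\<rho> > 0" using \<delta>_pos \<delta>_le by simp
  have \<tau>: "\<tau> > 0" "\<tau> \<le> \<rho> / 2" "?n * \<tau> \<le> \<kappa> / 4"
  proof -
    show "\<tau> > 0" using \<kappa> \<rho>0 by (simp add: \<tau>_def)
    show "\<tau> \<le> \<rho> / 2" by (simp add: \<tau>_def)
    have "\<tau> \<le> \<kappa> / (4 * ?n)" by (simp add: \<tau>_def)
    then show "?n * \<tau> \<le> \<kappa> / 4" by (simp add: field_simps)
  qed
  define r where "r = \<rho> - \<tau>"
  have r: "0 < r" "r < \<rho>" "r \<le> \<rho>" "r \<le> 1" using \<tau> \<rho>0 \<rho>_lt by (auto simp: r_def)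
  define \<epsilon> where "\<epsilon> = \<kappa> / 2"
  have \<epsilon>: "\<epsilon> > 0" using \<kappa> by (simp add: \<epsilon>_def)
  have ex: "m + ?n * (\<rho> - r) + ?n * (1 - r) * e \<le> - \<epsilon>"
  proof -
    have "m + ?n * (\<rho> - r) + ?n * (1 - r) * e = - \<kappa> + ?n * \<tau> + (?n * \<tau>) * e"
      by (simp add: \<kappa>_def r_def algebra_simps)
    also have "(?n * \<tau>) * e \<le> (?n * \<tau>) * 1" using e \<tau>(1) by (intro mult_left_mono) auto
    finally have "m + ?n * (\<rho> - r) + ?n * (1 - r) * e \<le> - \<kappa> + ?n * \<tau> + ?n * \<tau> * 1" by simp
    then show ?thesis using \<tau>(3) \<kappa> unfolding \<epsilon>_def by linarith
  qed
  obtain C1 where C1: "C1 \<ge> 0" and C1all: "\<forall>j f g v z. bcs f \<longrightarrow> bcs g \<longrightarrow> 2 powi v \<le> 2 * 2 powr (- (real j * r)) \<longrightarrow>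
    norm (LBINT x. piece j (\<lambda>y. indicator (tcube3 v z) y * f y) x * (indicator (tcube 0 v z) x * g x))
     \<le> C1 * 2 powr (real j * (m + ?n * (\<rho> - r) + ?n * (1 - r) * (1 / p + 1 / q - 1)))
        * (vol (tcube 0 v z) * (av p f (tcube3 v z) * av q g (tcube3 v z)))"
    using near_cube[OF r(1,3) p q] by (elim exE conjE) (rule that)
  obtain C2 where C2: "C2 \<ge> 0" and C2all: "\<forall>j v f w y \<theta> Z. 2 powr (- (real j * r)) \<le> 2 powi v \<longrightarrow> \<bar>v\<bar> \<le> int j \<longrightarrow> bcs f \<longrightarrow> bcs w \<longrightarrow>
    0 \<le> \<theta> \<longrightarrow> \<theta> \<le> 1 / 2 \<longrightarrow> 0 \<le> y \<longrightarrow> (\<forall>u Z. finite Z \<longrightarrow> grid_form p q f w u Z \<le> y * 2 powr (\<theta> * real_of_int \<bar>u\<bar>)) \<longrightarrow> finite Z \<longrightarrow>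
    norm (\<Sum>z\<in>Z. LBINT x. piece j (\<lambda>y. indicator (- tcube3 v z) y * f y) x * (indicator (tcube 0 v z) x * w x))
     \<le> C2 * 2 powr (- (real j * (\<epsilon> - \<theta>))) * y"
    using far_total[OF r(1,2,4) p(1) q(1), of \<epsilon>] by (elim exE conjE) (rule that)
  have main: "norm (LBINT x. piece j f x * w x) \<le> (C1 + C2) * 2 powr (- (real j * (\<epsilon> - \<theta>))) * y"
    if f: "bcs f" and w: "bcs w" and \<theta>: "0 \<le> \<theta>" "\<theta> \<le> 1 / 2" and y: "0 \<le> y"
      and X: "\<forall>u Z. finite Z \<longrightarrow> grid_form p q f w u Z \<le> y * 2 powr (\<theta> * real_of_int \<bar>u\<bar>)" for j f w y \<theta>
  proof -
    \<comment> \<open>The integer scale whose side is between once and twice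
      \<open>2 powr (- j * r)\<close>: the lower bound serves the far part, the upper one the near
      part.\<close>
    define v where "v = - \<lfloor>real j * r\<rfloor>"
    have jr: "0 \<le> real j * r" "real j * r \<le> real j" using r by (auto intro: mult_left_le)
    have vi: "real_of_int v \<le> - (real j * r) + 1" "- (real j * r) \<le> real_of_int v" by (simp_all add: v_def) linarith+
    have va: "\<bar>v\<bar> \<le> int j"
    proof -
      have "0 \<le> \<lfloor>real j * r\<rfloor>" using jr by simp
      moreover have "\<lfloor>real j * r\<rfloor> \<le> int j" using jr by (simp add: floor_le_iff)
      ultimately show ?thesis by (simp add: v_def)
    qed
    have vp: "(2::real) powi v = 2 powr (real_of_int v)" by (simp add: powr_real_of_int')
    have v1: "2 powr (- (real j * r)) \<le> (2 powi v :: real)" unfolding vp by (rule powr_mono) (use vi in auto)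
    have v2: "2 powi v \<le> (2 * 2 powr (- (real j * r)) :: real)"
    proof -
      have "2 powr (real_of_int v) \<le> (2::real) powr (- (real j * r) + 1)" by (rule powr_mono) (use vi in auto)
      then show ?thesis unfolding vp powr_add by simp
    qed
    define Z where "Z = cube_index v ` {x. w x \<noteq> 0}"
    have Z: "finite Z" unfolding Z_def by (rule finite_cube_index[OF w])
    define a1 where "a1 = (\<lambda>z x. piece j (\<lambda>y. indicator (tcube3 v z) y * f y) x * (indicator (tcube 0 v z) x * w x))"
    define a2 where "a2 = (\<lambda>z x. piece j (\<lambda>y. indicator (- tcube3 v z) y * f y) x * (indicator (tcube 0 v z) x * w x))"
    have i1: "integrable lborel (a1 z)" "integrable lborel (a2 z)" for z
      unfolding a1_def a2_def by (intro bcs_integrable piece_pair_bcs bcs_indicator f w; auto simp: tcube_borel)+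
    have sp: "piece j f x * w x = (\<Sum>z\<in>Z. a1 z x + a2 z x)" for x
    proof -
      have t: "a1 z x + a2 z x = (if z = cube_index v x then piece j f x * w x else 0)" for z
      proof (cases "z = cube_index v x")
        case True
        have "piece j f x = piece j (\<lambda>y. indicator (tcube3 v z) y * f y) x + piece j (\<lambda>y. indicator (- tcube3 v z) y * f y) x"
          by (intro piece_add bcs_indicator f) (auto simp: tcube_borel indicator_def)
        then show ?thesis using True cube_index_mem[of x v] by (simp add: a1_def a2_def distrib_right)
      next
        case False
        then show ?thesis by (simp add: a1_def a2_def indicator_def cube_index_iff)
      qed
      show ?thesis unfolding t using Z by (auto simp: sum.delta Z_def)
    qed
    have dec: "(LBINT x. piece j f x * w x) = (\<Sum>z\<in>Z. LBINT x. a1 z x) + (\<Sum>z\<in>Z. LBINT x. a2 z x)"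
    proof -
      have "(LBINT x. piece j f x * w x) = (\<Sum>z\<in>Z. LBINT x. a1 z x + a2 z x)"
        unfolding sp by (rule integral_sum) (intro integrable_add i1)
      then show ?thesis by (simp only: integral_add[OF i1] sum.distrib)
    qed
    have n1: "norm (\<Sum>z\<in>Z. LBINT x. a1 z x) \<le> C1 * 2 powr (- (real j * (\<epsilon> - \<theta>))) * y"
    proof -
      have "norm (\<Sum>z\<in>Z. LBINT x. a1 z x) \<le> (\<Sum>z\<in>Z. C1 * 2 powr (real j * (- \<epsilon>))
        * (vol (tcube 0 v z) * (av p f (tcube3 v z) * av q w (tcube3 v z))))"
      proof (rule sum_norm_le)
        fix z assume "z \<in> Z"
        have "norm (LBINT x. a1 z x) \<le> C1 * 2 powr (real j * (m + ?n * (\<rho> - r) + ?n * (1 - r) * e))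
        * (vol (tcube 0 v z) * (av p f (tcube3 v z) * av q w (tcube3 v z)))"
          unfolding a1_def e_def using C1all f w v2 by blast
        also have "\<dots> \<le> C1 * 2 powr (real j * (- \<epsilon>))
        * (vol (tcube 0 v z) * (av p f (tcube3 v z) * av q w (tcube3 v z)))"
          using ex C1 by (intro mult_right_mono mult_left_mono powr_mono) (auto simp: av_nonneg)
        finally show "norm (LBINT x. a1 z x) \<le> C1 * 2 powr (real j * (- \<epsilon>))
        * (vol (tcube 0 v z) * (av p f (tcube3 v z) * av q w (tcube3 v z)))" .
      qed
      also have "\<dots> = C1 * 2 powr (real j * (- \<epsilon>)) * grid_form p q f w v Z" by (simp add: grid_form_def sum_distrib_left)
      also have "\<dots> \<le> C1 * 2 powr (real j * (- \<epsilon>)) * (y * 2 powr (\<theta> * real_of_int \<bar>v\<bar>))"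
        using X Z C1 by (intro mult_left_mono) auto
      also have "\<dots> \<le> C1 * 2 powr (real j * (- \<epsilon>)) * (y * 2 powr (\<theta> * real j))"
        using va \<theta> y C1 by (intro mult_left_mono powr_mono) auto
      also have "\<dots> = C1 * (2 powr (real j * (- \<epsilon>)) * 2 powr (\<theta> * real j)) * y" by simp
      also have "2 powr (real j * (- \<epsilon>)) * 2 powr (\<theta> * real j) = 2 powr (- (real j * (\<epsilon> - \<theta>)))"
        by (simp add: powr_add[symmetric] algebra_simps)
      finally show ?thesis .
    qed
    have n2: "norm (\<Sum>z\<in>Z. LBINT x. a2 z x) \<le> C2 * 2 powr (- (real j * (\<epsilon> - \<theta>))) * y"
      unfolding a2_def using C2all[rule_format, OF v1 va f w \<theta> y _ Z] X by blast
    show ?thesis unfolding dec using norm_triangle_mono[OF n1 n2] by (simp add: algebra_simps)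
  qed
  have "C1 + C2 \<ge> 0" using C1 C2 by simp
  then show ?thesis using main \<epsilon> by (intro exI[of _ \<epsilon>] conjI exI[of _ "C1 + C2"] allI impI) blast+
qed

text \<open>For exponents 2 and 2 the condition reduces to \<open>m < 0\<close>, and
  \<open>grid_form_l2\<close> bounds the grid forms with no loss, so \<open>\<theta> = 0\<close> is
  allowed.\<close>

lemma piece_l2_bilinear:
  "\<exists>\<epsilon>>0. \<exists>C\<ge>0. \<forall>j f w. bcs f \<longrightarrow> bcs w \<longrightarrow> norm (LBINT x. piece j f x * w x) \<le> C * 2 powr (- (real j * \<epsilon>)) * (l2 f * l2 w)"
proof -
  have two: "(1::real) \<le> 2" "(2::real) \<le> 2" and m0: "m + real CARD('n) * (1 - \<rho>) * (1 / 2 + 1 / 2 - 1) < 0" using m_neg by auto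
  obtain \<epsilon> C where \<epsilon>: "\<epsilon> > 0" and C: "C \<ge> 0" and Call: "\<forall>j f w y \<theta>. bcs f \<longrightarrow> bcs w \<longrightarrow> 0 \<le> \<theta> \<longrightarrow> \<theta> \<le> 1 / 2 \<longrightarrow> 0 \<le> y \<longrightarrow>
    (\<forall>u Z. finite Z \<longrightarrow> grid_form 2 2 f w u Z \<le> y * 2 powr (\<theta> * real_of_int \<bar>u\<bar>)) \<longrightarrow>
    norm (LBINT x. piece j f x * w x) \<le> C * 2 powr (- (real j * (\<epsilon> - \<theta>))) * y"
    using piece_bound[OF two two m0] by (elim exE conjE) (rule that)
  obtain K where K: "K \<ge> 0" and Kall: "\<forall>(f :: real^'n \<Rightarrow> complex) g v Z. bcs f \<longrightarrow> bcs g \<longrightarrow> finite Z \<longrightarrow> grid_form 2 2 f g v Z \<le> K * (l2 f * l2 g)"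
    using grid_form_l2 by (elim exE conjE) (rule that)
  have "norm (LBINT x. piece j f x * w x) \<le> (C * K) * 2 powr (- (real j * \<epsilon>)) * (l2 f * l2 w)" if f: "bcs f" and w: "bcs w" for j f w
  proof -
    have "norm (LBINT x. piece j f x * w x) \<le> C * 2 powr (- (real j * (\<epsilon> - 0))) * (K * (l2 f * l2 w))"
    proof (rule Call[rule_format])
      show "grid_form 2 2 f w u Z \<le> K * (l2 f * l2 w) * 2 powr (0 * real_of_int \<bar>u\<bar>)" if "finite Z" for u Z using Kall f w that by simp
    qed (use f w K in \<open>auto simp: l2_nonneg\<close>)
    then show ?thesis by (simp add: mult_ac)
  qed
  moreover have "C * K \<ge> 0" using C K by simp
  ultimately show ?thesis using \<epsilon> by blast
qed

end

section \<open>The sum of the pieces on square-integrable functions\<close>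

definition sq_integrable :: "('a::euclidean_space \<Rightarrow> complex) \<Rightarrow> bool" where
  "sq_integrable f \<longleftrightarrow> f \<in> borel_measurable borel \<and> integrable lborel (\<lambda>x. (norm (f x))\<^sup>2)"

lemma sq_integrable_borel: "sq_integrable f \<Longrightarrow> f \<in> borel_measurable borel" by (simp add: sq_integrable_def)

lemma bcs_sq: "bcs f \<Longrightarrow> sq_integrable f" by (simp add: sq_integrable_def bcs_measurable bcs_norm_sq)

lemma sq_integrable_lin:
  assumes "sq_integrable f" "sq_integrable g"
  shows "sq_integrable (\<lambda>x. c * f x + g x)"
proof -
  have [measurable]: "f \<in> borel_measurable borel" "g \<in> borel_measurable borel" using assms by (auto simp: sq_integrable_def)
  have "integrable lborel (\<lambda>x. (norm (c * f x + g x))\<^sup>2)"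
  proof (rule integrable_bound)
    show "integrable lborel (\<lambda>x. 2 * (norm c)\<^sup>2 * (norm (f x))\<^sup>2 + 2 * (norm (g x))\<^sup>2)"
      using assms by (intro integrable_add integrable_mult_right) (auto simp: sq_integrable_def)
    have "(norm (c * f x + g x))\<^sup>2 \<le> 2 * (norm c)\<^sup>2 * (norm (f x))\<^sup>2 + 2 * (norm (g x))\<^sup>2" for x
    proof -
      have "(norm (c * f x + g x))\<^sup>2 \<le> (norm c * norm (f x) + norm (g x))\<^sup>2"
        using norm_triangle_ineq[of "c * f x" "g x"] by (intro power_mono) (auto simp: norm_mult)
      also have "\<dots> \<le> 2 * (norm c * norm (f x))\<^sup>2 + 2 * (norm (g x))\<^sup>2"
        using sum_squares_bound[of "norm c * norm (f x)" "norm (g x)"] by (simp add: power2_sum)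
      finally show ?thesis by (simp add: power_mult_distrib)
    qed
    then show "AE x in lborel. norm ((norm (c * f x + g x))\<^sup>2) \<le> norm (2 * (norm c)\<^sup>2 * (norm (f x))\<^sup>2 + 2 * (norm (g x))\<^sup>2)"
      by simp
  qed measurable
  then show ?thesis by (simp add: sq_integrable_def)
qed

lemma sq_integrable_nn_integral: "sq_integrable f \<Longrightarrow> (\<integral>\<^sup>+x. ennreal ((norm (f x))\<^sup>2) \<partial>lborel) = ennreal ((l2 f)\<^sup>2)"
  unfolding l2_sq by (simp add: sq_integrable_def nn_integral_eq_integral)

lemma sq_integrable_from_nn:
  assumes "f \<in> borel_measurable borel" "(\<integral>\<^sup>+x. ennreal ((norm (f x))\<^sup>2) \<partial>lborel) \<le> ennreal (B\<^sup>2)" "B \<ge> 0"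
  shows "sq_integrable f" "l2 f \<le> B"
proof -
  note [measurable] = assms(1)
  have "integrable lborel (\<lambda>x. (norm (f x))\<^sup>2)"
    by (rule integrableI_bounded) (use assms(2) in \<open>auto simp: order_le_less_trans\<close>)
  then show s: "sq_integrable f" using assms by (simp add: sq_integrable_def)
  have "ennreal ((l2 f)\<^sup>2) \<le> ennreal (B\<^sup>2)" using assms(2) sq_integrable_nn_integral[OF s] by simp
  then have "(l2 f)\<^sup>2 \<le> B\<^sup>2" by simp
  then show "l2 f \<le> B" by (rule power2_le_imp_le) (rule assms(3))
qed

lemma fatou_sq:
  fixes F :: "nat \<Rightarrow> 'a::euclidean_space \<Rightarrow> complex"
  assumes [measurable]: "\<And>i. F i \<in> borel_measurable borel" and lim: "\<And>x. (\<lambda>i. F i x) \<longlonglongrightarrow> F0 x"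
    and b: "\<And>i. (\<integral>\<^sup>+x. ennreal ((norm (F i x))\<^sup>2) \<partial>lborel) \<le> c"
  shows "(\<integral>\<^sup>+x. ennreal ((norm (F0 x))\<^sup>2) \<partial>lborel) \<le> c"
proof -
  have "ennreal ((norm (F0 x))\<^sup>2) = liminf (\<lambda>i. ennreal ((norm (F i x))\<^sup>2))" for x
    by (rule lim_imp_Liminf[symmetric]) (auto intro!: tendsto_intros lim tendsto_ennrealI)
  then have "(\<integral>\<^sup>+x. ennreal ((norm (F0 x))\<^sup>2) \<partial>lborel) = (\<integral>\<^sup>+x. liminf (\<lambda>i. ennreal ((norm (F i x))\<^sup>2)) \<partial>lborel)" by simp
  also have "\<dots> \<le> liminf (\<lambda>i. \<integral>\<^sup>+x. ennreal ((norm (F i x))\<^sup>2) \<partial>lborel)"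
    by (rule nn_integral_liminf) measurable
  also have "\<dots> \<le> liminf (\<lambda>i::nat. c)" by (rule Liminf_mono) (simp add: b)
  also have "\<dots> = c" by (rule Liminf_const) simp
  finally show ?thesis .
qed

text \<open>The weights spend part of a geometric decay of squared norms to get absolute convergence
  at almost every point.\<close>

lemma weighted_cauchy_schwarz:
  fixes t :: "nat \<Rightarrow> complex"
  assumes b: "0 < b" "b < 1" and s: "summable (\<lambda>j. (1 / b) ^ j * (norm (t j))\<^sup>2)"
  shows "summable (\<lambda>j. norm (t j))" "(norm (\<Sum>j. t j))\<^sup>2 \<le> (\<Sum>j. (1 / b) ^ j * (norm (t j))\<^sup>2) / (1 - b)"
proof -
  define H where "H = (\<Sum>j. (1 / b) ^ j * (norm (t j))\<^sup>2)"
  have H0: "H \<ge> 0" unfolding H_def using b by (intro suminf_nonneg s) auto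
  have par: "(\<Sum>j<J. norm (t j)) \<le> sqrt (H / (1 - b))" for J
  proof -
    have "(\<Sum>j<J. norm (t j))\<^sup>2 = (\<Sum>j<J. sqrt (b ^ j) * (sqrt ((1 / b) ^ j) * norm (t j)))\<^sup>2"
    proof -
      have "sqrt (b ^ j) * (sqrt ((1 / b) ^ j) * norm (t j)) = norm (t j)" for j
      proof -
        have "sqrt (b ^ j) * sqrt ((1 / b) ^ j) = 1"
          unfolding real_sqrt_mult[symmetric] power_mult_distrib[symmetric] using b by simp
        then show ?thesis by (simp only: mult.assoc[symmetric] mult_1_left)
      qed
      then show ?thesis by (simp only:)
    qed
    also have "\<dots> \<le> (\<Sum>j<J. (sqrt (b ^ j))\<^sup>2) * (\<Sum>j<J. (sqrt ((1 / b) ^ j) * norm (t j))\<^sup>2)"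
      by (rule Cauchy_Schwarz_ineq_sum)
    also have "\<dots> = (\<Sum>j<J. b ^ j) * (\<Sum>j<J. (1 / b) ^ j * (norm (t j))\<^sup>2)"
      using b by (simp add: power_mult_distrib)
    also have "\<dots> \<le> 1 / (1 - b) * H"
    proof (intro mult_mono)
      show "(\<Sum>j<J. b ^ j) \<le> 1 / (1 - b)"
        using b by (subst sum_gp_strict) (auto intro!: divide_right_mono)
      show "(\<Sum>j<J. (1 / b) ^ j * (norm (t j))\<^sup>2) \<le> H"
        unfolding H_def using b by (intro sum_le_suminf s) auto
    qed (use b in \<open>auto intro!: sum_nonneg\<close>)
    finally show ?thesis by (intro real_le_rsqrt) simp
  qed
  show sm: "summable (\<lambda>j. norm (t j))"
    by (rule summableI_nonneg_bounded[OF _ par]) simp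
  have "norm (\<Sum>j. t j) \<le> (\<Sum>j. norm (t j))" by (rule summable_norm[OF sm])
  also have "\<dots> \<le> sqrt (H / (1 - b))" by (rule suminf_le_const[OF sm par])
  finally have "(norm (\<Sum>j. t j))\<^sup>2 \<le> (sqrt (H / (1 - b)))\<^sup>2" by (rule power_mono) simp
  then show "(norm (\<Sum>j. t j))\<^sup>2 \<le> (\<Sum>j. (1 / b) ^ j * (norm (t j))\<^sup>2) / (1 - b)"
    using b H0 by (simp add: H_def)
qed

context pdo_symbol begin

text \<open>In \<open>y\<close> the kernel is the transform of a bounded function of bounded
  support, hence square integrable. So a piece is defined at every point for every square-integrable
  input.\<close>

lemma kern_sq: "sq_integrable (kern j x)"
proof -
  obtain C where C: "C \<ge> 0" "\<And>z. norm (a z) \<le> C" using a_global_bound by metis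
  define w where "w = (\<lambda>\<xi>. cis (x \<bullet> \<xi>) * (complex_of_real (psi j \<xi>) * a (x, \<xi>)))"
  have ax[measurable]: "(\<lambda>\<xi>. a (x, \<xi>)) \<in> borel_measurable borel" by measurable
  have "bcs w"
  proof (rule bcsI[of w C "real CARD('n) * 2 ^ (j + 1)"])
    show "w \<in> borel_measurable borel" unfolding w_def by measurable
    show "norm (w \<xi>) \<le> C" for \<xi>
    proof -
      have "C * indicator (acube j) \<xi> \<le> C" using C(1) by (simp add: indicator_def)
      then show ?thesis using kern_sub_bound[OF C, of j \<xi> x] by (simp only: w_def norm_mult norm_cis mult_1_left)
    qed
    show "norm \<xi> \<le> real CARD('n) * 2 ^ (j + 1)" if "w \<xi> \<noteq> 0" for \<xi>
      using that by (intro annulus_norm_le psi_support) (auto simp: w_def)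
  qed
  from ft_props(1,2)[OF this] have "sq_integrable (ft w)" by (simp add: sq_integrable_def)
  moreover have "kern j x = ft w"
    unfolding kern_def ft_def w_def
    by (intro ext integral_cong refl) (simp add: inner_diff_left inner_diff_right inner_commute cis_mult mult.assoc[symmetric])
  ultimately show ?thesis by simp
qed

lemma kern_sq_integrable: "sq_integrable f \<Longrightarrow> integrable lborel (\<lambda>y. norm (kern j x y) * norm (f y))"
  using kern_sq[of j x] unfolding sq_integrable_def by (intro cauchy_schwarz_integral(1)) auto

lemma kern_sq_integrable': "sq_integrable f \<Longrightarrow> integrable lborel (\<lambda>y. kern j x y * f y)"
  using kern_sq_integrable[of f j x] sq_integrable_borel[of f] kern_borel2[of j x]
  by (subst integrable_norm_iff[symmetric]) (auto simp: norm_mult)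

lemma piece_lin: "sq_integrable f \<Longrightarrow> sq_integrable g \<Longrightarrow> piece j (\<lambda>y. c * f y + g y) x = c * piece j f x + piece j g x"
proof -
  assume f: "sq_integrable f" and g: "sq_integrable g"
  have "piece j (\<lambda>y. c * f y + g y) x = (LBINT y. c * (kern j x y * f y) + kern j x y * g y)"
    unfolding piece_def by (simp add: algebra_simps)
  also have "\<dots> = c * piece j f x + piece j g x"
    unfolding piece_def by (simp add: integral_add kern_sq_integrable' f g)
  finally show ?thesis .
qed

text \<open>Duality: the piece is tested against the conjugate of its own truncations to balls, and
  Fatou removes the truncation.\<close>

lemma piece_l2_bcs:
  assumes f: "bcs f" and K: "K \<ge> 0" and b: "\<And>w. bcs w \<Longrightarrow> norm (LBINT x. piece j f x * w x) \<le> K * l2 w"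
  shows "(\<integral>\<^sup>+x. ennreal ((norm (piece j f x))\<^sup>2) \<partial>lborel) \<le> ennreal (K\<^sup>2)"
proof (rule fatou_sq)
  have Tm[measurable]: "piece j f \<in> borel_measurable borel" by (intro piece_borel bcs_measurable f)
  have [measurable]: "cball (0::real^'n) (real i) \<in> sets borel" for i by simp
  define F where "F = (\<lambda>i::nat. \<lambda>x. indicator (cball 0 (real i)) x * piece j f x)"
  show "F i \<in> borel_measurable borel" for i unfolding F_def by measurable
  obtain M where M: "\<And>x. norm (piece j f x) \<le> M" using piece_bounded[OF f] by metis
  have M0: "M \<ge> 0" using M[of 0] norm_ge_zero order_trans by blast
  have Fb: "bcs (F i)" for i
  proof (rule bcsI[of "F i" M "real i"])
    show "F i \<in> borel_measurable borel" unfolding F_def by measurable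
    show "norm (F i x) \<le> M" for x using M[of x] M0 by (simp add: F_def indicator_def)
    show "norm x \<le> real i" if "F i x \<noteq> 0" for x using that by (simp add: F_def indicator_def split: if_splits)
  qed
  show "(\<lambda>i. F i x) \<longlonglongrightarrow> piece j f x" for x
  proof (rule tendsto_eventually)
    obtain N :: nat where N: "norm x \<le> real N" using real_arch_simple by blast
    show "\<forall>\<^sub>F i in sequentially. F i x = piece j f x"
      using eventually_ge_at_top[of N] by eventually_elim (use N in \<open>auto simp: F_def indicator_def\<close>)
  qed
  show "(\<integral>\<^sup>+x. ennreal ((norm (F i x))\<^sup>2) \<partial>lborel) \<le> ennreal (K\<^sup>2)" for i
  proof -
    let ?w = "\<lambda>x. cnj (F i x)"
    have w: "bcs ?w" by (rule bcs_cnj[OF Fb])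
    have lw: "l2 ?w = l2 (F i)" by (simp add: l2_def)
    have "(LBINT x. piece j f x * ?w x) = (LBINT x. complex_of_real ((norm (F i x))\<^sup>2))"
      by (intro integral_cong refl) (auto simp: F_def indicator_def complex_norm_square simp del: of_real_power)
    also have "\<dots> = complex_of_real ((l2 (F i))\<^sup>2)" by (simp only: l2_sq integral_complex_of_real)
    finally have "(l2 (F i))\<^sup>2 \<le> K * l2 (F i)" using b[OF w] by (simp add: lw del: of_real_power)
    then have "l2 (F i) \<le> K"
      using K l2_nonneg[of "F i"] by (cases "l2 (F i) = 0") (auto simp: power2_eq_square)
    then show ?thesis
      unfolding sq_integrable_nn_integral[OF bcs_sq[OF Fb]] by (intro ennreal_leI power_mono l2_nonneg)
  qed
qed

text \<open>Truncating the input in position and height reduces to \<open>bcs\<close>. The truncated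
  pieces converge at every point because the kernel is square integrable, and Fatou keeps the
  bound.\<close>

lemma piece_L2:
  "\<exists>\<epsilon>>0. \<exists>C\<ge>0. \<forall>j f. sq_integrable f \<longrightarrow> (\<integral>\<^sup>+x. ennreal ((norm (piece j f x))\<^sup>2) \<partial>lborel) \<le> ennreal ((C * 2 powr (- (real j * \<epsilon>)) * l2 f)\<^sup>2)"
proof -
  obtain \<epsilon> C where \<epsilon>: "\<epsilon> > 0" and C: "C \<ge> 0" and
    Call: "\<forall>j f w. bcs f \<longrightarrow> bcs w \<longrightarrow> norm (LBINT x. piece j f x * w x) \<le> C * 2 powr (- (real j * \<epsilon>)) * (l2 f * l2 w)"
    using piece_l2_bilinear by (elim exE conjE) (rule that)
  have b: "(\<integral>\<^sup>+x. ennreal ((norm (piece j f x))\<^sup>2) \<partial>lborel) \<le> ennreal ((C * 2 powr (- (real j * \<epsilon>)) * l2 f)\<^sup>2)" if f: "bcs f" for f j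
    by (rule piece_l2_bcs[OF f]) (use Call f C in \<open>auto simp: l2_nonneg mult.assoc\<close>)
  have "(\<integral>\<^sup>+x. ennreal ((norm (piece j f x))\<^sup>2) \<partial>lborel) \<le> ennreal ((C * 2 powr (- (real j * \<epsilon>)) * l2 f)\<^sup>2)" if f: "sq_integrable f" for f j
  proof -
    have [measurable]: "f \<in> borel_measurable borel" by (rule sq_integrable_borel[OF f])
    define fk where "fk = (\<lambda>k::nat. \<lambda>y. indicator {y. norm y \<le> real k \<and> norm (f y) \<le> real k} y * f y)"
    have [measurable]: "fk k \<in> borel_measurable borel" for k unfolding fk_def by measurable
    have fb: "bcs (fk k)" for k
      by (rule bcsI[of _ "real k" "real k"]) (auto simp: fk_def indicator_def split: if_splits)
    have fle: "norm (fk k y) \<le> norm (f y)" for k y by (simp add: fk_def indicator_def)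
    have lim: "(\<lambda>k. fk k y) \<longlonglongrightarrow> f y" for y
    proof (rule tendsto_eventually)
      obtain N :: nat where N: "max (norm y) (norm (f y)) \<le> real N" using real_arch_simple by blast
      show "\<forall>\<^sub>F k in sequentially. fk k y = f y"
        using eventually_ge_at_top[of N] by eventually_elim (use N in \<open>auto simp: fk_def indicator_def\<close>)
    qed
    show ?thesis
    proof (rule fatou_sq[of "\<lambda>k. piece j (fk k)"])
      show "piece j (fk k) \<in> borel_measurable borel" for k by (rule piece_borel) measurable
      show "(\<lambda>k. piece j (fk k) x) \<longlonglongrightarrow> piece j f x" for x
        unfolding piece_def
      proof (rule integral_dominated_convergence[OF _ _ kern_sq_integrable[OF f, of j x]])
        show "AE y in lborel. (\<lambda>k. kern j x y * fk k y) \<longlonglongrightarrow> kern j x y * f y" by (intro AE_I2 tendsto_intros lim)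
        show "AE y in lborel. norm (kern j x y * fk k y) \<le> norm (kern j x y) * norm (f y)" for k
          by (intro AE_I2) (simp add: norm_mult mult_left_mono fle)
      qed measurable
      show "(\<integral>\<^sup>+x. ennreal ((norm (piece j (fk k) x))\<^sup>2) \<partial>lborel) \<le> ennreal ((C * 2 powr (- (real j * \<epsilon>)) * l2 f)\<^sup>2)" for k
      proof (rule order_trans[OF b[OF fb]])
        have "l2 (fk k) \<le> l2 f"
          unfolding l2_def using f bcs_norm_sq[OF fb]
          by (intro real_sqrt_le_mono integral_mono) (auto simp: sq_integrable_def fle intro!: power_mono)
        then show "ennreal ((C * 2 powr (- (real j * \<epsilon>)) * l2 (fk k))\<^sup>2) \<le> ennreal ((C * 2 powr (- (real j * \<epsilon>)) * l2 f)\<^sup>2)"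
          using C by (intro ennreal_leI power_mono mult_left_mono) (auto simp: l2_nonneg)
      qed
    qed
  qed
  then show ?thesis using \<epsilon> C by blast
qed

text \<open>The junk value of a divergent series is harmless: the series converges almost everywhere on \<open>L\<^sup>2\<close>.\<close>

definition piece_sum :: "(real^'n \<Rightarrow> complex) \<Rightarrow> real^'n \<Rightarrow> complex" where
  "piece_sum f x = (\<Sum>j. piece j f x)"

lemma piece_sum_L2:
  "\<exists>B\<ge>0. \<forall>f. sq_integrable f \<longrightarrow> (AE x in lborel. summable (\<lambda>j. norm (piece j f x))) \<and> sq_integrable (piece_sum f) \<and> l2 (piece_sum f) \<le> B * l2 f"
  using piece_L2
proof (elim exE conjE, goal_cases)
  case (1 \<epsilon> C)
  note \<epsilon> = 1(1) and C = 1(2) and Call = 1(3)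
  define b where "b = 2 powr (- \<epsilon>)"
  have b: "0 < b" "b < 1" using \<epsilon> powr_less_mono[of "- \<epsilon>" 0 2] by (auto simp: b_def)
  have bj: "2 powr (- (real j * \<epsilon>)) = b ^ j" for j by (simp add: b_def powr_power mult.commute)
  have "(AE x in lborel. summable (\<lambda>j. norm (piece j f x))) \<and> sq_integrable (piece_sum f) \<and> l2 (piece_sum f) \<le> C / (1 - b) * l2 f" if f: "sq_integrable f" for f
  proof -
    have [measurable]: "piece j f \<in> borel_measurable borel" for j by (intro piece_borel sq_integrable_borel f)
    \<comment> \<open>The squared norms decay like \<open>b ^ (2 * j)\<close>, so after
      multiplication by \<open>(1 / b) ^ j\<close> they still sum; this is the weight that
      \<open>weighted_cauchy_schwarz\<close> expects.\<close>
    define h where "h = (\<lambda>j x. (1 / b) ^ j * (norm (piece j f x))\<^sup>2)"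
    have h0: "h j x \<ge> 0" for j x using b by (simp add: h_def)
    have [measurable]: "h j \<in> borel_measurable borel" for j unfolding h_def by measurable
    have hI: "(\<integral>\<^sup>+x. ennreal (h j x) \<partial>lborel) \<le> ennreal ((C * l2 f)\<^sup>2 * b ^ j)" for j
    proof -
      have "(\<integral>\<^sup>+x. ennreal (h j x) \<partial>lborel) = ennreal ((1 / b) ^ j) * (\<integral>\<^sup>+x. ennreal ((norm (piece j f x))\<^sup>2) \<partial>lborel)"
        unfolding h_def using b by (subst nn_integral_cmult[symmetric]) (auto simp: ennreal_mult)
      also have "\<dots> \<le> ennreal ((1 / b) ^ j) * ennreal ((C * b ^ j * l2 f)\<^sup>2)"
        using Call f by (intro mult_left_mono) (auto simp: bj)
      also have "\<dots> = ennreal ((C * l2 f)\<^sup>2 * b ^ j)"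
        using b C by (subst ennreal_mult[symmetric]) (auto simp: power_mult_distrib power2_eq_square power_one_over intro!: arg_cong[where f=ennreal])
      finally show ?thesis .
    qed
    define H where "H = (\<lambda>x. \<Sum>j. ennreal (h j x))"
    have Hm[measurable]: "H \<in> borel_measurable borel" unfolding H_def by measurable
    have HI: "(\<integral>\<^sup>+x. H x \<partial>lborel) \<le> ennreal ((C * l2 f)\<^sup>2 / (1 - b))"
    proof -
      have "(\<integral>\<^sup>+x. H x \<partial>lborel) = (\<Sum>j. \<integral>\<^sup>+x. ennreal (h j x) \<partial>lborel)" unfolding H_def by (rule nn_integral_suminf) simp
      also have "\<dots> \<le> (\<Sum>j. ennreal ((C * l2 f)\<^sup>2 * b ^ j))" by (intro suminf_le hI) auto
      also have "\<dots> = ennreal (\<Sum>j. (C * l2 f)\<^sup>2 * b ^ j)"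
        using b by (intro suminf_ennreal2) (auto intro!: summable_mult summable_geometric)
      also have "(\<Sum>j. (C * l2 f)\<^sup>2 * b ^ j) = (C * l2 f)\<^sup>2 / (1 - b)"
        using b by (simp add: suminf_mult summable_geometric suminf_geometric)
      finally show ?thesis .
    qed
    have "(\<integral>\<^sup>+x. H x \<partial>lborel) \<noteq> \<infinity>" using HI by (auto simp: top_unique)
    then have ae: "AE x in lborel. H x \<noteq> \<infinity>" by (intro nn_integral_PInf_AE) auto
    have pw: "summable (\<lambda>j. norm (piece j f x)) \<and> ennreal ((norm (piece_sum f x))\<^sup>2) \<le> ennreal (1 / (1 - b)) * H x" if "H x \<noteq> \<infinity>" for x
    proof -
      have s: "summable (\<lambda>j. h j x)" by (rule summable_suminf_not_top) (use that h0 in \<open>auto simp: H_def\<close>)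
      have Hx: "H x = ennreal (\<Sum>j. h j x)" unfolding H_def by (rule suminf_ennreal2[OF h0 s])
      note w = weighted_cauchy_schwarz[OF b, of "\<lambda>j. piece j f x", folded h_def, OF s[unfolded h_def], folded piece_sum_def]
      show ?thesis
      proof (intro conjI w(1))
        have "ennreal ((norm (piece_sum f x))\<^sup>2) \<le> ennreal (1 / (1 - b) * (\<Sum>j. h j x))"
          using w(2) by (intro ennreal_leI) (simp add: piece_sum_def h_def)
        also have "\<dots> = ennreal (1 / (1 - b)) * H x"
          unfolding Hx using b by (intro ennreal_mult suminf_nonneg[OF s] h0) auto
        finally show "ennreal ((norm (piece_sum f x))\<^sup>2) \<le> ennreal (1 / (1 - b)) * H x" .
      qed
    qed
    have T0m: "piece_sum f \<in> borel_measurable borel" unfolding piece_sum_def by measurable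
    have "(\<integral>\<^sup>+x. ennreal ((norm (piece_sum f x))\<^sup>2) \<partial>lborel) \<le> (\<integral>\<^sup>+x. ennreal (1 / (1 - b)) * H x \<partial>lborel)"
      by (rule nn_integral_mono_AE) (use ae in \<open>eventually_elim; use pw in blast\<close>)
    also have "\<dots> = ennreal (1 / (1 - b)) * (\<integral>\<^sup>+x. H x \<partial>lborel)" by (rule nn_integral_cmult) simp
    also have "\<dots> \<le> ennreal (1 / (1 - b)) * ennreal ((C * l2 f)\<^sup>2 / (1 - b))" by (rule mult_left_mono[OF HI]) simp
    also have "\<dots> = ennreal ((C / (1 - b) * l2 f)\<^sup>2)"
      using b by (simp add: ennreal_mult[symmetric] power_mult_distrib power2_eq_square)
    finally have I: "(\<integral>\<^sup>+x. ennreal ((norm (piece_sum f x))\<^sup>2) \<partial>lborel) \<le> ennreal ((C / (1 - b) * l2 f)\<^sup>2)" .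
    have B0: "C / (1 - b) * l2 f \<ge> 0" using b C by (simp add: l2_nonneg)
    have "AE x in lborel. summable (\<lambda>j. norm (piece j f x))" using ae by eventually_elim (use pw in blast)
    then show ?thesis using sq_integrable_from_nn[OF T0m I B0] by blast
  qed
  moreover have "C / (1 - b) \<ge> 0" using C b by simp
  ultimately show ?thesis by blast
qed

lemma piece_sum_lin:
  assumes f: "sq_integrable f" and g: "sq_integrable g"
  shows "AE x in lborel. piece_sum (\<lambda>y. c * f y + g y) x = c * piece_sum f x + piece_sum g x"
proof -
  have "AE x in lborel. summable (\<lambda>j. norm (piece j f x))" "AE x in lborel. summable (\<lambda>j. norm (piece j g x))"
    using piece_sum_L2 f g by blast+
  then show ?thesis
  proof eventually_elim
    case (elim x)
    then have s: "summable (\<lambda>j. piece j f x)" "summable (\<lambda>j. piece j g x)" by (auto intro: summable_norm_cancel)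
    show ?case unfolding piece_sum_def piece_lin[OF f g]
      using suminf_add[OF summable_mult[OF s(1), of c] s(2)] suminf_mult[OF s(1), of c] by simp
  qed
qed

text \<open>Two kinds of decay play different parts: that of the norms justifies exchanging sum and
  integral, while the finer bounds \<open>c\<close> on the pairings give the result.\<close>

lemma piece_sum_pair:
  assumes f: "sq_integrable f" and w: "sq_integrable w" and c: "\<And>j. norm (LBINT x. piece j f x * w x) \<le> c j" "summable c"
  shows "norm (LBINT x. piece_sum f x * w x) \<le> (\<Sum>j. c j)"
  using piece_L2
proof (elim exE conjE, goal_cases)
  case (1 \<epsilon> C)
  note \<epsilon> = 1(1) and C = 1(2) and Call = 1(3)
  define b where "b = 2 powr (- \<epsilon>)"
  have b: "0 < b" "b < 1" using \<epsilon> powr_less_mono[of "- \<epsilon>" 0 2] by (auto simp: b_def)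
  have bj: "2 powr (- (real j * \<epsilon>)) = b ^ j" for j by (simp add: b_def powr_power mult.commute)
  have Tm[measurable]: "piece j f \<in> borel_measurable borel" for j by (intro piece_borel sq_integrable_borel f)
  have wm[measurable]: "w \<in> borel_measurable borel" by (rule sq_integrable_borel[OF w])
  have T: "sq_integrable (piece j f)" "l2 (piece j f) \<le> C * b ^ j * l2 f" for j
  proof -
    have "0 \<le> C * b ^ j * l2 f" using C b by (simp add: l2_nonneg)
    then show "sq_integrable (piece j f)" "l2 (piece j f) \<le> C * b ^ j * l2 f"
      using sq_integrable_from_nn[OF Tm, of j "C * b ^ j * l2 f"] Call[rule_format, OF f, of j] unfolding bj by auto
  qed
  have I: "integrable lborel (\<lambda>x. norm (piece j f x) * norm (w x))" "(LBINT x. norm (piece j f x) * norm (w x)) \<le> l2 (piece j f) * l2 w" for j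
    using T(1)[of j] w unfolding sq_integrable_def by (intro cauchy_schwarz_integral; auto)+
  have I': "integrable lborel (\<lambda>x. piece j f x * w x)" for j
    using I(1)[of j] by (subst integrable_norm_iff[symmetric]) (auto simp: norm_mult)
  have ae: "AE x in lborel. summable (\<lambda>j. norm (piece j f x))" using piece_sum_L2 f by blast
  have "(LBINT x. piece_sum f x * w x) = (LBINT x. (\<Sum>j. piece j f x * w x))"
  proof (rule integral_cong_AE)
    show "(\<lambda>x. piece_sum f x * w x) \<in> borel_measurable lborel" unfolding piece_sum_def by measurable
    show "AE x in lborel. piece_sum f x * w x = (\<Sum>j. piece j f x * w x)"
      using ae by eventually_elim (simp add: piece_sum_def suminf_mult2 summable_norm_cancel)
  qed measurable
  also have "\<dots> = (\<Sum>j. LBINT x. piece j f x * w x)"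
  proof (rule integral_suminf[OF I'])
    show "AE x in lborel. summable (\<lambda>j. norm (piece j f x * w x))"
      using ae by eventually_elim (simp add: norm_mult summable_mult2)
    show "summable (\<lambda>j. LBINT x. norm (piece j f x * w x))"
    proof (rule summable_comparison_test')
      show "summable (\<lambda>j. C * l2 f * l2 w * b ^ j)" using b by (intro summable_mult summable_geometric) auto
      show "norm (LBINT x. norm (piece j f x * w x)) \<le> C * l2 f * l2 w * b ^ j" for j
      proof -
        have "(LBINT x. norm (piece j f x * w x)) \<le> l2 (piece j f) * l2 w" using I(2)[of j] by (simp add: norm_mult)
        also have "\<dots> \<le> (C * b ^ j * l2 f) * l2 w" by (intro mult_right_mono T l2_nonneg)
        finally show ?thesis by (simp add: mult_ac)
      qed
    qed
  qed
  finally have e: "(LBINT x. piece_sum f x * w x) = (\<Sum>j. LBINT x. piece j f x * w x)" .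
  show ?thesis unfolding e by (rule norm_suminf_le[OF c])
qed

text \<open>The equality holds at every point, since the input enters only through integrals against
  the kernels.\<close>

lemma piece_sum_cong: "(AE y in lborel. f y = g y) \<Longrightarrow> f \<in> borel_measurable borel \<Longrightarrow> g \<in> borel_measurable borel \<Longrightarrow> piece_sum f = piece_sum g"
  unfolding piece_sum_def piece_def
  by (intro ext suminf_cong integral_cong_AE) (auto intro: borel_measurable_times kern_borel2)

end

section \<open>Schwartz functions\<close>

lemma schwartz_diff: "schwartz f \<Longrightarrow> set bs \<subseteq> Basis \<Longrightarrow> iter_partial bs f differentiable (at z)"
  by (simp add: schwartz_def smooth_def)

lemma schwartz_cont: "schwartz f \<Longrightarrow> set bs \<subseteq> Basis \<Longrightarrow> continuous_on UNIV (iter_partial bs f)"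
  using schwartz_diff differentiable_imp_continuous_within by (blast intro: continuous_at_imp_continuous_on)

lemma schwartz_borel: "schwartz f \<Longrightarrow> set bs \<subseteq> Basis \<Longrightarrow> iter_partial bs f \<in> borel_measurable borel"
  by (intro borel_measurable_continuous_onI schwartz_cont)

text \<open>A weight with integrable inverse that factors over the coordinates and is comparable
  with powers of \<open>1 + norm x\<close> from above.\<close>

definition japanese :: "real^'n::finite \<Rightarrow> real" where
  "japanese x = (\<Prod>b\<in>Basis. 1 + (x \<bullet> b)\<^sup>2)"

lemma japanese_ge: "japanese x \<ge> 1"
  unfolding japanese_def by (intro prod_ge_1) auto

lemma japanese_integrable: "integrable lborel (\<lambda>x::real^'n::finite. inverse (japanese x))"
proof -
  have "integrable lborel (\<lambda>t::real. inverse (1 + t\<^sup>2))"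
    using integrable_inverse_1_plus_square by (simp add: set_integrable_def)
  then have h: "integrable lborel (\<lambda>t. complex_of_real (inverse (1 + t\<^sup>2)))" unfolding complex_of_real_integrable_eq .
  have "integrable lborel (\<lambda>x::real^'n. \<Prod>b\<in>Basis. complex_of_real (inverse (1 + (x \<bullet> b)\<^sup>2)))"
    by (rule lborel_product_integral(1)) (rule h)
  then have "integrable lborel (\<lambda>x::real^'n. complex_of_real (inverse (japanese x)))"
    by (simp only: japanese_def prod_inversef[symmetric] o_def of_real_prod)
  then show ?thesis by (rule complex_of_real_integrable_eq[THEN iffD1])
qed

lemma japanese_le_norm: "japanese x \<le> (1 + norm x) ^ (2 * CARD('n))" for x :: "real^'n::finite"
proof -
  have "japanese x \<le> (\<Prod>b\<in>(Basis::(real^'n) set). (1 + norm x)\<^sup>2)"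
    unfolding japanese_def
  proof (intro prod_mono conjI)
    fix b :: "real^'n" assume b: "b \<in> Basis"
    have "(x \<bullet> b)\<^sup>2 \<le> (norm x)\<^sup>2" using Basis_le_norm[OF b, of x] by (simp add: abs_le_square_iff[symmetric])
    then show "1 + (x \<bullet> b)\<^sup>2 \<le> (1 + norm x)\<^sup>2" using norm_ge_zero[of x] by (simp add: power2_sum del: norm_ge_zero)
  qed auto
  then show ?thesis by (simp add: power_mult[symmetric])
qed

lemma schwartz_japanese: 
  assumes f: "schwartz f" and bs: "set bs \<subseteq> Basis"
  obtains C where "C \<ge> 0" "\<And>x. norm (iter_partial bs f x) \<le> C * inverse (japanese x)"
proof -
  obtain C where C: "\<And>x. (1 + norm x) ^ (2 * CARD('a)) * norm (iter_partial bs f x) \<le> C"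
    using f bs unfolding schwartz_def by meson
  have "norm (iter_partial bs f x) \<le> max C 0 * inverse (japanese x)" for x
  proof -
    have "japanese x * norm (iter_partial bs f x) \<le> (1 + norm x) ^ (2 * CARD('a)) * norm (iter_partial bs f x)"
      by (intro mult_right_mono japanese_le_norm) auto
    also have "\<dots> \<le> max C 0" using C by (simp add: le_max_iff_disj)
    finally show ?thesis using japanese_ge[of x] by (simp add: field_simps)
  qed
  then show ?thesis by (intro that[of "max C 0"]) auto
qed

lemma schwartz_integrable:
  assumes f: "schwartz f" and bs: "set bs \<subseteq> Basis"
  shows "integrable lborel (iter_partial bs f)"
proof -
  obtain C where C: "C \<ge> 0" "\<And>x. norm (iter_partial bs f x) \<le> C * inverse (japanese x)"
    using schwartz_japanese[OF f bs] by metis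
  show ?thesis
  proof (rule integrable_bound[OF integrable_mult_right[OF japanese_integrable, of C]])
    show "iter_partial bs f \<in> borel_measurable lborel" using schwartz_borel[OF f bs] by simp
    show "AE x in lborel. norm (iter_partial bs f x) \<le> norm (C * inverse (japanese x))"
      using C(2) by (intro AE_I2) (auto intro: order_trans[OF _ abs_ge_self])
  qed
qed

lemma schwartz_sq:
  assumes f: "schwartz f"
  shows "sq_integrable f"
proof -
  have [measurable]: "f \<in> borel_measurable borel" using schwartz_borel[OF f, of "[]"] by simp
  obtain C where C: "C \<ge> 0" "\<And>x. norm (f x) \<le> C * inverse (japanese x)"
    using schwartz_japanese[OF f, of "[]"] by auto
  have C1: "norm (f x) \<le> C" for x
  proof -
    have "C * inverse (japanese x) \<le> C * 1" using C(1) japanese_ge[of x] by (intro mult_left_mono inverse_le_1_iff[THEN iffD2]) auto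
    then show ?thesis using C(2)[of x] by simp
  qed
  have fi: "integrable lborel f" using schwartz_integrable[OF f, of "[]"] by simp
  have "integrable lborel (\<lambda>x. (norm (f x))\<^sup>2)"
  proof (rule integrable_bound[OF integrable_mult_right[OF integrable_norm[OF fi], of C]])
    show "AE x in lborel. norm ((norm (f x))\<^sup>2) \<le> norm (C * norm (f x))"
      using C1 C(1) by (intro AE_I2) (simp add: power2_eq_square mult_right_mono)
  qed measurable
  then show ?thesis by (simp add: sq_integrable_def)
qed

lemma ft_l1: "norm (ft u \<xi>) \<le> l1 u"
  unfolding ft_def l1_def by (rule order_trans[OF integral_norm_bound]) (simp add: norm_mult)

lemma schwartz_ft_deriv:
  assumes f: "schwartz f" and b: "b \<in> Basis"
  shows "norm (ft (iter_partial (replicate N b) f) \<xi>) = \<bar>\<xi> \<bullet> b\<bar> ^ N * norm (ft f \<xi>)"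
proof (induction N)
  case (Suc N)
  define g where "g = iter_partial (replicate N b) f"
  define g' where "g' = iter_partial (replicate (Suc N) b) f"
  have sb: "set (replicate k b) \<subseteq> Basis" for k using b by auto
  have gi: "integrable lborel g" "integrable lborel g'" unfolding g_def g'_def by (intro schwartz_integrable f sb)+
  have [measurable]: "g \<in> borel_measurable borel" "g' \<in> borel_measurable borel" unfolding g_def g'_def by (intro schwartz_borel f sb)+
  have gc: "continuous_on UNIV g" "continuous_on UNIV g'" unfolding g_def g'_def by (intro schwartz_cont f sb)+
  let ?F = "\<lambda>y. cis (- (y \<bullet> \<xi>)) * g y"
  let ?F' = "\<lambda>y. cis (- (y \<bullet> \<xi>)) * g' y + (- \<i> * complex_of_real (\<xi> \<bullet> b)) * ?F y"
  have ci: "integrable lborel (\<lambda>y. cis (- (y \<bullet> \<xi>)) * h y)" if "integrable lborel h" "h \<in> borel_measurable borel" for h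
  proof -
    note [measurable] = that(2)
    show ?thesis using that(1) by (subst integrable_norm_iff[symmetric]) (auto simp: norm_mult)
  qed
  have i1: "integrable lborel ?F" "integrable lborel (\<lambda>y. cis (- (y \<bullet> \<xi>)) * g' y)" by (intro ci gi; measurable)+
  have "(LBINT y. ?F' y) = 0"
  proof (rule integral_partial_zero[of ?F])
    show "integrable lborel ?F'" by (intro integrable_add integrable_mult_right i1)
    show "continuous_on UNIV ?F'" by (intro continuous_intros gc)
    fix y
    have d1: "((\<lambda>t. g (y + t *\<^sub>R b)) has_vector_derivative g' y) (at 0)"
      using iter_partial_line_derivative[OF schwartz_diff[OF f sb], of N y b] by (simp add: g_def g'_def)
    have d2: "((\<lambda>t. cis (- ((y + t *\<^sub>R b) \<bullet> \<xi>))) has_vector_derivative - \<i> * complex_of_real (\<xi> \<bullet> b) * cis (- (y \<bullet> \<xi>))) (at 0)"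
    proof -
      obtain i where i: "b = axis i 1" using b by (auto simp: Basis_vec_def)
      have "(- \<xi>) \<bullet> u = - (u \<bullet> \<xi>)" for u by (simp add: inner_commute)
      then show ?thesis using cis_line_derivative[of "- \<xi>" y i] by (simp add: i inner_axis)
    qed
    show "((\<lambda>t. ?F (y + t *\<^sub>R b)) has_vector_derivative ?F' y) (at 0)"
      using has_vector_derivative_mult[OF d2 d1] by (simp add: algebra_simps)
  qed (rule i1)
  moreover have "(LBINT y. ?F' y) = ft g' \<xi> + (- \<i> * complex_of_real (\<xi> \<bullet> b)) * ft g \<xi>"
    unfolding ft_def by (subst integral_add) (auto intro!: i1 integrable_mult_right simp: mult.assoc)
  ultimately have "ft g' \<xi> = \<i> * complex_of_real (\<xi> \<bullet> b) * ft g \<xi>" by (simp add: algebra_simps add_eq_0_iff)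
  then have "norm (ft g' \<xi>) = \<bar>\<xi> \<bullet> b\<bar> * norm (ft g \<xi>)" by (simp add: norm_mult)
  then show ?case using Suc by (simp add: g_def g'_def)
qed simp

text \<open>The largest coordinate dominates the product. Thus pure derivatives of order
  \<open>2 * n\<close> in each direction suffice to show that the transform of a Schwartz function
  is integrable.\<close>

lemma japanese_le_sum: "japanese \<xi> \<le> 2 ^ CARD('n) * (1 + (\<Sum>b\<in>Basis. \<bar>\<xi> \<bullet> b\<bar> ^ (2 * CARD('n))))" for \<xi> :: "real^'n::finite"
proof -
  define M where "M = Max ((\<lambda>b. \<bar>\<xi> \<bullet> b\<bar>) ` Basis)"
  have "M \<in> (\<lambda>b. \<bar>\<xi> \<bullet> b\<bar>) ` Basis" unfolding M_def by (rule Max_in) auto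
  then obtain b0 where b0: "b0 \<in> Basis" "M = \<bar>\<xi> \<bullet> b0\<bar>" by blast
  have le: "\<bar>\<xi> \<bullet> b\<bar> \<le> M" if "b \<in> Basis" for b unfolding M_def by (rule Max_ge) (use that in auto)
  have M0: "M \<ge> 0" using b0 by simp
  have "japanese \<xi> \<le> (\<Prod>b\<in>(Basis::(real^'n) set). 1 + M\<^sup>2)"
    unfolding japanese_def using le M0 by (intro prod_mono) (auto simp: abs_le_square_iff[symmetric])
  also have "\<dots> = (1 + M\<^sup>2) ^ CARD('n)" by simp
  also have "\<dots> \<le> 2 ^ CARD('n) * (1 + M ^ (2 * CARD('n)))"
  proof (cases "M \<le> 1")
    case True
    then have "1 + M\<^sup>2 \<le> 2" using M0 by (simp add: power_le_one)
    then have "(1 + M\<^sup>2) ^ CARD('n) \<le> 2 ^ CARD('n)" by (intro power_mono) auto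
    also have "\<dots> \<le> 2 ^ CARD('n) * (1 + M ^ (2 * CARD('n)))" using M0 by simp
    finally show ?thesis .
  next
    case False
    then have "1 + M\<^sup>2 \<le> 2 * M\<^sup>2" by (simp add: one_le_power)
    then have "(1 + M\<^sup>2) ^ CARD('n) \<le> (2 * M\<^sup>2) ^ CARD('n)" by (intro power_mono) auto
    also have "\<dots> = 2 ^ CARD('n) * M ^ (2 * CARD('n))" by (simp add: power_mult_distrib power_mult)
    finally show ?thesis by (simp add: distrib_left order_trans)
  qed
  also have "M ^ (2 * CARD('n)) \<le> (\<Sum>b\<in>Basis. \<bar>\<xi> \<bullet> b\<bar> ^ (2 * CARD('n)))"
    unfolding b0(2) by (rule member_le_sum[OF b0(1)]) auto
  finally show ?thesis by simp
qed

lemma schwartz_ft: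
  assumes f: "schwartz f"
  shows "ft f \<in> borel_measurable borel" "integrable lborel (ft f)"
proof -
  have [measurable]: "f \<in> borel_measurable borel" using schwartz_borel[OF f, of "[]"] by simp
  show m: "ft f \<in> borel_measurable borel" unfolding ft_def[abs_def]
    by (rule lborel.borel_measurable_lebesgue_integral) measurable
  define C where "C = 2 ^ CARD('a) * (l1 f + (\<Sum>b\<in>Basis. l1 (iter_partial (replicate (2 * CARD('a)) b) f)))"
  have b: "norm (ft f \<xi>) \<le> C * inverse (japanese \<xi>)" for \<xi>
  proof -
    have "japanese \<xi> * norm (ft f \<xi>) \<le> 2 ^ CARD('a) * (1 + (\<Sum>b\<in>Basis. \<bar>\<xi> \<bullet> b\<bar> ^ (2 * CARD('a)))) * norm (ft f \<xi>)"
      by (intro mult_right_mono japanese_le_sum) auto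
    also have "\<dots> = 2 ^ CARD('a) * (norm (ft f \<xi>) + (\<Sum>b\<in>Basis. norm (ft (iter_partial (replicate (2 * CARD('a)) b) f) \<xi>)))"
      by (simp add: schwartz_ft_deriv[OF f] distrib_right sum_distrib_right)
    also have "\<dots> \<le> C" unfolding C_def by (intro mult_left_mono add_mono sum_mono ft_l1) auto
    finally show ?thesis using japanese_ge[of \<xi>] by (simp add: field_simps)
  qed
  show "integrable lborel (ft f)"
    by (rule integrable_bound[OF integrable_mult_right[OF japanese_integrable, of C]])
      (use m b in \<open>auto intro!: AE_I2 intro: order_trans[OF _ abs_ge_self]\<close>)
qed

context pdo_symbol begin

text \<open>The partial sums telescope to the operator with the frequency cutoff
  \<open>cut (int J)\<close>, which converge everywhere by dominated convergence; the sum of the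
  series is identified wherever it converges absolutely.\<close>

lemma schwartz_piece_sum:
  assumes f: "schwartz f"
  shows "AE x in lborel. piece_sum f x = pdo a f x"
proof -
  have [measurable]: "f \<in> borel_measurable borel" using schwartz_borel[OF f, of "[]"] by simp
  have fi: "integrable lborel f" using schwartz_integrable[OF f, of "[]"] by simp
  note ftm[measurable] = schwartz_ft(1)[OF f] and fti = schwartz_ft(2)[OF f]
  obtain C where C: "C \<ge> 0" "\<And>z. norm (a z) \<le> C" using a_global_bound by metis
  have four: "fourier f = ft f"
    unfolding fourier_def ft_def by (intro ext integral_completion) measurable
  have ax[measurable]: "(\<lambda>\<xi>. a (x, \<xi>)) \<in> borel_measurable borel" for x by measurable
  have pd: "pdo a f x = (LBINT \<xi>. cis (x \<bullet> \<xi>) * a (x, \<xi>) * ft f \<xi>)" for x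
    unfolding pdo_def four by (rule integral_completion) measurable
  have lim: "(\<lambda>J. \<Sum>j<Suc J. piece j f x) \<longlonglongrightarrow> pdo a f x" for x
  proof -
    have cm: "integrable lborel (\<lambda>\<xi>. norm (C * norm (ft f \<xi>)))" using fti by simp
    have I: "integrable lborel (\<lambda>\<xi>. (complex_of_real (psi j \<xi>) * ft f \<xi>) * (cis (x \<bullet> \<xi>) * a (x, \<xi>)))" for j
    proof (rule integrable_bound[OF cm])
      have "\<bar>psi j \<xi>\<bar> * norm (ft f \<xi>) * norm (a (x, \<xi>)) \<le> 1 * norm (ft f \<xi>) * C" for \<xi>
        using psi_abs_le[of j \<xi>] C by (intro mult_mono) auto
      then show "AE \<xi> in lborel. norm ((complex_of_real (psi j \<xi>) * ft f \<xi>) * (cis (x \<bullet> \<xi>) * a (x, \<xi>))) \<le> norm (norm (C * norm (ft f \<xi>)))"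
        using C(1) by (intro AE_I2) (simp add: norm_mult mult_ac)
    qed measurable
    have e: "(\<Sum>j<Suc J. piece j f x) = (LBINT \<xi>. complex_of_real (cut (int J) \<xi>) * (cis (x \<bullet> \<xi>) * a (x, \<xi>) * ft f \<xi>))" for J
    proof -
      have "(\<Sum>j<Suc J. piece j f x) = (LBINT \<xi>. (\<Sum>j<Suc J. (complex_of_real (psi j \<xi>) * ft f \<xi>) * (cis (x \<bullet> \<xi>) * a (x, \<xi>))))"
        unfolding piece_freq[OF fi] by (rule integral_sum[symmetric]) (rule I)
      also have "\<dots> = (LBINT \<xi>. complex_of_real (cut (int J) \<xi>) * (cis (x \<bullet> \<xi>) * a (x, \<xi>) * ft f \<xi>))"
        unfolding sum_psi[symmetric] of_real_sum sum_distrib_right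
        by (intro integral_cong refl sum.cong) (simp add: mult_ac)
      finally show ?thesis .
    qed
    show ?thesis unfolding e pd
    proof (rule integral_dominated_convergence[OF _ _ cm])
      show "(\<lambda>\<xi>. complex_of_real (cut (int J) \<xi>) * (cis (x \<bullet> \<xi>) * a (x, \<xi>) * ft f \<xi>)) \<in> borel_measurable lborel" for J
        unfolding sum_psi[symmetric] by measurable
      show "AE \<xi> in lborel. (\<lambda>J. complex_of_real (cut (int J) \<xi>) * (cis (x \<bullet> \<xi>) * a (x, \<xi>) * ft f \<xi>)) \<longlonglongrightarrow> cis (x \<bullet> \<xi>) * a (x, \<xi>) * ft f \<xi>"
      proof (intro AE_I2 tendsto_eventually)
        fix \<xi> :: "real^'n"
        obtain N where N: "norm \<xi> < 2 ^ N" using real_arch_pow[of 2 "norm \<xi>"] by auto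
        show "\<forall>\<^sub>F J in sequentially. complex_of_real (cut (int J) \<xi>) * (cis (x \<bullet> \<xi>) * a (x, \<xi>) * ft f \<xi>) = cis (x \<bullet> \<xi>) * a (x, \<xi>) * ft f \<xi>"
          using eventually_ge_at_top[of N]
        proof eventually_elim
          case (elim J)
          have "\<bar>\<xi> $ l\<bar> \<le> 2 ^ J" for l
          proof -
            have "\<bar>\<xi> $ l\<bar> \<le> norm \<xi>" by (rule component_le_norm_cart)
            also have "\<dots> \<le> 2 ^ N" using N by simp
            also have "\<dots> \<le> 2 ^ J" using elim by (intro power_increasing) auto
            finally show ?thesis .
          qed
          then have "cut (int J) \<xi> = 1" unfolding cut_def by (intro prod.neutral ballI bump_props(3)) simp
          then show ?case by simp
        qed
      qed
      show "AE \<xi> in lborel. norm (complex_of_real (cut (int J) \<xi>) * (cis (x \<bullet> \<xi>) * a (x, \<xi>) * ft f \<xi>)) \<le> norm (C * norm (ft f \<xi>))" for J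
      proof (rule AE_I2)
        fix \<xi> :: "real^'n"
        have "\<bar>cut (int J) \<xi>\<bar> * (norm (a (x, \<xi>)) * norm (ft f \<xi>)) \<le> 1 * (C * norm (ft f \<xi>))"
          using cut_bounds[of "int J" \<xi>] C by (intro mult_mono) auto
        then show "norm (complex_of_real (cut (int J) \<xi>) * (cis (x \<bullet> \<xi>) * a (x, \<xi>) * ft f \<xi>)) \<le> norm (C * norm (ft f \<xi>))"
          using C(1) by (simp add: norm_mult)
      qed
    qed measurable
  qed
  have "AE x in lborel. summable (\<lambda>j. norm (piece j f x))" using piece_sum_L2 schwartz_sq[OF f] by blast
  then show ?thesis
  proof eventually_elim
    case (elim x)
    then have "(\<lambda>n. \<Sum>j<n. piece j f x) \<longlonglongrightarrow> piece_sum f x" unfolding piece_sum_def by (rule summable_LIMSEQ[OF summable_norm_cancel])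
    then have "(\<lambda>J. \<Sum>j<Suc J. piece j f x) \<longlonglongrightarrow> piece_sum f x" by (rule LIMSEQ_Suc)
    then show ?case by (rule LIMSEQ_unique[OF _ lim])
  qed
qed

end

section \<open>Density of the Schwartz functions\<close>

lemma smooth1_scale: "smooth1 u \<Longrightarrow> smooth1 (\<lambda>x. u (c * x))"
proof (induction rule: smooth1.induct)
  case (flat n \<alpha> \<beta>)
  have "smooth1 (\<lambda>x. flat_exp n ((\<alpha> * c) * x + \<beta>))" by (rule smooth1.flat)
  then show ?case by (simp add: mult.assoc)
qed (auto intro: smooth1.intros)

lemma iter_partial_local_zero:
  fixes F :: "'a::euclidean_space \<Rightarrow> 'b::real_normed_vector"
  assumes "open S" and z: "\<And>x. x \<in> S \<Longrightarrow> F x = 0" and "x \<in> S"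
  shows "iter_partial bs F x = 0"
  using \<open>x \<in> S\<close>
proof (induction bs arbitrary: x)
  case (Cons b bs)
  have "((\<lambda>_. 0) has_derivative (\<lambda>_. 0)) (at x)" by simp
  then have "(iter_partial bs F has_derivative (\<lambda>_. 0)) (at x)"
    by (rule has_derivative_transform_within_open[OF _ \<open>open S\<close> Cons(2)]) (simp add: Cons.IH)
  then have "(\<lambda>_. 0) = frechet_derivative (iter_partial bs F) (at x)" by (rule frechet_derivative_at)
  then show ?case by (simp add: fun_eq_iff)
qed (simp add: z)

lemma smooth_alg_cont: "smooth_alg F \<Longrightarrow> continuous_on UNIV F"
  using smooth_alg_frechet(1) differentiable_imp_continuous_within by (blast intro: continuous_at_imp_continuous_on)

lemma schwartz_compact_support:
  fixes F :: "real^'n::finite \<Rightarrow> complex"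
  assumes F: "smooth_alg F" and R: "\<And>x. norm x > R \<Longrightarrow> F x = 0"
  shows "schwartz F"
  unfolding schwartz_def
proof (intro conjI allI impI)
  show "smooth F" by (rule smooth_alg_smooth[OF F])
  fix k :: nat and bs :: "(real^'n) list" assume bs: "set bs \<subseteq> Basis"
  let ?h = "\<lambda>x. (1 + norm x) ^ k * norm (iter_partial bs F x)"
  have "continuous_on (cball 0 R) ?h"
    by (intro continuous_intros continuous_on_subset[OF smooth_alg_cont[OF smooth_alg_iter_partial[OF F bs]]]) auto
  then have "bounded (?h ` cball 0 R)" by (intro compact_imp_bounded compact_continuous_image) auto
  then obtain C where "\<forall>y\<in>?h ` cball 0 R. norm y \<le> C" unfolding bounded_iff by blast
  then have C: "?h x \<le> C" if "norm x \<le> R" for x using that by auto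
  have o: "open {x::real^'n. norm x > R}" by (intro open_Collect_less continuous_intros)
  have "?h x \<le> max C 0" for x
  proof (cases "norm x \<le> R")
    case True
    then show ?thesis using C[of x] by (simp add: le_max_iff_disj)
  next
    case False
    then have "iter_partial bs F x = 0" by (intro iter_partial_local_zero[OF o]) (auto simp: R)
    then show ?thesis by simp
  qed
  then show "\<exists>C. \<forall>x. ?h x \<le> C" by blast
qed

lemma smooth_alg_polynomial:
  fixes p :: "'a::euclidean_space \<Rightarrow> real"
  shows "real_polynomial_function p \<Longrightarrow> smooth_alg (\<lambda>x. complex_of_real (p x))"
proof (induction rule: real_polynomial_function.induct)
  case (linear f)
  have e: "f x = (\<Sum>b\<in>Basis. (x \<bullet> b) * f b)" for x
  proof -
    interpret bounded_linear f by (rule linear)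
    have "f x = f (\<Sum>b\<in>Basis. (x \<bullet> b) *\<^sub>R b)" by (simp add: euclidean_representation)
    then show ?thesis by (simp add: sum scale)
  qed
  have "(\<lambda>x. complex_of_real (f x)) = (\<lambda>x. \<Sum>b\<in>Basis. complex_of_real (x \<bullet> b) * complex_of_real (f b))"
    unfolding of_real_mult[symmetric] of_real_sum[symmetric] by (rule ext) (rule arg_cong[OF e])
  moreover have "smooth_alg (\<lambda>x::'a. \<Sum>b\<in>Basis. complex_of_real (x \<bullet> b) * complex_of_real (f b))"
    by (intro smooth_alg_sum smooth_alg.mult smooth_alg.const smooth_alg.gen[OF smooth1.ident]) auto
  ultimately show ?case by simp
qed (auto intro: smooth_alg.intros)

lemma smooth_alg_polynomial_complex:
  fixes p :: "'a::euclidean_space \<Rightarrow> complex"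
  assumes "polynomial_function p"
  shows "smooth_alg p"
proof -
  have "real_polynomial_function (Re \<circ> p)" "real_polynomial_function (Im \<circ> p)"
    using assms bounded_linear_Re bounded_linear_Im unfolding polynomial_function_def by blast+
  then have "smooth_alg (\<lambda>x. complex_of_real ((Re \<circ> p) x) + \<i> * complex_of_real ((Im \<circ> p) x))"
    by (intro smooth_alg.add smooth_alg.mult smooth_alg.const smooth_alg_polynomial)
  then show ?thesis by (simp add: complex_eq[symmetric])
qed

definition cutoff :: "real \<Rightarrow> 'a::euclidean_space \<Rightarrow> complex" where
  "cutoff R x = (\<Prod>b\<in>Basis. complex_of_real (bump (inverse R * (x \<bullet> b))))"

lemma cutoff_smooth: "smooth_alg (cutoff R)"
  unfolding cutoff_def[abs_def]
  by (intro smooth_alg_prod smooth_alg.gen[OF smooth1_scale[OF smooth1_bump]]) auto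

lemma cutoff_props:
  fixes x :: "'a::euclidean_space"
  assumes R: "R > 0"
  shows "norm (cutoff R x) \<le> 1" "norm x \<le> R \<Longrightarrow> cutoff R x = 1" "norm x > 2 * R * DIM('a) \<Longrightarrow> cutoff R x = 0"
proof -
  show "norm (cutoff R x) \<le> 1"
  proof -
    have "norm (cutoff R x) = (\<Prod>b\<in>(Basis::'a set). norm (complex_of_real (bump (inverse R * (x \<bullet> b)))))"
      unfolding cutoff_def by (rule prod_norm[symmetric])
    also have "\<dots> \<le> 1" by (intro prod_le_1) (auto simp only: norm_of_real abs_of_nonneg[OF bump_props(1)] bump_props(1,2))
    finally show ?thesis .
  qed
  show "cutoff R x = 1" if "norm x \<le> R"
    unfolding cutoff_def
  proof (intro prod.neutral ballI)
    fix b :: 'a assume b: "b \<in> Basis"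
    have "\<bar>x \<bullet> b\<bar> \<le> R" using Basis_le_norm[OF b, of x] that by simp
    then have "\<bar>inverse R * (x \<bullet> b)\<bar> \<le> 1" using R by (simp add: abs_mult field_simps)
    then show "complex_of_real (bump (inverse R * (x \<bullet> b))) = 1" by (simp add: bump_props(3))
  qed
  show "cutoff R x = 0" if n: "norm x > 2 * R * DIM('a)"
  proof (rule ccontr)
    assume "cutoff R x \<noteq> 0"
    then have nz: "bump (inverse R * (x \<bullet> b)) \<noteq> 0" if "b \<in> Basis" for b using that by (auto simp: cutoff_def)
    have "\<bar>x \<bullet> b\<bar> \<le> 2 * R" if "b \<in> Basis" for b
    proof -
      have "\<bar>inverse R * (x \<bullet> b)\<bar> < 2" using nz[OF that] bump_props(4) by (meson not_le)
      then show ?thesis using R by (simp add: abs_mult field_simps)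
    qed
    then have "(\<Sum>b\<in>Basis. \<bar>x \<bullet> b\<bar>) \<le> real (card (Basis::'a set)) * (2 * R)" by (rule sum_bounded_above)
    then show False using norm_le_l1[of x] n by (simp add: mult_ac)
  qed
qed

text \<open>Continuous functions converge to \<open>f\<close> almost everywhere; on a large ball
  they are replaced by nearby polynomials, and a smooth cutoff equal to 1 on the support makes the
  products Schwartz functions. A uniform bound on the ball then gives convergence in the
  mean.\<close>

lemma schwartz_dense:
  fixes f :: "real^'n::finite \<Rightarrow> complex"
  assumes f: "bcs f"
  obtains h where "\<And>k. schwartz (h k)" "(\<lambda>k. LBINT x. (norm (f x - h k x))\<^sup>2) \<longlonglongrightarrow> 0"
proof -
  have fm[measurable]: "f \<in> borel_measurable borel" by (rule bcs_measurable[OF f])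
  obtain B where B: "B \<ge> 0" "\<And>x. norm (f x) \<le> B" using bcs_bound[OF f] by metis
  obtain R where R: "R > 0" "\<And>x. f x \<noteq> 0 \<Longrightarrow> norm x \<le> R" using bcs_support[OF f] by metis
  have "f \<in> borel_measurable lebesgue" using measurable_completion[of f lborel borel] fm by simp
  then have "f measurable_on UNIV" by (rule lebesgue_measurable_imp_measurable_on) simp
  then obtain N g where N: "negligible N" and g: "\<And>n. continuous_on UNIV (g n)" and gl: "\<And>x. x \<notin> N \<Longrightarrow> (\<lambda>n. g n x) \<longlonglongrightarrow> f x"
    unfolding measurable_on_def by auto
  \<comment> \<open>The projection onto the disc of radius \<open>B\<close> bounds the approximants
    uniformly without changing the values of \<open>f\<close>, so a dominating function
    exists.\<close>
  define c where "c = closest_point (cball (0::complex) B)"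
  have cne: "cball (0::complex) B \<noteq> {}" using B(1) by auto
  have cc: "continuous_on UNIV c" unfolding c_def using cne by (intro continuous_on_closest_point) auto
  have cB: "norm (c z) \<le> B" for z unfolding c_def using closest_point_in_set[of "cball (0::complex) B" z] cne by simp
  have cf: "c (f x) = f x" for x unfolding c_def by (rule closest_point_self) (simp add: B)
  define S where "S = cball (0::real^'n) (2 * R * DIM(real^'n))"
  have Sm[measurable]: "S \<in> sets borel" by (simp add: S_def)
  have "\<exists>p. polynomial_function p \<and> (\<forall>x\<in>S. norm (c (g n x) - p x) < inverse (real (Suc n)))" for n
    by (rule Stone_Weierstrass_polynomial_function)
      (auto simp: S_def intro!: continuous_on_compose2[OF cc] continuous_on_subset[OF g])
  then obtain p where p: "\<And>n. polynomial_function (p n)" "\<And>n x. x \<in> S \<Longrightarrow> norm (c (g n x) - p n x) < inverse (real (Suc n))"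
    by metis
  define h where "h = (\<lambda>n x. cutoff R x * p n x)"
  have out: "cutoff R x = 0" if "x \<notin> S" for x :: "real^'n" using that R(1) by (intro cutoff_props(3)) (auto simp: S_def)
  have hs: "schwartz (h n)" for n
  proof (rule schwartz_compact_support)
    show "smooth_alg (h n)" unfolding h_def by (intro smooth_alg.mult cutoff_smooth smooth_alg_polynomial_complex p)
    show "h n x = 0" if "norm x > 2 * R * DIM(real^'n)" for x using cutoff_props(3)[OF R(1) that] by (simp add: h_def)
  qed
  have hm[measurable]: "h n \<in> borel_measurable borel" for n using schwartz_borel[OF hs, of "[]"] by simp
  have hb: "norm (f x - h n x) \<le> (2 * B + 1) * indicator S x" for n x
  proof (cases "x \<in> S")
    case True
    have "norm (p n x) \<le> norm (c (g n x)) + norm (c (g n x) - p n x)"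
      using norm_triangle_ineq4[of "c (g n x)" "c (g n x) - p n x"] by simp
    also have "\<dots> \<le> B + 1" using cB[of "g n x"] p(2)[OF True, of n] inverse_le_1_iff[of "real (Suc n)"] by (intro add_mono) auto
    finally have "norm (cutoff R x) * norm (p n x) \<le> 1 * (B + 1)" using cutoff_props(1)[OF R(1)] by (intro mult_mono) auto
    then have "norm (h n x) \<le> B + 1" by (simp add: h_def norm_mult)
    then show ?thesis using True B(2)[of x] norm_triangle_ineq4[of "f x" "h n x"] by simp
  next
    case False
    then have "\<not> norm x \<le> R"
    proof -
      have "1 \<le> 2 * real DIM(real^'n)" using DIM_positive[where 'a="real^'n"] by linarith
      from mult_left_mono[OF this, of R] have "R * 1 \<le> R * (2 * DIM(real^'n))" using R(1) by simp
      then show ?thesis using False by (auto simp: S_def mult_ac)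
    qed
    then have "f x = 0" using R(2) by blast
    then show ?thesis using False out[OF False] by (simp add: h_def)
  qed
  have lim: "(\<lambda>n. h n x) \<longlonglongrightarrow> f x" if x: "x \<notin> N" for x
  proof (cases "x \<in> S")
    case True
    have "(\<lambda>n. c (g n x)) \<longlonglongrightarrow> c (f x)"
      by (rule continuous_on_tendsto_compose[OF cc gl[OF x]]) auto
    moreover have "(\<lambda>n. p n x - c (g n x)) \<longlonglongrightarrow> 0"
    proof (rule Lim_null_comparison[OF _ LIMSEQ_inverse_real_of_nat])
      show "\<forall>\<^sub>F n in sequentially. norm (p n x - c (g n x)) \<le> inverse (real (Suc n))"
        using p(2)[OF True] by (intro always_eventually allI) (simp add: norm_minus_commute less_imp_le)
    qed
    ultimately have "(\<lambda>n. (p n x - c (g n x)) + c (g n x)) \<longlonglongrightarrow> 0 + c (f x)" by (rule tendsto_add[rotated])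
    then have "(\<lambda>n. p n x) \<longlonglongrightarrow> f x" by (simp add: cf)
    then have "(\<lambda>n. h n x) \<longlonglongrightarrow> cutoff R x * f x" unfolding h_def by (intro tendsto_intros)
    moreover have "cutoff R x * f x = f x" using cutoff_props(2)[OF R(1), of x] R(2)[of x] by (cases "f x = 0") auto
    ultimately show ?thesis by simp
  next
    case False
    have "f x - h n x = 0" for n using hb[of x n] False by simp
    then show ?thesis by simp
  qed
  have iS: "integrable lborel (\<lambda>x. (2 * B + 1)\<^sup>2 * indicator S x :: real)"
    using emeasure_lborel_cball_finite[of "0::real^'n" "2 * R * DIM(real^'n)"]
    by (intro integrable_mult_right integrable_real_indicator) (auto simp: S_def)
  have "(\<lambda>n. LBINT x. (norm (f x - h n x))\<^sup>2) \<longlonglongrightarrow> (\<integral>x. 0 \<partial>(lborel :: (real^'n) measure))"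
  proof (rule integral_dominated_convergence[OF _ _ iS])
    have "AE x in lebesgue. x \<notin> N" using N by (simp add: negligible_iff_null_sets AE_not_in)
    then have "AE x in lborel. x \<notin> N" by (simp add: AE_completion_iff)
    then show "AE x in lborel. (\<lambda>n. (norm (f x - h n x))\<^sup>2) \<longlonglongrightarrow> 0"
    proof eventually_elim
      case (elim x)
      have "(\<lambda>n. (norm (f x - h n x))\<^sup>2) \<longlonglongrightarrow> (norm (f x - f x))\<^sup>2" by (intro tendsto_intros lim elim)
      then show ?case by simp
    qed
    show "AE x in lborel. norm ((norm (f x - h n x))\<^sup>2) \<le> (2 * B + 1)\<^sup>2 * indicator S x" for n
    proof (rule AE_I2)
      fix x
      have "(norm (f x - h n x))\<^sup>2 \<le> ((2 * B + 1) * indicator S x)\<^sup>2" using hb[of x n] by (rule power_mono) simp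
      then show "norm ((norm (f x - h n x))\<^sup>2) \<le> (2 * B + 1)\<^sup>2 * indicator S x" by (cases "x \<in> S") auto
    qed
  qed measurable
  then show ?thesis using that[OF hs] by simp
qed

section \<open>The bounded extension\<close>

definition borel_copy :: "('a::euclidean_space \<Rightarrow> complex) \<Rightarrow> 'a \<Rightarrow> complex" where
  "borel_copy f = (SOME g. g \<in> borel_measurable borel \<and> (AE x in lborel. f x = g x))"

lemma borel_copy:
  assumes "f \<in> borel_measurable lebesgue"
  shows "borel_copy f \<in> borel_measurable borel" "AE x in lborel. f x = borel_copy f x"
proof -
  have re: "(Re :: complex \<Rightarrow> real) \<in> borel_measurable borel" "(Im :: complex \<Rightarrow> real) \<in> borel_measurable borel"
    by (rule borel_measurable_continuous_onI, rule continuous_on_Re continuous_on_Im, rule continuous_on_id)+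
  note m = measurable_compose[OF assms re(1)] measurable_compose[OF assms re(2)]
  obtain u where u: "u \<in> borel_measurable borel" "AE x in lborel. Re (f x) = u x"
    using completion_ex_borel_measurable_real[OF m(1)] by auto
  obtain v where v: "v \<in> borel_measurable borel" "AE x in lborel. Im (f x) = v x"
    using completion_ex_borel_measurable_real[OF m(2)] by auto
  note [measurable] = u(1) v(1)
  have "(\<lambda>x. complex_of_real (u x) + \<i> * complex_of_real (v x)) \<in> borel_measurable borel" by measurable
  moreover have "AE x in lborel. f x = complex_of_real (u x) + \<i> * complex_of_real (v x)"
    using u(2) v(2)
  proof eventually_elim
    case (elim x)
    then show ?case by (simp add: complex_eq_iff)
  qed
  ultimately have "\<exists>g. g \<in> borel_measurable borel \<and> (AE x in lborel. f x = g x)" by blast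
  note c = someI_ex[OF this, folded borel_copy_def]
  show "borel_copy f \<in> borel_measurable borel" by (rule conjunct1[OF c])
  show "AE x in lborel. f x = borel_copy f x" by (rule conjunct2[OF c])
qed

lemma borel_lebesgue: "f \<in> borel_measurable borel \<Longrightarrow> f \<in> borel_measurable lebesgue"
  by (rule measurable_completion) simp

lemma L2_copy:
  fixes f g :: "real^'n::finite \<Rightarrow> complex"
  assumes f: "f \<in> borel_measurable lebesgue" and g[measurable]: "g \<in> borel_measurable borel" and ae: "AE x in lborel. f x = g x"
  shows "f \<in> L2 \<longleftrightarrow> sq_integrable g" "L2_norm f = l2 g"
proof -
  have gl: "g \<in> borel_measurable lebesgue" by (rule borel_lebesgue[OF g])
  have ae': "AE x in lebesgue. (norm (f x))\<^sup>2 = (norm (g x))\<^sup>2"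
    using AE_completion[OF ae] by eventually_elim simp
  have nc: "(\<lambda>z::complex. (norm z)\<^sup>2) \<in> borel_measurable borel"
    by (intro borel_measurable_continuous_onI continuous_intros)
  note m = measurable_compose[OF f nc] measurable_compose[OF gl nc]
  have mb: "(\<lambda>x. (norm (g x))\<^sup>2) \<in> borel_measurable lborel" by measurable
  note i1 = integrable_cong_AE[OF m ae'] and i2 = integrable_completion[OF mb]
  show "f \<in> L2 \<longleftrightarrow> sq_integrable g"
    unfolding L2_def sq_integrable_def mem_Collect_eq i1 i2 by (simp only: f g simp_thms)
  have "(LINT x|lebesgue. (norm (f x))\<^sup>2) = (LINT x|lebesgue. (norm (g x))\<^sup>2)"
    by (rule integral_cong_AE[OF m ae'])
  also have "\<dots> = (LINT x|lborel. (norm (g x))\<^sup>2)" by (rule integral_completion[OF mb])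
  finally show "L2_norm f = l2 g" unfolding L2_norm_def l2_def by (rule arg_cong)
qed

lemma sq_integrable_L2:
  assumes "sq_integrable g"
  shows "g \<in> L2" "L2_norm g = l2 g"
proof -
  have "AE x in lborel. g x = g x" by simp
  note c = L2_copy[OF borel_lebesgue[OF sq_integrable_borel[OF assms]] sq_integrable_borel[OF assms] this]
  show "g \<in> L2" unfolding c(1) by (rule assms)
  show "L2_norm g = l2 g" by (rule c(2))
qed

context pdo_symbol begin

text \<open>The witness behind the choice in \<open>pdo_L2\<close>. A Borel copy of the input is
  taken because the elements of \<open>L2\<close> are only Lebesgue measurable.\<close>

lemma extension_exists: "bounded_L2_extension a (\<lambda>f. piece_sum (borel_copy f))"
proof -
  obtain B where B: "B \<ge> 0" and Ball: "\<forall>f. sq_integrable f \<longrightarrow> (AE x in lborel. summable (\<lambda>j. norm (piece j f x))) \<and> sq_integrable (piece_sum f) \<and> l2 (piece_sum f) \<le> B * l2 f"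
    using piece_sum_L2 by (elim exE conjE) (rule that)
  note T0s = Ball[rule_format, THEN conjunct2, THEN conjunct1] and T0le = Ball[rule_format, THEN conjunct2, THEN conjunct2]
  have lm: "f \<in> borel_measurable lebesgue" if "f \<in> L2" for f :: "real^'n \<Rightarrow> complex" using that by (simp add: L2_def)
  have sqc: "sq_integrable (borel_copy f)" "L2_norm f = l2 (borel_copy f)" if "f \<in> L2" for f :: "real^'n \<Rightarrow> complex"
    using L2_copy[OF lm[OF that] borel_copy[OF lm[OF that]]] that by auto
  have 1: "\<forall>f\<in>L2. piece_sum (borel_copy f) \<in> L2"
    by (rule ballI) (rule sq_integrable_L2(1)[OF T0s[OF sqc(1)]])
  have 3: "\<forall>f\<in>L2. L2_norm (piece_sum (borel_copy f)) \<le> B * L2_norm f"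
  proof
    fix f :: "real^'n \<Rightarrow> complex" assume f: "f \<in> L2"
    show "L2_norm (piece_sum (borel_copy f)) \<le> B * L2_norm f"
      unfolding sq_integrable_L2(2)[OF T0s[OF sqc(1)[OF f]]] sqc(2)[OF f] by (rule T0le[OF sqc(1)[OF f]])
  qed
  have 2: "\<forall>f\<in>L2. \<forall>g\<in>L2. \<forall>c. AE x in lebesgue. piece_sum (borel_copy (\<lambda>y. c * f y + g y)) x = c * piece_sum (borel_copy f) x + piece_sum (borel_copy g) x"
  proof (intro ballI allI)
    fix f g :: "real^'n \<Rightarrow> complex" and c assume f: "f \<in> L2" and g: "g \<in> L2"
    note bm[measurable] = borel_copy(1)[OF lm[OF f]] borel_copy(1)[OF lm[OF g]]
    have hm: "(\<lambda>y. c * f y + g y) \<in> borel_measurable lebesgue" using lm[OF f] lm[OF g] by measurable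
    have "AE y in lborel. borel_copy (\<lambda>y. c * f y + g y) y = c * borel_copy f y + borel_copy g y"
      using borel_copy(2)[OF hm] borel_copy(2)[OF lm[OF f]] borel_copy(2)[OF lm[OF g]] by eventually_elim simp
    moreover have "(\<lambda>y. c * borel_copy f y + borel_copy g y) \<in> borel_measurable borel" by measurable
    ultimately have e: "piece_sum (borel_copy (\<lambda>y. c * f y + g y)) = piece_sum (\<lambda>y. c * borel_copy f y + borel_copy g y)"
      by (rule piece_sum_cong[OF _ borel_copy(1)[OF hm]])
    show "AE x in lebesgue. piece_sum (borel_copy (\<lambda>y. c * f y + g y)) x = c * piece_sum (borel_copy f) x + piece_sum (borel_copy g) x"
      unfolding e by (rule AE_completion[OF piece_sum_lin[OF sqc(1)[OF f] sqc(1)[OF g]]])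
  qed
  have 4: "\<forall>f. schwartz f \<longrightarrow> (AE x in lebesgue. piece_sum (borel_copy f) x = pdo a f x)"
  proof (intro allI impI)
    fix f :: "real^'n \<Rightarrow> complex" assume f: "schwartz f"
    have fb: "f \<in> borel_measurable borel" using schwartz_borel[OF f, of "[]"] by simp
    note bc = borel_copy[OF borel_lebesgue[OF fb]]
    have "piece_sum f = piece_sum (borel_copy f)" by (rule piece_sum_cong[OF bc(2) fb bc(1)])
    then show "AE x in lebesgue. piece_sum (borel_copy f) x = pdo a f x" using AE_completion[OF schwartz_piece_sum[OF f]] by simp
  qed
  have 3: "\<exists>B. \<forall>f\<in>L2. L2_norm (piece_sum (borel_copy f)) \<le> B * L2_norm f" using 3 by (rule exI)
  show ?thesis
    unfolding bounded_L2_extension_def by (rule conjI[OF 1 conjI[OF 2 conjI[OF 3 4]]])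
qed

text \<open>For a Schwartz function \<open>h\<close> both operators agree, so their difference on
  \<open>g\<close> equals that on \<open>g - h\<close>, and both are bounded. Density lets the
  right-hand side tend to 0. The Borel copies and null sets account for the length.\<close>

lemma extension_eq_piece_sum:
  assumes T: "bounded_L2_extension a T" and f: "f \<in> borel_measurable lebesgue" and g: "bcs g" and fg: "AE x in lborel. f x = g x"
  shows "AE x in lborel. T f x = piece_sum g x"
  using piece_sum_L2
proof (elim exE conjE, goal_cases)
  case (1 B)
  note B = 1(1) and Ball = 1(2)
  note T0s = Ball[rule_format, THEN conjunct2, THEN conjunct1] and T0le = Ball[rule_format, THEN conjunct2, THEN conjunct2]
  note Tu = T[unfolded bounded_L2_extension_def]
  note T_L2 = bspec[OF conjunct1[OF Tu]]
    and T_lin = conjunct1[OF conjunct2[OF Tu], rule_format]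
    and T_s = conjunct2[OF conjunct2[OF conjunct2[OF Tu]], rule_format]
  obtain B' where B': "\<forall>f\<in>L2. L2_norm (T f) \<le> B' * L2_norm f" using conjunct1[OF conjunct2[OF conjunct2[OF Tu]]] by (elim exE) (rule that)
  have gs: "sq_integrable g" by (rule bcs_sq[OF g])
  have fL: "f \<in> L2" using L2_copy(1)[OF f sq_integrable_borel[OF gs] fg] gs by simp
  define TF where "TF = borel_copy (T f)"
  have Tfm: "T f \<in> borel_measurable lebesgue" using T_L2[OF fL] by (simp add: L2_def)
  note TF = borel_copy[OF Tfm, folded TF_def]
  have TFs: "sq_integrable TF" using L2_copy(1)[OF Tfm TF] T_L2[OF fL] by simp
  define D where "D = (\<lambda>x. (- 1) * piece_sum g x + TF x)"
  have T0gs: "sq_integrable (piece_sum g)" by (rule T0s[OF gs])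
  have Ds: "sq_integrable D" unfolding D_def by (rule sq_integrable_lin[OF T0gs TFs])
  obtain h where h: "\<And>k. schwartz (h k)" "(\<lambda>k. LBINT x. (norm (g x - h k x))\<^sup>2) \<longlonglongrightarrow> 0"
    by (rule schwartz_dense[OF g]) (rule that; assumption)
  have Dle: "(l2 D)\<^sup>2 \<le> (2 * (max B' 0)\<^sup>2 + 2 * B\<^sup>2) * (LBINT x. (norm (g x - h k x))\<^sup>2)" for k
  proof -
    have hs: "sq_integrable (h k)" by (rule schwartz_sq[OF h(1)])
    define u where "u = (\<lambda>x. (- 1) * h k x + g x)"
    have us: "sq_integrable u" unfolding u_def by (rule sq_integrable_lin[OF hs gs])
    have lu: "(l2 u)\<^sup>2 = (LBINT x. (norm (g x - h k x))\<^sup>2)" unfolding l2_sq u_def by simp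
    define w where "w = (\<lambda>x. (- 1) * h k x + f x)"
    have hL: "h k \<in> L2" by (rule sq_integrable_L2(1)[OF hs])
    have wm: "w \<in> borel_measurable lebesgue"
      unfolding w_def using borel_lebesgue[OF sq_integrable_borel[OF hs]] f by measurable
    have wu: "AE x in lborel. w x = u x" using fg by eventually_elim (simp add: w_def u_def)
    note wc = L2_copy[OF wm sq_integrable_borel[OF us] wu]
    have wL: "w \<in> L2" using wc(1) us by simp
    define W where "W = borel_copy (T w)"
    have Twm: "T w \<in> borel_measurable lebesgue" using T_L2[OF wL] by (simp add: L2_def)
    note W = borel_copy[OF Twm, folded W_def]
    note Wc = L2_copy[OF Twm W]
    have Ws: "sq_integrable W" using Wc(1) T_L2[OF wL] by simp
    \<comment> \<open>The bound in \<open>bounded_L2_extension\<close> carries no sign, hence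
      \<open>max B' 0\<close>.\<close>
    have lW: "l2 W \<le> max B' 0 * l2 u"
    proof -
      have "l2 W \<le> B' * l2 u" using bspec[OF B' wL] Wc(2) wc(2) by simp
      also have "\<dots> \<le> max B' 0 * l2 u" by (intro mult_right_mono) (auto simp: l2_nonneg)
      finally show ?thesis .
    qed
    have T0us: "sq_integrable (piece_sum u)" "l2 (piece_sum u) \<le> B * l2 u" by (rule T0s[OF us] T0le[OF us])+
    have "AE x in lborel. T w x = (- 1) * T (h k) x + T f x"
      using T_lin[OF hL fL, of "- 1"] unfolding w_def AE_completion_iff .
    moreover have "AE x in lborel. T (h k) x = piece_sum (h k) x"
      using T_s[OF h(1), of k] schwartz_piece_sum[OF h(1), of k] unfolding AE_completion_iff by eventually_elim simp
    moreover have "AE x in lborel. piece_sum u x = (- 1) * piece_sum (h k) x + piece_sum g x"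
      unfolding u_def by (rule piece_sum_lin[OF hs gs])
    ultimately have ae: "AE x in lborel. D x = (- 1) * piece_sum u x + W x"
      using W(2) TF(2) by eventually_elim (simp add: D_def)
    have "(l2 D)\<^sup>2 \<le> (LBINT x. 2 * (norm (piece_sum u x))\<^sup>2 + 2 * (norm (W x))\<^sup>2)"
      unfolding l2_sq
    proof (rule integral_mono_AE)
      show "integrable lborel (\<lambda>x. (norm (D x))\<^sup>2)" using Ds by (simp add: sq_integrable_def)
      show "integrable lborel (\<lambda>x. 2 * (norm (piece_sum u x))\<^sup>2 + 2 * (norm (W x))\<^sup>2)" using T0us Ws by (simp add: sq_integrable_def)
      show "AE x in lborel. (norm (D x))\<^sup>2 \<le> 2 * (norm (piece_sum u x))\<^sup>2 + 2 * (norm (W x))\<^sup>2"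
        using ae
      proof eventually_elim
        case (elim x)
        have "(norm (D x))\<^sup>2 \<le> (norm (piece_sum u x) + norm (W x))\<^sup>2"
          unfolding elim using norm_triangle_ineq[of "(- 1) * piece_sum u x" "W x"] by (intro power_mono) auto
        also have "\<dots> \<le> 2 * (norm (piece_sum u x))\<^sup>2 + 2 * (norm (W x))\<^sup>2"
          using sum_squares_bound[of "norm (piece_sum u x)" "norm (W x)"] by (simp add: power2_sum)
        finally show ?case .
      qed
    qed
    also have "\<dots> = 2 * (l2 (piece_sum u))\<^sup>2 + 2 * (l2 W)\<^sup>2"
      unfolding l2_sq using T0us Ws by (simp add: sq_integrable_def)
    also have "\<dots> \<le> 2 * (B * l2 u)\<^sup>2 + 2 * (max B' 0 * l2 u)\<^sup>2"
      using lW T0us(2) by (intro add_mono mult_left_mono power_mono) (auto simp: l2_nonneg)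
    also have "\<dots> = (2 * (max B' 0)\<^sup>2 + 2 * B\<^sup>2) * (l2 u)\<^sup>2" by (simp add: power_mult_distrib algebra_simps)
    finally show ?thesis unfolding lu .
  qed
  have "(\<lambda>k. (2 * (max B' 0)\<^sup>2 + 2 * B\<^sup>2) * (LBINT x. (norm (g x - h k x))\<^sup>2)) \<longlonglongrightarrow> (2 * (max B' 0)\<^sup>2 + 2 * B\<^sup>2) * 0"
    by (intro tendsto_intros h(2))
  then have "(l2 D)\<^sup>2 \<le> 0" by (intro LIMSEQ_le_const[where a="(l2 D)\<^sup>2"]) (use Dle in auto)
  then have "(LBINT x. (norm (D x))\<^sup>2) = 0" unfolding l2_sq[symmetric] by simp
  then have "AE x in lborel. (norm (D x))\<^sup>2 = 0"
    using Ds integral_nonneg_eq_0_iff_AE[of lborel "\<lambda>x. (norm (D x))\<^sup>2"] by (simp add: sq_integrable_def)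
  then show ?thesis using TF(2) by eventually_elim (simp add: D_def)
qed

lemma pairing_eq:
  assumes f: "f \<in> borel_measurable lebesgue" "bcs f'" "AE x in lborel. f x = f' x"
    and g: "g \<in> borel_measurable lebesgue" "bcs g'" "AE x in lborel. g x = g' x"
  shows "L2_pairing (pdo_L2 a f) g = (LBINT x. piece_sum f' x * cnj (g' x))"
proof -
  have T: "bounded_L2_extension a (pdo_L2 a)" unfolding pdo_L2_def by (rule someI[of "bounded_L2_extension a", OF extension_exists])
  note ae = extension_eq_piece_sum[OF T f]
  have fL: "f \<in> L2" using L2_copy(1)[OF f(1) bcs_measurable[OF f(2)] f(3)] bcs_sq[OF f(2)] by simp
  have Tm: "pdo_L2 a f \<in> borel_measurable lebesgue" using bspec[OF conjunct1[OF T[unfolded bounded_L2_extension_def]] fL] by (simp add: L2_def)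
  have T0m[measurable]: "piece_sum f' \<in> borel_measurable borel" using piece_sum_L2 bcs_sq[OF f(2)] sq_integrable_borel by blast
  have [measurable]: "g' \<in> borel_measurable borel" by (rule bcs_measurable[OF g(2)])
  have m: "(\<lambda>x. piece_sum f' x * cnj (g' x)) \<in> borel_measurable borel" by measurable
  have "(LINT x|lebesgue. pdo_L2 a f x * cnj (g x)) = (LINT x|lebesgue. piece_sum f' x * cnj (g' x))"
  proof (rule integral_cong_AE)
    show "(\<lambda>x. pdo_L2 a f x * cnj (g x)) \<in> borel_measurable lebesgue" using Tm g(1) by measurable
    show "(\<lambda>x. piece_sum f' x * cnj (g' x)) \<in> borel_measurable lebesgue" by (rule borel_lebesgue[OF m])
    show "AE x in lebesgue. pdo_L2 a f x * cnj (g x) = piece_sum f' x * cnj (g' x)"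
      unfolding AE_completion_iff using ae g(3) by eventually_elim simp
  qed
  also have "\<dots> = (LBINT x. piece_sum f' x * cnj (g' x))" by (rule integral_completion) (use m in simp)
  finally show ?thesis unfolding L2_pairing_def .
qed

end

text \<open>A Borel copy may be unbounded, or nonzero far away, on a null set; truncating it in
  position and height repairs both.\<close>

lemma bcs_copy:
  assumes "bounded_compactly_supported f"
  obtains f' where "bcs f'" "AE x in lborel. f x = f' x"
proof -
  have f: "f \<in> borel_measurable lebesgue" using assms by (simp add: bounded_compactly_supported_def)
  note c[measurable] = borel_copy[OF f]
  obtain B where B: "\<And>x. norm (f x) \<le> B" using assms unfolding bounded_compactly_supported_def bounded_iff by auto
  obtain K where K: "compact K" "\<And>x. x \<notin> K \<Longrightarrow> f x = 0" using assms unfolding bounded_compactly_supported_def by blast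
  obtain R where R: "\<And>x. x \<in> K \<Longrightarrow> norm x \<le> R" using compact_imp_bounded[OF K(1)] unfolding bounded_iff by blast
  define f' where "f' = (\<lambda>x. indicator {x. norm x \<le> R \<and> norm (borel_copy f x) \<le> B} x * borel_copy f x)"
  have B0: "B \<ge> 0" using B[of 0] norm_ge_zero order_trans by blast
  have "bcs f'"
  proof (rule bcsI[of f' B R])
    have [measurable]: "borel_copy f \<in> borel_measurable borel" by (rule c(1))
    show "f' \<in> borel_measurable borel" unfolding f'_def by measurable
  qed (use B0 in \<open>auto simp: f'_def indicator_def split: if_splits\<close>)
  moreover have "AE x in lborel. f x = f' x"
    using c(2)
  proof eventually_elim
    case (elim x)
    show ?case
    proof (cases "x \<in> K")
      case True
      then show ?thesis using elim B[of x] R[of x] by (simp add: f'_def)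
    next
      case False
      then show ?thesis using elim K(2)[of x] by (simp add: f'_def)
    qed
  qed
  ultimately show ?thesis by (rule that)
qed

section \<open>Sparse domination\<close>

lemma Ip_cong:
  assumes "AE x in lborel. f x = g x" "f \<in> borel_measurable lebesgue" "g \<in> borel_measurable borel" "E \<in> sets borel"
  shows "(LINT x:E|lebesgue. norm (f x) powr p) = Ip p g E"
proof -
  have pc: "(\<lambda>z::complex. norm z powr p) \<in> borel_measurable borel" by measurable
  have m1: "(\<lambda>x. indicator E x *\<^sub>R (norm (f x) powr p)) \<in> borel_measurable lebesgue"
    by (intro borel_measurable_scaleR measurable_compose[OF assms(2) pc] borel_measurable_indicator) (use assms(4) in simp)
  note [measurable] = assms(3,4)
  have m2: "(\<lambda>x. indicator E x *\<^sub>R (norm (g x) powr p)) \<in> borel_measurable lborel" by measurable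
  have "(LINT x:E|lebesgue. norm (f x) powr p) = (LINT x|lebesgue. indicator E x *\<^sub>R (norm (g x) powr p))"
    unfolding set_lebesgue_integral_def
  proof (rule integral_cong_AE[OF m1])
    show "(\<lambda>x. indicator E x *\<^sub>R (norm (g x) powr p)) \<in> borel_measurable lebesgue" by (rule measurable_completion[OF m2])
    show "AE x in lebesgue. indicator E x *\<^sub>R (norm (f x) powr p) = indicator E x *\<^sub>R (norm (g x) powr p)"
      unfolding AE_completion_iff using assms(1) by eventually_elim simp
  qed
  also have "\<dots> = (LINT x|lborel. indicator E x *\<^sub>R (norm (g x) powr p))" by (rule integral_completion[OF m2])
  finally show ?thesis by (simp add: Ip_def)
qed

text \<open>This is what permits replacing the exponents of the theorem by smaller finite ones:
  averages increase with the exponent, and the essential supremum dominates them all.\<close>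

lemma av_le_average:
  assumes f: "f \<in> borel_measurable lebesgue" and g: "bcs g" and fg: "AE x in lborel. f x = g x"
    and E: "E \<in> fmeasurable lborel" "vol E > 0" and p: "1 \<le> p" "ennreal p \<le> P"
  shows "ennreal (av p g E) \<le> average P f E"
proof (cases "P = \<infinity>")
  case True
  have Eb: "E \<in> sets borel" using E(1) by (auto dest: fmeasurableD)
  define M where "M = esssup (restrict_space lebesgue E) (\<lambda>x. ennreal (norm (f x)))"
  have "AE x in restrict_space lebesgue E. ennreal (norm (f x)) \<le> M" unfolding M_def by (rule esssup_AE)
  then have "AE x in lebesgue. x \<in> E \<longrightarrow> ennreal (norm (f x)) \<le> M"
    using Eb by (subst (asm) AE_restrict_space_iff) auto
  then have ae: "AE x in lborel. x \<in> E \<longrightarrow> ennreal (norm (f x)) \<le> M" unfolding AE_completion_iff .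
  have "ennreal (av p g E) \<le> M"
  proof (cases M)
    case (real r)
    have "Ip p g E \<le> (LBINT x. r powr p * indicator E x)"
      unfolding Ip_def
    proof (rule integral_mono_AE)
      show "integrable lborel (\<lambda>x. indicator E x * norm (g x) powr p)" by (rule Ip_integrable) (use g p Eb in auto)
      show "integrable lborel (\<lambda>x. r powr p * indicator E x)"
        using E(1) by (intro integrable_mult_right integrable_real_indicator) (auto simp: fmeasurable_def)
      show "AE x in lborel. indicator E x * norm (g x) powr p \<le> r powr p * indicator E x"
        using ae fg
      proof eventually_elim
        case (elim x)
        then show ?case using real p by (auto simp: indicator_def intro!: powr_mono2)
      qed
    qed
    also have "\<dots> = r powr p * vol E" using Eb by simp
    finally have "Ip p g E / vol E \<le> r powr p" using E(2) by (simp add: pos_divide_le_eq)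
    then have "av p g E \<le> (r powr p) powr (1 / p)"
      unfolding av_def using Ip_nonneg[of p g E] p by (intro powr_mono2) auto
    then show ?thesis using p real by (simp add: powr_powr)
  qed simp
  then show ?thesis using True by (simp add: average_def M_def)
next
  case False
  then obtain P' where P': "P = ennreal P'" "P' \<ge> 0" by (cases P) auto
  have pP: "p \<le> P'" using p P' by simp
  have Eb: "E \<in> sets borel" using E(1) by (auto dest: fmeasurableD)
  have mE: "measure lebesgue E = vol E" using Eb by (simp add: measure_completion)
  have "average P f E = ennreal (av P' g E)"
    using P' Ip_cong[OF fg f bcs_measurable[OF g] Eb, of P'] by (simp add: average_def mE av_def)
  then show ?thesis using av_mono_exponent[OF g _ pP E] p by (simp add: ennreal_leI)
qed

lemma av_form_le_sparse_form:
  assumes S: "dyadic_collection S" and p: "1 \<le> p" "ennreal p \<le> P" and q: "1 \<le> q" "ennreal q \<le> Q"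
    and f: "f \<in> borel_measurable lebesgue" "bcs f'" "AE x in lborel. f x = f' x"
    and g: "g \<in> borel_measurable lebesgue" "bcs g'" "AE x in lborel. g x = g' x"
  shows "av_form p q f' g' S \<le> sparse_form S P Q f g"
  unfolding av_form_def sparse_form_def
proof (rule infsum_mono)
  fix R assume "R \<in> S"
  obtain D where D: "dyadic_lattice D" "S \<subseteq> D" using S by (auto simp: dyadic_collection_def)
  obtain c k where R: "R = half_open_cube c (2 powi k)"
    using bspec[OF conjunct1[OF D(1)[unfolded dyadic_lattice_def]] subsetD[OF D(2) \<open>R \<in> S\<close>]] by (elim exE) (rule that)
  have fm: "R \<in> fmeasurable lborel" unfolding R by (rule fmeasurable_half_open_cube)
  have \<mu>: "vol R > 0" unfolding R by (subst measure_half_open_cube) auto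
  have Rb: "R \<in> sets borel" using fm by (auto dest: fmeasurableD)
  have e: "emeasure lebesgue R = ennreal (vol R)"
  proof -
    have "emeasure lebesgue R = emeasure lborel R" using Rb by simp
    also have "\<dots> = ennreal (vol R)" unfolding R by (simp add: measure_half_open_cube)
    finally show ?thesis .
  qed
  have "ennreal (vol R * (av p f' R * av q g' R)) = ennreal (vol R) * ennreal (av p f' R) * ennreal (av q g' R)"
    by (simp add: ennreal_mult av_nonneg mult.assoc)
  also have "\<dots> \<le> emeasure lebesgue R * average P f R * average Q g R"
    unfolding e by (intro mult_mono av_le_average[OF f fm \<mu> p] av_le_average[OF g fm \<mu> q]) auto
  finally show "ennreal (vol R * (av p f' R * av q g' R)) \<le> emeasure lebesgue R * average P f R * average Q g R" .
qed (auto intro: nonneg_summable_on_complete)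

section \<open>Admissible exponents\<close>

lemma rational_below:
  assumes "P \<ge> (1::real)" "\<eta> > 0"
  obtains p where "p \<in> \<rat>" "1 \<le> p" "p \<le> P" "1 / p \<le> 1 / P + \<eta>"
\<comment> \<open>At the lower endpoint there is no room below, but 1 is itself rational.\<close>
proof (cases "P = 1")
  case True
  then show ?thesis using assms by (intro that[of 1]) auto
next
  case False
  define z where "z = 1 / (1 / P + \<eta>)"
  have Pp: "P > 1" using False assms by simp
  have z: "z > 0" "1 / z = 1 / P + \<eta>" using Pp assms by (auto simp: z_def add_pos_pos)
  have "z < P"
  proof -
    have "1 / P < 1 / z" using z assms by simp
    then show ?thesis using z(1) Pp by (simp add: field_simps)
  qed
  then obtain p where p: "p \<in> \<rat>" "max 1 z < p" "p < P" using Rats_dense_in_real[of "max 1 z" P] Pp by auto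
  have "1 / p \<le> 1 / z" using p z(1) by (intro divide_left_mono) auto
  then show ?thesis using p z(2) by (intro that[of p]) auto
qed

lemma ennreal_between_1_2:
  assumes "1 \<le> r" "r \<le> (2::ennreal)"
  obtains r' where "r = ennreal r'" "1 \<le> r'" "r' \<le> 2" "enn2real (1 / r) = 1 / r'"
proof -
  have "r < top" using assms(2) by (rule le_less_trans) simp
  then obtain r' where r': "r = ennreal r'" "r' \<ge> 0" by (cases r) auto
  have "1 \<le> r'" using assms(1) unfolding r'(1) by simp
  have "ennreal r' \<le> ennreal 2" using assms(2) unfolding r'(1) ennreal_numeral .
  then have "r' \<le> 2" by (subst (asm) ennreal_le_iff) auto
  have "1 / r = ennreal (1 / r')"
    unfolding r'(1) using \<open>1 \<le> r'\<close> divide_ennreal[of 1 r'] by simp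
  then show ?thesis using r' \<open>1 \<le> r'\<close> \<open>r' \<le> 2\<close> by (intro that[of r']) auto
qed

lemma conj_exponent_value:
  assumes "1 \<le> s"
  obtains t where "t = enn2real (1 / s)" "0 \<le> t" "t \<le> 1" "t < 1 \<Longrightarrow> conj_exponent s = ennreal (1 / (1 - t))" "t = 1 \<Longrightarrow> conj_exponent s = \<infinity>"
    "s \<le> 2 \<Longrightarrow> t \<ge> 1 / 2" "2 \<le> s \<Longrightarrow> t \<le> 1 / 2"
proof -
  define t where "t = enn2real (1 / s)"
  have le: "1 / s \<le> 1" using conj_exponent_eq[OF assms] by (metis le_iff_add)
  have t: "1 / s = ennreal t" "0 \<le> t" unfolding t_def using le_less_trans[OF le, of top] by simp_all
  have t1: "t \<le> 1" using le unfolding t(1) by simp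
  have d: "1 - 1 / s = ennreal (1 - t)" unfolding t(1) using t(2) t1 using ennreal_minus[of t 1] by simp
  have c1: "conj_exponent s = ennreal (1 / (1 - t))" if "t < 1"
    unfolding conj_exponent_def d using that divide_ennreal[of 1 "1 - t"] by simp
  have c2: "conj_exponent s = \<infinity>" if "t = 1" unfolding conj_exponent_def d using that by (simp add: divide_ennreal_def)
  have h1: "t \<ge> 1 / 2" if s: "s \<le> 2"
  proof -
    obtain r' where r': "1 \<le> r'" "r' \<le> 2" "enn2real (1 / s) = 1 / r'" by (rule ennreal_between_1_2[OF assms s])
    show ?thesis unfolding t_def r'(3) using r' by (simp add: field_simps)
  qed
  have h2: "t \<le> 1 / 2" if s: "2 \<le> s"
  proof (cases s)
    case (real r)
    have "ennreal 2 \<le> ennreal r" using s unfolding real(2) ennreal_numeral .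
    then have "2 \<le> r" using real(1) by simp
    moreover have "1 / s = ennreal (1 / r)"
      unfolding real(2) using \<open>2 \<le> r\<close> divide_ennreal[of 1 r] by simp
    ultimately show ?thesis unfolding t_def by (simp add: field_simps)
  next
    case top
    then show ?thesis unfolding t_def by (simp add: divide_ennreal_def)
  qed
  show ?thesis by (rule that[OF t_def t(2) t1 c1 c2 h1 h2])
qed

context pdo_symbol begin

text \<open>In the first family one may take \<open>q = 2\<close>, because \<open>s \<le> 2\<close> makes the conjugate exponent at least \<open>2\<close>.\<close>

lemma rational_exponents:
  assumes "(m < - real CARD('n) * (1 - \<rho>) * (enn2real (1 / r) - 1 / 2) \<and> 1 \<le> r \<and> r \<le> s \<and> s \<le> 2) \<or>
           (m < - real CARD('n) * (1 - \<rho>) * (enn2real (1 / r) - enn2real (1 / s)) \<and> 1 \<le> r \<and> r \<le> 2 \<and> 2 \<le> s \<and> s \<le> conj_exponent r)"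
  obtains p q where "p \<in> \<rat>" "q \<in> \<rat>" "1 \<le> p" "p \<le> 2" "1 \<le> q" "q \<le> 2" "ennreal p \<le> r" "ennreal q \<le> conj_exponent s"
    "m + real CARD('n) * (1 - \<rho>) * (1 / p + 1 / q - 1) < 0"
proof -
  let ?K = "real CARD('n) * (1 - \<rho>)"
  have K: "?K > 0" using \<rho>_lt by simp
  have "\<exists>P Q. 1 \<le> P \<and> P \<le> 2 \<and> 1 \<le> Q \<and> Q \<le> 2 \<and> ennreal P \<le> r \<and> ennreal Q \<le> conj_exponent s \<and> m + ?K * (1 / P + 1 / Q - 1) < 0"
    using assms
  proof
    assume a: "m < - real CARD('n) * (1 - \<rho>) * (enn2real (1 / r) - 1 / 2) \<and> 1 \<le> r \<and> r \<le> s \<and> s \<le> 2"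
    then have r: "1 \<le> r" "r \<le> 2" and s: "1 \<le> s" "s \<le> 2" by auto
    obtain P where P: "r = ennreal P" "1 \<le> P" "P \<le> 2" "enn2real (1 / r) = 1 / P" by (rule ennreal_between_1_2[OF r])
    obtain t where t: "t = enn2real (1 / s)" "0 \<le> t" "t \<le> 1" "t < 1 \<Longrightarrow> conj_exponent s = ennreal (1 / (1 - t))" "t = 1 \<Longrightarrow> conj_exponent s = \<infinity>"
      "s \<le> 2 \<Longrightarrow> t \<ge> 1 / 2" using conj_exponent_value[OF s(1)] by metis
    have t2: "t \<ge> 1 / 2" by (rule t(6)[OF s(2)])
    have "ennreal 2 \<le> conj_exponent s"
    proof (cases "t = 1")
      case False
      then have "2 \<le> 1 / (1 - t)" using t2 t(3) by (simp add: field_simps)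
      then show ?thesis using t(4) False t(3) by (simp add: ennreal_leI del: ennreal_numeral)
    qed (simp add: t(5))
    moreover have "m + ?K * (1 / P + 1 / 2 - 1) < 0" using a unfolding P(4) by (simp add: algebra_simps)
    ultimately show ?thesis using P by (intro exI[of _ P] exI[of _ 2]) auto
  next
    assume a: "m < - real CARD('n) * (1 - \<rho>) * (enn2real (1 / r) - enn2real (1 / s)) \<and> 1 \<le> r \<and> r \<le> 2 \<and> 2 \<le> s \<and> s \<le> conj_exponent r"
    then have r: "1 \<le> r" "r \<le> 2" and s: "2 \<le> s" by auto
    have s1: "1 \<le> s" using s by (rule order_trans[rotated]) simp
    obtain P where P: "r = ennreal P" "1 \<le> P" "P \<le> 2" "enn2real (1 / r) = 1 / P" by (rule ennreal_between_1_2[OF r])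
    obtain t where t: "t = enn2real (1 / s)" "0 \<le> t" "t \<le> 1" "t < 1 \<Longrightarrow> conj_exponent s = ennreal (1 / (1 - t))"
      "2 \<le> s \<Longrightarrow> t \<le> 1 / 2" using conj_exponent_value[OF s1] by metis
    have t2: "t \<le> 1 / 2" by (rule t(5)[OF s])
    define Q where "Q = 1 / (1 - t)"
    have Q: "1 \<le> Q" "Q \<le> 2" "1 / Q = 1 - t" "conj_exponent s = ennreal Q" using t(2,4) t2 by (auto simp: Q_def field_simps)
    have "m + ?K * (1 / P + 1 / Q - 1) < 0" unfolding Q(3) using a unfolding P(4) t(1)[symmetric] by (simp add: algebra_simps)
    then show ?thesis using P Q by (intro exI[of _ P] exI[of _ Q]) auto
  qed
  then obtain P Q where PQ: "1 \<le> P" "P \<le> 2" "1 \<le> Q" "Q \<le> 2" "ennreal P \<le> r" "ennreal Q \<le> conj_exponent s" "m + ?K * (1 / P + 1 / Q - 1) < 0"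
    by (elim exE conjE) (rule that)
  \<comment> \<open>Both reciprocals may grow by \<open>\<eta>\<close>, which uses
    \<open>2 * ?K * \<eta>\<close>, half of the gap.\<close>
  define \<eta> where "\<eta> = - (m + ?K * (1 / P + 1 / Q - 1)) / (4 * ?K)"
  have \<eta>: "\<eta> > 0" unfolding \<eta>_def using PQ(7) K by (intro divide_pos_pos) auto
  obtain p where p: "p \<in> \<rat>" "1 \<le> p" "p \<le> P" "1 / p \<le> 1 / P + \<eta>" by (rule rational_below[OF PQ(1) \<eta>])
  obtain q where q: "q \<in> \<rat>" "1 \<le> q" "q \<le> Q" "1 / q \<le> 1 / Q + \<eta>" by (rule rational_below[OF PQ(3) \<eta>])
  have "m + ?K * (1 / p + 1 / q - 1) < 0"
  proof -
    have "?K * (1 / p + 1 / q - 1) \<le> ?K * ((1 / P + 1 / Q - 1) + 2 * \<eta>)" using p(4) q(4) K by (intro mult_left_mono) auto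
    also have "\<dots> = ?K * (1 / P + 1 / Q - 1) + 2 * (?K * \<eta>)" by (simp add: algebra_simps)
    also have "?K * \<eta> = - (m + ?K * (1 / P + 1 / Q - 1)) / 4"
    proof -
      have "x * (y / (4 * x)) = y / 4" if "x > 0" for x y :: real using that by simp
      from this[OF K] show ?thesis unfolding \<eta>_def .
    qed
    finally have le: "?K * (1 / p + 1 / q - 1) \<le> ?K * (1 / P + 1 / Q - 1) + 2 * (- (m + ?K * (1 / P + 1 / Q - 1)) / 4)" .
    have "x \<le> y + 2 * (- (m + y) / 4) \<Longrightarrow> m + y < 0 \<Longrightarrow> m + x < 0" for x y by (simp add: field_simps)
    from this[OF le PQ(7)] show ?thesis .
  qed
  moreover have "ennreal p \<le> r" using ennreal_leI[OF p(3)] PQ(5) by (rule order_trans)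
  moreover have "ennreal q \<le> conj_exponent s" using ennreal_leI[OF q(3)] PQ(6) by (rule order_trans)
  ultimately show ?thesis using p q PQ by (intro that[of p q]) auto
qed

end

lemma grid_form_cnj: "grid_form p q f (\<lambda>x. cnj (g x)) v Z = grid_form p q f g v Z"
  by (simp add: grid_form_def av_def Ip_def)

context pdo_symbol begin

text \<open>The hypothesis is the output of \<open>grid_sum_domination\<close> for one triple. Since
  \<open>\<theta> < \<epsilon>\<close>, the bounds of the pieces form a geometric series in
  \<open>j\<close>.\<close>

lemma pairing_bound:
  assumes p: "1 \<le> p" "p \<le> 2" and q: "1 \<le> q" "q \<le> 2"
    and mneg: "m + real CARD('n) * (1 - \<rho>) * (1 / p + 1 / q - 1) < 0"
  shows "\<exists>\<theta> C. \<theta> \<in> \<rat> \<and> \<theta> > 0 \<and> C > 0 \<and> (\<forall>K f g S. K \<ge> 0 \<longrightarrow> bcs f \<longrightarrow> bcs g \<longrightarrow>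
      (\<forall>v Z. finite Z \<longrightarrow> ennreal (grid_form p q f g v Z) \<le> ennreal (K * 2 powr (\<theta> * real_of_int \<bar>v\<bar>)) * av_form p q f g S) \<longrightarrow>
      ennreal (norm (LBINT x. piece_sum f x * cnj (g x))) \<le> ennreal (C * (K + 1)) * av_form p q f g S)"
  using piece_bound[OF p q mneg]
proof (elim exE conjE, goal_cases)
  case (1 \<epsilon> C)
  note \<epsilon> = 1(1) and C = 1(2) and Call = 1(3)
  \<comment> \<open>Rational, so that the triple occurs in the countable enumeration for which the
    sparse family was built.\<close>
  obtain \<theta> where \<theta>: "\<theta> \<in> \<rat>" "0 < \<theta>" "\<theta> < min \<epsilon> (1 / 2)" using Rats_dense_in_real[of 0 "min \<epsilon> (1 / 2)"] \<epsilon> by auto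
  define b where "b = 2 powr (- (\<epsilon> - \<theta>))"
  have b: "0 < b" "b < 1" using \<theta> powr_less_mono[of "- (\<epsilon> - \<theta>)" 0 2] by (auto simp: b_def)
  have bj: "2 powr (- (real j * (\<epsilon> - \<theta>))) = b ^ j" for j by (simp add: b_def powr_power algebra_simps)
  \<comment> \<open>Adding 1 here and to \<open>K\<close> keeps the final constant positive: when
    the form is infinite the right-hand side must be infinite, whereas
    \<open>0 * \<infinity>\<close> would be 0.\<close>
  define D where "D = (C + 1) / (1 - b)"
  have D: "D > 0" using b C by (simp add: D_def)
  have main: "ennreal (norm (LBINT x. piece_sum f x * cnj (g x))) \<le> ennreal (D * (K + 1)) * av_form p q f g S"
    if K: "K \<ge> 0" and f: "bcs f" and g: "bcs g" and
      X: "\<forall>v Z. finite Z \<longrightarrow> ennreal (grid_form p q f g v Z) \<le> ennreal (K * 2 powr (\<theta> * real_of_int \<bar>v\<bar>)) * av_form p q f g S" for K f g S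
  proof (cases "av_form p q f g S")
    case top
    have "ennreal (D * (K + 1)) \<noteq> 0" using D K by simp
    then show ?thesis unfolding top by (simp add: ennreal_mult_top)
  next
    case (real L)
    define y where "y = K * L"
    have y: "y \<ge> 0" using K real by (simp add: y_def)
    have Xy: "grid_form p q f (\<lambda>x. cnj (g x)) u Z \<le> y * 2 powr (\<theta> * real_of_int \<bar>u\<bar>)" if "finite Z" for u Z
    proof -
      have "ennreal (grid_form p q f g u Z) \<le> ennreal (K * 2 powr (\<theta> * real_of_int \<bar>u\<bar>)) * ennreal L" using X[rule_format, OF that, of u] unfolding real(2) .
      also have "\<dots> = ennreal (y * 2 powr (\<theta> * real_of_int \<bar>u\<bar>))" using K real(1) by (simp add: ennreal_mult[symmetric] y_def mult_ac)
      finally show ?thesis unfolding grid_form_cnj using y by (simp add: ennreal_le_iff)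
    qed
    have c: "norm (LBINT x. piece j f x * cnj (g x)) \<le> C * y * b ^ j" for j
    proof -
      have "norm (LBINT x. piece j f x * cnj (g x)) \<le> C * 2 powr (- (real j * (\<epsilon> - \<theta>))) * y"
        by (rule Call[rule_format, OF f bcs_cnj[OF g] _ _ y Xy]) (use \<theta> in auto)
      then show ?thesis unfolding bj by (simp add: mult_ac)
    qed
    have s: "summable (\<lambda>j. C * y * b ^ j)" using b by (intro summable_mult summable_geometric) auto
    have "norm (LBINT x. piece_sum f x * cnj (g x)) \<le> (\<Sum>j. C * y * b ^ j)"
      by (rule piece_sum_pair[OF bcs_sq[OF f] bcs_sq[OF bcs_cnj[OF g]] c s])
    also have "\<dots> = C / (1 - b) * y" using b by (simp add: suminf_mult summable_geometric suminf_geometric)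
    also have "\<dots> \<le> D * y" unfolding D_def using b y by (intro mult_right_mono divide_right_mono) auto
    also have "\<dots> \<le> (D * (K + 1)) * L" unfolding y_def using D K real(1) by (simp add: algebra_simps)
    finally have "ennreal (norm (LBINT x. piece_sum f x * cnj (g x))) \<le> ennreal ((D * (K + 1)) * L)" by (rule ennreal_leI)
    also have "\<dots> = ennreal (D * (K + 1)) * av_form p q f g S"
      unfolding real(2) using D K real(1) by (intro ennreal_mult) auto
    finally show ?thesis .
  qed
  show ?thesis
    by (rule exI[of _ \<theta>], rule exI[of _ D], intro conjI \<theta> D allI impI, rule main; assumption)
qed

end

theorem theorem1p2:
  fixes a :: "(real^'n::finite) \<times> (real^'n) \<Rightarrow> complex"
    and m \<rho> \<delta> :: real
  assumes "a \<in> symbol_class m \<rho> \<delta>"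
    and "m < 0"
    and "0 < \<delta>" and "\<delta> \<le> \<rho>" and "\<rho> < 1"
  shows "\<exists>\<eta> :: real. \<exists>C :: ennreal \<Rightarrow> ennreal \<Rightarrow> real. 0 < \<eta> \<and> \<eta> < 1 \<and>
    (\<forall>f g. bounded_compactly_supported f \<and> bounded_compactly_supported g \<longrightarrow>
      (\<exists>S S'. dyadic_collection S \<and> eta_sparse \<eta> S \<and>
              dyadic_collection S' \<and> eta_sparse \<eta> S' \<and>
        (\<forall>r s :: ennreal.
          (m < - real CARD('n) * (1 - \<rho>) * (enn2real (1 / r) - 1 / 2) \<and>
             1 \<le> r \<and> r \<le> s \<and> s \<le> 2) \<or>
          (m < - real CARD('n) * (1 - \<rho>) * (enn2real (1 / r) - enn2real (1 / s)) \<and>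
             1 \<le> r \<and> r \<le> 2 \<and> 2 \<le> s \<and> s \<le> conj_exponent r) \<longrightarrow>
          ennreal (norm (L2_pairing (pdo_L2 a f) g))
            \<le> ennreal (C r s) * sparse_form S r (conj_exponent s) f g \<and>
          ennreal (norm (L2_pairing (pdo_L2 a f) g))
            \<le> ennreal (C r s) * sparse_form S' (conj_exponent s) r f g)))"
proof -
  interpret pdo_symbol a m \<rho> \<delta> by unfold_locales (rule assms)+
  let ?n = "real CARD('n)"
  define A where "A = {(p::real, q::real, \<theta>::real). p \<in> \<rat> \<and> q \<in> \<rat> \<and> \<theta> \<in> \<rat> \<and> p \<in> {1..2} \<and> q \<in> {1..2} \<and> \<theta> > 0}"
  have Ac: "countable A" by (rule countable_subset[of _ "\<rat> \<times> \<rat> \<times> \<rat>"]) (auto simp: A_def countable_rat)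
  have "(1, 1, 1) \<in> A" by (simp add: A_def)
  then have Ane: "A \<noteq> {}" by blast
  define e where "e = from_nat_into A"
  have eA: "e k \<in> A" for k unfolding e_def by (rule from_nat_into[OF Ane])
  have surj: "\<exists>k. e k = x" if "x \<in> A" for x unfolding e_def by (rule from_nat_into_surj[OF Ac that])
  define ps qs \<theta>s where "ps = (\<lambda>k. fst (e k))" and "qs = (\<lambda>k. fst (snd (e k)))" and "\<theta>s = (\<lambda>k. snd (snd (e k)))"
  have pq: "ps k \<in> {1..2}" "qs k \<in> {1..2}" "\<theta>s k > 0" for k
    using eA[of k] by (auto simp: A_def ps_def qs_def \<theta>s_def split_beta)
  obtain Cst :: "nat \<Rightarrow> real" where Cst: "\<forall>k. Cst k \<ge> 0" and grid: "\<forall>f g :: real^'n \<Rightarrow> complex. bcs f \<longrightarrow> bcs g \<longrightarrow>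
     (\<exists>S. dyadic_collection S \<and> eta_sparse (1 / 4) S \<and> (\<forall>k v Z. finite Z \<longrightarrow>
        ennreal (grid_form (ps k) (qs k) f g v Z) \<le> ennreal (Cst k * 2 powr (\<theta>s k * real_of_int \<bar>v\<bar>)) * av_form (ps k) (qs k) f g S))"
    using grid_sum_domination[of ps qs \<theta>s, OF pq] by (elim exE conjE) (rule that)
  define good where "good = (\<lambda>f' g' (S :: (real^'n) set set). dyadic_collection S \<and> (\<forall>k v Z. finite Z \<longrightarrow>
        ennreal (grid_form (ps k) (qs k) f' g' v Z) \<le> ennreal (Cst k * 2 powr (\<theta>s k * real_of_int \<bar>v\<bar>)) * av_form (ps k) (qs k) f' g' S))"
  define adm where "adm = (\<lambda>r s :: ennreal. (m < - ?n * (1 - \<rho>) * (enn2real (1 / r) - 1 / 2) \<and> 1 \<le> r \<and> r \<le> s \<and> s \<le> 2) \<or>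
          (m < - ?n * (1 - \<rho>) * (enn2real (1 / r) - enn2real (1 / s)) \<and> 1 \<le> r \<and> r \<le> 2 \<and> 2 \<le> s \<and> s \<le> conj_exponent r))"
  define copy where "copy = (\<lambda>f f' :: real^'n \<Rightarrow> complex. f \<in> borel_measurable lebesgue \<and> bcs f' \<and> (AE x in lborel. f x = f' x))"
  have bound: "\<exists>c\<ge>0. \<forall>f f' g g' S. copy f f' \<longrightarrow> copy g g' \<longrightarrow> good f' g' S \<longrightarrow>
      ennreal (norm (L2_pairing (pdo_L2 a f) g)) \<le> ennreal c * sparse_form S P Q f g"
    if p: "p \<in> \<rat>" "1 \<le> p" "p \<le> 2" "ennreal p \<le> P" and q: "q \<in> \<rat>" "1 \<le> q" "q \<le> 2" "ennreal q \<le> Q"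
      and mn: "m + ?n * (1 - \<rho>) * (1 / p + 1 / q - 1) < 0" for p q P Q
  proof -
    obtain \<theta> C where \<theta>: "\<theta> \<in> \<rat>" "\<theta> > 0" and C: "C > 0" and
      pb: "\<forall>K f g S. K \<ge> 0 \<longrightarrow> bcs f \<longrightarrow> bcs g \<longrightarrow>
      (\<forall>v Z. finite Z \<longrightarrow> ennreal (grid_form p q f g v Z) \<le> ennreal (K * 2 powr (\<theta> * real_of_int \<bar>v\<bar>)) * av_form p q f g S) \<longrightarrow>
      ennreal (norm (LBINT x. piece_sum f x * cnj (g x))) \<le> ennreal (C * (K + 1)) * av_form p q f g S"
      using pairing_bound[OF p(2,3) q(2,3) mn] by (elim exE conjE) (rule that)
    have "(p, q, \<theta>) \<in> A" using p q \<theta> by (simp add: A_def)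
    then obtain k where k: "e k = (p, q, \<theta>)" using surj by blast
    have kk: "ps k = p" "qs k = q" "\<theta>s k = \<theta>" using k by (auto simp: ps_def qs_def \<theta>s_def)
    show ?thesis
    proof (intro exI[of _ "C * (Cst k + 1)"] conjI allI impI)
      show "C * (Cst k + 1) \<ge> 0" using C Cst by simp
      fix f f' g g' S assume f: "copy f f'" and g: "copy g g'" and gd: "good f' g' S"
      note f = f[unfolded copy_def] and g = g[unfolded copy_def]
      note gd = gd[unfolded good_def]
      have X: "ennreal (grid_form p q f' g' v Z) \<le> ennreal (Cst k * 2 powr (\<theta> * real_of_int \<bar>v\<bar>)) * av_form p q f' g' S" if "finite Z" for v Z
        using conjunct2[OF gd, rule_format, OF that, of k v] unfolding kk .
      have "L2_pairing (pdo_L2 a f) g = (LBINT x. piece_sum f' x * cnj (g' x))"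
        using f g by (intro pairing_eq) auto
      then have "ennreal (norm (L2_pairing (pdo_L2 a f) g)) \<le> ennreal (C * (Cst k + 1)) * av_form p q f' g' S"
        using pb[rule_format, of "Cst k" f' g' S, OF spec[OF Cst] conjunct1[OF conjunct2[OF f]] conjunct1[OF conjunct2[OF g]] X] by simp
      also have "\<dots> \<le> ennreal (C * (Cst k + 1)) * sparse_form S P Q f g"
        using f g by (intro mult_left_mono av_form_le_sparse_form[OF conjunct1[OF gd] p(2,4) q(2,4)]) auto
      finally show "ennreal (norm (L2_pairing (pdo_L2 a f) g)) \<le> ennreal (C * (Cst k + 1)) * sparse_form S P Q f g" .
    qed
  qed
  \<comment> \<open>The functions and the family are quantified inside, so the constant chosen from
    this predicate depends on \<open>r\<close> and \<open>s\<close> alone.\<close>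
  define ok where "ok = (\<lambda>r s c. \<forall>f f' g g' S. copy f f' \<longrightarrow> copy g g' \<longrightarrow> good f' g' S \<longrightarrow>
      ennreal (norm (L2_pairing (pdo_L2 a f) g)) \<le> ennreal c * sparse_form S r (conj_exponent s) f g \<and>
      ennreal (norm (L2_pairing (pdo_L2 a f) g)) \<le> ennreal c * sparse_form S (conj_exponent s) r f g)"
  have ex: "\<exists>c. ok r s c" if rs: "adm r s" for r s
  proof -
    obtain p q where pq': "p \<in> \<rat>" "q \<in> \<rat>" "1 \<le> p" "p \<le> 2" "1 \<le> q" "q \<le> 2" "ennreal p \<le> r" "ennreal q \<le> conj_exponent s"
      "m + ?n * (1 - \<rho>) * (1 / p + 1 / q - 1) < 0"
      by (rule rational_exponents[OF rs[unfolded adm_def]]) (rule that; assumption)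
    have mn': "m + ?n * (1 - \<rho>) * (1 / q + 1 / p - 1) < 0" using pq'(9) by (simp only: add.commute[of "1 / q"])
    obtain c1 where c1: "c1 \<ge> 0" "\<forall>f f' g g' S. copy f f' \<longrightarrow> copy g g' \<longrightarrow> good f' g' S \<longrightarrow>
      ennreal (norm (L2_pairing (pdo_L2 a f) g)) \<le> ennreal c1 * sparse_form S r (conj_exponent s) f g"
      using bound[OF pq'(1,3,4,7) pq'(2,5,6,8) pq'(9)] by (elim exE conjE) (rule that)
    obtain c2 where c2: "c2 \<ge> 0" "\<forall>f f' g g' S. copy f f' \<longrightarrow> copy g g' \<longrightarrow> good f' g' S \<longrightarrow>
      ennreal (norm (L2_pairing (pdo_L2 a f) g)) \<le> ennreal c2 * sparse_form S (conj_exponent s) r f g"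
      using bound[OF pq'(2,5,6,8) pq'(1,3,4,7) mn'] by (elim exE conjE) (rule that)
    have "ok r s (max c1 c2)"
      unfolding ok_def
    proof (intro allI impI conjI)
      fix f f' g g' S assume h: "copy f f'" "copy g g'" "good f' g' S"
      have "ennreal c1 * sparse_form S r (conj_exponent s) f g \<le> ennreal (max c1 c2) * sparse_form S r (conj_exponent s) f g"
        by (intro mult_right_mono ennreal_leI) auto
      with c1(2)[rule_format, OF h] show "ennreal (norm (L2_pairing (pdo_L2 a f) g)) \<le> ennreal (max c1 c2) * sparse_form S r (conj_exponent s) f g"
        by (rule order_trans)
      have "ennreal c2 * sparse_form S (conj_exponent s) r f g \<le> ennreal (max c1 c2) * sparse_form S (conj_exponent s) r f g"
        by (intro mult_right_mono ennreal_leI) auto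
      with c2(2)[rule_format, OF h] show "ennreal (norm (L2_pairing (pdo_L2 a f) g)) \<le> ennreal (max c1 c2) * sparse_form S (conj_exponent s) r f g"
        by (rule order_trans)
    qed
    then show ?thesis by (rule exI)
  qed
  define C where "C = (\<lambda>r s. SOME c. ok r s c)"
  have okC: "ok r s (C r s)" if "adm r s" for r s unfolding C_def by (rule someI_ex[OF ex[OF that]])
  show ?thesis
  proof (intro exI[of _ "1 / 4"] exI[of _ C] conjI allI impI, goal_cases)
    case fg: (3 f g)
    obtain f' where f': "bcs f'" "AE x in lborel. f x = f' x" by (rule bcs_copy[OF conjunct1[OF fg]])
    obtain g' where g': "bcs g'" "AE x in lborel. g x = g' x" by (rule bcs_copy[OF conjunct2[OF fg]])
    have cp: "copy f f'" "copy g g'"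
      using fg f' g' by (auto simp: copy_def bounded_compactly_supported_def)
    obtain S where S: "dyadic_collection S" "eta_sparse (1 / 4) S" and X: "\<forall>k v Z. finite Z \<longrightarrow>
        ennreal (grid_form (ps k) (qs k) f' g' v Z) \<le> ennreal (Cst k * 2 powr (\<theta>s k * real_of_int \<bar>v\<bar>)) * av_form (ps k) (qs k) f' g' S"
      using grid[rule_format, OF f'(1) g'(1)] by (elim exE conjE) (rule that)
    have gd: "good f' g' S" unfolding good_def using S(1) X by (rule conjI)
    have res: "\<forall>r s. adm r s \<longrightarrow>
          ennreal (norm (L2_pairing (pdo_L2 a f) g)) \<le> ennreal (C r s) * sparse_form S r (conj_exponent s) f g \<and>
          ennreal (norm (L2_pairing (pdo_L2 a f) g)) \<le> ennreal (C r s) * sparse_form S (conj_exponent s) r f g"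
      by (intro allI impI) (rule okC[unfolded ok_def, rule_format, OF _ cp gd])
    show ?case
      by (rule exI[of _ S], rule exI[of _ S]) (intro conjI S res[unfolded adm_def])
  qed simp_all
qed

end
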